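(* Let $\mathbf u,\mathbf v$ be inner functions and let $\varphi_0\in H^\infty$ be a multiplier between $\mathcal K_{\mathbf u}$ and $\mathcal K_{\mathbf v}$ (that is, $\varphi_0\mathcal K_{\mathbf u}\subset\mathcal K_{\mathbf v}$) such that $\operatorname{clos}\varphi_0\mathcal K_{\mathbf u}=\mathcal K_{\mathbf v}$ and $1/\varphi_0\notin H^2$. Suppose that $m(E_{\mathbf v})=1$. Under these hypotheses $\varphi_0$ is outer, and $\varphi_0=c\,\mathbf v\,\overline{\mathbf u}\,\overline{\varphi_0}$ $m$-a.e. on $\mathbb T$ for some $c\in\mathbb T$. With this $c$, define $T\in\mathcal L(H^2)$ by $$T=S+(\mathbf v-\varphi_0\mathbf u)\otimes\frac{1}{\overline c\,\varphi_0(0)}P_{H^2}(\mathbf v\overline\chi).$$ Then $T\sim S$, and $T$ does not have an isometric asymptote.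
   Context: $\mathbb D$ is the open unit disc, $\mathbb T$ the unit circle, $m$ normalized Lebesgue measure on $\mathbb T$, $H^2$, $H^\infty$ are the Hardy spaces on $\mathbb D$ (identified with their boundary functions on $\mathbb T$), $\chi(z)=z$, $S\in\mathcal L(H^2)$ is multiplication by $\chi$ (the unilateral shift), $P_{H^2}$ is the orthogonal projection of $L^2(\mathbb T,m)$ onto $H^2$. The rank-one operator $a\otimes b$ acts by $(a\otimes b)x=(x,b)a$. An inner function is a function $\mathbf u\in H^\infty$ with $|\mathbf u(\zeta)|=1$ for $m$-a.e. $\zeta\in\mathbb T$; for an inner function $\mathbf u$, $\mathcal K_{\mathbf u}=H^2\ominus\mathbf uH^2$. For an inner function $\mathbf v$ and $\zeta\in\mathbb T$ such that the nontangential boundary value $\mathbf v(\zeta)$ exists and $|\mathbf v(\zeta)|=1$, set $k_{\mathbf v,\zeta}(z)=\dfrac{1-\overline{\mathbf v(\zeta)}\mathbf v(z)}{1-\overline\zeta z}$, $z\in\mathbb D$; and $E_{\mathbf v}=\{\zeta\in\mathbb T: k_{\mathbf v,\zeta}\in H^2\}$ (the set of such $\zeta$ for which this function lies in $H^2$). All Hilbert spaces are complex and separable; operators and transformations are linear and bounded; $\mathcal L(\mathcal H,\mathcal K)$ is the space of transformations from $\mathcal H$ to $\mathcal K$, $\mathcal L(\mathcal H)=\mathcal L(\mathcal H,\mathcal H)$. A quasiaffinity is a transformation with zero kernel and dense range; $T\prec R$ means there is a quasiaffinity $X$ with $XT=RX$; $T\sim R$ (quasisimilar) means $T\prec R$ and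 $R\prec T$. An isometric asymptote of $T\in\mathcal L(\mathcal H)$ is a pair $(X,U)$, where $U\in\mathcal L(\mathcal K)$ is an isometry and $X\in\mathcal L(\mathcal H,\mathcal K)$ satisfies $XT=UX$, such that for any other pair $(Y,V)$, where $V\in\mathcal L(\mathcal K')$ is an isometry and $Y\in\mathcal L(\mathcal H,\mathcal K')$ satisfies $YT=VY$, there exists a unique $Z\in\mathcal L(\mathcal K,\mathcal K')$ with $ZU=VZ$ and $Y=ZX$.
   Formalization: That φ₀ is outer and φ₀ = c v ū φ̄₀ for some c is claimed only when K_u ≠ {0}: for u = v = 1, φ₀(z) = z all hypotheses hold but both claims fail. The claims on T are stated for every c of modulus 1 satisfying the identity. *)

theory Defs
  imports "HOL-Analysis.Analysis" "HOL-Library.Function_Algebras"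
begin

section \<open>Separable complex Hilbert spaces and their transformations\<close>

text \<open>
  The addition of a space is that of the ambient type; the space itself is a linear subspace
  of that type, and the inner product is only constrained on it.
\<close>

record 'a ipspace =
  car :: "'a set"
  scl :: "complex \<Rightarrow> 'a \<Rightarrow> 'a"
  ip :: "'a \<Rightarrow> 'a \<Rightarrow> complex"

definition hnorm :: "'a::ab_group_add ipspace \<Rightarrow> 'a \<Rightarrow> real" where
  "hnorm H x = sqrt (Re (ip H x x))"

text \<open>The value \<open>0\<close> off the space is there because \<^locale>\<open>Metric_space\<close> requires
  a nonnegative symmetric distance on the whole type.\<close>

definition hdist :: "'a::ab_group_add ipspace \<Rightarrow> 'a \<Rightarrow> 'a \<Rightarrow> real" where
  "hdist H x y = (if x \<in> car H \<and> y \<in> car H then hnorm H (x - y) else 0)"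

definition htop :: "'a::ab_group_add ipspace \<Rightarrow> 'a topology" where
  "htop H = Metric_space.mtopology (car H) (hdist H)"

locale separable_hilbert_space = vector_space "scl H"
  for H :: "'a::ab_group_add ipspace" +
  assumes subspace_car: "subspace (car H)"
    and ip_add_left: "\<lbrakk>x \<in> car H; y \<in> car H; z \<in> car H\<rbrakk> \<Longrightarrow> ip H (x + y) z = ip H x z + ip H y z"
    and ip_scl_left: "\<lbrakk>x \<in> car H; y \<in> car H\<rbrakk> \<Longrightarrow> ip H (scl H a x) y = a * ip H x y"
    and ip_cnj: "\<lbrakk>x \<in> car H; y \<in> car H\<rbrakk> \<Longrightarrow> ip H x y = cnj (ip H y x)"
    and ip_nonneg: "x \<in> car H \<Longrightarrow> 0 \<le> Re (ip H x x)"
    and ip_eq_0: "\<lbrakk>x \<in> car H; ip H x x = 0\<rbrakk> \<Longrightarrow> x = 0"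
    and complete: "Metric_space.mcomplete (car H) (hdist H)"
    and separable: "separable_space (htop H)"

text \<open>
  \<open>\<L>(\<H>, \<K>)\<close>. Transformations are extensional functions, so that equality of
  transformations (needed for the uniqueness in \<open>isometric_asymptote\<close>) is equality in HOL.
\<close>

definition transformations ::
    "'a::ab_group_add ipspace \<Rightarrow> 'b::ab_group_add ipspace \<Rightarrow> ('a \<Rightarrow> 'b) set" where
  "transformations H K = {X \<in> car H \<rightarrow>\<^sub>E car K.
     (\<forall>x\<in>car H. \<forall>y\<in>car H. X (x + y) = X x + X y) \<and>
     (\<forall>a. \<forall>x\<in>car H. X (scl H a x) = scl K a (X x)) \<and>
     (\<exists>C. \<forall>x\<in>car H. hnorm K (X x) \<le> C * hnorm H x)}"

definition isometries :: "'a::ab_group_add ipspace \<Rightarrow> ('a \<Rightarrow> 'a) set" where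
  "isometries K = {U \<in> transformations K K. \<forall>x\<in>car K. hnorm K (U x) = hnorm K x}"

text \<open>\<open>XT = RX\<close>, where \<open>X\<close> is defined on \<open>\<H>\<close>.\<close>

definition intertwines ::
    "'a::ab_group_add ipspace \<Rightarrow> ('a \<Rightarrow> 'b) \<Rightarrow> ('a \<Rightarrow> 'a) \<Rightarrow> ('b \<Rightarrow> 'b) \<Rightarrow> bool" where
  "intertwines H X T R \<longleftrightarrow> (\<forall>x\<in>car H. X (T x) = R (X x))"

definition quasiaffinity ::
    "'a::ab_group_add ipspace \<Rightarrow> 'b::ab_group_add ipspace \<Rightarrow> ('a \<Rightarrow> 'b) \<Rightarrow> bool" where
  "quasiaffinity H K X \<longleftrightarrow> X \<in> transformations H K \<and>
     {x \<in> car H. X x = 0} = {0} \<and> htop K closure_of (X ` car H) = car K"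

definition quasiaffine_transform ::
    "'a::ab_group_add ipspace \<Rightarrow> ('a \<Rightarrow> 'a) \<Rightarrow> 'b::ab_group_add ipspace \<Rightarrow> ('b \<Rightarrow> 'b) \<Rightarrow> bool" where
  "quasiaffine_transform H T K R \<longleftrightarrow> (\<exists>X. quasiaffinity H K X \<and> intertwines H X T R)"

definition quasisimilar ::
    "'a::ab_group_add ipspace \<Rightarrow> ('a \<Rightarrow> 'a) \<Rightarrow> 'b::ab_group_add ipspace \<Rightarrow> ('b \<Rightarrow> 'b) \<Rightarrow> bool" where
  "quasisimilar H T K R \<longleftrightarrow> quasiaffine_transform H T K R \<and> quasiaffine_transform K R H T"

definition rank_one :: "'a::ab_group_add ipspace \<Rightarrow> 'a \<Rightarrow> 'a \<Rightarrow> 'a \<Rightarrow> 'a" where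
  "rank_one H a b = (\<lambda>x\<in>car H. scl H (ip H x b) a)"

text \<open>A pair \<open>(X, U)\<close> with \<open>U\<close> an isometry of the Hilbert space \<open>\<K>\<close> and \<open>XT = UX\<close>.\<close>

definition isometric_pair ::
    "'a::ab_group_add ipspace \<Rightarrow> ('a \<Rightarrow> 'a) \<Rightarrow> 'b::ab_group_add ipspace \<Rightarrow> ('a \<Rightarrow> 'b) \<Rightarrow> ('b \<Rightarrow> 'b) \<Rightarrow> bool" where
  "isometric_pair H T K X U \<longleftrightarrow> separable_hilbert_space K \<and>
     U \<in> isometries K \<and> X \<in> transformations H K \<and> intertwines H X T U"

text \<open>
  HOL cannot quantify over types inside a formula, so the competing spaces \<open>\<K>'\<close> of the universal
  property live in one type. This loses nothing: every separable Hilbert space is isometrically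
  isomorphic to a closed subspace of \<open>\<ell>\<^sup>2\<close>, which is a linear subspace of \<^typ>\<open>nat \<Rightarrow> complex\<close>.
\<close>

definition isometric_asymptote ::
    "'a::ab_group_add ipspace \<Rightarrow> ('a \<Rightarrow> 'a) \<Rightarrow> 'b::ab_group_add ipspace \<Rightarrow> ('a \<Rightarrow> 'b) \<Rightarrow> ('b \<Rightarrow> 'b) \<Rightarrow> bool" where
  "isometric_asymptote H T K X U \<longleftrightarrow> isometric_pair H T K X U \<and>
     (\<forall>(K' :: (nat \<Rightarrow> complex) ipspace) Y V. isometric_pair H T K' Y V \<longrightarrow>
        (\<exists>!Z. Z \<in> transformations K K' \<and> intertwines K Z U V \<and> (\<forall>x\<in>car H. Y x = Z (X x))))"


section \<open>Hardy spaces on the disc\<close>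

text \<open>Normalized Lebesgue measure on the unit circle.\<close>

definition mT :: "complex measure" where
  "mT = completion (distr (uniform_measure lborel {0..<2 * pi}) (restrict_space borel (sphere 0 1)) cis)"

text \<open>Convergence along the supremum filter is convergence in every Stolz angle at \<open>\<zeta>\<close>.\<close>

definition nontangential :: "complex \<Rightarrow> complex filter" where
  "nontangential \<zeta> = (SUP \<alpha>\<in>{1<..}. at \<zeta> within {z \<in> ball 0 1. dist z \<zeta> < \<alpha> * (1 - norm z)})"

definition bv :: "(complex \<Rightarrow> complex) \<Rightarrow> complex \<Rightarrow> complex" where
  "bv f \<zeta> = Lim (nontangential \<zeta>) f"

text \<open>A function on the disc is represented by its extension by \<open>0\<close> to the plane.
  Since \<open>1 / 0 = 0\<close> in HOL, the reciprocal of the zero function is \<open>0\<close>; a hypothesis that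
  \<open>1 / \<phi>\<close> is not in \<open>H\<^sup>2\<close> therefore includes that \<open>\<phi>\<close> is not identically \<open>0\<close>.\<close>

definition on_disc :: "(complex \<Rightarrow> complex) \<Rightarrow> complex \<Rightarrow> complex" where
  "on_disc f = (\<lambda>z. if z \<in> ball 0 1 then f z else 0)"

definition disc_holomorphic :: "(complex \<Rightarrow> complex) set" where
  "disc_holomorphic = {f. f holomorphic_on ball 0 1 \<and> (\<forall>z. z \<notin> ball 0 1 \<longrightarrow> f z = 0)}"

definition H2 :: "(complex \<Rightarrow> complex) ipspace" where
  "H2 = \<lparr>car = {f \<in> disc_holomorphic.
             bdd_above ((\<lambda>r. \<integral>\<zeta>. (cmod (f (of_real r * \<zeta>)))\<^sup>2 \<partial>mT) ` {0..<1})},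
         scl = (\<lambda>a f z. a * f z),
         ip = (\<lambda>f g. \<integral>\<zeta>. bv f \<zeta> * cnj (bv g \<zeta>) \<partial>mT)\<rparr>"

definition Hinf :: "(complex \<Rightarrow> complex) set" where
  "Hinf = {f \<in> disc_holomorphic. bounded (f ` ball 0 1)}"

definition shift :: "(complex \<Rightarrow> complex) \<Rightarrow> complex \<Rightarrow> complex" where
  "shift = (\<lambda>f\<in>car H2. \<lambda>z. z * f z)"

text \<open>The orthogonal projection \<open>P\<close> of \<open>L\<^sup>2\<close> of the circle onto \<open>H\<^sup>2\<close>: \<open>g - P g\<close> is orthogonal to \<open>H\<^sup>2\<close>.\<close>

definition proj_H2 :: "(complex \<Rightarrow> complex) \<Rightarrow> complex \<Rightarrow> complex" where
  "proj_H2 g = (THE f. f \<in> car H2 \<and>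
     (\<forall>h\<in>car H2. (\<integral>\<zeta>. (g \<zeta> - bv f \<zeta>) * cnj (bv h \<zeta>) \<partial>mT) = 0))"

definition inner_function :: "(complex \<Rightarrow> complex) \<Rightarrow> bool" where
  "inner_function u \<longleftrightarrow> u \<in> Hinf \<and> (AE \<zeta> in mT. cmod (bv u \<zeta>) = 1)"

definition outer_function :: "(complex \<Rightarrow> complex) \<Rightarrow> bool" where
  "outer_function f \<longleftrightarrow> f \<in> disc_holomorphic \<and>
     (\<exists>\<gamma> (k :: complex \<Rightarrow> real). cmod \<gamma> = 1 \<and> integrable mT k \<and>
        (\<forall>z\<in>ball 0 1. f z = \<gamma> * exp (\<integral>\<zeta>. (\<zeta> + z) / (\<zeta> - z) * of_real (k \<zeta>) \<partial>mT)))"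

definition model_space :: "(complex \<Rightarrow> complex) \<Rightarrow> (complex \<Rightarrow> complex) set" where
  "model_space u = {f \<in> car H2. \<forall>g\<in>car H2. ip H2 f (u * g) = 0}"

definition boundary_kernel :: "(complex \<Rightarrow> complex) \<Rightarrow> complex \<Rightarrow> complex \<Rightarrow> complex" where
  "boundary_kernel v \<zeta> = on_disc (\<lambda>z. (1 - cnj (bv v \<zeta>) * v z) / (1 - cnj \<zeta> * z))"

definition E_set :: "(complex \<Rightarrow> complex) \<Rightarrow> complex set" where
  "E_set v = {\<zeta> \<in> sphere 0 1. (\<exists>l. (v \<longlongrightarrow> l) (nontangential \<zeta>)) \<and> cmod (bv v \<zeta>) = 1 \<and>
                              boundary_kernel v \<zeta> \<in> car H2}"

definition T_op :: "(complex \<Rightarrow> complex) \<Rightarrow> (complex \<Rightarrow> complex) \<Rightarrow> (complex \<Rightarrow> complex) \<Rightarrow> complex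
    \<Rightarrow> (complex \<Rightarrow> complex) \<Rightarrow> complex \<Rightarrow> complex" where
  "T_op u v \<phi> c = (\<lambda>f\<in>car H2. shift f +
     rank_one H2 (v - \<phi> * u) (scl H2 (1 / (cnj c * \<phi> 0)) (proj_H2 (\<lambda>\<zeta>. bv v \<zeta> * cnj \<zeta>))) f)"

end

theory Submission
  imports Defs "HOL-Complex_Analysis.Complex_Analysis"
begin

text \<open>
  For an inner function \<open>w\<close>, let \<open>toep w f\<close> be the projection of \<open>cnj w * f\<close> to the Hardy space, so that
  \<open>f = (f - w * toep w f) + w * toep w f\<close> splits the Hardy space into the model space of \<open>w\<close> and the
  multiples of \<open>w\<close>. The theorem rests on the two transformations
  \<open>Xop f = \<phi> * (f - u * toep u f) + v * toep u f\<close> and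
  \<open>Yop f = (f - v * toep v f) + \<phi> * (u * toep v f)\<close>. Since \<open>\<phi>\<close> maps the model space of
  \<open>u\<close> into that of \<open>v\<close>, one has \<open>toep v (Xop f) = toep u f\<close> and \<open>Yop (Xop f) = \<phi> * f\<close>. The boundary relation
  \<open>\<phi> = c * v * cnj u * cnj \<phi>\<close> is exactly what makes \<open>Xop\<close> and \<open>Yop\<close> intertwine \<open>T\<close> with the shift
  (\<open>TX\<close>, \<open>YT\<close>). Since \<open>\<phi>\<close> is outer, both are quasiaffinities, and \<open>T\<close> is quasisimilar to the shift.

  That \<open>\<phi>\<close> is outer is seen as follows. The closure of the multiples of \<open>\<phi>\<close> contains the reproducing
  kernel \<open>1 - cnj (v 0) * v\<close> of the model space of \<open>v\<close>, which has a bounded inverse; hence \<open>\<phi>\<close> is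
  cyclic for the shift, and cyclic bounded functions are outer (\<open>cyclic_outer\<close>). The natural
  conjugations of the two model spaces turn \<open>\<phi>\<close> into a multiplier \<open>\<psi>\<close> with boundary values
  \<open>v * cnj u * cnj \<phi>\<close>, which is cyclic for the same reason. Two outer functions of equal modulus on the
  circle are proportional, and this gives \<open>c\<close>.

  Now suppose that \<open>(X0, U)\<close> is an isometric asymptote. Then \<open>X0 \<circ> Xop\<close> intertwines the shift with an
  isometry, so the square of its norm on polynomials \<open>p\<close> is the integral of \<open>\<rho> * \<bar>p\<bar>\<^sup>2\<close> for an integrable density
  \<open>\<rho>\<close> (\<open>polynomial_density\<close>). Competing pairs are \<open>f \<mapsto> sqrt \<tau> * Yop f / \<phi>\<close>, followed by Fourier
  coefficients, together with the bilateral shift. This is bounded whenever \<open>\<tau> \<le> 1\<close> and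
  \<open>\<tau> * weight\<close> is integrable, where \<open>weight\<close> is the squared norm of the boundary kernel divided by
  \<open>\<bar>\<phi>\<bar>\<^sup>2\<close>: this is the place where almost every boundary point must belong to \<open>E_set v\<close>, because there
  the boundary values of functions of the model space are inner products with the boundary
  kernel (\<open>AE_bv_model_space\<close>). As \<open>Yop (Xop f) = \<phi> * f\<close>, the universal property says that each such
  \<open>\<tau>\<close> is dominated by a multiple of \<open>\<rho>\<close>, and there are enough of them to force \<open>\<rho>\<close> to be bounded away
  from \<open>0\<close> (\<open>essentially_bounded_below\<close>). So \<open>X0 \<circ> Xop\<close> is bounded below; on the model space of \<open>u\<close>,
  where \<open>Xop\<close> is multiplication by \<open>\<phi>\<close>, this makes \<open>\<phi>\<close> bounded below, the reproducing kernel above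
  becomes divisible by \<open>\<phi>\<close> within the Hardy space, and so does \<open>1\<close>
  (\<open>reciprocal_of_bounded_below\<close>). This contradicts the hypothesis on \<open>1 / \<phi>\<close>. If the model space of
  \<open>u\<close> is zero, the boundary relation forces \<open>\<phi>\<close> to be constant, with the same contradiction.

  The Hardy space is given by integral means over circles and its inner product by nontangential
  boundary values. The connection between the two is Fatou's theorem in the form \<open>Fatou_l2\<close>, obtained
  from a weak type estimate for the difference quotients of a primitive; it also provides a
  subsequence of the Taylor polynomials which converges almost everywhere on the circle, and this
  is what identifies boundary values with the values of a boundary kernel.
\<close>

section \<open>Normalized Lebesgue measure on the circle\<close>

text \<open>The Borel measure of which the measure on the circle is the completion.\<close>

definition mT0 :: "complex measure" where
  "mT0 = distr (uniform_measure lborel {0..<2 * pi}) (restrict_space borel (sphere 0 1)) cis"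

lemma mT_mT0: "mT = completion mT0"
  by (simp add: mT_def mT0_def)

lemma measurable_cis: "cis \<in> uniform_measure lborel {0..<2 * pi} \<rightarrow>\<^sub>M restrict_space borel (sphere 0 1)"
proof -
  have "cis \<in> borel_measurable borel"
    by (intro borel_measurable_continuous_onI continuous_intros)
  then show ?thesis
    by (intro measurable_restrict_space2) (auto simp: measurable_cong_sets[OF sets_uniform_measure refl])
qed

lemma sets_mT0 [measurable_cong]: "sets mT0 = sets (restrict_space borel (sphere 0 1))"
  by (simp add: mT0_def)

lemma space_mT [simp]: "space mT = sphere 0 1"
  by (simp add: mT_def space_restrict_space)

lemma space_mT0 [simp]: "space mT0 = sphere 0 1"
  by (simp add: mT0_def space_restrict_space)

lemma emeasure_mT0_space: "emeasure mT0 (space mT0) = 1"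
proof -
  have 1: "cis -` sphere 0 1 = (UNIV :: real set)" by auto
  have 2: "sphere 0 1 \<in> sets (restrict_space borel (sphere (0::complex) 1))"
    by (simp add: sets_restrict_space_iff)
  have "emeasure mT0 (sphere 0 1) = emeasure (uniform_measure lborel {0..<2 * pi}) (UNIV :: real set)"
    unfolding mT0_def by (subst emeasure_distr[OF measurable_cis 2]) (simp add: 1)
  also have "\<dots> = 1"
    by (subst emeasure_uniform_measure) (simp_all add: divide_ennreal)
  finally show ?thesis by simp
qed

lemma emeasure_mT_space: "emeasure mT (sphere 0 1) = 1"
proof -
  have "emeasure (completion mT0) (space mT0) = emeasure mT0 (space mT0)"
    by (subst emeasure_completion) (simp_all only: main_part[OF sets.top] sets.top sets_completionI_sets)
  then show ?thesis by (simp only: mT_mT0 emeasure_mT0_space) (simp only: space_mT0)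
qed

interpretation mT: finite_measure mT
  by (rule finite_measureI) (simp add: emeasure_mT_space)

interpretation mT: complete_measure mT
  unfolding mT_mT0 by unfold_locales

lemma measure_mT_space [simp]: "measure mT (sphere 0 1) = 1"
  by (simp add: measure_def emeasure_mT_space)

lemma integral_mT0:
  fixes f :: "complex \<Rightarrow> 'a::{banach,second_countable_topology}"
  assumes "f \<in> borel_measurable mT0"
  shows "integral\<^sup>L mT0 f = (1 / (2 * pi)) *\<^sub>R (LINT t:{0..2*pi}|lborel. f (cis t))"
proof -
  have m [measurable]: "f \<in> borel_measurable (restrict_space borel (sphere 0 1))"
    using assms by (simp cong: measurable_cong_sets add: sets_mT0)
  have c [measurable]: "(\<lambda>t. f (cis t)) \<in> borel_measurable lborel"
    using measurable_compose[OF measurable_cis m] by (simp add: measurable_cong_sets[OF sets_uniform_measure refl])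
  have "integral\<^sup>L mT0 f = (\<integral>t. f (cis t) \<partial>uniform_measure lborel {0..<2*pi})"
    unfolding mT0_def by (rule integral_distr[OF measurable_cis m])
  also have "uniform_measure lborel {0..<2*pi} = density lborel (\<lambda>t. ennreal (indicator {0..<2*pi} t / (2 * pi)))"
    unfolding uniform_measure_def
    by (intro density_cong) (auto simp: divide_ennreal[symmetric] ennreal_indicator ennreal_mult split: split_indicator)
  also have "(\<integral>t. f (cis t) \<partial>density lborel (\<lambda>t. ennreal (indicator {0..<2*pi} t / (2 * pi)))) =
     (\<integral>t. (indicator {0..<2*pi} t / (2 * pi)) *\<^sub>R f (cis t) \<partial>lborel)"
    by (rule integral_density) auto
  also have "\<dots> = (\<integral>t. (1 / (2*pi)) *\<^sub>R (indicator {0..2*pi} t *\<^sub>R f (cis t)) \<partial>lborel)"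
  proof (rule integral_cong_AE)
    have "AE t in lborel. t \<noteq> 2 * pi" by (rule AE_lborel_singleton)
    then show "AE t in lborel. (indicator {0..<2*pi} t / (2 * pi)) *\<^sub>R f (cis t) = (1 / (2*pi)) *\<^sub>R (indicator {0..2*pi} t *\<^sub>R f (cis t))"
      by eventually_elim (auto split: split_indicator)
  qed auto
  finally show ?thesis by (simp only: set_lebesgue_integral_def integral_scaleR_right)
qed

lemma borel_measurable_mT_continuous:
  fixes f :: "complex \<Rightarrow> 'a::{banach,second_countable_topology}"
  assumes "continuous_on (sphere 0 1) f"
  shows "f \<in> borel_measurable mT0" "f \<in> borel_measurable mT"
proof -
  show *: "f \<in> borel_measurable mT0"
    using borel_measurable_continuous_on_restrict[OF assms] by (simp cong: measurable_cong_sets add: sets_mT0)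
  then show "f \<in> borel_measurable mT"
    unfolding mT_mT0 by (rule measurable_completion)
qed

lemma integrable_mT_continuous:
  fixes f :: "complex \<Rightarrow> 'a::{banach,second_countable_topology}"
  assumes "continuous_on (sphere 0 1) f"
  shows "integrable mT f"
proof -
  have "compact (f ` sphere 0 1)"
    by (intro compact_continuous_image assms) auto
  then obtain B where "\<And>z. z \<in> sphere 0 1 \<Longrightarrow> norm (f z) \<le> B"
    by (meson compact_imp_bounded bounded_iff imageI)
  then show ?thesis
    by (intro mT.integrable_const_bound[where B=B] AE_I2 borel_measurable_mT_continuous assms) auto
qed

lemma set_integral_cis_period:
  fixes n :: int and a :: real and m :: nat
  shows "(LINT t:{a..a + 2*pi*m}|lborel. cis (n * t)) = (if n = 0 then 2 * pi * m else 0)"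
proof (cases "n = 0")
  case True
  have "(LINT t:{a..a + 2*pi*m}|lborel. cis (n * t)) = (LINT t:{a..a + 2*pi*m}|lborel. (1::complex))"
    using True by simp
  also have "\<dots> = 2 * pi * m" by (simp add: scaleR_conv_of_real set_lebesgue_integral_def)
  finally show ?thesis using True by simp
next
  case False
  let ?F = "\<lambda>t::real. cis (n * t) / (\<i> * n)"
  have per: "cis (n * (a + 2*pi*m)) = cis (n * a)"
  proof -
    have "cis (n * (a + 2*pi*m)) = cis (n * a) * cis (2 * pi * of_int (n * int m))"
      by (simp add: cis_mult algebra_simps)
    then show ?thesis by (simp add: cis_multiple_2pi)
  qed
  have "(LINT t:{a..a + 2*pi*m}|lborel. cis (n * t)) = ?F (a + 2*pi*m) - ?F a"
    unfolding set_lebesgue_integral_def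
  proof (rule integral_FTC_Icc)
    fix x assume "a \<le> x" "x \<le> a + 2*pi*m"
    have "((\<lambda>z. exp (\<i> * (of_int n * z)) / (\<i> * of_int n)) has_field_derivative cis (n * x)) (at (of_real x))"
      by (rule derivative_eq_intros refl | use False in \<open>simp add: cis_conv_exp field_simps\<close>)+
    from has_vector_derivative_real_field[OF this]
    show "(?F has_vector_derivative cis (n * x)) (at x within {a..a + 2*pi*m})"
      by (simp add: cis_conv_exp)
  qed (auto intro!: continuous_intros)
  also have "\<dots> = 0" by (simp only: per) simp
  finally show ?thesis using False by simp
qed

lemma integral_mT_power:
  fixes n m :: nat
  shows "(\<integral>y. y ^ n * cnj y ^ m \<partial>mT) = (if n = m then 1 else 0)"
proof -
  have c: "continuous_on (sphere 0 1) (\<lambda>y::complex. y ^ n * cnj y ^ m)"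
    by (intro continuous_intros)
  note m = borel_measurable_mT_continuous(1)[OF c]
  have "(\<integral>y. y ^ n * cnj y ^ m \<partial>mT) = (1 / (2*pi)) *\<^sub>R (LINT t:{0..2*pi}|lborel. cis t ^ n * cnj (cis t) ^ m)"
    unfolding mT_mT0 integral_completion[OF m] by (rule integral_mT0[OF m])
  also have "(\<lambda>t. cis t ^ n * cnj (cis t) ^ m) = (\<lambda>t. cis (of_int (int n - int m) * t))"
    by (rule ext) (simp only: cis_cnj Complex.DeMoivre cis_mult, simp add: algebra_simps)
  also have "(LINT t:{0..2*pi}|lborel. cis (of_int (int n - int m) * t)) = (if int n - int m = 0 then 2 * pi else 0)"
    using set_integral_cis_period[of 0 1 "int n - int m"] by simp
  finally show ?thesis by (auto simp: scaleR_conv_of_real)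
qed

lemma cis_Arg2pi_sphere:
  assumes "y \<in> sphere 0 1"
  shows "cis (Arg2pi y) = y"
  using Arg2pi_eq[of y] assms by (simp add: cis_conv_exp)

lemma Arg2pi_cis: "t \<in> {0..<2*pi} \<Longrightarrow> Arg2pi (cis t) = t"
  by (rule Arg2pi_unique[of 1]) (auto simp: cis_conv_exp)

lemma borel_measurable_Arg2pi [measurable]: "Arg2pi \<in> borel_measurable borel"
proof (rule measurable_piecewise_restrict[of "{\<real>\<^sub>\<ge>\<^sub>0, - \<real>\<^sub>\<ge>\<^sub>0}"])
  fix \<Omega> :: "complex set" assume "\<Omega> \<in> {\<real>\<^sub>\<ge>\<^sub>0, - \<real>\<^sub>\<ge>\<^sub>0}"
  then consider "\<Omega> = \<real>\<^sub>\<ge>\<^sub>0" | "\<Omega> = - \<real>\<^sub>\<ge>\<^sub>0" by auto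
  then show "Arg2pi \<in> borel_measurable (restrict_space borel \<Omega>)"
  proof cases
    case 1
    have "Arg2pi z = 0" if "z \<in> \<real>\<^sub>\<ge>\<^sub>0" for z
      using that by (auto simp: Arg2pi_eq_0 complex_nonneg_Reals_iff complex_is_Real_iff)
    then have "Arg2pi \<in> borel_measurable (restrict_space borel \<Omega>) \<longleftrightarrow> (\<lambda>z. 0::real) \<in> borel_measurable (restrict_space borel \<Omega>)"
      using 1 by (intro measurable_cong) (auto simp: space_restrict_space)
    then show ?thesis by simp
  next
    case 2
    have "continuous_on \<Omega> Arg2pi"
      using 2 by (auto intro!: continuous_at_imp_continuous_on continuous_at_Arg2pi)
    then show ?thesis by (rule borel_measurable_continuous_on_restrict)
  qed
qed (auto intro: closed_nonneg_Reals_complex)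

lemma emeasure_mT0_Arg2pi:
  assumes [measurable]: "N \<in> sets borel" and "N \<subseteq> {0..<2*pi}"
  shows "{y \<in> sphere 0 1. Arg2pi y \<in> N} \<in> sets mT0"
    and "emeasure mT0 {y \<in> sphere 0 1. Arg2pi y \<in> N} = emeasure lborel N / ennreal (2 * pi)"
proof -
  have s: "{y \<in> sphere 0 1. Arg2pi y \<in> N} = sphere 0 1 \<inter> (Arg2pi -` N \<inter> space borel)" by auto
  have "Arg2pi -` N \<inter> space borel \<in> sets borel" by measurable
  then have *: "{y \<in> sphere 0 1. Arg2pi y \<in> N} \<in> sets (restrict_space borel (sphere (0::complex) 1))"
    unfolding s by (subst sets_restrict_space_iff) auto
  then show "{y \<in> sphere 0 1. Arg2pi y \<in> N} \<in> sets mT0"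
    by (simp add: sets_mT0)
  have "emeasure mT0 {y \<in> sphere 0 1. Arg2pi y \<in> N} =
     emeasure (uniform_measure lborel {0..<2*pi}) (cis -` {y \<in> sphere 0 1. Arg2pi y \<in> N})"
    unfolding mT0_def by (subst emeasure_distr[OF measurable_cis *]) auto
  also have "cis -` {y \<in> sphere 0 1. Arg2pi y \<in> N} = {t. Arg2pi (cis t) \<in> N}" by auto
  also have "emeasure (uniform_measure lborel {0..<2*pi}) {t. Arg2pi (cis t) \<in> N} =
     emeasure lborel ({0..<2*pi} \<inter> {t. Arg2pi (cis t) \<in> N}) / emeasure lborel {0..<2*pi}"
  proof (rule emeasure_uniform_measure)
    have [measurable]: "cis \<in> borel_measurable borel"
      by (intro borel_measurable_continuous_onI continuous_intros)
    show "{t. Arg2pi (cis t) \<in> N} \<in> sets lborel" by measurable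
  qed auto
  also have "{0..<2*pi} \<inter> {t. Arg2pi (cis t) \<in> N} = N"
    using assms(2) by (auto simp: Arg2pi_cis)
  finally show "emeasure mT0 {y \<in> sphere 0 1. Arg2pi y \<in> N} = emeasure lborel N / ennreal (2 * pi)"
    by simp
qed

lemma AE_mT_cisI:
  assumes "AE t in lborel. t \<in> {0..<2*pi} \<longrightarrow> P (cis t)"
  shows "AE y in mT. P y"
proof -
  obtain N where N: "N \<in> null_sets lborel" "{t \<in> space lborel. \<not> (t \<in> {0..<2*pi} \<longrightarrow> P (cis t))} \<subseteq> N"
    using assms by (auto elim!: AE_E simp: null_sets_def)
  let ?A = "{y \<in> sphere 0 1. Arg2pi y \<in> N \<inter> {0..<2*pi}}"
  have N0: "emeasure lborel (N \<inter> {0..<2*pi}) = 0"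
    using N(1) emeasure_mono[of "N \<inter> {0..<2*pi}" N lborel] by (simp add: null_sets_def)
  have *: "N \<inter> {0..<2*pi} \<in> sets borel" using N(1) by (auto simp: null_sets_def)
  have "?A \<in> null_sets mT0"
    using emeasure_mT0_Arg2pi[OF *] N0 by (auto simp: null_sets_def)
  moreover have "{y \<in> space mT0. \<not> P y} \<subseteq> ?A"
  proof
    fix y assume "y \<in> {y \<in> space mT0. \<not> P y}"
    then have z: "y \<in> sphere 0 1" "\<not> P (cis (Arg2pi y))" by (auto simp: cis_Arg2pi_sphere)
    have "Arg2pi y \<in> {0..<2*pi}" using Arg2pi[of y] by auto
    then show "y \<in> ?A" using z N(2) by auto
  qed
  ultimately have "AE y in mT0. P y" by (rule AE_I')
  then show ?thesis unfolding mT_mT0 by (rule AE_completion)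
qed

text \<open>The circle is a union of finitely many short arcs, one of which meets the given set in positive measure.\<close>

lemma mT_small_subset:
  assumes A: "A \<in> sets mT" "measure mT A > 0" and "e > 0"
  obtains B where "B \<in> sets mT" "B \<subseteq> A" "measure mT B > 0" "measure mT B \<le> e"
proof -
  obtain n :: nat where n: "n > 0" "1 / e < n"
    by (metis gr0I less_trans of_nat_0_less_iff reals_Archimedean2 zero_less_divide_1_iff assms(3))
  define N where "N k = {2 * pi * k / n ..< 2 * pi * (real k + 1) / n}" for k :: nat
  define C where "C k = {y \<in> sphere 0 1. Arg2pi y \<in> N k}" for k :: nat
  have Nsub: "N k \<subseteq> {0..<2*pi}" if "k < n" for k
  proof -
    have "real k + 1 \<le> n" using that by linarith
    then have "2 * pi * (real k + 1) / n \<le> 2 * pi" using n by (simp add: divide_le_eq)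
    then show ?thesis unfolding N_def by (auto intro: order_trans[rotated] less_le_trans)
  qed
  have "N k \<in> sets borel" for k by (simp add: N_def)
  have Cs: "C k \<in> sets mT" and Cm: "measure mT (C k) = 1 / n" if "k < n" for k
  proof -
    note * = emeasure_mT0_Arg2pi[OF \<open>N k \<in> sets borel\<close> Nsub[OF that], folded C_def]
    show "C k \<in> sets mT" using *(1) by (simp add: mT_mT0)
    have "emeasure lborel (N k) = ennreal (2 * pi / n)"
      unfolding N_def using n by (subst emeasure_lborel_Ico) (auto simp: divide_right_mono diff_divide_distrib[symmetric] algebra_simps)
    then have "emeasure mT0 (C k) = ennreal (1 / n)"
      using *(2) by (simp add: divide_ennreal)
    then show "measure mT (C k) = 1 / n"
      using *(1) by (simp add: mT_mT0 measure_def)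
  qed
  have cover: "A \<subseteq> (\<Union>k<n. C k)"
  proof
    fix y assume "y \<in> A"
    then have z: "y \<in> sphere 0 1" using sets.sets_into_space[OF A(1)] by auto
    define s where "s = Arg2pi y * n / (2 * pi)"
    have s: "0 \<le> s" "s < n" using Arg2pi[of y] n by (auto simp: s_def field_simps)
    define k where "k = nat \<lfloor>s\<rfloor>"
    have k: "real k \<le> s" "s < real k + 1" using s by (auto simp: k_def)
    then have "k < n" using s by linarith
    moreover have "Arg2pi y \<in> N k" using k n unfolding N_def s_def by (auto simp: field_simps)
    ultimately show "y \<in> (\<Union>k<n. C k)" using z by (auto simp: C_def)
  qed
  have "\<exists>k<n. measure mT (A \<inter> C k) > 0"
  proof (rule ccontr)
    assume "\<not> ?thesis"
    then have 0: "measure mT (A \<inter> C k) = 0" if "k < n" for k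
      using that by (meson antisym measure_nonneg not_less)
    have "A = (\<Union>k<n. A \<inter> C k)" using cover by auto
    then have "measure mT A \<le> (\<Sum>k<n. measure mT (A \<inter> C k))"
      using mT.finite_measure_subadditive_finite[of "{..<n}" "\<lambda>k. A \<inter> C k"] A(1) Cs by auto
    then show False using 0 A(2) by simp
  qed
  then obtain k where k: "k < n" "measure mT (A \<inter> C k) > 0" by blast
  have "measure mT (A \<inter> C k) \<le> 1 / n"
    using mT.finite_measure_mono[of "A \<inter> C k" "C k"] Cs Cm k(1) by auto
  also have "1 / n \<le> e" using n \<open>e > 0\<close> by (simp add: field_simps)
  finally show ?thesis using that[of "A \<inter> C k"] A(1) Cs k by auto
qed

text \<open>Inner regularity holds for the Borel measure, and a measurable set of the completion differs from a Borel set by a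
  null set.\<close>

lemma mT_compact_subset:
  assumes A: "A \<in> sets mT" "measure mT A > 0"
  obtains K where "compact K" "K \<subseteq> A" "K \<in> sets mT" "measure mT K > 0"
proof -
  obtain S N N' where S: "A = S \<union> N" "N \<subseteq> N'" "N' \<in> null_sets mT0" "S \<in> sets mT0"
    using A(1) unfolding mT_mT0 by (rule sets_completionE)
  have "emeasure mT0 S \<noteq> 0"
  proof
    assume "emeasure mT0 S = 0"
    then have "S \<in> null_sets mT0" using S by auto
    then have "A \<in> null_sets mT" unfolding mT_mT0 S(1)
      using null_sets_completion_subset[OF S(2) null_sets_completionI[OF S(3)]] null_sets_completionI[of S mT0] by (intro null_sets.Un)
    then show False using A(2) by (simp add: measure_def null_sets_def)
  qed
  define B where "B = distr mT0 borel (\<lambda>x. x)"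
  have id: "(\<lambda>x. x) \<in> mT0 \<rightarrow>\<^sub>M borel"
    by (metis measurable_ident_sets measurable_restrict_space1 sets_mT0 measurable_cong_sets measurable_ident id_def)
  have Sb: "S \<in> sets borel" "S \<subseteq> sphere 0 1" using S(4) by (auto simp: sets_mT0 sets_restrict_space)
  have BS: "emeasure B X = emeasure mT0 X" if "X \<in> sets borel" "X \<subseteq> sphere 0 1" for X
    using that id by (simp add: B_def emeasure_distr Int_absorb2)
  have "emeasure B (space B) \<noteq> \<infinity>"
    using id emeasure_mT0_space by (simp add: B_def emeasure_distr)
  then have "emeasure B S = (SUP K \<in> {K. K \<subseteq> S \<and> compact K}. emeasure B K)"
    using Sb by (intro inner_regular) (auto simp: B_def)
  then have "(SUP K \<in> {K. K \<subseteq> S \<and> compact K}. emeasure B K) > 0"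
    using \<open>emeasure mT0 S \<noteq> 0\<close> BS[OF Sb] by (simp add: zero_less_iff_neq_zero)
  then obtain K where K: "K \<subseteq> S" "compact K" "emeasure B K > 0"
    by (auto simp: less_SUP_iff)
  have Kb: "K \<in> sets borel" "K \<subseteq> sphere 0 1" using K Sb by (auto intro: borel_compact)
  then have K0: "K \<in> sets mT0" by (auto simp: sets_mT0 sets_restrict_space_iff)
  have "measure mT K > 0"
    using K(3) BS[OF Kb] K0 mT.emeasure_eq_measure[of K] by (simp add: mT_mT0) 
  with that[of K] K S K0 show ?thesis by (auto simp: mT_mT0)
qed

section \<open>Fatou's theorem\<close>

lemma radial_nontangential:
  assumes "y \<in> sphere 0 1"
  shows "filterlim (\<lambda>r. of_real r * y) (nontangential y) (at_left 1)"
proof -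
  have l: "((\<lambda>r. of_real r * y) \<longlongrightarrow> y) (at_left 1)"
    by (rule tendsto_eq_intros refl | simp)+
  have "eventually (\<lambda>r::real. r \<in> {0<..<1}) (at_left 1)"
    by (intro eventually_at_leftI[of 0]) auto
  then have "eventually (\<lambda>r. of_real r * y \<in> {z \<in> ball 0 1. dist z y < 2 * (1 - norm z)} \<and> of_real r * y \<noteq> y) (at_left 1)"
  proof eventually_elim
    case (elim r)
    have "of_real r * y - y = of_real (r - 1) * y" by (simp add: algebra_simps)
    then have "dist (of_real r * y) y = 1 - r"
      using assms elim by (simp add: dist_norm norm_mult del: of_real_diff)
    then show ?case using assms elim by (auto simp: norm_mult)
  qed
  with l have "filterlim (\<lambda>r. of_real r * y) (at y within {z \<in> ball 0 1. dist z y < 2 * (1 - norm z)}) (at_left 1)"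
    by (auto simp: filterlim_at elim: eventually_mono)
  then show ?thesis
    unfolding nontangential_def
    by (rule filterlim_mono[OF _ SUP_upper order_refl]) auto
qed

lemma nontangential_neq_bot [simp]: "y \<in> sphere 0 1 \<Longrightarrow> nontangential y \<noteq> bot"
proof
  assume "y \<in> sphere 0 1" "nontangential y = bot"
  then have "filterlim (\<lambda>r. of_real r * y) bot (at_left 1)" using radial_nontangential[of y] by simp
  then have "eventually (\<lambda>r::real. False) (at_left 1)" unfolding filterlim_iff by (auto dest: spec[of _ "\<lambda>_. False"])
  then show False by simp
qed

lemma bvI: "(f \<longlongrightarrow> l) (nontangential y) \<Longrightarrow> y \<in> sphere 0 1 \<Longrightarrow> bv f y = l"
  unfolding bv_def by (rule tendsto_Lim) auto

lemma eventually_nontangential: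
  "eventually P (nontangential y) \<longleftrightarrow>
     (\<forall>\<alpha>>1. eventually P (at y within {z \<in> ball 0 1. dist z y < \<alpha> * (1 - norm z)}))"
  unfolding nontangential_def by (auto simp: eventually_Sup)

lemma nontangential_disc: "eventually (\<lambda>z. z \<in> ball 0 1) (nontangential y)"
  unfolding eventually_nontangential by (auto simp: eventually_at_topological)

text \<open>After subtracting the tangent line at the boundary point, the primitive is \<open>o(\<bar>z - y\<bar>)\<close>
  along the circle. The maximum principle carries this estimate into the disc, and Cauchy's inequality on discs of
  radius comparable to the distance from the circle, which in a Stolz angle is comparable to the distance from the
  point, turns it into convergence of the derivative.\<close>

lemma boundary_derivative_imp_nontangential_limit:
  assumes cont: "continuous_on (cball 0 1) F"
    and der: "\<And>z. z \<in> ball 0 1 \<Longrightarrow> (F has_field_derivative f z) (at z)"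
    and D: "((\<lambda>s. F (cis s)) has_vector_derivative D) (at t)"
  shows "(f \<longlongrightarrow> D / (\<i> * cis t)) (nontangential (cis t))"
proof -
  define y where "y = cis t"
  define L where "L = D / (\<i> * cis t)"
  define R where "R z = F z - F y - L * (z - y)" for z
  have zeta: "norm y = 1" "y * cnj y = 1" "cnj y * y = 1" by (auto simp: y_def cis_cnj cis_mult)
  have dz: "norm (1 - z * cnj y) = norm (z - y)" for z
  proof -
    have "1 - z * cnj y = (y - z) * cnj y" by (simp add: algebra_simps zeta)
    then show ?thesis by (simp add: norm_mult norm_minus_commute zeta)
  qed
  have Rcont: "continuous_on (cball 0 1) R"
    unfolding R_def by (intro continuous_intros cont)
  have Rder: "(R has_field_derivative f z - L) (at z)" if "z \<in> ball 0 1" for z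
    unfolding R_def by (rule derivative_eq_intros der that refl | simp)+
  have Rhol: "R holomorphic_on ball 0 1"
    unfolding holomorphic_on_open[OF open_ball] using Rder by blast
  have 1: "\<exists>\<delta>>0. \<forall>\<xi>\<in>sphere 0 1. norm (\<xi> - y) < \<delta> \<longrightarrow> norm (R \<xi>) \<le> \<epsilon> * norm (\<xi> - y)" if "\<epsilon> > 0" for \<epsilon>
  proof -
    have "((\<lambda>s. cis s) has_vector_derivative \<i> * cis t) (at t)"
    proof -
      have "((\<lambda>z. exp (\<i> * z)) has_field_derivative \<i> * cis t) (at (of_real t))"
        by (rule derivative_eq_intros refl | simp add: cis_conv_exp)+
      from has_vector_derivative_real_field[OF this] show ?thesis by (simp add: cis_conv_exp)
    qed
    then have "((\<lambda>s. R (cis s)) has_vector_derivative (D - 0 - L * (\<i> * cis t - 0))) (at t)"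
      unfolding R_def by (intro has_vector_derivative_diff D has_vector_derivative_const has_vector_derivative_mult_right)
    then have "((\<lambda>s. R (cis s)) has_derivative (\<lambda>x. 0)) (at t)"
      by (simp add: L_def has_vector_derivative_def)
    then have "\<forall>e>0. \<exists>d>0. \<forall>s. norm (s - t) < d \<longrightarrow> norm (R (cis s) - R (cis t) - 0) \<le> e * norm (s - t)"
      unfolding has_derivative_at_alt by blast
    moreover have "R (cis t) = 0" by (simp add: R_def y_def)
    ultimately have "\<exists>d>0. \<forall>s. \<bar>s - t\<bar> < d \<longrightarrow> norm (R (cis s)) \<le> \<epsilon> / 2 * \<bar>s - t\<bar>"
      using \<open>\<epsilon> > 0\<close> by (metis diff_zero half_gt_zero real_norm_def)
    then obtain d where d: "d > 0" "\<And>s. \<bar>s - t\<bar> < d \<Longrightarrow> norm (R (cis s)) \<le> \<epsilon> / 2 * \<bar>s - t\<bar>" by blast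
    have "(Ln has_field_derivative inverse 1) (at 1)"
      by (rule has_field_derivative_Ln) (auto simp: complex_nonpos_Reals_iff)
    then have "\<forall>e>0. \<exists>d>0. \<forall>x. norm (x - 1) < d \<longrightarrow> norm (Ln x - Ln 1 - inverse 1 * (x - 1)) \<le> e * norm (x - 1)"
      unfolding has_field_derivative_def has_derivative_at_alt by blast
    then have "\<exists>d>0. \<forall>x. norm (x - 1) < d \<longrightarrow> norm (Ln x - (x - 1)) \<le> 1 * norm (x - 1)"
      using zero_less_one by (metis Ln_1 diff_zero inverse_1 mult_1)
    then obtain d' where d': "d' > 0" "\<And>x. norm (x - 1) < d' \<Longrightarrow> norm (Ln x - (x - 1)) \<le> 1 * norm (x - 1)"
      by blast
    show ?thesis
    proof (intro exI[of _ "min d' (d / 2)"] conjI ballI impI)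
      fix \<xi> :: complex assume x: "\<xi> \<in> sphere 0 1" "norm (\<xi> - y) < min d' (d / 2)"
      define w where "w = \<xi> * cnj y"
      have w: "norm w = 1" "norm (w - 1) = norm (\<xi> - y)" "\<xi> = y * w"
        using x dz[of \<xi>] by (auto simp: w_def norm_mult zeta norm_minus_commute mult.left_commute)
      have "norm (Ln w - (w - 1)) \<le> norm (w - 1)" using d'(2)[of w] x w by auto
      then have "norm (Ln w) \<le> 2 * norm (\<xi> - y)"
        using norm_triangle_ineq[of "Ln w - (w - 1)" "w - 1"] w by simp
      then have im: "\<bar>Im (Ln w)\<bar> \<le> 2 * norm (\<xi> - y)"
        using abs_Im_le_cmod[of "Ln w"] by linarith
      have "w \<noteq> 0" using w by auto
      have "exp (Ln w) = w" by (rule exp_Ln) fact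
      moreover have "Re (Ln w) = 0" using \<open>w \<noteq> 0\<close> w by simp
      ultimately have "cis (Im (Ln w)) = w"
        by (simp add: exp_eq_polar)
      then have xi: "\<xi> = cis (t + Im (Ln w))" using w(3) by (simp add: y_def cis_mult[symmetric])
      have "norm (R \<xi>) \<le> \<epsilon> / 2 * \<bar>Im (Ln w)\<bar>"
        using d(2)[of "t + Im (Ln w)"] im x xi by auto
      also have "\<dots> \<le> \<epsilon> / 2 * (2 * norm (\<xi> - y))" using im that by (intro mult_left_mono) auto
      finally show "norm (R \<xi>) \<le> \<epsilon> * norm (\<xi> - y)" by simp
    qed (use d d' in auto)
  qed
  have 2: "\<exists>\<eta>>0. \<forall>z\<in>ball 0 1. norm (z - y) < \<eta> \<longrightarrow> norm (R z) \<le> 2 * \<epsilon> * norm (z - y)" if e: "\<epsilon> > 0" for \<epsilon>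
  proof -
    obtain \<delta> where \<delta>: "\<delta> > 0" "\<And>\<xi>. \<xi> \<in> sphere 0 1 \<Longrightarrow> norm (\<xi> - y) < \<delta> \<Longrightarrow> norm (R \<xi>) \<le> \<epsilon> * norm (\<xi> - y)"
      using 1[OF e] by blast
    have "compact (R ` cball 0 1)" by (intro compact_continuous_image Rcont) auto
    then obtain M where M: "M > 0" "\<And>z. z \<in> cball 0 1 \<Longrightarrow> norm (R z) \<le> M"
      using compact_imp_bounded[THEN bounded_pos[THEN iffD1]] by (metis imageI)
    \<comment> \<open>The scale at which the bound near the point and the trivial bound by \<open>M\<close> on the rest of the circle match.\<close>
    define s where "s = \<epsilon> * \<delta> * \<delta> / M"
    have s: "s > 0" using e \<delta> M by (simp add: s_def)
    have den: "norm (1 + of_real a - z * cnj y) \<ge> a" "norm (1 + of_real a - z * cnj y) \<ge> norm (z - y)"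
      if "z \<in> cball 0 1" "a > 0" for z a
    proof -
      have n: "norm (z * cnj y) \<le> 1" using that zeta by (simp add: norm_mult)
      then have re: "Re (z * cnj y) \<le> 1" using complex_Re_le_cmod order_trans by blast
      have "norm (1 + of_real a :: complex) - norm (z * cnj y) \<le> norm (1 + of_real a - z * cnj y)"
        by (rule norm_triangle_ineq2)
      moreover have "norm (1 + of_real a :: complex) = 1 + a"
        using that by (metis abs_of_pos add_pos_pos norm_of_real of_real_1 of_real_add zero_less_one)
      ultimately show "norm (1 + of_real a - z * cnj y) \<ge> a" using n by linarith
      have "norm (1 - z * cnj y) \<le> norm (1 + of_real a - z * cnj y)"
      proof -
        define w where "w = z * cnj y"
        have "(1 - Re w)\<^sup>2 \<le> (1 + a - Re w)\<^sup>2" using re that(2) by (intro power_mono) (auto simp: w_def)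
        then have "cmod (1 - w) \<le> cmod (1 + of_real a - w)" by (simp add: cmod_def)
        then show ?thesis by (simp add: w_def)
      qed
      then show "norm (1 + of_real a - z * cnj y) \<ge> norm (z - y)" by (simp add: dz)
    qed
    have key: "norm (R z) * s \<le> \<epsilon> * norm (1 + of_real s - z * cnj y) * norm (1 + of_real a - z * cnj y)"
      if z: "z \<in> ball 0 1" and a: "a > 0" for z a
    proof -
      \<comment> \<open>The first factor of the denominator compensates for the weaker bound far from the point; the second, with
        \<open>a\<close> tending to \<open>0\<close>, avoids a pole at the point.\<close>
      define g where "g z = R z * of_real s / ((1 + of_real s - z * cnj y) * (1 + of_real a - z * cnj y))" for z
      have nz: "(1 + of_real s - z * cnj y) * (1 + of_real a - z * cnj y) \<noteq> 0" if "z \<in> cball 0 1" for z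
        using den(1)[OF that s] den(1)[OF that a] s a by auto
      have "norm (g z) \<le> \<epsilon>"
      proof (rule maximum_modulus_frontier[where S = "ball 0 1" and f = g])
        show "g holomorphic_on interior (ball 0 1)"
          unfolding g_def using nz by (auto intro!: holomorphic_intros Rhol)
        show "continuous_on (closure (ball 0 1)) g"
          unfolding g_def using nz by (auto intro!: continuous_intros Rcont)
        fix \<xi> :: complex assume "\<xi> \<in> frontier (ball 0 1)"
        then have xi: "\<xi> \<in> sphere 0 1" "\<xi> \<in> cball 0 1" by auto
        have *: "norm (R \<xi>) * s \<le> \<epsilon> * norm (\<xi> - y) * norm (1 + of_real s - \<xi> * cnj y)"
        proof (cases "norm (\<xi> - y) < \<delta>")
          case True
          then show ?thesis using \<delta>(2)[OF xi(1) True] den(1)[OF xi(2) s] s e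
            by (intro mult_mono) auto
        next
          case False
          have "norm (R \<xi>) * s \<le> M * s" using M(2)[OF xi(2)] s by (intro mult_right_mono) auto
          also have "\<dots> = \<epsilon> * \<delta> * \<delta>" using M(1) by (simp add: s_def)
          also have "\<dots> \<le> \<epsilon> * norm (\<xi> - y) * norm (1 + of_real s - \<xi> * cnj y)"
            using False den(2)[OF xi(2) s] e \<delta> by (intro mult_mono) auto
          finally show ?thesis .
        qed
        also have "\<dots> \<le> \<epsilon> * norm (1 + of_real a - \<xi> * cnj y) * norm (1 + of_real s - \<xi> * cnj y)"
          using den(2)[OF xi(2) a] e by (intro mult_mono) auto
        finally show "norm (g \<xi>) \<le> \<epsilon>"
          using nz[OF xi(2)] s by (simp add: g_def norm_divide norm_mult divide_le_eq mult_ac)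
      qed (use z in auto)
      then show ?thesis
        using nz[of z] z s by (simp add: g_def norm_divide norm_mult divide_le_eq mult_ac)
    qed
    have key2: "norm (R z) * s \<le> \<epsilon> * norm (1 + of_real s - z * cnj y) * norm (z - y)" if z: "z \<in> ball 0 1" for z
    proof (rule tendsto_le[of "at_right (0::real)"])
      show "((\<lambda>a. norm (R z) * s) \<longlongrightarrow> norm (R z) * s) (at_right 0)" by simp
      have "((\<lambda>a. \<epsilon> * norm (1 + of_real s - z * cnj y) * norm (1 + of_real a - z * cnj y)) \<longlongrightarrow>
         \<epsilon> * norm (1 + of_real s - z * cnj y) * norm (1 + of_real 0 - z * cnj y)) (at_right 0)"
        by (intro tendsto_intros)
      then show "((\<lambda>a. \<epsilon> * norm (1 + of_real s - z * cnj y) * norm (1 + of_real a - z * cnj y)) \<longlongrightarrow>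
         \<epsilon> * norm (1 + of_real s - z * cnj y) * norm (z - y)) (at_right 0)" by (simp add: dz)
      show "\<forall>\<^sub>F a in at_right 0. norm (R z) * s \<le> \<epsilon> * norm (1 + of_real s - z * cnj y) * norm (1 + of_real a - z * cnj y)"
        using eventually_at_right_less[of 0] by eventually_elim (use key z in auto)
    qed simp
    show ?thesis
    proof (intro exI[of _ s] conjI ballI impI)
      fix z assume z: "z \<in> ball 0 1" "norm (z - y) < s"
      have "1 + of_real s - z * cnj y = of_real s + (1 - z * cnj y)" by simp
      then have "norm (1 + of_real s - z * cnj y) \<le> s + norm (z - y)"
        using norm_triangle_ineq[of "of_real s" "1 - z * cnj y"] s by (simp only: dz) simp
      then have "norm (1 + of_real s - z * cnj y) \<le> 2 * s" using z by simp
      then have "\<epsilon> * norm (1 + of_real s - z * cnj y) * norm (z - y) \<le> \<epsilon> * (2 * s) * norm (z - y)"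
        using e by (intro mult_right_mono mult_left_mono) auto
      with key2[OF z(1)] have "norm (R z) * s \<le> (2 * \<epsilon> * norm (z - y)) * s" by (simp add: mult_ac)
      then show "norm (R z) \<le> 2 * \<epsilon> * norm (z - y)" using s by simp
    qed (use s in auto)
  qed
  have "((\<lambda>z. f z) \<longlongrightarrow> L) (nontangential y)"
  proof (rule tendstoI)
    fix e :: real assume e: "e > 0"
    show "\<forall>\<^sub>F x in nontangential y. dist (f x) L < e"
      unfolding eventually_nontangential
    proof (intro allI impI)
      fix \<alpha> :: real assume \<alpha>: "\<alpha> > 1"
      define \<epsilon> where "\<epsilon> = e / (4 * (2 * \<alpha> + 1))"
      have \<epsilon>: "\<epsilon> > 0" using e \<alpha> by (simp add: \<epsilon>_def)
      obtain \<eta> where \<eta>: "\<eta> > 0" "\<And>z. z \<in> ball 0 1 \<Longrightarrow> norm (z - y) < \<eta> \<Longrightarrow> norm (R z) \<le> 2 * \<epsilon> * norm (z - y)"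
        using 2[OF \<epsilon>] by blast
      show "\<forall>\<^sub>F x in at y within {z \<in> ball 0 1. dist z y < \<alpha> * (1 - cmod z)}. dist (f x) L < e"
        unfolding eventually_at
      proof (intro exI[of _ "\<eta> / 2"] conjI ballI impI)
        fix z assume "z \<in> {z \<in> ball 0 1. dist z y < \<alpha> * (1 - cmod z)}" "z \<noteq> y \<and> dist z y < \<eta> / 2"
        then have z: "norm z < 1" "norm (z - y) < \<alpha> * (1 - cmod z)" "norm (z - y) < \<eta> / 2"
          by (auto simp: dist_norm)
        \<comment> \<open>The closed disc of this radius stays in the open unit disc, and its radius is comparable to the distance from
          \<open>z\<close> to the boundary point.\<close>
        define \<rho> where "\<rho> = (1 - norm z) / 2"
        have \<rho>: "\<rho> > 0" using z by (simp add: \<rho>_def)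
        have sub: "cball z \<rho> \<subseteq> ball 0 1"
        proof
          fix x assume "x \<in> cball z \<rho>"
          then have "norm (x - z) \<le> \<rho>" by (simp add: dist_norm norm_minus_commute)
          then have "norm x \<le> norm z + \<rho>" using norm_triangle_ineq[of z "x - z"] by simp
          then show "x \<in> ball 0 1" using z by (simp add: \<rho>_def field_simps)
        qed
        have rle: "2 * \<rho> \<le> norm (z - y)"
          using norm_triangle_ineq2[of y z] zeta by (simp add: \<rho>_def norm_minus_commute)
        have "norm ((deriv ^^ 1) R z) \<le> fact 1 * (2 * \<epsilon> * ((2 * \<alpha> + 1) * \<rho>)) / \<rho> ^ 1"
        proof (rule Cauchy_inequality)
          show "R holomorphic_on ball z \<rho>"
            using sub ball_subset_cball by (blast intro: holomorphic_on_subset[OF Rhol])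
          show "continuous_on (cball z \<rho>) R"
            using sub ball_subset_cball by (blast intro: continuous_on_subset[OF Rcont])
          fix x assume x: "norm (z - x) = \<rho>"
          then have xb: "x \<in> ball 0 1" using sub by (auto simp: dist_norm)
          have xz: "norm (x - y) \<le> \<rho> + norm (z - y)"
            using norm_triangle_ineq[of "x - z" "z - y"] x by (simp add: norm_minus_commute)
          have "norm (R x) \<le> 2 * \<epsilon> * norm (x - y)"
            using xz rle z(3) \<rho> by (intro \<eta>(2) xb) linarith
          also have "\<dots> \<le> 2 * \<epsilon> * ((2 * \<alpha> + 1) * \<rho>)"
          proof -
            have "norm (z - y) \<le> 2 * \<alpha> * \<rho>" using z(2) by (simp add: \<rho>_def)
            then have "norm (x - y) \<le> (2 * \<alpha> + 1) * \<rho>" using xz by (simp add: algebra_simps)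
            then show ?thesis using \<epsilon> by (intro mult_left_mono) auto
          qed
          finally show "norm (R x) \<le> 2 * \<epsilon> * ((2 * \<alpha> + 1) * \<rho>)" .
        qed fact
        moreover have "deriv R z = f z - L" using Rder[of z] z by (intro DERIV_imp_deriv) auto
        ultimately have "norm (f z - L) \<le> 2 * \<epsilon> * (2 * \<alpha> + 1)" using \<rho> by simp
        also have "\<dots> = e / 2" using \<alpha> by (simp add: \<epsilon>_def field_simps)
        also have "\<dots> < e" using e by simp
        finally show "dist (f z) L < e" by (simp add: dist_norm)
      qed (use \<eta> in auto)
    qed
  qed
  then show ?thesis by (simp add: y_def L_def)
qed

subsection \<open>Cauchy--Schwarz\<close>

lemma sq_le_mult_of_AM_GM:
  fixes x A B :: real
  assumes "x \<ge> 0" "A \<ge> 0" "B \<ge> 0" and *: "\<And>t. t > 0 \<Longrightarrow> 2 * x \<le> t * A + B / t"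
  shows "x\<^sup>2 \<le> A * B"
proof (cases "A = 0 \<or> B = 0")
  case False
  then have AB: "A > 0" "B > 0" using assms by auto
  have "2 * x \<le> sqrt (B / A) * A + B / sqrt (B / A)" using AB by (intro *) auto
  also have "\<dots> = 2 * sqrt (A * B)"
  proof -
    have "sqrt (B / A) * A = sqrt (A * B)" "B / sqrt (B / A) = sqrt (A * B)"
      using AB by (simp_all add: real_sqrt_divide real_sqrt_mult real_div_sqrt field_simps)
    then show ?thesis by simp
  qed
  finally have "x \<le> sqrt (A * B)" by simp
  then have "x\<^sup>2 \<le> (sqrt (A * B))\<^sup>2" using assms(1) by (intro power_mono) auto
  then show ?thesis using AB by simp
next
  case True
  have "x \<le> 0"
  proof (rule ccontr)
    assume "\<not> x \<le> 0"
    then have x: "x > 0" by simp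
    show False
    proof (cases "A = 0")
      case True
      have "B / ((B + 1) / x) \<le> x" using x assms by (simp add: divide_simps)
      moreover have "(B + 1) / x > 0" using x assms by simp
      ultimately have "2 * x \<le> x" using *[of "(B + 1) / x"] True by simp
      then show False using x by simp
    next
      case False
      then have "B = 0" using \<open>A = 0 \<or> B = 0\<close> by simp
      have "x / (A + 1) * A \<le> x" using x assms by (simp add: divide_simps)
      moreover have "x / (A + 1) > 0" using x assms by simp
      ultimately have "2 * x \<le> x" using *[of "x / (A + 1)"] \<open>B = 0\<close> by simp
      then show False using x by simp
    qed
  qed
  then show ?thesis using assms True by auto
qed

lemma borel_measurable_cnj [measurable (raw)]:
  "f \<in> borel_measurable M \<Longrightarrow> (\<lambda>x. cnj (f x)) \<in> borel_measurable M"
  by (rule borel_measurable_continuous_on[where f = cnj]) (auto intro: continuous_intros)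

lemma integrable_mult_cnj:
  fixes f g :: "'a \<Rightarrow> complex"
  assumes [measurable]: "f \<in> borel_measurable M" "g \<in> borel_measurable M"
    and "integrable M (\<lambda>x. (cmod (f x))\<^sup>2)" "integrable M (\<lambda>x. (cmod (g x))\<^sup>2)"
  shows "integrable M (\<lambda>x. f x * cnj (g x))"
proof (rule Bochner_Integration.integrable_bound)
  show "integrable M (\<lambda>x. (cmod (f x))\<^sup>2 + (cmod (g x))\<^sup>2)" using assms by auto
  show "AE x in M. norm (f x * cnj (g x)) \<le> norm ((cmod (f x))\<^sup>2 + (cmod (g x))\<^sup>2)"
  proof (rule AE_I2)
    fix x 
    have "2 * (cmod (f x) * cmod (g x)) \<le> (cmod (f x))\<^sup>2 + (cmod (g x))\<^sup>2"
      using sum_squares_bound[of "cmod (f x)" "cmod (g x)"] by simp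
    moreover have "0 \<le> cmod (f x) * cmod (g x)" by simp
    ultimately show "norm (f x * cnj (g x)) \<le> norm ((cmod (f x))\<^sup>2 + (cmod (g x))\<^sup>2)"
      unfolding norm_mult complex_mod_cnj real_norm_def by linarith
  qed
qed measurable

lemma Cauchy_Schwarz_integral:
  fixes f g :: "'a \<Rightarrow> complex"
  assumes [measurable]: "f \<in> borel_measurable M" "g \<in> borel_measurable M"
    and i: "integrable M (\<lambda>x. (cmod (f x))\<^sup>2)" "integrable M (\<lambda>x. (cmod (g x))\<^sup>2)"
  shows "(cmod (\<integral>x. f x * cnj (g x) \<partial>M))\<^sup>2 \<le> (\<integral>x. (cmod (f x))\<^sup>2 \<partial>M) * (\<integral>x. (cmod (g x))\<^sup>2 \<partial>M)"
proof (rule sq_le_mult_of_AM_GM)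
  fix t :: real assume t: "t > 0"
  have "cmod (\<integral>x. f x * cnj (g x) \<partial>M) \<le> (\<integral>x. (t * (cmod (f x))\<^sup>2 + (cmod (g x))\<^sup>2 / t) / 2 \<partial>M)"
  proof (rule order_trans[OF integral_norm_bound integral_mono])
    fix x
    have "2 * (sqrt t * cmod (f x)) * (cmod (g x) / sqrt t) \<le> (sqrt t * cmod (f x))\<^sup>2 + (cmod (g x) / sqrt t)\<^sup>2"
      by (rule sum_squares_bound)
    then show "norm (f x * cnj (g x)) \<le> (t * (cmod (f x))\<^sup>2 + (cmod (g x))\<^sup>2 / t) / 2"
      using t by (simp add: norm_mult power_mult_distrib power_divide)
  qed (use i integrable_mult_cnj[OF assms] in auto)
  also have "\<dots> = (t * (\<integral>x. (cmod (f x))\<^sup>2 \<partial>M) + (\<integral>x. (cmod (g x))\<^sup>2 \<partial>M) / t) / 2"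
    using i by simp
  finally show "2 * cmod (\<integral>x. f x * cnj (g x) \<partial>M) \<le> t * (\<integral>x. (cmod (f x))\<^sup>2 \<partial>M) + (\<integral>x. (cmod (g x))\<^sup>2 \<partial>M) / t"
    by simp
qed auto

subsection \<open>The primitive of a power series with square summable coefficients\<close>

definition l2 :: "(nat \<Rightarrow> complex) \<Rightarrow> bool" where
  "l2 a \<longleftrightarrow> summable (\<lambda>n. (cmod (a n))\<^sup>2)"

definition psum :: "(nat \<Rightarrow> complex) \<Rightarrow> nat \<Rightarrow> complex \<Rightarrow> complex" where
  "psum a N z = (\<Sum>n<N. a n * z ^ n)"

definition pser :: "(nat \<Rightarrow> complex) \<Rightarrow> complex \<Rightarrow> complex" where
  "pser a = on_disc (\<lambda>z. \<Sum>n. a n * z ^ n)"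

definition prim_coeff :: "(nat \<Rightarrow> complex) \<Rightarrow> nat \<Rightarrow> complex" where
  "prim_coeff a n = (if n = 0 then 0 else a (n - 1) / of_nat n)"

text \<open>The primitive of the power series; its coefficients are absolutely summable, so that it is continuous up to the
  circle.\<close>

definition prim :: "(nat \<Rightarrow> complex) \<Rightarrow> complex \<Rightarrow> complex" where
  "prim a z = (\<Sum>n. prim_coeff a n * z ^ n)"

lemma l2_summable_prim:
  assumes "l2 a"
  shows "summable (\<lambda>n. cmod (prim_coeff a n))"
proof (subst summable_Suc_iff[symmetric], rule summable_comparison_test')
  show "summable (\<lambda>n. (cmod (a n))\<^sup>2 + inverse (real (Suc n) ^ 2))"
    using assms inverse_squares_sums by (intro summable_add) (auto simp: l2_def sums_iff inverse_eq_divide)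
  fix n :: nat
  have "2 * cmod (a n) * inverse (real (Suc n)) \<le> (cmod (a n))\<^sup>2 + (inverse (real (Suc n)))\<^sup>2"
    by (rule sum_squares_bound)
  moreover have "0 \<le> cmod (a n) * inverse (real (Suc n))" by simp
  ultimately have "cmod (a n) * inverse (real (Suc n)) \<le> (cmod (a n))\<^sup>2 + (inverse (real (Suc n)))\<^sup>2" by linarith
  then show "norm (cmod (prim_coeff a (Suc n))) \<le> (cmod (a n))\<^sup>2 + inverse (real (Suc n) ^ 2)"
    by (simp add: prim_coeff_def divide_inverse power_inverse norm_mult norm_inverse del: of_nat_Suc)
qed

lemma l2_bounded:
  assumes "l2 a"
  obtains B where "\<And>n. cmod (a n) \<le> B"
proof -
  have "(\<lambda>n. (cmod (a n))\<^sup>2) \<longlonglongrightarrow> 0" using assms unfolding l2_def by (rule summable_LIMSEQ_zero)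
  then have "Bseq (\<lambda>n. (cmod (a n))\<^sup>2)" by (meson convergentI convergent_imp_Bseq)
  then obtain K where K: "K > 0" "\<And>n. norm ((cmod (a n))\<^sup>2) \<le> K" by (auto elim!: BseqE)
  have "cmod (a n) \<le> sqrt K" for n using K(2)[of n] by (intro real_le_rsqrt) simp
  then show ?thesis using that by blast
qed

lemma bounded_coeff_summable:
  fixes a :: "nat \<Rightarrow> complex"
  assumes "\<And>n. cmod (a n) \<le> B" "norm z < 1"
  shows "summable (\<lambda>n. norm (a n * z ^ n))"
proof (rule summable_comparison_test')
  show "summable (\<lambda>n. B * norm z ^ n)" using assms by (intro summable_mult summable_geometric) auto
  show "norm (norm (a n * z ^ n)) \<le> B * norm z ^ n" for n
    using assms(1)[of n] by (simp add: norm_mult norm_power mult_right_mono)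
qed

lemma l2_power_summable:
  assumes "l2 a" "norm z < 1"
  shows "summable (\<lambda>n. norm (a n * z ^ n))" "summable (\<lambda>n. a n * z ^ n)"
proof -
  obtain B where "\<And>n. cmod (a n) \<le> B" using l2_bounded[OF assms(1)] by blast
  then show "summable (\<lambda>n. norm (a n * z ^ n))" using assms(2) by (rule bounded_coeff_summable)
  then show "summable (\<lambda>n. a n * z ^ n)" by (rule summable_norm_cancel)
qed

lemma prim_uniform:
  assumes "l2 a"
  shows "uniform_limit (cball 0 1) (\<lambda>N z. \<Sum>n<N. prim_coeff a n * z ^ n) (prim a) sequentially"
  unfolding prim_def
proof (rule Weierstrass_m_test)
  show "summable (\<lambda>n. cmod (prim_coeff a n))" by (rule l2_summable_prim[OF assms])
  show "norm (prim_coeff a n * z ^ n) \<le> cmod (prim_coeff a n)" if "z \<in> cball 0 1" for n z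
    using that mult_left_mono[of "norm z ^ n" 1 "cmod (prim_coeff a n)"] by (simp add: norm_mult norm_power power_le_one)
qed

lemma prim_continuous: "l2 a \<Longrightarrow> continuous_on (cball 0 1) (prim a)"
  by (rule uniform_limit_theorem[OF _ prim_uniform]) (auto intro!: always_eventually continuous_intros)

lemma prim_deriv:
  assumes "l2 a" "z \<in> ball 0 1"
  shows "(prim a has_field_derivative pser a z) (at z)"
proof -
  have d: "diffs (prim_coeff a) = a"
    by (rule ext) (simp add: diffs_def prim_coeff_def del: of_nat_Suc)
  have "((\<lambda>z. \<Sum>n. prim_coeff a n * z ^ n) has_field_derivative (\<Sum>n. diffs (prim_coeff a) n * z ^ n)) (at z)"
  proof (rule termdiffs_strong[where K = 1])
    show "summable (\<lambda>n. prim_coeff a n * 1 ^ n)"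
      using l2_summable_prim[OF assms(1)] by (simp add: summable_norm_cancel)
  qed (use assms in auto)
  then show ?thesis using assms by (simp add: d prim_def[abs_def] pser_def on_disc_def)
qed

lemma psum_cis_norm2:
  fixes m :: nat
  shows "(LINT t:{s..s + 2*pi*m}|lborel. (cmod (psum a N (cis t)))\<^sup>2) = 2 * pi * m * (\<Sum>n<N. (cmod (a n))\<^sup>2)"
proof -
  have "complex_of_real (LINT t:{s..s + 2*pi*m}|lborel. (cmod (psum a N (cis t)))\<^sup>2) =
     (LINT t:{s..s + 2*pi*m}|lborel. complex_of_real ((cmod (psum a N (cis t)))\<^sup>2))"
    by (rule set_integral_complex_of_real[symmetric])
  also have "(\<lambda>t. complex_of_real ((cmod (psum a N (cis t)))\<^sup>2)) = 
      (\<lambda>t. \<Sum>j<N. \<Sum>k<N. a j * cnj (a k) * cis (of_int (int j - int k) * t))"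
  proof
    fix t
    have "complex_of_real ((cmod (psum a N (cis t)))\<^sup>2) = psum a N (cis t) * cnj (psum a N (cis t))"
      by (rule complex_norm_square)
    also have "\<dots> = (\<Sum>j<N. \<Sum>k<N. (a j * cis t ^ j) * (cnj (a k) * cnj (cis t) ^ k))"
      by (simp add: psum_def sum_product)
    also have "\<dots> = (\<Sum>j<N. \<Sum>k<N. a j * cnj (a k) * cis (of_int (int j - int k) * t))"
    proof (intro sum.cong refl)
      fix j k
      have "cis t ^ j * cnj (cis t) ^ k = cis (of_int (int j - int k) * t)"
        by (simp only: cis_cnj Complex.DeMoivre cis_mult, simp add: algebra_simps)
      then show "(a j * cis t ^ j) * (cnj (a k) * cnj (cis t) ^ k) = a j * cnj (a k) * cis (of_int (int j - int k) * t)"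
        by (metis (no_types, lifting) mult.assoc mult.left_commute)
    qed
    finally show "complex_of_real ((cmod (psum a N (cis t)))\<^sup>2) = (\<Sum>j<N. \<Sum>k<N. a j * cnj (a k) * cis (of_int (int j - int k) * t))" .
  qed
  also have "(LINT t:{s..s + 2*pi*m}|lborel. \<Sum>j<N. \<Sum>k<N. a j * cnj (a k) * cis (of_int (int j - int k) * t)) =
     (\<Sum>j<N. \<Sum>k<N. a j * cnj (a k) * (LINT t:{s..s + 2*pi*m}|lborel. cis (of_int (int j - int k) * t)))"
  proof -
    have i: "set_integrable lborel {s..s + 2*pi*m} (\<lambda>t. a j * cnj (a k) * cis (of_int (int j - int k) * t))" for j k
      by (intro borel_integrable_atLeastAtMost' continuous_intros)
    have i2: "set_integrable lborel {s..s + 2*pi*m} (\<lambda>t. \<Sum>k<N. a j * cnj (a k) * cis (of_int (int j - int k) * t))" for j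
      by (intro borel_integrable_atLeastAtMost' continuous_intros)
    show ?thesis
      using i i2 unfolding set_lebesgue_integral_def set_integrable_def
      by (simp add: scaleR_sum_right integral_sum mult_scaleR_right[symmetric] del: mult_scaleR_right scaleR_conv_of_real sum.inter_filter sum_indicator_scaleR sum_indicator_mult)
  qed
  also have "\<dots> = (\<Sum>j<N. \<Sum>k<N. if j = k then a j * cnj (a k) * (2 * pi * m) else 0)"
    unfolding set_integral_cis_period by (intro sum.cong refl) auto
  also have "\<dots> = (\<Sum>j<N. a j * cnj (a j) * (2 * pi * m))" by simp
  also have "\<dots> = complex_of_real (2 * pi * m * (\<Sum>n<N. (cmod (a n))\<^sup>2))"
    by (simp add: complex_norm_square[symmetric] sum_distrib_right[symmetric] mult.commute del: of_real_power flip: of_real_sum of_real_power)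
  finally show ?thesis using of_real_eq_iff by blast
qed

text \<open>Increments along an arc are integrals of the partial sums, so that sums of squared increments over disjoint arcs are
  controlled by the orthogonality of the powers.\<close>

lemma prim_partial_increment:
  fixes x y :: real
  assumes "x \<le> y"
  shows "(\<Sum>n<Suc N. prim_coeff a n * cis y ^ n) - (\<Sum>n<Suc N. prim_coeff a n * cis x ^ n) =
     (LINT t:{x..y}|lborel. \<i> * cis t * psum a N (cis t))"
    (is "?F y - ?F x = _")
proof -
  have der: "(?F has_vector_derivative \<i> * cis t * psum a N (cis t)) (at t within S)" for t S
  proof -
    have F: "?F = (\<lambda>t. \<Sum>n<N. a n / of_nat (Suc n) * cis t ^ Suc n)"
      by (subst sum.lessThan_Suc_shift) (simp add: prim_coeff_def del: of_nat_Suc power_Suc sum.lessThan_Suc)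
    have "((\<lambda>z. \<Sum>n<N. a n / of_nat (Suc n) * exp (\<i> * z) ^ Suc n) has_field_derivative
       (\<Sum>n<N. a n / of_nat (Suc n) * (of_nat (Suc n) * cis t ^ n * (\<i> * cis t)))) (at (of_real t))"
      by (rule derivative_eq_intros refl sum.cong | simp add: cis_conv_exp del: of_nat_Suc)+
    from has_vector_derivative_real_field[OF this]
    show ?thesis unfolding F
      by (simp add: cis_conv_exp psum_def sum_distrib_left mult_ac del: of_nat_Suc power_Suc)
  qed
  show ?thesis unfolding set_lebesgue_integral_def
    by (rule integral_FTC_Icc[symmetric, OF assms der]) (auto simp: psum_def intro!: continuous_intros)
qed

text \<open>Cauchy--Schwarz bounds each term by the integral of the squared partial sum over its arc. The arcs are disjoint and
  cover the circle at most three times, whence the constant.\<close>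

lemma weak_type_partial:
  assumes fin: "finite I" and le: "\<And>i. i \<in> I \<Longrightarrow> x i \<le> y i"
    and sub: "\<And>i. i \<in> I \<Longrightarrow> {x i..y i} \<subseteq> {- 2 * pi..4 * pi}"
    and disj: "\<And>i j. i \<in> I \<Longrightarrow> j \<in> I \<Longrightarrow> i \<noteq> j \<Longrightarrow> {x i..y i} \<inter> {x j..y j} = {}"
  shows "(\<Sum>i\<in>I. (cmod ((\<Sum>n<Suc N. prim_coeff a n * cis (y i) ^ n) - (\<Sum>n<Suc N. prim_coeff a n * cis (x i) ^ n)))\<^sup>2 / (y i - x i))
     \<le> 6 * pi * (\<Sum>n<N. (cmod (a n))\<^sup>2)"
proof -
  define g where "g t = (cmod (psum a N (cis t)))\<^sup>2" for t
  have gc: "continuous_on S g" for S unfolding g_def psum_def by (intro continuous_intros)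
  have gi: "set_integrable lborel {s..r} g" for s r
    by (intro borel_integrable_atLeastAtMost' gc)
  have "(cmod ((\<Sum>n<Suc N. prim_coeff a n * cis (y i) ^ n) - (\<Sum>n<Suc N. prim_coeff a n * cis (x i) ^ n)))\<^sup>2 / (y i - x i)
    \<le> (LINT t:{x i..y i}|lborel. g t)" if "i \<in> I" for i
  proof (cases "x i = y i")
    case True
    then show ?thesis by (simp add: set_lebesgue_integral_def g_def)
  next
    case False
    then have lt: "x i < y i" using le[OF that] by simp
    let ?A = "{x i..y i}"
    have c1: "set_integrable lborel ?A (\<lambda>t. g t)" by (rule gi)
    have mm: "(\<lambda>t. indicat_real ?A t *\<^sub>R (\<i> * cis t * psum a N (cis t))) \<in> borel_measurable lborel"
      "(\<lambda>t. indicat_real ?A t *\<^sub>R (1::complex)) \<in> borel_measurable lborel"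
      unfolding psum_def 
      by (auto intro!: borel_measurable_continuous_on_indicator continuous_intros)
    have sq1: "(\<lambda>t. (cmod (indicat_real ?A t *\<^sub>R (\<i> * cis t * psum a N (cis t))))\<^sup>2) = (\<lambda>t. indicat_real ?A t *\<^sub>R g t)"
      by (auto simp: g_def norm_mult split: split_indicator)
    have sq2: "(\<lambda>t. (cmod (indicat_real ?A t *\<^sub>R (1::complex)))\<^sup>2) = indicat_real ?A"
      by (auto split: split_indicator)
    have eq: "(\<lambda>t. indicat_real ?A t *\<^sub>R (\<i> * cis t * psum a N (cis t)) * cnj (indicat_real ?A t *\<^sub>R 1)) =
      (\<lambda>t. indicat_real ?A t *\<^sub>R (\<i> * cis t * psum a N (cis t)))"
      by (auto split: split_indicator)
    have "(cmod (LINT t:?A|lborel. \<i> * cis t * psum a N (cis t)))\<^sup>2 \<le> (LINT t:?A|lborel. g t) * (\<integral>t. indicat_real ?A t \<partial>lborel)"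
      using Cauchy_Schwarz_integral[OF mm] c1 unfolding sq1 sq2 eq set_lebesgue_integral_def set_integrable_def
      using lt by simp
    also have "(\<integral>t. indicat_real ?A t \<partial>lborel) = y i - x i" using lt by simp
    finally show ?thesis using lt unfolding prim_partial_increment[OF le[OF that]] by (simp add: divide_le_eq)
  qed
  then have "(\<Sum>i\<in>I. (cmod ((\<Sum>n<Suc N. prim_coeff a n * cis (y i) ^ n) - (\<Sum>n<Suc N. prim_coeff a n * cis (x i) ^ n)))\<^sup>2 / (y i - x i))
     \<le> (\<Sum>i\<in>I. (LINT t:{x i..y i}|lborel. g t))" by (intro sum_mono) auto
  also have "\<dots> = (\<integral>t. (\<Sum>i\<in>I. indicat_real {x i..y i} t *\<^sub>R g t) \<partial>lborel)"
    using gi unfolding set_lebesgue_integral_def set_integrable_def by (simp add: integral_sum)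
  also have "\<dots> \<le> (LINT t:{- 2 * pi..4 * pi}|lborel. g t)"
    unfolding set_lebesgue_integral_def
  proof (rule integral_mono)
    fix t
    have g0: "g t \<ge> 0" by (simp add: g_def)
    show "(\<Sum>i\<in>I. indicat_real {x i..y i} t *\<^sub>R g t) \<le> indicat_real {- 2 * pi..4 * pi} t *\<^sub>R g t"
    proof (cases "\<exists>i\<in>I. t \<in> {x i..y i}")
      case True
      then obtain i where i: "i \<in> I" "t \<in> {x i..y i}" by blast
      have "(\<Sum>j\<in>I. indicat_real {x j..y j} t *\<^sub>R g t) = (\<Sum>j\<in>I. if j = i then g t else 0)"
      proof (intro sum.cong refl)
        fix j assume "j \<in> I"
        then show "indicat_real {x j..y j} t *\<^sub>R g t = (if j = i then g t else 0)"
          using disj[OF \<open>j \<in> I\<close> i(1)] i(2) by (cases "j = i") (auto simp: indicator_def)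
      qed
      also have "\<dots> = g t" using fin i by simp
      also have "\<dots> = indicat_real {- 2 * pi..4 * pi} t *\<^sub>R g t" using sub[OF i(1)] i(2) by (auto simp: indicator_def)
      finally show ?thesis by simp
    next
      case False
      then have "(\<Sum>i\<in>I. indicat_real {x i..y i} t *\<^sub>R g t) = 0" by (intro sum.neutral) (auto simp: indicator_def)
      then show ?thesis using g0 by (simp add: indicator_def)
    qed
  qed (use gi in \<open>auto simp: set_integrable_def\<close>)
  also have "\<dots> = 6 * pi * (\<Sum>n<N. (cmod (a n))\<^sup>2)"
    using psum_cis_norm2[where s = "- 2 * pi" and m = 3 and a = a and N = N] unfolding g_def by simp
  finally show ?thesis .
qed

lemma weak_type_finite:
  assumes a: "l2 a" and fin: "finite I" and le: "\<And>i. i \<in> I \<Longrightarrow> x i \<le> y i"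
    and sub: "\<And>i. i \<in> I \<Longrightarrow> {x i..y i} \<subseteq> {- 2 * pi..4 * pi}"
    and disj: "\<And>i j. i \<in> I \<Longrightarrow> j \<in> I \<Longrightarrow> i \<noteq> j \<Longrightarrow> {x i..y i} \<inter> {x j..y j} = {}"
  shows "(\<Sum>i\<in>I. (cmod (prim a (cis (y i)) - prim a (cis (x i))))\<^sup>2 / (y i - x i)) \<le> 6 * pi * (\<Sum>n. (cmod (a n))\<^sup>2)"
proof (rule LIMSEQ_le)
  have l: "(\<lambda>N. \<Sum>n<Suc N. prim_coeff a n * cis t ^ n) \<longlonglongrightarrow> prim a (cis t)" for t
    using tendsto_uniform_limitI[OF prim_uniform[OF a], of "cis t"] by (subst filterlim_sequentially_Suc) simp
  show "(\<lambda>N. \<Sum>i\<in>I. (cmod ((\<Sum>n<Suc N. prim_coeff a n * cis (y i) ^ n) - (\<Sum>n<Suc N. prim_coeff a n * cis (x i) ^ n)))\<^sup>2 / (y i - x i))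
    \<longlonglongrightarrow> (\<Sum>i\<in>I. (cmod (prim a (cis (y i)) - prim a (cis (x i))))\<^sup>2 / (y i - x i))"
    unfolding divide_inverse by (intro tendsto_intros l)
  show "(\<lambda>N. 6 * pi * (\<Sum>n<N. (cmod (a n))\<^sup>2)) \<longlonglongrightarrow> 6 * pi * (\<Sum>n. (cmod (a n))\<^sup>2)"
    using a unfolding l2_def by (intro tendsto_intros summable_LIMSEQ)
  show "\<exists>N. \<forall>n\<ge>N. (\<Sum>i\<in>I. (cmod ((\<Sum>k<Suc n. prim_coeff a k * cis (y i) ^ k) - (\<Sum>k<Suc n. prim_coeff a k * cis (x i) ^ k)))\<^sup>2 / (y i - x i))
      \<le> 6 * pi * (\<Sum>k<n. (cmod (a k))\<^sup>2)"
    by (intro exI allI impI weak_type_partial fin le sub disj)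
qed

text \<open>The parameters at which some difference quotient of the primitive exceeds the level \<open>l\<close>, a superlevel set
  of a maximal function.\<close>

definition bad_set :: "(nat \<Rightarrow> complex) \<Rightarrow> real \<Rightarrow> real set" where
  "bad_set a l = {t\<in>{0<..<2*pi}. \<exists>s. 0 < \<bar>s\<bar> \<and> \<bar>s\<bar> \<le> 1 \<and> cmod (prim a (cis (t + s)) - prim a (cis t)) > l * \<bar>s\<bar>}"

lemma prim_cis_continuous: "l2 a \<Longrightarrow> continuous_on UNIV (\<lambda>t. prim a (cis t))"
  by (rule continuous_on_compose2[OF prim_continuous]) (auto intro!: continuous_intros)

lemma open_bad_set:
  assumes "l2 a"
  shows "open (bad_set a l)"
proof -
  have "bad_set a l = (\<Union>s\<in>{s. 0 < \<bar>s\<bar> \<and> \<bar>s\<bar> \<le> 1}. {0<..<2*pi} \<inter> {t. l * \<bar>s\<bar> < cmod (prim a (cis (t + s)) - prim a (cis t))})"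
    by (auto simp: bad_set_def)
  also have "open \<dots>"
  proof (intro open_UN ballI open_Int open_Collect_less)
    fix s :: real
    have "continuous_on UNIV (\<lambda>t. prim a (cis (t + s)))"
      by (rule continuous_on_compose2[OF prim_cis_continuous[OF assms]]) (auto intro!: continuous_intros)
    then show "continuous_on UNIV (\<lambda>t. cmod (prim a (cis (t + s)) - prim a (cis t)))"
      by (intro continuous_intros prim_cis_continuous assms)
  qed (auto intro!: continuous_intros)
  finally show ?thesis .
qed

text \<open>The weak type inequality of the maximal function: Vitali's covering lemma extracts disjoint intervals on which
  \<open>weak_type_finite\<close> applies, and whose fivefold enlargements cover the bad set.\<close>

lemma emeasure_bad_set:
  assumes a: "l2 a" and l: "l > 0"
  shows "emeasure lborel (bad_set a l) \<le> ennreal (30 * pi * (\<Sum>n. (cmod (a n))\<^sup>2) / l\<^sup>2)"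
proof -
  define A where "A = (\<Sum>n. (cmod (a n))\<^sup>2)"
  define K where "K = {(t, s). t \<in> {0<..<2*pi} \<and> 0 < \<bar>s\<bar> \<and> \<bar>s\<bar> \<le> 1 \<and> cmod (prim a (cis (t + s)) - prim a (cis t)) > l * \<bar>s\<bar>}"
  \<comment> \<open>Centre and radius of the interval with end points \<open>t\<close> and \<open>t + s\<close>.\<close>
  define c where "c = (\<lambda>(t::real, s::real). t + s / 2)"
  define r where "r = (\<lambda>(t::real, s::real). \<bar>s\<bar> / 2)"
  have cover: "bad_set a l \<subseteq> (\<Union>i\<in>K. cball (c i) (r i))"
  proof
    fix t assume "t \<in> bad_set a l"
    then obtain s where s: "(t, s) \<in> K" by (auto simp: bad_set_def K_def)
    have "t \<in> cball (c (t, s)) (r (t, s))" by (auto simp: c_def r_def dist_real_def)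
    then show "t \<in> (\<Union>i\<in>K. cball (c i) (r i))" using s by blast
  qed
  have rK: "0 < r i \<and> r i \<le> 1" if "i \<in> K" for i using that by (auto simp: K_def r_def)
  obtain C where C: "countable C" "C \<subseteq> K" "pairwise (\<lambda>i j. disjnt (cball (c i) (r i)) (cball (c j) (r j))) C"
    "bad_set a l \<subseteq> (\<Union>i\<in>C. cball (c i) (5 * r i))"
    using Vitali_covering_lemma_cballs[OF cover rK] by blast
  have fin: "(\<Sum>i\<in>I. 10 * r i) \<le> 30 * pi * A / l\<^sup>2" if I: "finite I" "I \<subseteq> C" for I
  proof -
    have cb: "{c i - r i..c i + r i} = cball (c i) (r i)" for i by (simp add: cball_eq_atLeastAtMost)
    have "(\<Sum>i\<in>I. (cmod (prim a (cis (c i + r i)) - prim a (cis (c i - r i))))\<^sup>2 / ((c i + r i) - (c i - r i))) \<le> 6 * pi * A"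
      unfolding A_def
    proof (rule weak_type_finite[OF a I(1)])
      fix i assume "i \<in> I"
      then have i: "i \<in> K" using I C by auto
      then show "c i - r i \<le> c i + r i" using rK by fastforce
      show "{c i - r i..c i + r i} \<subseteq> {- 2 * pi..4 * pi}"
        using i pi_gt3 by (auto simp: K_def c_def r_def abs_if split: if_splits)
    next
      fix i j assume "i \<in> I" "j \<in> I" "i \<noteq> j"
      then show "{c i - r i..c i + r i} \<inter> {c j - r j..c j + r j} = {}"
        using C(3) I(2) unfolding cb pairwise_def disjnt_def by blast
    qed
    moreover have "l\<^sup>2 * (2 * r i) \<le> (cmod (prim a (cis (c i + r i)) - prim a (cis (c i - r i))))\<^sup>2 / ((c i + r i) - (c i - r i))"
      if "i \<in> I" for i
    proof -
      obtain t s where i: "i = (t, s)" by force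
      have ts: "(t, s) \<in> K" using that I C i by auto
      then have s: "0 < \<bar>s\<bar>" "cmod (prim a (cis (t + s)) - prim a (cis t)) > l * \<bar>s\<bar>" by (auto simp: K_def)
      have "cmod (prim a (cis (c i + r i)) - prim a (cis (c i - r i))) = cmod (prim a (cis (t + s)) - prim a (cis t))"
        by (cases "s > 0") (auto simp: i c_def r_def norm_minus_commute add.commute)
      moreover have "(l * \<bar>s\<bar>)\<^sup>2 \<le> (cmod (prim a (cis (t + s)) - prim a (cis t)))\<^sup>2"
        using s l by (intro power_mono) auto
      moreover have "(c i + r i) - (c i - r i) = \<bar>s\<bar>" "2 * r i = \<bar>s\<bar>" by (auto simp: i r_def)
      ultimately show ?thesis using s(1)
        by (simp add: le_divide_eq power_mult_distrib power2_eq_square mult_ac)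
    qed
    ultimately have "(\<Sum>i\<in>I. l\<^sup>2 * (2 * r i)) \<le> 6 * pi * A" by (meson order_trans sum_mono)
    then have "l\<^sup>2 * (2 * sum r I) \<le> 6 * pi * A" by (simp add: sum_distrib_left)
    moreover have "(\<Sum>i\<in>I. 10 * r i) = 10 * sum r I" by (simp add: sum_distrib_left)
    ultimately show ?thesis using l by (simp add: le_divide_eq mult_ac)
  qed
  define D where "D n = (if n \<in> to_nat_on C ` C then cball (c (from_nat_into C n)) (5 * r (from_nat_into C n)) else {})" for n
  have UD: "(\<Union>i\<in>C. cball (c i) (5 * r i)) \<subseteq> (\<Union>n. D n)"
  proof
    fix x assume "x \<in> (\<Union>i\<in>C. cball (c i) (5 * r i))"
    then obtain i where i: "i \<in> C" "x \<in> cball (c i) (5 * r i)" by blast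
    then have "x \<in> D (to_nat_on C i)" using C(1) by (simp add: D_def)
    then show "x \<in> (\<Union>n. D n)" by blast
  qed
  have "emeasure lborel (bad_set a l) \<le> emeasure lborel (\<Union>n. D n)"
  proof (rule emeasure_mono)
    show "bad_set a l \<subseteq> (\<Union>n. D n)" using C(4) UD by blast
    have "D n \<in> sets lborel" for n by (auto simp: D_def)
    then show "(\<Union>n. D n) \<in> sets lborel" by blast
  qed
  also have "\<dots> \<le> (\<Sum>n. emeasure lborel (D n))"
    by (rule emeasure_subadditive_countably) (auto simp: D_def)
  also have "\<dots> \<le> ennreal (30 * pi * A / l\<^sup>2)"
  proof (rule suminf_le_const)
    fix n
    define I where "I = {i\<in>C. to_nat_on C i < n}"
    have inj: "inj_on (to_nat_on C) I" by (rule inj_on_subset[OF inj_on_to_nat_on[OF C(1)]]) (auto simp: I_def)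
    have "finite (to_nat_on C ` I)" by (rule finite_subset[of _ "{..<n}"]) (auto simp: I_def)
    then have finI: "finite I" using inj by (rule finite_imageD)
    have "(\<Sum>k<n. emeasure lborel (D k)) = (\<Sum>k\<in>to_nat_on C ` I. emeasure lborel (D k))"
      by (rule sum.mono_neutral_right) (auto simp: I_def D_def)
    also have "\<dots> = (\<Sum>i\<in>I. emeasure lborel (D (to_nat_on C i)))"
      using inj by (simp add: sum.reindex)
    also have "\<dots> = (\<Sum>i\<in>I. ennreal (10 * r i))"
    proof (rule sum.cong[OF refl])
      fix i assume i: "i \<in> I"
      then have "0 < r i" using rK[of i] C(2) by (auto simp: I_def)
      then show "emeasure lborel (D (to_nat_on C i)) = ennreal (10 * r i)"
        using i C(1) by (simp add: I_def D_def cball_eq_atLeastAtMost)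
    qed
    also have "\<dots> = ennreal (\<Sum>i\<in>I. 10 * r i)"
    proof (rule sum_ennreal)
      fix i assume "i \<in> I"
      then show "0 \<le> 10 * r i" using rK[of i] C(2) by (auto simp: I_def)
    qed
    also have "\<dots> \<le> ennreal (30 * pi * A / l\<^sup>2)"
      by (intro ennreal_leI fin finI) (auto simp: I_def)
    finally show "(\<Sum>k<n. emeasure lborel (D k)) \<le> ennreal (30 * pi * A / l\<^sup>2)" .
  qed simp
  finally show ?thesis by (simp add: A_def)
qed

definition l2_tail :: "(nat \<Rightarrow> complex) \<Rightarrow> nat \<Rightarrow> nat \<Rightarrow> complex" where
  "l2_tail a N n = (if n < N then 0 else a n)"

lemma l2_l2_tail: "l2 a \<Longrightarrow> l2 (l2_tail a N)"
  unfolding l2_def by (rule summable_comparison_test') (auto simp: l2_tail_def)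

lemma suminf_l2_tail:
  assumes "l2 a"
  shows "(\<Sum>n. (cmod (l2_tail a N n))\<^sup>2) = (\<Sum>n. (cmod (a n))\<^sup>2) - (\<Sum>n<N. (cmod (a n))\<^sup>2)"
proof -
  have "(\<Sum>n. (cmod (l2_tail a N n))\<^sup>2) = (\<Sum>n. (cmod (l2_tail a N (n + N)))\<^sup>2) + (\<Sum>n<N. (cmod (l2_tail a N n))\<^sup>2)"
    using l2_l2_tail[OF assms, of N] unfolding l2_def by (rule suminf_split_initial_segment)
  also have "\<dots> = (\<Sum>n. (cmod (a (n + N)))\<^sup>2)" by (simp add: l2_tail_def)
  also have "\<dots> = (\<Sum>n. (cmod (a n))\<^sup>2) - (\<Sum>n<N. (cmod (a n))\<^sup>2)"
    using assms unfolding l2_def by (rule suminf_minus_initial_segment)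
  finally show ?thesis .
qed

lemma l2_tail_norm_tendsto_0:
  assumes "l2 a"
  shows "(\<lambda>N. \<Sum>n. (cmod (l2_tail a N n))\<^sup>2) \<longlonglongrightarrow> 0"
proof -
  have "(\<lambda>N. (\<Sum>n. (cmod (a n))\<^sup>2) - (\<Sum>n<N. (cmod (a n))\<^sup>2)) \<longlonglongrightarrow> (\<Sum>n. (cmod (a n))\<^sup>2) - (\<Sum>n. (cmod (a n))\<^sup>2)"
    using assms unfolding l2_def by (intro tendsto_intros summable_LIMSEQ)
  then show ?thesis using suminf_l2_tail[OF assms] by simp
qed

lemma prim_split:
  assumes a: "l2 a" and z: "z \<in> cball 0 1"
  shows "prim a z = (\<Sum>n<Suc N. prim_coeff a n * z ^ n) + prim (l2_tail a N) z"
proof -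
  have s: "summable (\<lambda>n. prim_coeff b n * z ^ n)" if "l2 b" for b
  proof (rule summable_comparison_test'[OF l2_summable_prim[OF that]])
    show "norm (prim_coeff b n * z ^ n) \<le> cmod (prim_coeff b n)" for n
      using z mult_left_mono[of "norm z ^ n" 1 "cmod (prim_coeff b n)"] by (simp add: norm_mult norm_power power_le_one)
  qed
  have "prim (l2_tail a N) z = (\<Sum>n. prim_coeff (l2_tail a N) (n + Suc N) * z ^ (n + Suc N)) + (\<Sum>n<Suc N. prim_coeff (l2_tail a N) n * z ^ n)"
    unfolding prim_def by (rule suminf_split_initial_segment[OF s[OF l2_l2_tail[OF a]]])
  also have "(\<Sum>n<Suc N. prim_coeff (l2_tail a N) n * z ^ n) = 0"
    by (rule sum.neutral) (auto simp: prim_coeff_def l2_tail_def)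
  also have "(\<lambda>n. prim_coeff (l2_tail a N) (n + Suc N) * z ^ (n + Suc N)) = (\<lambda>n. prim_coeff a (n + Suc N) * z ^ (n + Suc N))"
    by (auto simp: prim_coeff_def l2_tail_def)
  finally show ?thesis
    using suminf_split_initial_segment[OF s[OF a], of "Suc N"] by (simp add: prim_def)
qed

text \<open>If \<open>g\<close> differs from differentiable functions \<open>p k\<close> by functions whose difference quotients
  at the point \<open>t\<close> are at most \<open>2 ^ - k\<close>, the derivatives of the \<open>p k\<close> form a
  Cauchy sequence and their limit is the derivative of \<open>g\<close>.\<close>

lemma derivative_from_tails:
  fixes g :: "real \<Rightarrow> complex" and p :: "nat \<Rightarrow> real \<Rightarrow> complex"
  assumes p: "\<And>k. (p k has_vector_derivative d k) (at t)"
    and q: "eventually (\<lambda>k. \<forall>s. \<bar>s\<bar> \<le> 1 \<longrightarrow> cmod ((g (t + s) - p k (t + s)) - (g t - p k t)) \<le> (1/2) ^ k * \<bar>s\<bar>) sequentially"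
  obtains D where "(g has_vector_derivative D) (at t)" "d \<longlonglongrightarrow> D"
proof -
  obtain k0 where k0: "\<And>k s. k \<ge> k0 \<Longrightarrow> \<bar>s\<bar> \<le> 1 \<Longrightarrow> cmod ((g (t + s) - p k (t + s)) - (g t - p k t)) \<le> (1/2) ^ k * \<bar>s\<bar>"
    using q unfolding eventually_sequentially by blast
  have near: "\<exists>\<delta>>0. \<forall>s. \<bar>s\<bar> < \<delta> \<longrightarrow> cmod (g (t + s) - g t - of_real s * d k) \<le> (e + (1/2) ^ k) * \<bar>s\<bar>" if "k \<ge> k0" "e > 0" for k e
  proof -
    from p[of k] have "\<forall>e>0. \<exists>\<delta>>0. \<forall>y. norm (y - t) < \<delta> \<longrightarrow> norm (p k y - p k t - (y - t) *\<^sub>R d k) \<le> e * norm (y - t)"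
      unfolding has_vector_derivative_def has_derivative_at_alt by blast
    with \<open>e > 0\<close> obtain \<delta> where \<delta>: "\<delta> > 0" "\<And>y. norm (y - t) < \<delta> \<Longrightarrow> norm (p k y - p k t - (y - t) *\<^sub>R d k) \<le> e * norm (y - t)"
      by blast
    show ?thesis
    proof (intro exI[of _ "min \<delta> 1"] conjI allI impI)
      fix s :: real assume s: "\<bar>s\<bar> < min \<delta> 1"
      have "g (t + s) - g t - of_real s * d k = (p k (t + s) - p k t - of_real s * d k) + ((g (t + s) - p k (t + s)) - (g t - p k t))"
        by simp
      also have "cmod \<dots> \<le> e * \<bar>s\<bar> + (1/2) ^ k * \<bar>s\<bar>"
        using \<delta>(2)[of "t + s"] k0[OF that(1), of s] s
        by (intro norm_triangle_mono) (auto simp: scaleR_conv_of_real)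
      finally show "cmod (g (t + s) - g t - of_real s * d k) \<le> (e + (1/2) ^ k) * \<bar>s\<bar>" by (simp add: algebra_simps)
    qed (use \<delta> in auto)
  qed
  have dd: "cmod (d k - d j) \<le> (1/2) ^ k + (1/2) ^ j" if kj: "k \<ge> k0" "j \<ge> k0" for k j
  proof (rule field_le_epsilon)
    fix e :: real assume "e > 0"
    then have e: "e / 2 > 0" by simp
    obtain \<delta>1 where 1: "\<delta>1 > 0" "\<And>s. \<bar>s\<bar> < \<delta>1 \<Longrightarrow> cmod (g (t + s) - g t - of_real s * d k) \<le> (e/2 + (1/2) ^ k) * \<bar>s\<bar>"
      using near[OF kj(1) e] by blast
    obtain \<delta>2 where 2: "\<delta>2 > 0" "\<And>s. \<bar>s\<bar> < \<delta>2 \<Longrightarrow> cmod (g (t + s) - g t - of_real s * d j) \<le> (e/2 + (1/2) ^ j) * \<bar>s\<bar>"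
      using near[OF kj(2) e] by blast
    define s where "s = min \<delta>1 \<delta>2 / 2"
    have s: "s > 0" "\<bar>s\<bar> < \<delta>1" "\<bar>s\<bar> < \<delta>2" using 1(1) 2(1) by (auto simp: s_def)
    have "of_real s * (d k - d j) = (g (t + s) - g t - of_real s * d j) - (g (t + s) - g t - of_real s * d k)"
      by (simp add: algebra_simps)
    also have "cmod \<dots> \<le> (e/2 + (1/2) ^ j) * \<bar>s\<bar> + (e/2 + (1/2) ^ k) * \<bar>s\<bar>"
      by (intro order_trans[OF norm_triangle_ineq4] add_mono 1(2) 2(2) s)
    finally have "s * cmod (d k - d j) \<le> (e/2 + (1/2) ^ j) * \<bar>s\<bar> + (e/2 + (1/2) ^ k) * \<bar>s\<bar>"
      using s(1) by (simp add: norm_mult)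
    also have "\<dots> = s * ((1/2) ^ k + (1/2) ^ j + e)" using s(1) by (simp add: algebra_simps)
    finally have "s * cmod (d k - d j) \<le> s * ((1/2) ^ k + (1/2) ^ j + e)" .
    then show "cmod (d k - d j) \<le> (1/2) ^ k + (1/2) ^ j + e" using s(1) by simp
  qed
  have "Cauchy d"
  proof (rule metric_CauchyI)
    fix e :: real assume "e > 0"
    then obtain n where n: "(1/2::real) ^ n < e / 2" using real_arch_pow_inv[of "e/2" "1/2"] by auto
    show "\<exists>M. \<forall>m\<ge>M. \<forall>n\<ge>M. dist (d m) (d n) < e"
    proof (intro exI[of _ "max k0 n"] allI impI)
      fix i j assume ij: "i \<ge> max k0 n" "j \<ge> max k0 n"
      have "(1/2::real) ^ i \<le> (1/2) ^ n" "(1/2::real) ^ j \<le> (1/2) ^ n"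
        using ij by (auto intro: power_decreasing)
      moreover have "cmod (d i - d j) \<le> (1/2) ^ i + (1/2) ^ j" using ij by (intro dd) auto
      ultimately show "dist (d i) (d j) < e" unfolding dist_norm using n by linarith
    qed
  qed
  then obtain D where D: "d \<longlonglongrightarrow> D" by (meson Cauchy_convergent convergentD)
  have dD: "cmod (d k - D) \<le> (1/2) ^ k" if "k \<ge> k0" for k
  proof (rule LIMSEQ_le)
    show "(\<lambda>j. cmod (d k - d j)) \<longlonglongrightarrow> cmod (d k - D)" by (intro tendsto_intros D)
    show "(\<lambda>j. (1/2) ^ k + (1/2) ^ j) \<longlonglongrightarrow> (1/2::real) ^ k"
      by (rule tendsto_eq_intros LIMSEQ_power_zero refl | simp)+
    show "\<exists>N. \<forall>n\<ge>N. cmod (d k - d n) \<le> (1/2) ^ k + (1/2) ^ n" using dd[OF that] by blast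
  qed
  have "(g has_derivative (\<lambda>h. h *\<^sub>R D)) (at t)"
    unfolding has_derivative_at_alt
  proof (intro conjI allI impI bounded_linear_scaleR_left)
    fix e :: real assume "e > 0"
    then have e: "e / 4 > 0" by simp
    obtain n where n: "(1/2::real) ^ n < e / 4" using real_arch_pow_inv[OF e, of "1/2"] by auto
    define k where "k = max k0 n"
    have "(1/2::real) ^ k \<le> (1/2) ^ n" by (auto intro: power_decreasing simp: k_def)
    then have k: "k \<ge> k0" "(1/2::real) ^ k < e / 4" using le_less_trans[OF _ n] by (simp_all only: k_def max.cobounded1)
    obtain \<delta> where \<delta>: "\<delta> > 0" "\<And>s. \<bar>s\<bar> < \<delta> \<Longrightarrow> cmod (g (t + s) - g t - of_real s * d k) \<le> (e/4 + (1/2) ^ k) * \<bar>s\<bar>"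
      using near[OF k(1) e] by blast
    show "\<exists>\<delta>>0. \<forall>y. norm (y - t) < \<delta> \<longrightarrow> norm (g y - g t - (y - t) *\<^sub>R D) \<le> e * norm (y - t)"
    proof (intro exI[of _ \<delta>] conjI allI impI)
      fix y assume y: "norm (y - t) < \<delta>"
      define s where "s = y - t"
      have "g y - g t - (y - t) *\<^sub>R D = (g (t + s) - g t - of_real s * d k) + of_real s * (d k - D)"
        by (simp add: s_def scaleR_conv_of_real algebra_simps)
      also have "cmod \<dots> \<le> (e/4 + (1/2) ^ k) * \<bar>s\<bar> + \<bar>s\<bar> * (1/2) ^ k"
      proof (rule norm_triangle_mono)
        show "cmod (g (t + s) - g t - of_real s * d k) \<le> (e/4 + (1/2) ^ k) * \<bar>s\<bar>" using y by (intro \<delta>(2)) (simp add: s_def)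
        show "cmod (of_real s * (d k - D)) \<le> \<bar>s\<bar> * (1/2) ^ k"
          using dD[OF k(1)] unfolding norm_mult norm_of_real by (intro mult_left_mono) auto
      qed
      also have "\<dots> \<le> e * \<bar>s\<bar>"
      proof -
        have "e/4 + (1/2) ^ k + (1/2) ^ k \<le> e" using k(2) \<open>e > 0\<close> by simp
        from mult_right_mono[OF this, of "\<bar>s\<bar>"] show ?thesis by (simp add: algebra_simps)
      qed
      finally show "norm (g y - g t - (y - t) *\<^sub>R D) \<le> e * norm (y - t)" by (simp add: s_def)
    qed fact
  qed
  then have "(g has_vector_derivative D) (at t)" by (simp add: has_vector_derivative_def)
  with D show ?thesis using that by blast
qed

text \<open>Along a subsequence the tails of the coefficients are so small that, by the weak type inequality and the lemma of
  Borel and Cantelli, almost every point avoids all but finitely many of the bad sets. There the primitive is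
  differentiable along the circle, which gives the nontangential limit of its derivative, and the same limit is
  attained by the partial sums along the subsequence.\<close>

theorem Fatou_l2:
  assumes a: "l2 a"
  obtains N where "\<And>k. k \<le> N k" and "AE y in mT. (pser a \<longlongrightarrow> bv (pser a) y) (nontangential y) \<and> (\<lambda>k. psum a (N k) y) \<longlonglongrightarrow> bv (pser a) y"
proof -
  have "\<exists>N\<ge>k. (\<Sum>n. (cmod (l2_tail a N n))\<^sup>2) < (1/8) ^ k" for k
  proof -
    have "eventually (\<lambda>N. (\<Sum>n. (cmod (l2_tail a N n))\<^sup>2) < (1/8) ^ k) sequentially"
      by (rule order_tendstoD(2)[OF l2_tail_norm_tendsto_0[OF a]]) simp
    then show ?thesis unfolding eventually_sequentially using nat_le_linear by blast
  qed
  then obtain N where N: "\<And>k. (\<Sum>n. (cmod (l2_tail a (N k) n))\<^sup>2) < (1/8) ^ k" and Nk: "\<And>k. k \<le> N k" by metis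
  \<comment> \<open>The levels \<open>2 ^ - k\<close> and the norms \<open>8 ^ - k\<close> of the tails make the measures of the bad sets
    summable.\<close>
  define B where "B k = bad_set (l2_tail a (N k)) ((1/2) ^ k)" for k
  have Bm: "emeasure lborel (B k) \<le> ennreal (30 * pi * (1/2) ^ k)" for k
  proof -
    have "emeasure lborel (B k) \<le> ennreal (30 * pi * (\<Sum>n. (cmod (l2_tail a (N k) n))\<^sup>2) / ((1/2) ^ k)\<^sup>2)"
      unfolding B_def by (intro emeasure_bad_set l2_l2_tail a) auto
    also have "\<dots> \<le> ennreal (30 * pi * (1/8) ^ k / ((1/2) ^ k)\<^sup>2)"
      using N[of k] by (intro ennreal_leI divide_right_mono mult_left_mono) auto
    also have "30 * pi * (1/8) ^ k / ((1/2) ^ k)\<^sup>2 = 30 * pi * ((1/2) ^ k)"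
    proof -
      have "(1/8::real) ^ k = (1/2) ^ k * ((1/2) ^ k)\<^sup>2"
        by (simp add: power2_eq_square power_mult_distrib[symmetric])
      then show ?thesis by simp
    qed
    finally show ?thesis .
  qed
  have Bs: "B k \<in> sets lborel" for k
    unfolding B_def using open_bad_set[OF l2_l2_tail[OF a]] by auto
  have "AE t in lborel. eventually (\<lambda>k. t \<in> space lborel - B k) sequentially"
  proof (rule borel_cantelli_AE1[OF Bs])
    show fin: "emeasure lborel (B k) < \<infinity>" for k
      using Bm[of k] by (simp add: le_less_trans)
    show "summable (\<lambda>k. measure lborel (B k))"
    proof (rule summable_comparison_test')
      show "summable (\<lambda>k. 30 * pi * (1/2) ^ k)" by (intro summable_mult summable_geometric) auto
      show "norm (measure lborel (B k)) \<le> 30 * pi * (1/2) ^ k" for k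
        using enn2real_mono[OF Bm[of k]] by (simp add: measure_def)
    qed
  qed
  moreover have "AE t in lborel. t \<noteq> 0" by (rule AE_lborel_singleton)
  ultimately have "AE t in lborel. t \<in> {0..<2*pi} \<longrightarrow> 
     (pser a \<longlongrightarrow> bv (pser a) (cis t)) (nontangential (cis t)) \<and> (\<lambda>k. psum a (N k) (cis t)) \<longlonglongrightarrow> bv (pser a) (cis t)"
  proof eventually_elim
    case (elim t)
    show ?case
    proof
      assume t: "t \<in> {0..<2*pi}"
      define p where "p k s = (\<Sum>n<Suc (N k). prim_coeff a n * cis s ^ n)" for k s
      define d where "d k = \<i> * cis t * psum a (N k) (cis t)" for k
      have pd: "(p k has_vector_derivative d k) (at t)" for k
      proof -
        have F: "p k = (\<lambda>t. \<Sum>n<N k. a n / of_nat (Suc n) * cis t ^ Suc n)"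
          unfolding p_def by (subst sum.lessThan_Suc_shift) (simp add: prim_coeff_def del: of_nat_Suc power_Suc sum.lessThan_Suc)
        have "((\<lambda>z. \<Sum>n<N k. a n / of_nat (Suc n) * exp (\<i> * z) ^ Suc n) has_field_derivative
           (\<Sum>n<N k. a n / of_nat (Suc n) * (of_nat (Suc n) * cis t ^ n * (\<i> * cis t)))) (at (of_real t))"
          by (rule derivative_eq_intros refl sum.cong | simp add: cis_conv_exp del: of_nat_Suc)+
        from has_vector_derivative_real_field[OF this]
        show ?thesis unfolding F d_def
          by (simp add: cis_conv_exp psum_def sum_distrib_left mult_ac del: of_nat_Suc power_Suc)
      qed
      have ev: "eventually (\<lambda>k. \<forall>s. \<bar>s\<bar> \<le> 1 \<longrightarrow> cmod ((prim a (cis (t + s)) - p k (t + s)) - (prim a (cis t) - p k t)) \<le> (1/2) ^ k * \<bar>s\<bar>) sequentially"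
        using elim(1)
      proof eventually_elim
        case (elim k)
        show ?case
        proof (intro allI impI)
          fix s :: real assume s: "\<bar>s\<bar> \<le> 1"
          have "prim a (cis x) - p k x = prim (l2_tail a (N k)) (cis x)" for x
            using prim_split[OF a, of "cis x" "N k"] by (simp add: p_def)
          moreover have "\<not> cmod (prim (l2_tail a (N k)) (cis (t + s)) - prim (l2_tail a (N k)) (cis t)) > (1/2) ^ k * \<bar>s\<bar>"
          proof (cases "s = 0")
            case False
            then show ?thesis using elim s t \<open>t \<noteq> 0\<close> by (auto simp: B_def bad_set_def)
          qed simp
          ultimately show "cmod ((prim a (cis (t + s)) - p k (t + s)) - (prim a (cis t) - p k t)) \<le> (1/2) ^ k * \<bar>s\<bar>"
            by (simp add: not_less)
        qed
      qed
      obtain D where D: "((\<lambda>s. prim a (cis s)) has_vector_derivative D) (at t)" "d \<longlonglongrightarrow> D"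
        using derivative_from_tails[of p d t "\<lambda>s. prim a (cis s)", OF pd ev] by blast
      define l where "l = D / (\<i> * cis t)"
      have nt: "(pser a \<longlongrightarrow> l) (nontangential (cis t))"
        unfolding l_def by (rule boundary_derivative_imp_nontangential_limit[OF prim_continuous[OF a] prim_deriv[OF a] D(1)])
      then have bv: "bv (pser a) (cis t) = l" by (rule bvI) simp
      have "(\<lambda>k. d k / (\<i> * cis t)) \<longlonglongrightarrow> l" unfolding l_def by (intro tendsto_intros D(2)) simp
      then show "(pser a \<longlongrightarrow> bv (pser a) (cis t)) (nontangential (cis t)) \<and> (\<lambda>k. psum a (N k) (cis t)) \<longlonglongrightarrow> bv (pser a) (cis t)"
        using nt by (simp add: bv d_def)
    qed
  qed
  from that[OF Nk AE_mT_cisI[OF this]] show ?thesis .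
qed

section \<open>Square integrable functions on the circle and the Hardy space\<close>

definition L2 :: "(complex \<Rightarrow> complex) \<Rightarrow> bool" where
  "L2 h \<longleftrightarrow> h \<in> borel_measurable mT \<and> integrable mT (\<lambda>y. (cmod (h y))\<^sup>2)"

definition lip :: "(complex \<Rightarrow> complex) \<Rightarrow> (complex \<Rightarrow> complex) \<Rightarrow> complex" where
  "lip g h = (\<integral>y. g y * cnj (h y) \<partial>mT)"

definition lnorm2 :: "(complex \<Rightarrow> complex) \<Rightarrow> real" where
  "lnorm2 h = (\<integral>y. (cmod (h y))\<^sup>2 \<partial>mT)"

lemma L2_measurable [measurable_dest]: "L2 h \<Longrightarrow> h \<in> borel_measurable mT"
  by (simp add: L2_def)

lemma L2_integrable_sq: "L2 h \<Longrightarrow> integrable mT (\<lambda>y. (cmod (h y))\<^sup>2)"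
  by (simp add: L2_def)

lemma L2_integrable_lip: "L2 g \<Longrightarrow> L2 h \<Longrightarrow> integrable mT (\<lambda>y. g y * cnj (h y))"
  unfolding L2_def by (intro integrable_mult_cnj) auto

lemma lnorm2_nonneg [simp]: "lnorm2 h \<ge> 0"
  unfolding lnorm2_def by simp

lemma lip_bound: "L2 g \<Longrightarrow> L2 h \<Longrightarrow> (cmod (lip g h))\<^sup>2 \<le> lnorm2 g * lnorm2 h"
  unfolding lip_def lnorm2_def L2_def by (intro Cauchy_Schwarz_integral) auto

lemma L2_bounded_mult:
  assumes "L2 h" "g \<in> borel_measurable mT" "AE y in mT. cmod (g y) \<le> B"
  shows "L2 (\<lambda>y. g y * h y)" "lnorm2 (\<lambda>y. g y * h y) \<le> B\<^sup>2 * lnorm2 h"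
proof -
  note [measurable] = assms(2) L2_measurable[OF assms(1)]
  have i: "integrable mT (\<lambda>y. B\<^sup>2 * (cmod (h y))\<^sup>2)" using L2_integrable_sq[OF assms(1)] by simp
  have ae: "AE y in mT. (cmod (g y * h y))\<^sup>2 \<le> B\<^sup>2 * (cmod (h y))\<^sup>2"
    using assms(3) by eventually_elim (simp add: norm_mult power_mult_distrib mult_right_mono power_mono)
  have i2: "integrable mT (\<lambda>y. (cmod (g y * h y))\<^sup>2)"
    by (rule Bochner_Integration.integrable_bound[OF i]) (use ae in auto)
  then show "L2 (\<lambda>y. g y * h y)" by (auto simp: L2_def)
  have "lnorm2 (\<lambda>y. g y * h y) \<le> (\<integral>y. B\<^sup>2 * (cmod (h y))\<^sup>2 \<partial>mT)"
    unfolding lnorm2_def by (rule integral_mono_AE[OF i2 i ae])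
  then show "lnorm2 (\<lambda>y. g y * h y) \<le> B\<^sup>2 * lnorm2 h" by (simp add: lnorm2_def)
qed

lemma L2_cnj [simp]: "L2 h \<Longrightarrow> L2 (\<lambda>y. cnj (h y))"
  by (auto simp: L2_def)

lemma norm_add_sq_le: "(cmod (x + y))\<^sup>2 \<le> 2 * (cmod x)\<^sup>2 + 2 * (cmod y)\<^sup>2"
proof -
  have "(cmod (x + y))\<^sup>2 \<le> (cmod x + cmod y)\<^sup>2" by (intro power_mono norm_triangle_ineq) auto
  also have "\<dots> \<le> 2 * (cmod x)\<^sup>2 + 2 * (cmod y)\<^sup>2"
    using sum_squares_bound[of "cmod x" "cmod y"] by (simp add: power2_sum)
  finally show ?thesis .
qed

lemma L2_add: 
  assumes "L2 g" "L2 h" shows "L2 (\<lambda>y. g y + h y)" "lnorm2 (\<lambda>y. g y + h y) \<le> 2 * lnorm2 g + 2 * lnorm2 h"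
proof -
  note [measurable] = assms[THEN L2_measurable]
  have i: "integrable mT (\<lambda>y. 2 * (cmod (g y))\<^sup>2 + 2 * (cmod (h y))\<^sup>2)" using assms[THEN L2_integrable_sq] by simp
  have i2: "integrable mT (\<lambda>y. (cmod (g y + h y))\<^sup>2)"
    by (rule Bochner_Integration.integrable_bound[OF i]) (auto intro!: norm_add_sq_le AE_I2)
  then show "L2 (\<lambda>y. g y + h y)" by (auto simp: L2_def)
  have "lnorm2 (\<lambda>y. g y + h y) \<le> (\<integral>y. 2 * (cmod (g y))\<^sup>2 + 2 * (cmod (h y))\<^sup>2 \<partial>mT)"
    unfolding lnorm2_def by (intro integral_mono i i2 norm_add_sq_le)
  then show "lnorm2 (\<lambda>y. g y + h y) \<le> 2 * lnorm2 g + 2 * lnorm2 h"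
    using assms[THEN L2_integrable_sq] by (simp add: lnorm2_def)
qed

lemma L2_cmult: "L2 h \<Longrightarrow> L2 (\<lambda>y. c * h y)"
  by (rule L2_bounded_mult(1)[where B = "cmod c"]) auto

lemma L2_minus: assumes "L2 g" "L2 h" shows "L2 (\<lambda>y. g y - h y)" "lnorm2 (\<lambda>y. g y - h y) \<le> 2 * lnorm2 g + 2 * lnorm2 h"
  using L2_add[OF assms(1) L2_cmult[OF assms(2), of "-1"]] by (simp_all add: lnorm2_def)

lemma L2_continuous: "continuous_on (sphere 0 1) h \<Longrightarrow> L2 h"
  unfolding L2_def by (auto intro!: borel_measurable_mT_continuous integrable_mT_continuous continuous_intros)

lemma L2_bounded:
  assumes "h \<in> borel_measurable mT" "AE y in mT. cmod (h y) \<le> B"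
  shows "L2 h"
  using L2_bounded_mult(1)[OF L2_continuous[of "\<lambda>_. 1"] assms] by simp

lemma L2_power [simp]: "L2 (\<lambda>y. y ^ n)" "L2 (\<lambda>y. cnj y ^ n)" "L2 (\<lambda>_. c)" "L2 (\<lambda>y. y)" "L2 cnj"
  by (auto intro!: L2_continuous continuous_intros)

lemma L2_psum [simp]: "L2 (psum a N)"
  by (auto intro!: L2_continuous continuous_intros simp: psum_def)

lemma lip_add_left: "L2 f \<Longrightarrow> L2 g \<Longrightarrow> L2 h \<Longrightarrow> lip (\<lambda>y. f y + g y) h = lip f h + lip g h"
  unfolding lip_def using L2_integrable_lip by (simp add: ring_distribs)

lemma lip_diff_left: "L2 f \<Longrightarrow> L2 g \<Longrightarrow> L2 h \<Longrightarrow> lip (\<lambda>y. f y - g y) h = lip f h - lip g h"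
  unfolding lip_def using L2_integrable_lip by (simp add: ring_distribs)

lemma lip_cmult_left: "lip (\<lambda>y. c * f y) h = c * lip f h"
  unfolding lip_def by (simp add: mult.assoc)

lemma lip_cnj: "cnj (lip f g) = lip g f"
proof -
  have "cnj (lip f g) = (\<integral>y. cnj (f y * cnj (g y)) \<partial>mT)"
    unfolding lip_def by (rule Bochner_Integration.integral_cnj[symmetric])
  then show ?thesis by (simp add: lip_def mult.commute)
qed

lemma lip_self: "lip f f = of_real (lnorm2 f)"
  unfolding lip_def lnorm2_def complex_norm_square[symmetric] by (rule integral_complex_of_real)

lemma lip_cong_AE: 
  assumes "L2 f" "L2 g" "L2 f'" "L2 g'" "AE y in mT. f y = f' y" "AE y in mT. g y = g' y"
  shows "lip f g = lip f' g'"
  unfolding lip_def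
  by (rule integral_cong_AE) (use assms in \<open>auto dest!: L2_measurable\<close>)

lemma lnorm2_cong_AE: 
  assumes "f \<in> borel_measurable mT" "f' \<in> borel_measurable mT" "AE y in mT. f y = f' y"
  shows "lnorm2 f = lnorm2 f'"
  unfolding lnorm2_def
  by (rule integral_cong_AE) (use assms in auto)

lemma mT_measurable_cong_AE:
  assumes g: "g \<in> borel_measurable mT" and ae: "AE y in mT. f y = g y"
  shows "f \<in> borel_measurable mT"
proof (rule measurableI)
  fix A :: "'a set" assume A: "A \<in> sets borel"
  obtain N where N: "N \<in> null_sets mT" "{y \<in> space mT. f y \<noteq> g y} \<subseteq> N"
    using ae by (auto elim!: AE_E simp: null_sets_def)
  have "f -` A \<inter> space mT = (g -` A \<inter> space mT - N) \<union> (f -` A \<inter> space mT \<inter> N)"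
    using N(2) sets.sets_into_space[of N mT] N(1) by (auto simp: null_sets_def)
  moreover have "f -` A \<inter> space mT \<inter> N \<in> sets mT"
    using N(1) by (intro mT.complete[of _ N]) auto
  moreover have "g -` A \<inter> space mT - N \<in> sets mT"
    using measurable_sets[OF g A] N(1) by auto
  ultimately show "f -` A \<inter> space mT \<in> sets mT" by (metis sets.Un)
qed simp

lemma L2_cong_AE:
  assumes "L2 g" "AE y in mT. f y = g y"
  shows "L2 f" "lnorm2 f = lnorm2 g"
proof -
  have m: "f \<in> borel_measurable mT" using mT_measurable_cong_AE assms by (auto simp: L2_def)
  have "integrable mT (\<lambda>y. (cmod (f y))\<^sup>2) \<longleftrightarrow> integrable mT (\<lambda>y. (cmod (g y))\<^sup>2)"
    by (rule integrable_cong_AE) (use m assms in \<open>auto simp: L2_def\<close>)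
  then show "L2 f" using assms(1) m by (simp add: L2_def)
  then show "lnorm2 f = lnorm2 g" using assms by (intro lnorm2_cong_AE) (auto simp: L2_def)
qed

lemma mT_measurable_AE_lim:
  fixes f :: "complex \<Rightarrow> complex"
  assumes "\<And>k. p k \<in> borel_measurable mT" "AE y in mT. (\<lambda>k. p k y) \<longlonglongrightarrow> f y"
  shows "f \<in> borel_measurable mT"
proof (rule mT_measurable_cong_AE)
  show "(\<lambda>y. lim (\<lambda>k. p k y)) \<in> borel_measurable mT"
    using assms(1) by (rule borel_measurable_lim_metric)
  show "AE y in mT. f y = lim (\<lambda>k. p k y)"
    using assms(2) by eventually_elim (simp add: limI)
qed

lemma lip_psum_power: "lip (psum a N) (\<lambda>y. y ^ m) = (if m < N then a m else 0)"
proof -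
  have "lip (psum a N) (\<lambda>y. y ^ m) = (\<integral>y. (\<Sum>n<N. a n * (y ^ n * cnj y ^ m)) \<partial>mT)"
    by (simp add: lip_def psum_def sum_distrib_right mult.assoc)
  also have "\<dots> = (\<Sum>n<N. a n * (\<integral>y. y ^ n * cnj y ^ m \<partial>mT))"
    by (subst Bochner_Integration.integral_sum) (auto intro!: integrable_mT_continuous continuous_intros)
  also have "\<dots> = (\<Sum>n<N. if n = m then a n else 0)" by (intro sum.cong refl) (auto simp: integral_mT_power)
  finally show ?thesis by simp
qed

lemma lip_psum_right:
  assumes "L2 h"
  shows "lip h (psum a N) = (\<Sum>n<N. lip h (\<lambda>y. y ^ n) * cnj (a n))"
proof -
  have "lip h (psum a N) = (\<integral>y. (\<Sum>n<N. cnj (a n) * (h y * cnj (y ^ n))) \<partial>mT)"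
    by (simp add: lip_def psum_def sum_distrib_left mult_ac)
  also have "\<dots> = (\<Sum>n<N. cnj (a n) * (\<integral>y. h y * cnj (y ^ n) \<partial>mT))"
    by (subst Bochner_Integration.integral_sum) (auto intro!: L2_integrable_lip[OF assms] integrable_mult_right simp del: complex_cnj_power)
  finally show ?thesis by (simp add: lip_def mult.commute)
qed

lemma lnorm2_psum: "lnorm2 (psum a N) = (\<Sum>n<N. (cmod (a n))\<^sup>2)"
proof -
  have "of_real (lnorm2 (psum a N)) = (\<Sum>n<N. a n * cnj (a n))"
    unfolding lip_self[symmetric] by (subst lip_psum_right) (auto simp: lip_psum_power)
  also have "\<dots> = of_real (\<Sum>n<N. (cmod (a n))\<^sup>2)"
    unfolding complex_norm_square[symmetric] of_real_sum ..
  finally show ?thesis using of_real_eq_iff by blast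
qed

lemma psum_cnj: "(\<integral>y. psum a N y * y ^ Suc m \<partial>mT) = 0"
proof -
  have "(\<integral>y. psum a N y * y ^ Suc m \<partial>mT) = (\<integral>y. (\<Sum>n<N. a n * (y ^ (n + Suc m) * cnj y ^ 0)) \<partial>mT)"
    by (simp add: psum_def sum_distrib_right sum_distrib_left mult_ac power_add)
  also have "\<dots> = (\<Sum>n<N. a n * (\<integral>y. y ^ (n + Suc m) * cnj y ^ 0 \<partial>mT))"
    by (subst Bochner_Integration.integral_sum) (auto intro!: integrable_mT_continuous continuous_intros)
  also have "\<dots> = 0" by (simp only: integral_mT_power) simp
  finally show ?thesis .
qed

subsection \<open>The boundary function of a power series\<close>

lemma psum_diff_tail:
  assumes "M \<le> N"
  shows "psum a N y - psum a M y = psum (l2_tail a M) N y"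
proof -
  have "psum a N y = (\<Sum>n<M. a n * y ^ n) + (\<Sum>n=M..<N. a n * y ^ n)"
    unfolding psum_def using assms by (simp add: sum.atLeastLessThan_concat lessThan_atLeast0)
  moreover have "psum (l2_tail a M) N y = (\<Sum>n<M. l2_tail a M n * y ^ n) + (\<Sum>n=M..<N. l2_tail a M n * y ^ n)"
    unfolding psum_def using assms by (simp add: sum.atLeastLessThan_concat lessThan_atLeast0)
  ultimately show ?thesis by (simp add: psum_def l2_tail_def)
qed

text \<open>The last inequality, an \<open>L\<^sup>2\<close> estimate of the rest, follows from Fatou's lemma along the
  subsequence of \<open>Fatou_l2\<close>.\<close>

lemma bv_pser_facts:
  assumes a: "l2 a"
  shows "AE y in mT. (pser a \<longlongrightarrow> bv (pser a) y) (nontangential y)"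
    and "L2 (bv (pser a))"
    and "lnorm2 (\<lambda>y. bv (pser a) y - psum a M y) \<le> (\<Sum>n. (cmod (l2_tail a M n))\<^sup>2)"
proof -
  obtain N where Nk: "\<And>k. k \<le> N k" and ae: "AE y in mT. (pser a \<longlongrightarrow> bv (pser a) y) (nontangential y) \<and> (\<lambda>k. psum a (N k) y) \<longlonglongrightarrow> bv (pser a) y"
    using Fatou_l2[OF a] by blast
  then show "AE y in mT. (pser a \<longlongrightarrow> bv (pser a) y) (nontangential y)" by auto
  have ae': "AE y in mT. (\<lambda>k. psum a (N k) y) \<longlonglongrightarrow> bv (pser a) y" using ae by auto
  have meas: "bv (pser a) \<in> borel_measurable mT"
    by (rule mT_measurable_AE_lim[OF _ ae']) (auto intro: L2_measurable)
  have main: "integrable mT (\<lambda>y. (cmod (bv (pser a) y - psum a M y))\<^sup>2)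
    \<and> lnorm2 (\<lambda>y. bv (pser a) y - psum a M y) \<le> (\<Sum>n. (cmod (l2_tail a M n))\<^sup>2)" for M
  proof -
    note [measurable] = meas L2_measurable[OF L2_psum]
    define T where "T = (\<Sum>n. (cmod (l2_tail a M n))\<^sup>2)"
    have T0: "T \<ge> 0" unfolding T_def using l2_l2_tail[OF a, of M] by (intro suminf_nonneg) (auto simp: l2_def)
    have "(\<integral>\<^sup>+y. ennreal ((cmod (bv (pser a) y - psum a M y))\<^sup>2) \<partial>mT) = 
        (\<integral>\<^sup>+y. liminf (\<lambda>k. ennreal ((cmod (psum a (N k) y - psum a M y))\<^sup>2)) \<partial>mT)"
    proof (rule nn_integral_cong_AE)
      show "AE y in mT. ennreal ((cmod (bv (pser a) y - psum a M y))\<^sup>2) = liminf (\<lambda>k. ennreal ((cmod (psum a (N k) y - psum a M y))\<^sup>2))"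
        using ae'
      proof eventually_elim
        case (elim y)
        then have "(\<lambda>k. ennreal ((cmod (psum a (N k) y - psum a M y))\<^sup>2)) \<longlonglongrightarrow> ennreal ((cmod (bv (pser a) y - psum a M y))\<^sup>2)"
          by (intro tendsto_intros)
        then show ?case by (intro lim_imp_Liminf[symmetric] trivial_limit_sequentially)
      qed
    qed
    also have "\<dots> \<le> liminf (\<lambda>k. \<integral>\<^sup>+y. ennreal ((cmod (psum a (N k) y - psum a M y))\<^sup>2) \<partial>mT)"
      by (rule nn_integral_liminf) measurable
    also have "\<dots> \<le> ennreal T"
    proof (rule Liminf_le)
      show "\<forall>\<^sub>F k in sequentially. (\<integral>\<^sup>+y. ennreal ((cmod (psum a (N k) y - psum a M y))\<^sup>2) \<partial>mT) \<le> ennreal T"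
        using eventually_ge_at_top[of M]
      proof eventually_elim
        case (elim k)
        then have MN: "M \<le> N k" using Nk[of k] by simp
        have "(\<integral>\<^sup>+y. ennreal ((cmod (psum a (N k) y - psum a M y))\<^sup>2) \<partial>mT) = ennreal (lnorm2 (psum (l2_tail a M) (N k)))"
          unfolding psum_diff_tail[OF MN] lnorm2_def
          by (rule nn_integral_eq_integral) (auto intro: L2_integrable_sq)
        also have "\<dots> \<le> ennreal T"
          unfolding lnorm2_psum T_def using l2_l2_tail[OF a, of M]
          by (intro ennreal_leI sum_le_suminf) (auto simp: l2_def)
        finally show ?case .
      qed
    qed simp
    finally have le: "(\<integral>\<^sup>+y. ennreal ((cmod (bv (pser a) y - psum a M y))\<^sup>2) \<partial>mT) \<le> ennreal T" .
    have int: "integrable mT (\<lambda>y. (cmod (bv (pser a) y - psum a M y))\<^sup>2)"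
      by (rule integrableI_bounded) (use le in \<open>auto intro: le_less_trans\<close>)
    have "ennreal (lnorm2 (\<lambda>y. bv (pser a) y - psum a M y)) \<le> ennreal T"
      using le nn_integral_eq_integral[OF int] by (simp add: lnorm2_def)
    then show ?thesis using int T0 by (simp add: T_def)
  qed
  then show "lnorm2 (\<lambda>y. bv (pser a) y - psum a M y) \<le> (\<Sum>n. (cmod (l2_tail a M n))\<^sup>2)" by blast
  show "L2 (bv (pser a))" using main[of 0] meas by (simp add: L2_def psum_def)
qed

lemma lip_bv_psum_tendsto:
  assumes a: "l2 a" and h: "L2 h"
  shows "(\<lambda>M. lip (psum a M) h) \<longlonglongrightarrow> lip (bv (pser a)) h"
proof -
  have "(\<lambda>M. lip (bv (pser a)) h - lip (psum a M) h) \<longlonglongrightarrow> 0"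
  proof (rule Lim_null_comparison)
    show "\<forall>\<^sub>F M in sequentially. norm (lip (bv (pser a)) h - lip (psum a M) h) \<le> sqrt ((\<Sum>n. (cmod (l2_tail a M n))\<^sup>2) * lnorm2 h)"
    proof (intro always_eventually allI)
      fix M
      have d: "L2 (\<lambda>y. bv (pser a) y - psum a M y)" by (intro L2_minus bv_pser_facts a) auto
      have "(cmod (lip (\<lambda>y. bv (pser a) y - psum a M y) h))\<^sup>2 \<le> lnorm2 (\<lambda>y. bv (pser a) y - psum a M y) * lnorm2 h"
        by (rule lip_bound[OF d h])
      also have "\<dots> \<le> (\<Sum>n. (cmod (l2_tail a M n))\<^sup>2) * lnorm2 h"
        by (intro mult_right_mono bv_pser_facts a) auto
      finally show "norm (lip (bv (pser a)) h - lip (psum a M) h) \<le> sqrt ((\<Sum>n. (cmod (l2_tail a M n))\<^sup>2) * lnorm2 h)"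
        using h by (simp add: lip_diff_left bv_pser_facts a real_le_rsqrt)
    qed
    show "(\<lambda>M. sqrt ((\<Sum>n. (cmod (l2_tail a M n))\<^sup>2) * lnorm2 h)) \<longlonglongrightarrow> 0"
      using tendsto_real_sqrt[OF tendsto_mult_right[OF l2_tail_norm_tendsto_0[OF a], of "lnorm2 h"]] by simp
  qed
  from tendsto_diff[OF tendsto_const[of "lip (bv (pser a)) h"] this] show ?thesis by simp
qed

lemma lip_bv_pser_power: "l2 a \<Longrightarrow> lip (bv (pser a)) (\<lambda>y. y ^ m) = a m"
proof -
  assume a: "l2 a"
  have "eventually (\<lambda>M. lip (psum a M) (\<lambda>y. y ^ m) = a m) sequentially"
    using eventually_gt_at_top[of m] by eventually_elim (simp add: lip_psum_power)
  then have "(\<lambda>M. lip (psum a M) (\<lambda>y. y ^ m)) \<longlonglongrightarrow> a m" by (rule tendsto_eventually)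
  with lip_bv_psum_tendsto[OF a, of "\<lambda>y. y ^ m"] show ?thesis using LIMSEQ_unique by auto
qed

lemma lip_bv_pser_cnj_power: "l2 a \<Longrightarrow> lip (bv (pser a)) (\<lambda>y. cnj y ^ Suc m) = 0"
proof -
  assume a: "l2 a"
  have "lip (psum a M) (\<lambda>y. cnj y ^ Suc m) = 0" for M
    using psum_cnj[of a M m] by (simp add: lip_def)
  with lip_bv_psum_tendsto[OF a, of "\<lambda>y. cnj y ^ Suc m"]
  have "(\<lambda>M::nat. 0) \<longlonglongrightarrow> lip (bv (pser a)) (\<lambda>y. cnj y ^ Suc m)" by (simp del: power_Suc)
  from LIMSEQ_unique[OF this tendsto_const] show ?thesis .
qed

lemma lip_bv_pser:
  assumes a: "l2 a" and b: "l2 b"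
  shows "(\<lambda>n. a n * cnj (b n)) sums lip (bv (pser a)) (bv (pser b))"
proof -
  have "lip (psum a M) (bv (pser b)) = (\<Sum>n<M. a n * cnj (b n))" for M
  proof -
    have "lip (psum a M) (bv (pser b)) = cnj (lip (bv (pser b)) (psum a M))" by (simp add: lip_cnj)
    also have "\<dots> = (\<Sum>n<M. a n * cnj (b n))"
      by (subst lip_psum_right) (auto simp: bv_pser_facts b lip_bv_pser_power mult.commute)
    finally show ?thesis .
  qed
  with lip_bv_psum_tendsto[OF a bv_pser_facts(2)[OF b]] show ?thesis by (simp add: sums_def)
qed

lemma lnorm2_bv_pser:
  assumes a: "l2 a"
  shows "lnorm2 (bv (pser a)) = (\<Sum>n. (cmod (a n))\<^sup>2)"
proof -
  have "(\<lambda>n. complex_of_real ((cmod (a n))\<^sup>2)) sums complex_of_real (lnorm2 (bv (pser a)))"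
    using lip_bv_pser[OF a a] unfolding complex_norm_square[symmetric] lip_self .
  then have "(\<lambda>n. (cmod (a n))\<^sup>2) sums lnorm2 (bv (pser a))" by (simp only: sums_of_real_iff)
  then show ?thesis by (simp add: sums_iff)
qed

lemma pser_disc_holomorphic:
  assumes "l2 a" shows "pser a \<in> disc_holomorphic"
proof -
  have "(\<lambda>z. \<Sum>n. a n * z ^ n) holomorphic_on ball 0 1"
  proof (rule power_series_holomorphic)
    fix w :: complex assume "w \<in> ball 0 1"
    then show "(\<lambda>n. a n * (w - 0) ^ n) sums (\<Sum>n. a n * w ^ n)"
      using l2_power_summable(2)[OF assms, of w] by (simp add: summable_sums)
  qed
  then have "pser a holomorphic_on ball 0 1"
    by (rule holomorphic_transform) (auto simp: pser_def on_disc_def)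
  then show ?thesis by (auto simp: disc_holomorphic_def pser_def on_disc_def)
qed

text \<open>Dilations are analytic across the circle. Therefore they have square summable Taylor coefficients, and their boundary
  values are ordinary values.\<close>

lemma disc_holomorphic_dilate:
  assumes f: "f \<in> disc_holomorphic" and r: "0 \<le> r" "r < 1"
  defines "b \<equiv> \<lambda>n. (deriv ^^ n) f 0 / fact n * of_real r ^ n"
  shows "l2 b" "\<And>y. y \<in> sphere 0 1 \<Longrightarrow> bv (pser b) y = f (of_real r * y)"
    "\<And>z. z \<in> ball 0 1 \<Longrightarrow> pser b z = f (of_real r * z)"
proof -
  have hol: "f holomorphic_on ball 0 1" using f by (auto simp: disc_holomorphic_def)
  have sums: "(\<lambda>n. b n * z ^ n) sums f (of_real r * z)" if "z \<in> cball 0 1" for z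
  proof -
    have "norm (of_real r * z) < 1"
      using that r by (auto simp: norm_mult intro: le_less_trans[OF mult_left_le])
    then show ?thesis
      using holomorphic_power_series[OF hol, of "of_real r * z"] by (simp add: b_def power_mult_distrib mult_ac)
  qed
  show l2b: "l2 b"
  proof -
    obtain s where s: "r < s" "s < 1" using r dense by blast
    have "summable (\<lambda>n. (deriv ^^ n) f 0 / fact n * (of_real s - 0) ^ n)"
      using holomorphic_power_series[OF hol, of "of_real s"] s r by (intro sums_summable) auto
    then have "(\<lambda>n. (deriv ^^ n) f 0 / fact n * of_real s ^ n) \<longlonglongrightarrow> 0"
      using summable_LIMSEQ_zero by fastforce
    then have "Bseq (\<lambda>n. (deriv ^^ n) f 0 / fact n * of_real s ^ n)" by (intro convergent_imp_Bseq convergentI)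
    then obtain K where K: "\<And>n. norm ((deriv ^^ n) f 0 / fact n * of_real s ^ n) \<le> K" unfolding Bseq_def by blast
    show ?thesis unfolding l2_def
    proof (rule summable_comparison_test')
      have "r / s < 1" "r / s \<ge> 0" using s r by auto
      then have "(r / s)\<^sup>2 < 1" by (simp add: abs_square_less_1)
      then show "summable (\<lambda>n. K\<^sup>2 * ((r / s)\<^sup>2) ^ n)" by (intro summable_mult summable_geometric) simp
      fix n
      have "b n = (deriv ^^ n) f 0 / fact n * of_real s ^ n * of_real (r / s) ^ n"
        using s r by (simp add: b_def power_divide)
      then have "cmod (b n) \<le> K * (r / s) ^ n"
        using mult_right_mono[OF K[of n], of "(r / s) ^ n"] s r by (simp add: norm_mult norm_power norm_divide)
      then have "(cmod (b n))\<^sup>2 \<le> (K * (r / s) ^ n)\<^sup>2" by (intro power_mono) auto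
      then show "norm ((cmod (b n))\<^sup>2) \<le> K\<^sup>2 * ((r / s)\<^sup>2) ^ n"
        by (simp add: power_mult_distrib flip: power_mult) (simp add: mult.commute)
    qed
  qed
  show eq: "pser b z = f (of_real r * z)" if "z \<in> ball 0 1" for z
    using sums[of z] that by (simp add: pser_def on_disc_def sums_iff)
  fix y :: complex assume z: "y \<in> sphere 0 1"
  show "bv (pser b) y = f (of_real r * y)"
  proof (rule bvI[OF _ z])
    have "isCont f (of_real r * y)"
      using hol r z by (intro continuous_on_interior[OF holomorphic_on_imp_continuous_on]) (auto simp: norm_mult)
    then have c: "isCont (\<lambda>z. f (of_real r * z)) y"
      by (rule isCont_o2[rotated]) (intro continuous_intros)
    have "((\<lambda>z. f (of_real r * z)) \<longlongrightarrow> f (of_real r * y)) (nontangential y)"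
    proof (rule tendstoI)
      fix e :: real assume "e > 0"
      from tendstoD[OF c[unfolded isCont_def] this]
      have "eventually (\<lambda>z. dist (f (of_real r * z)) (f (of_real r * y)) < e) (at y)" .
      then show "eventually (\<lambda>z. dist (f (of_real r * z)) (f (of_real r * y)) < e) (nontangential y)"
        unfolding eventually_nontangential by (auto simp: eventually_at_filter elim: eventually_mono)
    qed
    then show "(pser b \<longlongrightarrow> f (of_real r * y)) (nontangential y)"
      by (rule Lim_transform_eventually) (rule eventually_mono[OF nontangential_disc], simp add: eq)
  qed
qed

lemma circle_mean:
  assumes f: "f \<in> disc_holomorphic" and r: "0 \<le> r" "r < 1"
  shows "(\<integral>y. (cmod (f (of_real r * y)))\<^sup>2 \<partial>mT) = (\<Sum>n. (cmod ((deriv ^^ n) f 0 / fact n * of_real r ^ n))\<^sup>2)"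
proof -
  define b where "b n = (deriv ^^ n) f 0 / fact n * of_real r ^ n" for n
  note d = disc_holomorphic_dilate[OF assms, folded b_def]
  have "(\<integral>y. (cmod (f (of_real r * y)))\<^sup>2 \<partial>mT) = lnorm2 (bv (pser b))"
    unfolding lnorm2_def by (rule Bochner_Integration.integral_cong) (auto simp: d(2))
  also have "\<dots> = (\<Sum>n. (cmod (b n))\<^sup>2)"
    by (rule lnorm2_bv_pser[OF d(1)])
  finally show ?thesis by (simp only: b_def)
qed

lemma H2_car: "f \<in> car H2 \<longleftrightarrow> f \<in> disc_holomorphic \<and>
     bdd_above ((\<lambda>r. \<integral>y. (cmod (f (of_real r * y)))\<^sup>2 \<partial>mT) ` {0..<1})"
  by (simp add: H2_def)

text \<open>By orthogonality of the powers, the mean is the sum of the squared coefficients damped by powers of the radius.\<close>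

lemma pser_circle_mean_le:
  assumes a: "l2 a" and f: "f = pser a" and r: "r \<in> {0..<1}"
  shows "(\<integral>y. (cmod (f (of_real r * y)))\<^sup>2 \<partial>mT) \<le> (\<Sum>n. (cmod (a n))\<^sup>2)"
proof -
  have dh: "f \<in> disc_holomorphic" using a f pser_disc_holomorphic by simp
  define b where "b n = a n * of_real r ^ n" for n
  have bn: "(cmod (b n))\<^sup>2 \<le> (cmod (a n))\<^sup>2" for n
  proof -
    have "cmod (a n) * r ^ n \<le> cmod (a n) * 1" using r by (intro mult_left_mono power_le_one) auto
    then show ?thesis using r by (intro power_mono) (auto simp: b_def norm_mult norm_power)
  qed
  have b: "l2 b" unfolding l2_def by (rule summable_comparison_test'[of _ 0, OF a[unfolded l2_def]]) (simp add: bn)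
  define c where "c n = (deriv ^^ n) f 0 / fact n * of_real r ^ n" for n
  note d = disc_holomorphic_dilate[OF dh, of r, folded c_def]
  have "pser b = pser c"
  proof
    fix z show "pser b z = pser c z"
    proof (cases "z \<in> ball 0 1")
      case True
      then have "norm (of_real r * z) < 1" using r by (auto simp: norm_mult intro: le_less_trans[OF mult_left_le_one_le])
      then show ?thesis using True d(3)[of z] r
        by (simp add: f) (simp add: pser_def on_disc_def b_def power_mult_distrib mult_ac)
    qed (auto simp: pser_def on_disc_def)
  qed
  have "(\<integral>y. (cmod (f (of_real r * y)))\<^sup>2 \<partial>mT) = lnorm2 (bv (pser c))"
    unfolding lnorm2_def by (rule Bochner_Integration.integral_cong) (use d(2) r in auto)
  also have "\<dots> = (\<Sum>n. (cmod (b n))\<^sup>2)" using \<open>pser b = pser c\<close> lnorm2_bv_pser[OF b] by simp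
  also have "\<dots> \<le> (\<Sum>n. (cmod (a n))\<^sup>2)"
    using a b bn by (intro suminf_le) (auto simp: l2_def)
  finally show ?thesis .
qed

text \<open>Bounded circle means give square summable coefficients by letting the radius tend to \<open>1\<close> in finite
  partial sums.\<close>

theorem H2_iff_pser: "f \<in> car H2 \<longleftrightarrow> (\<exists>a. l2 a \<and> f = pser a)"
proof
  assume f: "f \<in> car H2"
  then have dh: "f \<in> disc_holomorphic" by (simp add: H2_car)
  have "\<exists>K. \<forall>r\<in>{0..<1}. (\<integral>y. (cmod (f (of_real r * y)))\<^sup>2 \<partial>mT) \<le> K"
    using f by (simp add: H2_car bdd_above_def)
  then obtain K where K: "\<And>r. r \<in> {0..<1} \<Longrightarrow> (\<integral>y. (cmod (f (of_real r * y)))\<^sup>2 \<partial>mT) \<le> K" by blast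
  define a where "a n = (deriv ^^ n) f 0 / fact n" for n
  have part: "(\<Sum>n<N. (cmod (a n))\<^sup>2) \<le> K" for N
  proof (rule tendsto_le[of "at_left (1::real)"])
    show "((\<lambda>r. \<Sum>n<N. (cmod (a n * of_real r ^ n))\<^sup>2) \<longlongrightarrow> (\<Sum>n<N. (cmod (a n))\<^sup>2)) (at_left 1)"
      by (rule tendsto_eq_intros refl | simp)+
    have "eventually (\<lambda>r::real. r \<in> {0<..<1}) (at_left 1)"
      by (intro eventually_at_leftI[of 0]) auto
    then show "\<forall>\<^sub>F r in at_left 1. (\<Sum>n<N. (cmod (a n * of_real r ^ n))\<^sup>2) \<le> K"
    proof eventually_elim
      case (elim r)
      then have r: "0 \<le> r" "r < 1" by auto
      have "(\<Sum>n<N. (cmod (a n * of_real r ^ n))\<^sup>2) \<le> (\<Sum>n. (cmod (a n * of_real r ^ n))\<^sup>2)"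
        using disc_holomorphic_dilate(1)[OF dh r] by (intro sum_le_suminf) (auto simp: l2_def a_def)
      also have "\<dots> \<le> K" using K[of r] r circle_mean[OF dh r] by (simp add: a_def)
      finally show ?case .
    qed
  qed auto
  have "l2 a" unfolding l2_def
  proof (rule bounded_imp_summable)
    show "(\<Sum>n\<le>N. (cmod (a n))\<^sup>2) \<le> K" for N using part[of "Suc N"] by (simp add: lessThan_Suc_atMost)
  qed simp
  moreover have "f = pser a"
  proof
    fix z show "f z = pser a z"
    proof (cases "z \<in> ball 0 1")
      case True
      then show ?thesis
        using dh holomorphic_power_series[of f 0 1 z] by (simp add: disc_holomorphic_def pser_def on_disc_def a_def sums_iff)
    qed (use dh in \<open>auto simp: disc_holomorphic_def pser_def on_disc_def\<close>)
  qed
  ultimately show "\<exists>a. l2 a \<and> f = pser a" by blast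
next
  assume "\<exists>a. l2 a \<and> f = pser a"
  then obtain a where a: "l2 a" "f = pser a" by blast
  have dh: "f \<in> disc_holomorphic" using a pser_disc_holomorphic by simp
  have "(\<integral>y. (cmod (f (of_real r * y)))\<^sup>2 \<partial>mT) \<le> (\<Sum>n. (cmod (a n))\<^sup>2)" if r: "r \<in> {0..<1}" for r
    by (rule pser_circle_mean_le[OF a r])
  then have "bdd_above ((\<lambda>r. \<integral>y. (cmod (f (of_real r * y)))\<^sup>2 \<partial>mT) ` {0..<1})" by (intro bdd_aboveI2)
  then show "f \<in> car H2" using dh by (simp add: H2_car)
qed

subsection \<open>The Hardy space through boundary functions\<close>

text \<open>Taylor coefficients, written as Fourier coefficients of the boundary function; the two agree by
  \<open>H2_sums\<close>.\<close>

definition tc :: "(complex \<Rightarrow> complex) \<Rightarrow> nat \<Rightarrow> complex" where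
  "tc f n = lip (bv f) (\<lambda>y. y ^ n)"

text \<open>In contrast to an equation for \<^const>\<open>bv\<close>, this relation is preserved by sums and products.\<close>

definition has_bv :: "(complex \<Rightarrow> complex) \<Rightarrow> (complex \<Rightarrow> complex) \<Rightarrow> bool" where
  "has_bv f h \<longleftrightarrow> (AE y in mT. (f \<longlongrightarrow> h y) (nontangential y))"

lemma AE_sphere: "AE y in mT. y \<in> sphere 0 1"
  using AE_space[of mT] by simp

lemma AE_mT_const: "(AE y in mT. P) \<longleftrightarrow> P"
proof (cases P)
  case False
  have "ae_filter mT \<noteq> bot" using emeasure_mT_space by (simp add: ae_filter_eq_bot_iff)
  then show ?thesis using False by (simp add: eventually_False)
qed simp

lemma has_bv_imp: "has_bv f h \<Longrightarrow> AE y in mT. bv f y = h y"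
proof -
  assume "has_bv f h"
  from this[unfolded has_bv_def] AE_sphere show "AE y in mT. bv f y = h y"
    by eventually_elim (rule bvI)
qed

lemma has_bv_add: "has_bv f h \<Longrightarrow> has_bv g k \<Longrightarrow> has_bv (f + g) (\<lambda>y. h y + k y)"
  unfolding has_bv_def plus_fun_def by (auto elim!: eventually_elim2 intro: tendsto_intros)

lemma has_bv_diff: "has_bv f h \<Longrightarrow> has_bv g k \<Longrightarrow> has_bv (f - g) (\<lambda>y. h y - k y)"
  unfolding has_bv_def fun_diff_def by (auto elim!: eventually_elim2 intro: tendsto_intros)

lemma has_bv_mult: "has_bv f h \<Longrightarrow> has_bv g k \<Longrightarrow> has_bv (f * g) (\<lambda>y. h y * k y)"
  unfolding has_bv_def times_fun_def by (auto elim!: eventually_elim2 intro: tendsto_intros)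

lemma has_bv_cmult: "has_bv f h \<Longrightarrow> has_bv (\<lambda>z. c * f z) (\<lambda>y. c * h y)"
  unfolding has_bv_def by (auto elim!: eventually_mono intro: tendsto_intros)

lemma has_bv_shift:
  assumes "has_bv f h" shows "has_bv (\<lambda>z. z * f z) (\<lambda>y. y * h y)"
proof -
  have *: "((\<lambda>z. z) \<longlongrightarrow> y) (nontangential y)" for y
  proof (rule tendstoI)
    fix e :: real assume "e > 0"
    then show "eventually (\<lambda>z. dist z y < e) (nontangential y)"
      unfolding eventually_nontangential by (auto simp: eventually_at)
  qed
  show ?thesis using assms unfolding has_bv_def by (auto elim!: eventually_mono intro: tendsto_intros *)
qed

lemma has_bv_cong_disc:
  assumes "has_bv f h" "\<And>z. z \<in> ball 0 1 \<Longrightarrow> f z = g z"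
  shows "has_bv g h"
proof -
  have "(g \<longlongrightarrow> h y) (nontangential y)" if "(f \<longlongrightarrow> h y) (nontangential y)" for y
    using that by (rule Lim_transform_eventually) (rule eventually_mono[OF nontangential_disc], simp add: assms)
  then show ?thesis using assms(1) unfolding has_bv_def by (auto elim!: eventually_mono)
qed

lemma H2_E:
  assumes "f \<in> car H2"
  shows "l2 (tc f)" "pser (tc f) = f" "L2 (bv f)" "has_bv f (bv f)" "f \<in> disc_holomorphic"
proof -
  obtain a where a: "l2 a" "f = pser a" using assms by (auto simp: H2_iff_pser)
  have "tc f = a" by (rule ext) (simp add: tc_def a lip_bv_pser_power)
  then show "l2 (tc f)" "pser (tc f) = f" "L2 (bv f)" "has_bv f (bv f)" "f \<in> disc_holomorphic"
    using a bv_pser_facts[OF a(1)] pser_disc_holomorphic[OF a(1)] by (auto simp: has_bv_def)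
qed

lemma H2_measurable: "f \<in> car H2 \<Longrightarrow> bv f \<in> borel_measurable mT"
  by (intro L2_measurable H2_E)

lemma H2_pser: "l2 a \<Longrightarrow> pser a \<in> car H2" by (auto simp: H2_iff_pser)

lemma tc_pser: "l2 a \<Longrightarrow> tc (pser a) = a"
  by (rule ext) (simp add: tc_def lip_bv_pser_power)

lemma H2_sums:
  assumes "f \<in> car H2" "z \<in> ball 0 1"
  shows "(\<lambda>n. tc f n * z ^ n) sums f z"
proof -
  have "f z = pser (tc f) z" by (simp add: H2_E assms)
  also have "\<dots> = (\<Sum>n. tc f n * z ^ n)" using assms(2) by (simp add: pser_def on_disc_def)
  finally show ?thesis
    using l2_power_summable(2)[OF H2_E(1)[OF assms(1)], of z] assms(2) by (simp add: summable_sums)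
qed

lemma H2_outside: "f \<in> car H2 \<Longrightarrow> z \<notin> ball 0 1 \<Longrightarrow> f z = 0"
  using H2_E(5) by (auto simp: disc_holomorphic_def)

lemma H2_bv_cnj_power: "f \<in> car H2 \<Longrightarrow> lip (bv f) (\<lambda>y. cnj y ^ Suc m) = 0"
  using lip_bv_pser_cnj_power[of "tc f" m] by (simp add: H2_E)

lemma l2_add: "l2 a \<Longrightarrow> l2 b \<Longrightarrow> l2 (\<lambda>n. a n + b n)"
  unfolding l2_def
  by (rule summable_comparison_test'[of "\<lambda>n. 2 * (cmod (a n))\<^sup>2 + 2 * (cmod (b n))\<^sup>2" 0]) (auto intro!: norm_add_sq_le summable_add summable_mult)

lemma l2_cmult: "l2 a \<Longrightarrow> l2 (\<lambda>n. c * a n)"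
  unfolding l2_def by (simp add: norm_mult power_mult_distrib summable_mult)

lemma H2_add: 
  assumes "f \<in> car H2" "g \<in> car H2" shows "f + g \<in> car H2"
proof -
  have "f + g = pser (\<lambda>n. tc f n + tc g n)"
  proof
    fix z show "(f + g) z = pser (\<lambda>n. tc f n + tc g n) z"
      using sums_add[OF H2_sums[OF assms(1), of z] H2_sums[OF assms(2), of z]] H2_outside[OF assms(1), of z] H2_outside[OF assms(2), of z]
      by (cases "z \<in> ball 0 1") (auto simp: pser_def on_disc_def sums_iff ring_distribs)
  qed
  then show ?thesis using assms by (auto intro!: H2_pser l2_add H2_E)
qed

lemma H2_cmult: 
  assumes "f \<in> car H2" shows "(\<lambda>z. c * f z) \<in> car H2"
proof -
  have "(\<lambda>z. c * f z) = pser (\<lambda>n. c * tc f n)"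
  proof
    fix z show "c * f z = pser (\<lambda>n. c * tc f n) z"
      using sums_mult[OF H2_sums[OF assms(1), of z], of c] H2_outside[OF assms(1), of z]
      by (cases "z \<in> ball 0 1") (auto simp: pser_def on_disc_def sums_iff mult.assoc)
  qed
  then show ?thesis using assms by (auto intro!: H2_pser l2_cmult H2_E)
qed

lemma H2_diff: "f \<in> car H2 \<Longrightarrow> g \<in> car H2 \<Longrightarrow> f - g \<in> car H2"
  using H2_add[OF _ H2_cmult[of g "-1"], of f] by (simp add: fun_diff_def plus_fun_def)

lemma H2_zero [simp]: "0 \<in> car H2"
  using H2_pser[of "\<lambda>_. 0"] by (simp add: l2_def pser_def on_disc_def zero_fun_def)

lemma bv_zero: "y \<in> sphere 0 1 \<Longrightarrow> bv 0 y = 0"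
  by (rule bvI) (auto simp: zero_fun_def)

lemma AE_bv_add: "f \<in> car H2 \<Longrightarrow> g \<in> car H2 \<Longrightarrow> AE y in mT. bv (f + g) y = bv f y + bv g y"
  by (intro has_bv_imp has_bv_add H2_E)

lemma AE_bv_diff: "f \<in> car H2 \<Longrightarrow> g \<in> car H2 \<Longrightarrow> AE y in mT. bv (f - g) y = bv f y - bv g y"
  by (intro has_bv_imp has_bv_diff H2_E)

lemma AE_bv_cmult: "f \<in> car H2 \<Longrightarrow> AE y in mT. bv (\<lambda>z. c * f z) y = c * bv f y"
  by (intro has_bv_imp has_bv_cmult H2_E)

lemma ip_H2: "ip H2 f g = lip (bv f) (bv g)" by (simp add: H2_def lip_def)

lemma scl_H2: "scl H2 c f = (\<lambda>z. c * f z)" by (simp add: H2_def)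

lemma hnorm_H2: "hnorm H2 f = sqrt (lnorm2 (bv f))"
  by (simp add: hnorm_def ip_H2 lip_self)

lemma lip_bv_bv:
  assumes "f \<in> car H2" "g \<in> car H2"
  shows "(\<lambda>n. tc f n * cnj (tc g n)) sums lip (bv f) (bv g)"
  using lip_bv_pser[OF H2_E(1)[OF assms(1)] H2_E(1)[OF assms(2)]] by (simp add: H2_E assms)

lemma lnorm2_bv: "f \<in> car H2 \<Longrightarrow> lnorm2 (bv f) = (\<Sum>n. (cmod (tc f n))\<^sup>2)"
  using lnorm2_bv_pser[of "tc f"] by (simp add: H2_E)

lemma H2_norm_0: "f \<in> car H2 \<Longrightarrow> lnorm2 (bv f) = 0 \<Longrightarrow> f = 0"
proof -
  assume f: "f \<in> car H2" "lnorm2 (bv f) = 0"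
  then have "\<forall>n. (cmod (tc f n))\<^sup>2 = 0"
  proof -
    have "summable (\<lambda>n. (cmod (tc f n))\<^sup>2)" using H2_E(1)[OF f(1)] by (simp only: l2_def)
    from suminf_eq_zero_iff[OF this] lnorm2_bv[OF f(1)] f(2) show ?thesis by simp
  qed
  then have "tc f = (\<lambda>_. 0)" by auto
  then have "pser (\<lambda>_. 0) = f" using H2_E(2)[OF f(1)] by simp
  then show "f = 0" by (auto simp: pser_def on_disc_def zero_fun_def)
qed

lemma disc_holomorphic_mult: "f \<in> disc_holomorphic \<Longrightarrow> g \<in> disc_holomorphic \<Longrightarrow> f * g \<in> disc_holomorphic"
  by (auto simp: disc_holomorphic_def times_fun_def intro!: holomorphic_intros)

lemma disc_holomorphic_on_disc: "f holomorphic_on ball 0 1 \<Longrightarrow> on_disc f \<in> disc_holomorphic"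
  by (auto simp: disc_holomorphic_def on_disc_def intro: holomorphic_transform)

lemma Hinf_bound: "\<phi> \<in> Hinf \<Longrightarrow> \<exists>M>0. \<forall>z. cmod (\<phi> z) \<le> M"
proof -
  assume p: "\<phi> \<in> Hinf"
  then obtain M where "M > 0" "\<forall>z\<in>ball 0 1. cmod (\<phi> z) \<le> M" by (auto simp: Hinf_def bounded_pos)
  then have "cmod (\<phi> z) \<le> M" for z
    using p by (cases "z \<in> ball 0 1") (auto simp: Hinf_def disc_holomorphic_def)
  then show ?thesis using \<open>M > 0\<close> by blast
qed

lemma dilate_L2:
  assumes f: "f \<in> disc_holomorphic" and r: "0 \<le> r" "r < 1"
  shows "L2 (\<lambda>y. f (of_real r * y))"
proof (rule L2_continuous)
  have "continuous_on (ball 0 1) f" using f by (auto simp: disc_holomorphic_def holomorphic_on_imp_continuous_on)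
  then show "continuous_on (sphere 0 1) (\<lambda>y. f (of_real r * y))"
    by (rule continuous_on_compose2) (use r in \<open>auto intro!: continuous_intros simp: norm_mult\<close>)
qed

text \<open>The circle means of a product are at most those of one factor times the squared supremum of the other.\<close>

lemma Hinf_mult:
  assumes p: "\<phi> \<in> Hinf" and f: "f \<in> car H2"
  shows "\<phi> * f \<in> car H2"
proof -
  obtain M where M: "M > 0" "\<And>z. cmod (\<phi> z) \<le> M" using Hinf_bound[OF p] by blast
  have pd: "\<phi> \<in> disc_holomorphic" using p by (simp add: Hinf_def)
  have fd: "f \<in> disc_holomorphic" using f by (simp add: H2_car)
  have "\<exists>K. \<forall>r\<in>{0..<1}. (\<integral>y. (cmod (f (of_real r * y)))\<^sup>2 \<partial>mT) \<le> K"
    using f by (simp add: H2_car bdd_above_def)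
  then obtain K where K: "\<And>r. r \<in> {0..<1} \<Longrightarrow> (\<integral>y. (cmod (f (of_real r * y)))\<^sup>2 \<partial>mT) \<le> K" by blast
  have "(\<integral>y. (cmod ((\<phi> * f) (of_real r * y)))\<^sup>2 \<partial>mT) \<le> M\<^sup>2 * K" if r: "r \<in> {0..<1}" for r
  proof -
    have r': "0 \<le> r" "r < 1" using r by auto
    have "lnorm2 (\<lambda>y. \<phi> (of_real r * y) * f (of_real r * y)) \<le> M\<^sup>2 * lnorm2 (\<lambda>y. f (of_real r * y))"
      using M(2) L2_measurable[OF dilate_L2[OF pd r']] by (intro L2_bounded_mult(2) dilate_L2 fd r') auto
    also have "\<dots> \<le> M\<^sup>2 * K" using K[OF r] by (intro mult_left_mono) (auto simp: lnorm2_def)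
    finally show ?thesis by (simp add: lnorm2_def)
  qed
  then have "bdd_above ((\<lambda>r. \<integral>y. (cmod ((\<phi> * f) (of_real r * y)))\<^sup>2 \<partial>mT) ` {0..<1})" by (intro bdd_aboveI2)
  then show ?thesis using disc_holomorphic_mult[OF pd fd] by (simp add: H2_car)
qed

definition one_disc :: "complex \<Rightarrow> complex" where "one_disc = on_disc (\<lambda>_. 1)"

lemma one_disc_Hinf: "one_disc \<in> Hinf"
  unfolding one_disc_def Hinf_def using disc_holomorphic_on_disc[of "\<lambda>_. 1"] by (auto simp: on_disc_def bounded_iff)

lemma one_disc_H2 [simp]: "one_disc \<in> car H2"
proof -
  have "one_disc = pser (\<lambda>n. if n = 0 then 1 else 0)"
  proof
    fix z :: complex
    have "(\<Sum>n. (if n = 0 then 1 else 0) * z ^ n) = 1" by (subst suminf_finite[of "{0}"]) auto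
    then show "one_disc z = pser (\<lambda>n. if n = 0 then 1 else 0) z" by (simp add: one_disc_def pser_def on_disc_def)
  qed
  moreover have "l2 (\<lambda>n. if n = 0 then 1 else 0)" unfolding l2_def by (rule summable_finite[of "{0}"]) auto
  ultimately show ?thesis by (metis H2_pser)
qed

lemma bv_one_disc: "y \<in> sphere 0 1 \<Longrightarrow> bv one_disc y = 1"
proof (rule bvI)
  have "((\<lambda>_. 1) \<longlongrightarrow> 1) (nontangential y)" by simp
  then show "(one_disc \<longlongrightarrow> 1) (nontangential y)"
    by (rule Lim_transform_eventually) (rule eventually_mono[OF nontangential_disc], simp add: one_disc_def on_disc_def)
qed

lemma lip_one_disc: "lip h (bv one_disc) = lip h (\<lambda>_. 1)"
  unfolding lip_def by (rule Bochner_Integration.integral_cong) (simp_all add: bv_one_disc)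

lemma Hinf_H2: "\<phi> \<in> Hinf \<Longrightarrow> \<phi> \<in> car H2"
proof -
  assume p: "\<phi> \<in> Hinf"
  have "\<phi> * one_disc = \<phi>"
    using p by (auto simp: one_disc_def on_disc_def times_fun_def Hinf_def disc_holomorphic_def)
  then show ?thesis using Hinf_mult[OF p one_disc_H2] by simp
qed

lemma Hinf_bv_bound:
  assumes "\<phi> \<in> Hinf" "\<And>z. z \<in> ball 0 1 \<Longrightarrow> cmod (\<phi> z) \<le> M"
  shows "AE y in mT. cmod (bv \<phi> y) \<le> M"
  using H2_E(4)[OF Hinf_H2[OF assms(1)]] AE_sphere unfolding has_bv_def
proof eventually_elim
  case (elim y)
  show ?case
    by (rule Lim_norm_ubound[OF _ elim(1)]) (use elim in \<open>auto intro: eventually_mono[OF nontangential_disc] assms\<close>)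
qed

text \<open>The reproducing kernel of the Hardy space at the point \<open>w\<close>.\<close>

definition szego :: "complex \<Rightarrow> complex \<Rightarrow> complex" where
  "szego w = pser (\<lambda>n. cnj w ^ n)"

lemma szego:
  assumes w: "w \<in> ball 0 1"
  shows "szego w \<in> Hinf" "tc (szego w) n = cnj w ^ n" "\<And>z. z \<in> ball 0 1 \<Longrightarrow> szego w z = 1 / (1 - cnj w * z)"
proof -
  have w1: "norm w < 1" using w by simp
  have l: "l2 (\<lambda>n. cnj w ^ n)" unfolding l2_def
  proof -
    have "(norm w)\<^sup>2 < 1" using w1 by (simp add: abs_square_less_1)
    moreover have "(\<lambda>n. (cmod (cnj w ^ n))\<^sup>2) = (\<lambda>n. ((norm w)\<^sup>2) ^ n)"
      by (simp add: norm_power power_mult[symmetric] mult.commute)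
    ultimately show "summable (\<lambda>n. (cmod (cnj w ^ n))\<^sup>2)" by (simp add: summable_geometric)
  qed
  show "tc (szego w) n = cnj w ^ n" by (simp add: szego_def tc_pser[OF l])
  show eq: "szego w z = 1 / (1 - cnj w * z)" if "z \<in> ball 0 1" for z
  proof -
    have "norm (cnj w * z) < 1" using that w1 mult_strict_mono[of "norm w" 1 "norm z" 1] by (auto simp: norm_mult)
    then have "(\<lambda>n. (cnj w * z) ^ n) sums (1 / (1 - cnj w * z))" by (rule geometric_sums)
    then show ?thesis using that by (simp add: szego_def pser_def on_disc_def power_mult_distrib sums_iff)
  qed
  have "bounded (szego w ` ball 0 1)"
  proof (rule boundedI)
    fix y assume "y \<in> szego w ` ball 0 1"
    then obtain z where z: "z \<in> ball 0 1" "y = szego w z" by blast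
    have "norm (cnj w * z) \<le> norm w" using z by (auto simp: norm_mult intro: mult_left_le)
    then have "1 - norm w \<le> norm (1 - cnj w * z)"
      using norm_triangle_ineq2[of 1 "cnj w * z"] by simp
    then show "norm y \<le> 1 / (1 - norm w)" using z w1 eq[OF z(1)] by (simp add: norm_divide divide_left_mono frac_le)
  qed
  then show "szego w \<in> Hinf" using pser_disc_holomorphic[OF l] by (simp add: Hinf_def szego_def)
qed

lemma H2_eval:
  assumes f: "f \<in> car H2" and w: "w \<in> ball 0 1"
  shows "f w = lip (bv f) (bv (szego w))"
proof -
  have "(\<lambda>n. tc f n * cnj (tc (szego w) n)) sums lip (bv f) (bv (szego w))"
    by (rule lip_bv_bv[OF f Hinf_H2[OF szego(1)[OF w]]])
  then show ?thesis using H2_sums[OF f w] by (simp add: szego(2)[OF w] sums_iff)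
qed

text \<open>Applying the reproducing property to the product of \<open>f\<close> with the reproducing kernel \<open>k\<close> at
  \<open>w\<close> bounds \<open>\<bar>k w * f w\<bar>\<close> by \<open>M * k w\<close>, because \<open>k w\<close>
  is the squared norm of \<open>k\<close>.\<close>

lemma H2_boundary_bound:
  assumes f: "f \<in> car H2" and M: "AE y in mT. cmod (bv f y) \<le> M" and w: "w \<in> ball 0 1"
  shows "cmod (f w) \<le> M"
proof -
  define k where "k = szego w"
  have kH: "k \<in> car H2" "k \<in> Hinf" using szego(1)[OF w] Hinf_H2 by (auto simp: k_def)
  have M0: "M \<ge> 0"
  proof -
    have "AE y in mT. 0 \<le> M" using M by eventually_elim (rule order_trans[OF norm_ge_zero])
    then show ?thesis by (simp add: AE_mT_const)
  qed
  have kf: "k * f \<in> car H2" by (rule Hinf_mult[OF kH(2) f])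
  have kw: "k w = of_real (lnorm2 (bv k))" using H2_eval[OF kH(1) w] by (simp add: k_def lip_self)
  have pos: "lnorm2 (bv k) > 0"
  proof -
    have "k w = 1 / (1 - cnj w * w)" using szego(3)[OF w w] by (simp add: k_def)
    moreover have "cnj w * w \<noteq> 1"
    proof
      assume "cnj w * w = 1"
      then have "norm (cnj w * w) = 1" by simp
      then have "norm w * norm w = 1" by (simp add: norm_mult)
      then show False using w mult_strict_mono[of "norm w" 1 "norm w" 1] by auto
    qed
    ultimately have "lnorm2 (bv k) \<noteq> 0" using kw by auto
    then show ?thesis using lnorm2_nonneg[of "bv k"] by linarith
  qed
  have ae: "AE y in mT. bv (k * f) y = bv f y * bv k y"
    using has_bv_imp[OF has_bv_mult[OF H2_E(4)[OF kH(1)] H2_E(4)[OF f]]] by eventually_elim (simp add: mult.commute)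
  have L: "L2 (\<lambda>y. bv f y * bv k y)" and Ln: "lnorm2 (\<lambda>y. bv f y * bv k y) \<le> M\<^sup>2 * lnorm2 (bv k)"
    using L2_bounded_mult[OF H2_E(3)[OF kH(1)] H2_measurable[OF f] M] by auto
  have "(cmod ((k * f) w))\<^sup>2 \<le> lnorm2 (bv (k * f)) * lnorm2 (bv k)"
    unfolding H2_eval[OF kf w] k_def[symmetric] by (intro lip_bound H2_E kf kH)
  also have "lnorm2 (bv (k * f)) = lnorm2 (\<lambda>y. bv f y * bv k y)" by (rule L2_cong_AE[OF L ae])
  also have "\<dots> * lnorm2 (bv k) \<le> (M\<^sup>2 * lnorm2 (bv k)) * lnorm2 (bv k)"
    using Ln by (intro mult_right_mono) auto
  finally have "(cmod (f w) * lnorm2 (bv k))\<^sup>2 \<le> (M * lnorm2 (bv k))\<^sup>2"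
    by (simp add: kw norm_mult power2_eq_square mult_ac)
  then have "cmod (f w) * lnorm2 (bv k) \<le> M * lnorm2 (bv k)"
    by (rule power2_le_imp_le) (use M0 in auto)
  then show ?thesis using pos by simp
qed

lemma Hinf_of_boundary:
  assumes "f \<in> car H2" "AE y in mT. cmod (bv f y) \<le> M"
  shows "f \<in> Hinf"
  using H2_E(5)[OF assms(1)] by (auto simp: Hinf_def intro!: boundedI[where B = M] H2_boundary_bound[OF assms])

subsection \<open>Completeness of the trigonometric system\<close>

text \<open>Real trigonometric polynomials. On the circle, a conjugated power has modulus \<open>1\<close>, so that the modulus of
  such a function is that of an analytic polynomial.\<close>

definition trig_real :: "(complex \<Rightarrow> real) \<Rightarrow> bool" where
  "trig_real f \<longleftrightarrow> (\<exists>N (p :: complex poly). \<forall>y\<in>sphere 0 1. of_real (f y) = cnj y ^ N * poly p y)"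

lemma sphere_cnj: "y \<in> sphere 0 1 \<Longrightarrow> cnj y * y = 1" "y \<in> sphere 0 1 \<Longrightarrow> y * cnj y = 1"
  by (auto simp: complex_norm_square[symmetric] mult.commute)

lemma sphere_cnj_power: "y \<in> sphere 0 1 \<Longrightarrow> cnj y ^ n * y ^ n = 1"
  by (simp add: power_mult_distrib[symmetric] sphere_cnj)

text \<open>The theorem of Stone and Weierstrass; real and imaginary part separate the points of the circle.\<close>

lemma trig_real_approx:
  assumes "continuous_on (sphere 0 1) g" "e > 0"
  obtains f where "trig_real f" "continuous_on (sphere 0 1) f" "\<And>y. y \<in> sphere 0 1 \<Longrightarrow> \<bar>g y - f y\<bar> < e"
proof -
  have "\<exists>f. (trig_real f \<and> continuous_on (sphere 0 1) f) \<and> (\<forall>y\<in>sphere 0 1. \<bar>g y - f y\<bar> < e)"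
  proof (rule Stone_Weierstrass_HOL[where S = "sphere (0::complex) 1" and f = g and e = e])
    fix c :: real
    show "trig_real (\<lambda>x. c) \<and> continuous_on (sphere 0 1) (\<lambda>x::complex. c)"
      unfolding trig_real_def by (auto intro!: exI[of _ 0] exI[of _ "[:of_real c:]"])
  next
    fix f g assume "(trig_real f \<and> continuous_on (sphere 0 1) f) \<and> (trig_real g \<and> continuous_on (sphere 0 1) g)"
    moreover then obtain N p M q where 
      1: "\<forall>y\<in>sphere 0 1. of_real (f y) = cnj y ^ N * poly p y" "\<forall>y\<in>sphere 0 1. of_real (g y) = cnj y ^ M * poly q y"
      unfolding trig_real_def by blast
    have "of_real (f y + g y) = cnj y ^ (N + M) * poly (p * monom 1 M + q * monom 1 N) y"
      "of_real (f y * g y) = cnj y ^ (N + M) * poly (p * q) y" if "y \<in> sphere 0 1" for y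
    proof -
      have "cnj y ^ (N + M) * poly (p * monom 1 M + q * monom 1 N) y = 
        cnj y ^ N * poly p y * (cnj y ^ M * y ^ M) + cnj y ^ M * poly q y * (cnj y ^ N * y ^ N)"
        by (simp add: poly_monom power_add algebra_simps)
      also have "\<dots> = of_real (f y + g y)" using 1 that by (simp add: sphere_cnj_power)
      finally show "of_real (f y + g y) = cnj y ^ (N + M) * poly (p * monom 1 M + q * monom 1 N) y" by simp
      show "of_real (f y * g y) = cnj y ^ (N + M) * poly (p * q) y"
        using 1 that by (simp add: power_add mult_ac)
    qed
    ultimately show "trig_real (\<lambda>x. f x + g x) \<and> continuous_on (sphere 0 1) (\<lambda>x. f x + g x)"
      "trig_real (\<lambda>x. f x * g x) \<and> continuous_on (sphere 0 1) (\<lambda>x. f x * g x)"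
      unfolding trig_real_def by (blast intro: continuous_on_add continuous_on_mult)+
  next
    fix x x' :: complex assume xy: "x \<in> sphere 0 1 \<and> x' \<in> sphere 0 1 \<and> x \<noteq> x'"
    have "trig_real Re" unfolding trig_real_def
    proof (intro exI ballI)
      fix y :: complex assume z: "y \<in> sphere 0 1"
      show "complex_of_real (Re y) = cnj y ^ 1 * poly [:1/2, 0, 1/2:] y"
        using sphere_cnj[OF z] complex_add_cnj[of y] by (simp add: algebra_simps) (simp add: field_simps)
    qed
    moreover have "trig_real Im" unfolding trig_real_def
    proof (intro exI ballI)
      fix y :: complex assume z: "y \<in> sphere 0 1"
      show "complex_of_real (Im y) = cnj y ^ 1 * poly [:\<i>/2, 0, -\<i>/2:] y"
      proof -
        have "cnj y ^ 1 * poly [:\<i>/2, 0, -\<i>/2:] y = \<i>/2 * (cnj y - (cnj y * y) * y)" by (simp add: algebra_simps)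
        also have "\<dots> = complex_of_real (Im y)" unfolding sphere_cnj[OF z] by (simp add: complex_eq_iff)
        finally show ?thesis ..
      qed
    qed
    ultimately show "\<exists>f. (trig_real f \<and> continuous_on (sphere 0 1) f) \<and> f x \<noteq> f x'"
      using xy complex_eqI[of x x'] continuous_on_Re[OF continuous_on_id] continuous_on_Im[OF continuous_on_id] by metis
  qed (use assms in auto)
  then show ?thesis using that by blast
qed

text \<open>A continuous function is uniformly close to a real trigonometric polynomial, whose square is the squared modulus of an
  analytic polynomial.\<close>

lemma integral_nonneg_of_polynomials:
  fixes s :: "complex \<Rightarrow> real"
  assumes s: "integrable mT s" and pos: "\<And>a N. (\<integral>y. s y * (cmod (psum a N y))\<^sup>2 \<partial>mT) \<ge> 0"
    and g: "continuous_on (sphere 0 1) g"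
  shows "(\<integral>y. s y * (g y)\<^sup>2 \<partial>mT) \<ge> 0"
proof -
  have intc: "integrable mT (\<lambda>y. s y * h y)" if h: "continuous_on (sphere 0 1) h" for h :: "complex \<Rightarrow> real"
  proof -
    have "compact (h ` sphere 0 1)" by (intro compact_continuous_image h) auto
    then have "bounded (h ` sphere 0 1)" by (rule compact_imp_bounded)
    then have "\<exists>B. \<forall>y\<in>sphere 0 1. \<bar>h y\<bar> \<le> B" by (simp add: bounded_iff)
    then obtain B where B: "\<And>y. y \<in> sphere 0 1 \<Longrightarrow> \<bar>h y\<bar> \<le> B" by blast
    show ?thesis
    proof (rule Bochner_Integration.integrable_bound)
      show "integrable mT (\<lambda>y. B * s y)" using s by simp
      show "AE y in mT. norm (s y * h y) \<le> norm (B * s y)"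
      proof (rule AE_I2)
        fix y assume "y \<in> space mT"
        then have "\<bar>h y\<bar> \<le> \<bar>B\<bar>" using B[of y] by auto
        then show "norm (s y * h y) \<le> norm (B * s y)"
          using mult_left_mono[of "\<bar>h y\<bar>" "\<bar>B\<bar>" "\<bar>s y\<bar>"] by (simp add: abs_mult mult.commute)
      qed
    qed (use s borel_measurable_mT_continuous(2)[OF h] in auto)
  qed
  have "compact (g ` sphere 0 1)" by (intro compact_continuous_image g) auto
  then have "bounded (g ` sphere 0 1)" by (rule compact_imp_bounded)
  then have "\<exists>B. \<forall>y\<in>sphere 0 1. \<bar>g y\<bar> \<le> B" by (simp add: bounded_iff)
  then obtain B where B: "\<And>y. y \<in> sphere 0 1 \<Longrightarrow> \<bar>g y\<bar> \<le> B" by blast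
  have B0: "B \<ge> 0" using B[of 1] by simp
  define I where "I = (\<integral>y. \<bar>s y\<bar> \<partial>mT)"
  have est: "- (e * (2 * B + e) * I) \<le> (\<integral>y. s y * (g y)\<^sup>2 \<partial>mT)" if e: "e > 0" for e
  proof -
    obtain f where f: "trig_real f" "continuous_on (sphere 0 1) f" "\<And>y. y \<in> sphere 0 1 \<Longrightarrow> \<bar>g y - f y\<bar> < e"
      using trig_real_approx[OF g e] by blast
    obtain N p where p: "\<And>y. y \<in> sphere 0 1 \<Longrightarrow> of_real (f y) = cnj y ^ N * poly p y"
      using f(1) unfolding trig_real_def by blast
    have "(\<integral>y. s y * (f y)\<^sup>2 \<partial>mT) = (\<integral>y. s y * (cmod (psum (coeff p) (Suc (degree p)) y))\<^sup>2 \<partial>mT)"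
    proof (rule Bochner_Integration.integral_cong[OF refl])
      fix y assume "y \<in> space mT"
      then have z: "y \<in> sphere 0 1" by simp
      have "\<bar>f y\<bar> = cmod (of_real (f y))" by simp
      also have "\<dots> = cmod (poly p y)" unfolding p[OF z] using z by (simp add: norm_mult norm_power)
      also have "poly p y = psum (coeff p) (Suc (degree p)) y" by (simp add: psum_def poly_altdef lessThan_Suc_atMost)
      finally show "s y * (f y)\<^sup>2 = s y * (cmod (psum (coeff p) (Suc (degree p)) y))\<^sup>2"
        by (metis power2_abs)
    qed
    then have f0: "(\<integral>y. s y * (f y)\<^sup>2 \<partial>mT) \<ge> 0" using pos by simp
    have ig: "integrable mT (\<lambda>y. s y * (g y)\<^sup>2)" "integrable mT (\<lambda>y. s y * (f y)\<^sup>2)"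
      by (intro intc continuous_intros g f)+
    have "(\<integral>y. s y * (f y)\<^sup>2 \<partial>mT) - (\<integral>y. s y * (g y)\<^sup>2 \<partial>mT) = (\<integral>y. s y * (f y)\<^sup>2 - s y * (g y)\<^sup>2 \<partial>mT)"
      using ig by simp
    also have "\<dots> \<le> (\<integral>y. e * (2 * B + e) * \<bar>s y\<bar> \<partial>mT)"
    proof (rule integral_mono)
      fix y assume "y \<in> space mT"
      then have z: "y \<in> sphere 0 1" by simp
      have "\<bar>(f y)\<^sup>2 - (g y)\<^sup>2\<bar> = \<bar>f y - g y\<bar> * \<bar>f y + g y\<bar>"
        by (simp add: power2_eq_square abs_mult[symmetric] algebra_simps)
      also have "\<dots> \<le> e * (2 * B + e)" using f(3)[OF z] B[OF z] e by (intro mult_mono) auto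
      finally have "\<bar>s y\<bar> * \<bar>(f y)\<^sup>2 - (g y)\<^sup>2\<bar> \<le> \<bar>s y\<bar> * (e * (2 * B + e))" by (intro mult_left_mono) auto
      moreover have "s y * (f y)\<^sup>2 - s y * (g y)\<^sup>2 \<le> \<bar>s y\<bar> * \<bar>(f y)\<^sup>2 - (g y)\<^sup>2\<bar>"
        by (simp add: abs_mult[symmetric] right_diff_distrib)
      ultimately show "s y * (f y)\<^sup>2 - s y * (g y)\<^sup>2 \<le> e * (2 * B + e) * \<bar>s y\<bar>" by (simp add: mult.commute)
    qed (use ig s in auto)
    also have "\<dots> = e * (2 * B + e) * I" by (simp add: I_def)
    finally show ?thesis using f0 by simp
  qed
  show ?thesis
  proof (rule tendsto_le[of "at_right (0::real)"])
    show "((\<lambda>e. - (e * (2 * B + e) * I)) \<longlongrightarrow> 0) (at_right 0)"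
      by (rule tendsto_eq_intros refl | simp)+
    show "\<forall>\<^sub>F e in at_right 0. - (e * (2 * B + e) * I) \<le> (\<integral>y. s y * (g y)\<^sup>2 \<partial>mT)"
      using eventually_at_right_less[of 0] by eventually_elim (rule est)
  qed auto
qed

text \<open>If the density were negative on a set of positive measure, it would be so on a compact set \<open>K\<close>, whose
  indicator is a decreasing limit of continuous functions.\<close>

lemma AE_nonneg_of_polynomials:
  fixes s :: "complex \<Rightarrow> real"
  assumes s: "integrable mT s" and pos: "\<And>a N. (\<integral>y. s y * (cmod (psum a N y))\<^sup>2 \<partial>mT) \<ge> 0"
  shows "AE y in mT. s y \<ge> 0"
proof (rule ccontr)
  assume neg: "\<not> ?thesis"
  note [measurable] = borel_measurable_integrable[OF s]
  define A where "A = {y\<in>space mT. s y < 0}"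
  have A: "A \<in> sets mT" unfolding A_def by measurable
  have "measure mT A \<noteq> 0"
  proof
    assume "measure mT A = 0"
    then have "A \<in> null_sets mT" using A mT.emeasure_eq_measure[of A] by (auto simp: null_sets_def)
    then have "AE y in mT. y \<notin> A" by (rule AE_not_in)
    then have "AE y in mT. s y \<ge> 0" using AE_space by eventually_elim (auto simp: A_def)
    then show False using neg by blast
  qed
  then have "measure mT A > 0" using measure_nonneg[of mT A] by linarith
  then obtain K where K: "compact K" "K \<subseteq> A" "K \<in> sets mT" "measure mT K > 0" using mT_compact_subset[OF A] by blast
  have Kne: "K \<noteq> {}" using K(4) by auto
  define g where "g n y = max 0 (1 - real n * infdist y K)" for n y
  have gc: "continuous_on (sphere 0 1) (g n)" for n unfolding g_def by (intro continuous_intros)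
  have lim: "(\<lambda>n. g n y) \<longlonglongrightarrow> indicat_real K y" for y
  proof (cases "y \<in> K")
    case True
    then show ?thesis by (simp add: g_def)
  next
    case False
    then have d: "infdist y K > 0" using K(1) Kne in_closed_iff_infdist_zero[of K y] compact_imp_closed infdist_nonneg[of y K] by force
    obtain n0 where n0: "1 / infdist y K < real n0" using reals_Archimedean2 by blast
    have "eventually (\<lambda>n. g n y = 0) sequentially"
      using eventually_ge_at_top[of n0]
    proof eventually_elim
      case (elim n)
      then have "1 / infdist y K \<le> real n" using n0 by linarith
      then have "1 \<le> real n * infdist y K" using d by (simp add: divide_le_eq)
      then show ?case by (simp add: g_def)
    qed
    then show ?thesis using False by (simp add: tendsto_eventually)
  qed
  have g01: "0 \<le> g n y" "g n y \<le> 1" for n y using infdist_nonneg[of y K] by (auto simp: g_def)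
  have l1: "(\<lambda>n. \<integral>y. s y * (g n y)\<^sup>2 \<partial>mT) \<longlonglongrightarrow> (\<integral>y. s y * (indicat_real K y)\<^sup>2 \<partial>mT)"
  proof (rule integral_dominated_convergence[where w = "\<lambda>y. \<bar>s y\<bar>"])
    show "(\<lambda>y. s y * (indicat_real K y)\<^sup>2) \<in> borel_measurable mT" using K(3) by measurable
    show "(\<lambda>y. s y * (g n y)\<^sup>2) \<in> borel_measurable mT" for n 
      using borel_measurable_mT_continuous(2)[OF gc[of n]] by measurable
    show "AE y in mT. (\<lambda>n. s y * (g n y)\<^sup>2) \<longlonglongrightarrow> s y * (indicat_real K y)\<^sup>2"
      by (intro AE_I2 tendsto_intros lim)
    show "AE y in mT. norm (s y * (g n y)\<^sup>2) \<le> \<bar>s y\<bar>" for n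
      using g01[of n] by (auto simp: abs_mult power_le_one intro!: AE_I2 mult_left_le)
  qed (use s in auto)
  have l2: "(\<integral>y. s y * (g n y)\<^sup>2 \<partial>mT) \<ge> 0" for n
    by (rule integral_nonneg_of_polynomials[OF s pos gc])
  have ge: "(\<integral>y. s y * (indicat_real K y)\<^sup>2 \<partial>mT) \<ge> 0" by (rule LIMSEQ_le_const[OF l1]) (use l2 in blast)
  have i: "integrable mT (\<lambda>y. - (s y * (indicat_real K y)\<^sup>2))"
    by (rule Bochner_Integration.integrable_bound[OF s]) (use K(3) in \<open>auto split: split_indicator\<close>)
  have nn: "AE y in mT. 0 \<le> - (s y * (indicat_real K y)\<^sup>2)"
    using K(2) by (auto simp: A_def split: split_indicator intro!: AE_I2)
  have "(\<integral>y. - (s y * (indicat_real K y)\<^sup>2) \<partial>mT) = 0"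
    using ge integral_nonneg_AE[OF nn] by simp
  then have "AE y in mT. - (s y * (indicat_real K y)\<^sup>2) = 0"
    using integral_nonneg_eq_0_iff_AE[OF i nn] by blast
  then have "AE y in mT. y \<notin> K"
    by eventually_elim (use K(2) in \<open>auto simp: A_def split: split_indicator_asm\<close>)
  then have "K \<in> null_sets mT" using K(3) sets.sets_into_space[OF K(3)] by (subst (asm) AE_iff_null_sets[symmetric]) auto
  then show False using K(4) by (simp add: measure_def null_sets_def)
qed

lemma lip_power_shift:
  "y \<in> sphere 0 1 \<Longrightarrow> n \<le> m \<Longrightarrow> y ^ n * cnj y ^ m = cnj y ^ (m - n)"
  "y \<in> sphere 0 1 \<Longrightarrow> m \<le> n \<Longrightarrow> y ^ n * cnj y ^ m = y ^ (n - m)"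
proof -
  assume z: "y \<in> sphere 0 1"
  { assume "n \<le> m" 
    then have "cnj y ^ m = cnj y ^ n * cnj y ^ (m - n)" by (simp add: power_add[symmetric])
    then show "y ^ n * cnj y ^ m = cnj y ^ (m - n)" using sphere_cnj_power[OF z, of n] by (simp add: mult_ac) }
  { assume "m \<le> n" 
    then have "y ^ n = y ^ m * y ^ (n - m)" by (simp add: power_add[symmetric])
    then show "y ^ n * cnj y ^ m = y ^ (n - m)" using sphere_cnj_power[OF z, of m] by (simp add: mult_ac) }
qed

lemma L2_integrable: "L2 h \<Longrightarrow> integrable mT h"
  using L2_integrable_lip[of h "\<lambda>_. 1"] by simp

text \<open>The squared modulus of a polynomial is a combination of products of a power and a conjugated power, so that its
  integrals are determined by Fourier coefficients.\<close>

lemma psum_sq_expand: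
  "complex_of_real ((cmod (psum a N y))\<^sup>2) = (\<Sum>i<N. \<Sum>j<N. a i * cnj (a j) * (y ^ i * cnj y ^ j))"
  unfolding complex_norm_square psum_def cnj_sum sum_product by (simp add: mult_ac)

lemma integrable_mult_powers:
  assumes "integrable mT h"
  shows "integrable mT (\<lambda>y. h y * (y ^ i * cnj y ^ j))"
proof (rule Bochner_Integration.integrable_bound[OF assms])
  have "(\<lambda>y. y ^ i * cnj y ^ j) \<in> borel_measurable mT"
    by (intro borel_measurable_mT_continuous continuous_intros)
  then show "(\<lambda>y. h y * (y ^ i * cnj y ^ j)) \<in> borel_measurable mT" using assms by measurable
  show "AE y in mT. norm (h y * (y ^ i * cnj y ^ j)) \<le> norm (h y)"
    by (rule AE_I2) (auto simp: norm_mult norm_power)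
qed

lemma integral_psum_sq:
  assumes "integrable mT h"
  shows "(\<integral>y. h y * complex_of_real ((cmod (psum a N y))\<^sup>2) \<partial>mT) =
     (\<Sum>i<N. \<Sum>j<N. a i * cnj (a j) * (\<integral>y. h y * (y ^ i * cnj y ^ j) \<partial>mT))"
proof -
  have "(\<integral>y. h y * complex_of_real ((cmod (psum a N y))\<^sup>2) \<partial>mT) =
     (\<integral>y. (\<Sum>i<N. \<Sum>j<N. a i * cnj (a j) * (h y * (y ^ i * cnj y ^ j))) \<partial>mT)"
    unfolding psum_sq_expand by (simp add: sum_distrib_left mult_ac)
  also have "\<dots> = (\<Sum>i<N. \<Sum>j<N. a i * cnj (a j) * (\<integral>y. h y * (y ^ i * cnj y ^ j) \<partial>mT))"
    using integrable_mult_powers[OF assms] by (simp add: Bochner_Integration.integral_sum)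
  finally show ?thesis .
qed

lemma lip_as_powers: 
  assumes "L2 h" 
  shows "(\<integral>y. h y * (y ^ i * cnj y ^ j) \<partial>mT) = (if i \<le> j then lip h (\<lambda>y. y ^ (j - i)) else lip h (\<lambda>y. cnj y ^ (i - j)))"
  unfolding lip_def by (auto intro!: Bochner_Integration.integral_cong simp: lip_power_shift)

text \<open>If all Fourier coefficients vanish, the real and the imaginary part of the function and of its negative are
  nonnegative against all squared moduli of polynomials.\<close>

lemma fourier_uniqueness:
  assumes h: "L2 h" and 1: "\<And>n. lip h (\<lambda>y. y ^ n) = 0" and 2: "\<And>n. lip h (\<lambda>y. cnj y ^ Suc n) = 0"
  shows "AE y in mT. h y = 0"
proof -
  have ih: "integrable mT h" by (rule L2_integrable[OF h])
  have z: "(\<integral>y. h y * complex_of_real ((cmod (psum a N y))\<^sup>2) \<partial>mT) = 0" for a N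
  proof -
    have "(if i \<le> j then lip h (\<lambda>y. y ^ (j - i)) else lip h (\<lambda>y. cnj y ^ (i - j))) = 0" for i j :: nat
    proof (cases "i \<le> j")
      case False
      then have "i - j = Suc (i - Suc j)" by simp
      then show ?thesis using False 2[of "i - Suc j"] by (simp del: power_Suc)
    qed (use 1 in simp)
    then show ?thesis unfolding integral_psum_sq[OF ih] lip_as_powers[OF h] by simp
  qed
  have iz: "integrable mT (\<lambda>y. h y * complex_of_real ((cmod (psum a N y))\<^sup>2))" for a N
    unfolding psum_sq_expand sum_distrib_left
    using integrable_mult_powers[OF ih] by (simp add: mult.left_commute[of _ "_ * _" "_ * _ "]) 
  have R: "(\<integral>y. Re (h y) * (cmod (psum a N y))\<^sup>2 \<partial>mT) = 0" and I: "(\<integral>y. Im (h y) * (cmod (psum a N y))\<^sup>2 \<partial>mT) = 0" for a N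
    using integral_Re[OF iz[of a N]] integral_Im[OF iz[of a N]] z[of a N] by simp_all
  have i: "integrable mT (\<lambda>y. Re (h y))" "integrable mT (\<lambda>y. Im (h y))" using ih by auto
  have "AE y in mT. 0 \<le> Re (h y)" "AE y in mT. 0 \<le> - Re (h y)" "AE y in mT. 0 \<le> Im (h y)" "AE y in mT. 0 \<le> - Im (h y)"
    by (rule AE_nonneg_of_polynomials; use i R I in simp)+
  then show ?thesis by eventually_elim (simp add: complex_eq_iff)
qed

text \<open>Bessel's inequality, from the Cauchy--Schwarz inequality with a partial sum of the Fourier series.\<close>

lemma l2_fourier:
  assumes h: "L2 h"
  shows "l2 (\<lambda>n. lip h (\<lambda>y. y ^ n))" "(\<Sum>n. (cmod (lip h (\<lambda>y. y ^ n)))\<^sup>2) \<le> lnorm2 h"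
proof -
  define a where "a n = lip h (\<lambda>y. y ^ n)" for n
  have part: "(\<Sum>n<N. (cmod (a n))\<^sup>2) \<le> lnorm2 h" for N
  proof -
    define s where "s = (\<Sum>n<N. (cmod (a n))\<^sup>2)"
    have s0: "s \<ge> 0" unfolding s_def by (simp add: sum_nonneg)
    have "lip h (psum a N) = of_real s"
      unfolding lip_psum_right[OF h] s_def a_def[symmetric] of_real_sum complex_norm_square ..
    then have "s\<^sup>2 \<le> lnorm2 h * s"
      using lip_bound[OF h L2_psum, of a N] s0 by (simp add: lnorm2_psum s_def[symmetric])
    then have "s * s \<le> lnorm2 h * s" by (simp add: power2_eq_square)
    then have "s \<le> lnorm2 h" using s0 by (cases "s = 0") auto
    then show ?thesis by (simp add: s_def)
  qed
  have "summable (\<lambda>n. (cmod (a n))\<^sup>2)"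
  proof (rule bounded_imp_summable)
    show "(\<Sum>n\<le>N. (cmod (a n))\<^sup>2) \<le> lnorm2 h" for N using part[of "Suc N"] by (simp add: lessThan_Suc_atMost)
  qed simp
  then show "l2 (\<lambda>n. lip h (\<lambda>y. y ^ n))" by (simp add: l2_def a_def)
  have "(\<Sum>n. (cmod (a n))\<^sup>2) \<le> lnorm2 h"
    by (rule suminf_le_const[OF \<open>summable _\<close> part])
  then show "(\<Sum>n. (cmod (lip h (\<lambda>y. y ^ n)))\<^sup>2) \<le> lnorm2 h" by (simp add: a_def)
qed

text \<open>The Riesz projection: the power series whose coefficients are the Fourier coefficients of nonnegative index.\<close>

definition rproj :: "(complex \<Rightarrow> complex) \<Rightarrow> complex \<Rightarrow> complex" where
  "rproj h = pser (\<lambda>n. lip h (\<lambda>y. y ^ n))"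

lemma rproj_H2: "L2 h \<Longrightarrow> rproj h \<in> car H2"
  unfolding rproj_def by (intro H2_pser l2_fourier)

lemma tc_rproj: "L2 h \<Longrightarrow> tc (rproj h) n = lip h (\<lambda>y. y ^ n)"
  unfolding rproj_def by (simp add: tc_pser l2_fourier)

lemma rproj_norm: "L2 h \<Longrightarrow> lnorm2 (bv (rproj h)) \<le> lnorm2 h"
  using l2_fourier(2)[of h] by (simp add: lnorm2_bv rproj_H2 tc_rproj)

lemma lip_rproj:
  assumes h: "L2 h" and g: "g \<in> car H2"
  shows "lip h (bv g) = lip (bv (rproj h)) (bv g)"
proof -
  have "(\<lambda>M. lip (psum (tc g) M) h) \<longlonglongrightarrow> lip (bv g) h"
    using lip_bv_psum_tendsto[OF H2_E(1)[OF g] h] by (simp add: H2_E[OF g])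
  moreover have "(\<lambda>M. lip (psum (tc g) M) (bv (rproj h))) \<longlonglongrightarrow> lip (bv g) (bv (rproj h))"
    using lip_bv_psum_tendsto[OF H2_E(1)[OF g] H2_E(3)[OF rproj_H2[OF h]]] by (simp add: H2_E[OF g])
  moreover have "lip (psum (tc g) M) h = lip (psum (tc g) M) (bv (rproj h))" for M
  proof -
    have "lip h (psum (tc g) M) = lip (bv (rproj h)) (psum (tc g) M)"
      by (simp add: lip_psum_right h H2_E rproj_H2 tc_def[symmetric] tc_rproj)
    then show ?thesis by (metis lip_cnj)
  qed
  ultimately have "lip (bv g) h = lip (bv g) (bv (rproj h))" using LIMSEQ_unique by simp
  then show ?thesis by (metis lip_cnj)
qed

lemma rproj_unique:
  assumes h: "L2 h" and f: "f \<in> car H2" and orth: "\<And>n. lip h (\<lambda>y. y ^ n) = tc f n"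
  shows "rproj h = f"
  using orth H2_E(2)[OF f] by (simp add: rproj_def)

definition mono_disc :: "nat \<Rightarrow> complex \<Rightarrow> complex" where
  "mono_disc n = on_disc (\<lambda>z. z ^ n)"

lemma pser_finite:
  assumes "\<And>n. n \<ge> N \<Longrightarrow> a n = 0"
  shows "pser a = on_disc (psum a N)" "l2 a"
proof -
  show "pser a = on_disc (psum a N)"
    unfolding pser_def psum_def on_disc_def
    by (intro ext if_cong refl suminf_finite) (use assms in \<open>auto simp: not_less\<close>)
  show "l2 a" unfolding l2_def by (rule summable_finite[of "{..<N}"]) (use assms in \<open>auto simp: not_less\<close>)
qed

lemma poly_disc_H2: "on_disc (psum a N) \<in> car H2"
  and bv_poly_disc: "y \<in> sphere 0 1 \<Longrightarrow> bv (on_disc (psum a N)) y = psum a N y"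
proof -
  define b where "b n = (if n < N then a n else 0)" for n
  have "psum a N = psum b N" by (rule ext) (simp add: psum_def b_def)
  then have "on_disc (psum a N) = on_disc (psum b N)" by simp
  then show "on_disc (psum a N) \<in> car H2"
    using pser_finite[of N b] H2_pser[of b] by (simp add: b_def)
  assume z: "y \<in> sphere 0 1"
  show "bv (on_disc (psum a N)) y = psum a N y"
  proof (rule bvI[OF _ z])
    have "isCont (psum a N) y" unfolding psum_def by (intro continuous_intros)
    have "(psum a N \<longlongrightarrow> psum a N y) (nontangential y)"
    proof (rule tendstoI)
      fix e :: real assume "e > 0"
      from tendstoD[OF \<open>isCont (psum a N) y\<close>[unfolded isCont_def] this]
      show "\<forall>\<^sub>F x in nontangential y. dist (psum a N x) (psum a N y) < e"
        unfolding eventually_nontangential by (auto simp: eventually_at_filter elim: eventually_mono)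
    qed
    then show "(on_disc (psum a N) \<longlongrightarrow> psum a N y) (nontangential y)"
      by (rule Lim_transform_eventually) (rule eventually_mono[OF nontangential_disc], simp add: on_disc_def)
  qed
qed

lemma mono_disc_psum: "mono_disc n = on_disc (psum (\<lambda>k. if k = n then 1 else 0) (Suc n))"
proof -
  have "psum (\<lambda>k. if k = n then 1 else 0) (Suc n) z = (\<Sum>k<Suc n. if k = n then z ^ k else 0)" for z
    unfolding psum_def by (intro sum.cong) auto
  then have "psum (\<lambda>k. if k = n then 1 else 0) (Suc n) = (\<lambda>z. z ^ n)" by (intro ext) simp
  then show ?thesis by (simp only: mono_disc_def)
qed

lemma mono_disc_H2 [simp]: "mono_disc n \<in> car H2"
  unfolding mono_disc_psum by (rule poly_disc_H2)

lemma bv_mono_disc: "y \<in> sphere 0 1 \<Longrightarrow> bv (mono_disc n) y = y ^ n"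
  unfolding mono_disc_psum bv_poly_disc by (simp add: psum_def)

lemma lip_mono_disc: "L2 h \<Longrightarrow> lip h (bv (mono_disc n)) = lip h (\<lambda>y. y ^ n)"
  unfolding lip_def by (rule Bochner_Integration.integral_cong) (auto simp: bv_mono_disc)

lemma proj_H2_eq:
  assumes h: "L2 h"
  shows "proj_H2 h = rproj h"
  unfolding proj_H2_def
proof (rule the_equality)
  have eq: "(\<integral>y. (h y - bv f y) * cnj (bv g y) \<partial>mT) = lip h (bv g) - lip (bv f) (bv g)" if "f \<in> car H2" "g \<in> car H2" for f g
    using lip_diff_left[OF h H2_E(3)[OF that(1)] H2_E(3)[OF that(2)]] by (simp add: lip_def)
  show "rproj h \<in> car H2 \<and> (\<forall>g\<in>car H2. (\<integral>y. (h y - bv (rproj h) y) * cnj (bv g y) \<partial>mT) = 0)"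
    using h by (auto simp: rproj_H2 eq lip_rproj[symmetric])
  fix f assume f: "f \<in> car H2 \<and> (\<forall>g\<in>car H2. (\<integral>y. (h y - bv f y) * cnj (bv g y) \<partial>mT) = 0)"
  then have fH: "f \<in> car H2" by simp
  have "lip h (\<lambda>y. y ^ n) = tc f n" for n
  proof -
    have "lip h (bv (mono_disc n)) = lip (bv f) (bv (mono_disc n))"
      using f eq[OF fH mono_disc_H2] by auto
    then show ?thesis using h H2_E(3)[OF fH] by (simp add: lip_mono_disc tc_def)
  qed
  then show "f = rproj h" using rproj_unique[OF h fH] by simp
qed

text \<open>Both sides have the same Fourier coefficients; the constant term is counted twice by the two projections.\<close>

theorem riesz_decomposition:
  assumes h: "L2 h"
  shows "AE y in mT. h y = bv (rproj h) y + cnj (bv (rproj (\<lambda>y. cnj (h y))) y) - lip h (\<lambda>_. 1)"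
proof -
  define f where "f = rproj h"
  define g where "g = rproj (\<lambda>y. cnj (h y))"
  define c where "c = lip h (\<lambda>_. 1)"
  have hc: "L2 (\<lambda>y. cnj (h y))" using h by simp
  have fg: "f \<in> car H2" "g \<in> car H2" unfolding f_def g_def by (intro rproj_H2 h hc)+
  define k where "k y = h y - (bv f y + cnj (bv g y) - c)" for y
  have k1: "L2 (\<lambda>y. bv f y + cnj (bv g y))" by (intro L2_add L2_cnj H2_E fg)
  have k2: "L2 (\<lambda>y. bv f y + cnj (bv g y) - c)" by (intro L2_minus k1) simp
  have k: "L2 k" unfolding k_def by (intro L2_minus h k2)
  have lipk: "lip k q = lip h q - (lip (bv f) q + lip (\<lambda>y. cnj (bv g y)) q - lip (\<lambda>_. c) q)" if q: "L2 q" for q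
    unfolding k_def
    by (subst lip_diff_left[OF h k2 q], subst lip_diff_left[OF k1 _ q], simp, subst lip_add_left)
       (auto intro!: L2_cnj H2_E fg q)
  have cc: "lip (\<lambda>y. cnj (h y)) (\<lambda>y. cnj (q y)) = cnj (lip h q)" for h q
    unfolding lip_def Bochner_Integration.integral_cnj[symmetric] by simp
  have cpow: "lip (\<lambda>y. c) (\<lambda>y. y ^ n) = (if n = 0 then c else 0)" for n
  proof -
    have "psum (\<lambda>_. c) 1 = (\<lambda>y. c)" by (rule ext) (simp add: psum_def)
    then show ?thesis using lip_psum_power[of "\<lambda>_. c" 1 n] by simp
  qed
  have "AE y in mT. k y = 0"
  proof (rule fourier_uniqueness[OF k])
    fix n
    have "lip (\<lambda>y. cnj (bv g y)) (\<lambda>y. y ^ n) = cnj (lip (bv g) (\<lambda>y. cnj y ^ n))"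
      using cc[of "bv g" "\<lambda>y. cnj y ^ n"] by simp
    also have "\<dots> = (if n = 0 then c else 0)"
    proof (cases n)
      case 0
      have "lip (bv g) (\<lambda>y. y ^ 0) = lip (\<lambda>y. cnj (h y)) (\<lambda>y. y ^ 0)"
        using tc_rproj[OF hc, of 0] unfolding g_def[symmetric] tc_def .
      then show ?thesis using 0 cc[of h "\<lambda>_. 1"] by (simp add: c_def)
    next
      case (Suc m)
      then show ?thesis using H2_bv_cnj_power[OF fg(2), of m] by simp
    qed
    finally show "lip k (\<lambda>y. y ^ n) = 0"
      using tc_rproj[OF h, of n] by (simp add: lipk cpow tc_def f_def[symmetric])
  next
    fix n
    have "lip (\<lambda>y. cnj (bv g y)) (\<lambda>y. cnj y ^ Suc n) = cnj (lip (bv g) (\<lambda>y. y ^ Suc n))"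
      using cc[of "bv g" "\<lambda>y. y ^ Suc n"] by simp
    also have "lip (bv g) (\<lambda>y. y ^ Suc n) = lip (\<lambda>y. cnj (h y)) (\<lambda>y. y ^ Suc n)"
      using tc_rproj[OF hc, of "Suc n"] unfolding g_def[symmetric] tc_def .
    also have "\<dots> = cnj (lip h (\<lambda>y. cnj y ^ Suc n))" using cc[of h "\<lambda>y. cnj y ^ Suc n"] by simp
    finally have 1: "lip (\<lambda>y. cnj (bv g y)) (\<lambda>y. cnj y ^ Suc n) = lip h (\<lambda>y. cnj y ^ Suc n)" by simp
    have 2: "lip (\<lambda>y. c) (\<lambda>y. cnj y ^ Suc n) = 0"
      using psum_cnj[of "\<lambda>_. c" 1 n] by (simp add: lip_def psum_def)
    show "lip k (\<lambda>y. cnj y ^ Suc n) = 0"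
      using 1 2 H2_bv_cnj_power[OF fg(1), of n] by (subst lipk) (auto intro!: L2_continuous continuous_intros simp del: power_Suc)
  qed
  then show ?thesis by eventually_elim (simp add: k_def f_def g_def c_def)
qed

corollary H2_of_fourier:
  assumes h: "L2 h" and neg: "\<And>n. lip h (\<lambda>y. cnj y ^ Suc n) = 0"
  shows "AE y in mT. bv (rproj h) y = h y"
proof -
  have cc: "lip (\<lambda>y. cnj (h y)) (\<lambda>y. cnj (q y)) = cnj (lip h q)" for q
    unfolding lip_def Bochner_Integration.integral_cnj[symmetric] by simp
  define c where "c = cnj (lip h (\<lambda>_. 1))"
  have "rproj (\<lambda>y. cnj (h y)) = on_disc (psum (\<lambda>_. c) 1)"
  proof -
    have "(\<lambda>n. lip (\<lambda>y. cnj (h y)) (\<lambda>y. y ^ n)) = (\<lambda>n. if n = 0 then c else 0)"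
    proof
      fix n show "lip (\<lambda>y. cnj (h y)) (\<lambda>y. y ^ n) = (if n = 0 then c else 0)"
        using cc[of "\<lambda>y. cnj y ^ n"] neg[of "n - 1"] by (cases n) (auto simp: c_def)
    qed
    then have "rproj (\<lambda>y. cnj (h y)) = pser (\<lambda>n. if n = 0 then c else 0)" by (simp add: rproj_def)
    also have "\<dots> = on_disc (psum (\<lambda>n. if n = 0 then c else 0) 1)" by (rule pser_finite) auto
    also have "psum (\<lambda>n. if n = 0 then c else 0) 1 = psum (\<lambda>_. c) 1" by (auto simp: psum_def)
    finally show ?thesis .
  qed
  then have 1: "bv (rproj (\<lambda>y. cnj (h y))) y = c" if "y \<in> sphere 0 1" for y
    using bv_poly_disc[OF that, of "\<lambda>_. c" 1] by (simp add: psum_def)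
  show ?thesis using riesz_decomposition[OF h] AE_sphere
    by eventually_elim (simp add: 1 c_def)
qed

subsection \<open>Fourier coefficients indexed by the natural numbers\<close>

text \<open>The characters of the circle, indexed by the integers.\<close>

definition freq :: "int \<Rightarrow> complex \<Rightarrow> complex" where
  "freq k y = (if k \<ge> 0 then y ^ nat k else cnj y ^ nat (- k))"

text \<open>All Fourier coefficients in one sequence, the integers being enumerated by \<^const>\<open>int_decode\<close>.\<close>

definition fourier :: "(complex \<Rightarrow> complex) \<Rightarrow> nat \<Rightarrow> complex" where
  "fourier h n = lip h (freq (int_decode n))"

lemma L2_freq [simp]: "L2 (freq k)"
  unfolding freq_def by (cases "k \<ge> 0") simp_all

lemma freq_Suc: 
  assumes "y \<in> sphere 0 1" shows "freq (k + 1) y = y * freq k y"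
proof -
  consider "k \<ge> 0" | "k = -1" | "k < -1" by linarith
  then show ?thesis
  proof cases
    case 1
    then have "nat (k + 1) = Suc (nat k)" by simp
    then show ?thesis using 1 by (simp add: freq_def)
  next
    case 2
    then show ?thesis using assms by (simp add: freq_def sphere_cnj)
  next
    case 3
    then have "nat (- k) = Suc (nat (- (k + 1)))" by simp
    then show ?thesis using 3 sphere_cnj[OF assms] by (simp add: freq_def mult.assoc[symmetric])
  qed
qed

theorem parseval:
  assumes h: "L2 h"
  shows "(\<lambda>n. (cmod (fourier h n))\<^sup>2) sums lnorm2 h"
proof -
  define f where "f = rproj h"
  define g where "g = rproj (\<lambda>y. cnj (h y))"
  define c where "c = lip h (\<lambda>_. 1)"
  have hc: "L2 (\<lambda>y. cnj (h y))" using h by simp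
  have fg: "f \<in> car H2" "g \<in> car H2" unfolding f_def g_def by (intro rproj_H2 h hc)+
  have cc: "lip (\<lambda>y. cnj (h y)) (\<lambda>y. cnj (q y)) = cnj (lip h q)" for q
    unfolding lip_def Bochner_Integration.integral_cnj[symmetric] by simp
  have tf: "fourier h (int_encode (int n)) = tc f n" for n
    by (simp add: fourier_def freq_def[abs_def] f_def tc_rproj h)
  have tg: "fourier h (int_encode (- int n)) = cnj (tc g n)" for n
  proof -
    have "fourier h (int_encode (- int n)) = lip h (\<lambda>y. cnj y ^ n)"
      by (cases "n = 0") (simp_all add: fourier_def freq_def[abs_def])
    also have "\<dots> = cnj (tc g n)" unfolding g_def tc_rproj[OF hc] using cc[of "\<lambda>y. cnj y ^ n"] by simp
    finally show ?thesis .
  qed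
  have c0: "tc f 0 = c" "tc g 0 = cnj c" using tf[of 0] tg[of 0] by (simp_all add: f_def tc_rproj h c_def)
  have Sf: "summable (\<lambda>n. (cmod (tc f n))\<^sup>2)" "summable (\<lambda>n. (cmod (tc g n))\<^sup>2)"
    using H2_E(1)[OF fg(1)] H2_E(1)[OF fg(2)] by (simp_all add: l2_def)
  have norm: "lnorm2 h = (\<Sum>n. (cmod (tc f n))\<^sup>2) + (\<Sum>n. (cmod (tc g n))\<^sup>2) - (cmod c)\<^sup>2"
  proof -
    have L: "L2 (\<lambda>y. bv f y + cnj (bv g y))" "L2 (\<lambda>y. cnj (bv g y))" by (intro L2_add L2_cnj H2_E fg)+
    have "lip h h = lip (\<lambda>y. bv f y + cnj (bv g y) - c) h"
      by (rule lip_cong_AE) (use h L riesz_decomposition[OF h] in \<open>auto intro: L2_minus simp: f_def g_def c_def\<close>)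
    also have "\<dots> = lip (bv f) h + lip (\<lambda>y. cnj (bv g y)) h - lip (\<lambda>_. c) h"
      by (subst lip_diff_left[OF L(1) _ h], simp, subst lip_add_left[OF H2_E(3)[OF fg(1)] L(2) h]) simp
    also have "lip (bv f) h = lip (bv f) (bv f)"
      using lip_rproj[OF h fg(1)] unfolding f_def by (metis lip_cnj)
    also have "lip (\<lambda>y. cnj (bv g y)) h = lip (bv g) (bv g)"
    proof -
      have "lip (\<lambda>y. cnj (bv g y)) h = lip (\<lambda>y. cnj (h y)) (bv g)" by (simp add: lip_def mult.commute)
      then show ?thesis using lip_rproj[OF hc fg(2)] by (simp add: g_def)
    qed
    also have "lip (\<lambda>_. c) h = c * cnj c"
    proof -
      have "lip (\<lambda>_. c) h = cnj (lip h (\<lambda>_. c))" by (simp add: lip_cnj)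
      also have "lip h (\<lambda>_. c) = cnj c * lip h (\<lambda>_. 1)" by (simp add: lip_def mult.commute)
      finally show ?thesis by (simp add: c_def mult.commute)
    qed
    finally have "complex_of_real (lnorm2 h) = of_real (lnorm2 (bv f) + lnorm2 (bv g) - (cmod c)\<^sup>2)"
      by (simp only: lip_self of_real_add of_real_diff complex_norm_square)
    then have "lnorm2 h = lnorm2 (bv f) + lnorm2 (bv g) - (cmod c)\<^sup>2" using of_real_eq_iff by blast
    then show ?thesis by (simp add: lnorm2_bv fg)
  qed
  have "((\<lambda>n. (cmod (fourier h n))\<^sup>2) has_sum lnorm2 h) UNIV"
  proof -
    have A: "((\<lambda>n. (cmod (tc f n))\<^sup>2) has_sum (\<Sum>n. (cmod (tc f n))\<^sup>2)) UNIV"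
      using Sf(1) by (intro norm_summable_imp_has_sum summable_sums) auto
    have B: "((\<lambda>n. (cmod (tc g (Suc n)))\<^sup>2) has_sum ((\<Sum>n. (cmod (tc g n))\<^sup>2) - (cmod c)\<^sup>2)) UNIV"
    proof -
      have "(\<lambda>n. (cmod (tc g (Suc n)))\<^sup>2) sums ((\<Sum>n. (cmod (tc g n))\<^sup>2) - (cmod (tc g 0))\<^sup>2)"
        using summable_sums[OF Sf(2)] by (subst sums_Suc_iff) (simp add: algebra_simps)
      then show ?thesis using Sf(2) by (intro norm_summable_imp_has_sum) (auto simp: c0 summable_Suc_iff[of "\<lambda>n. (cmod (tc g n))\<^sup>2"])
    qed
    have A': "((\<lambda>k. (cmod (fourier h (int_encode k)))\<^sup>2) has_sum (\<Sum>n. (cmod (tc f n))\<^sup>2)) {0..}"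
    proof -
      have "((\<lambda>k. (cmod (fourier h (int_encode k)))\<^sup>2) has_sum (\<Sum>n. (cmod (tc f n))\<^sup>2)) (int ` UNIV)"
        using A by (subst has_sum_reindex) (auto simp: o_def tf)
      moreover have "int ` UNIV = {0..}" by (auto simp: image_def intro: nonneg_int_cases)
      ultimately show ?thesis by simp
    qed
    have B': "((\<lambda>k. (cmod (fourier h (int_encode k)))\<^sup>2) has_sum ((\<Sum>n. (cmod (tc g n))\<^sup>2) - (cmod c)\<^sup>2)) {..<0}"
    proof -
      have "((\<lambda>k. (cmod (fourier h (int_encode k)))\<^sup>2) has_sum ((\<Sum>n. (cmod (tc g n))\<^sup>2) - (cmod c)\<^sup>2)) ((\<lambda>n. - int (Suc n)) ` UNIV)"
        using B by (subst has_sum_reindex) (auto simp: o_def tg inj_on_def simp del: of_nat_Suc)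
      moreover have "(\<lambda>n. - int (Suc n)) ` UNIV = {..<0}"
      proof (intro equalityI subsetI)
        fix k :: int assume "k \<in> {..<0}"
        then have "k = - int (Suc (nat (- k - 1)))" by simp
        then show "k \<in> (\<lambda>n. - int (Suc n)) ` UNIV" by blast
      qed auto
      ultimately show ?thesis by simp
    qed
    have "((\<lambda>k. (cmod (fourier h (int_encode k)))\<^sup>2) has_sum lnorm2 h) ({0..} \<union> {..<0})"
    proof -
      have "{0..} \<inter> {..<0::int} = {}" by auto
      from has_sum_Un_disjoint[OF A' B' this] show ?thesis unfolding norm diff_conv_add_uminus add.assoc .
    qed
    moreover have "{0..} \<union> {..<0::int} = UNIV" by auto
    ultimately have "((\<lambda>k. (cmod (fourier h (int_encode k)))\<^sup>2) has_sum lnorm2 h) UNIV" by simp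
    moreover have "UNIV = range int_decode" using bij_int_decode by (simp add: bij_def)
    ultimately have "((\<lambda>k. (cmod (fourier h (int_encode k)))\<^sup>2) has_sum lnorm2 h) (range int_decode)" by simp
    then show ?thesis by (subst (asm) has_sum_reindex) (auto simp: o_def intro: inj_int_decode)
  qed
  then show ?thesis by (rule has_sum_imp_sums)
qed

section \<open>Outer functions\<close>

lemma H2_at_0: "f \<in> car H2 \<Longrightarrow> f 0 = tc f 0"
  using sums_unique2[OF H2_sums[of f 0] powser_sums_zero[of "tc f"]] by simp

lemma H2_mean: "f \<in> car H2 \<Longrightarrow> lip (bv f) (\<lambda>_. 1) = f 0"
  by (simp add: H2_at_0 tc_def)

lemma lnorm2_one [simp]: "lnorm2 (\<lambda>_. 1) = 1"
  by (simp add: lnorm2_def)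

lemma H2_at_0_le: "f \<in> car H2 \<Longrightarrow> (cmod (f 0))\<^sup>2 \<le> lnorm2 (bv f)"
  using lip_bound[OF H2_E(3) L2_power(3)[of 1], of f] by (simp add: H2_mean)

lemma has_bv_of_cont:
  fixes F :: "complex \<Rightarrow> complex"
  assumes "\<And>y. y \<in> sphere 0 1 \<Longrightarrow> isCont F y" "\<And>z. z \<in> ball 0 1 \<Longrightarrow> f z = F z" "y \<in> sphere 0 1"
  shows "(f \<longlongrightarrow> F y) (nontangential y)"
proof -
  have "(F \<longlongrightarrow> F y) (nontangential y)"
  proof (rule tendstoI)
    fix e :: real assume "e > 0"
    from tendstoD[OF assms(1)[OF assms(3), unfolded isCont_def] this]
    show "\<forall>\<^sub>F x in nontangential y. dist (F x) (F y) < e"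
      unfolding eventually_nontangential by (auto simp: eventually_at_filter elim: eventually_mono)
  qed
  then show ?thesis
    by (rule Lim_transform_eventually) (rule eventually_mono[OF nontangential_disc], simp add: assms(2))
qed

lemma bv_szego:
  assumes w: "w \<in> ball 0 1" and z: "y \<in> sphere 0 1"
  shows "bv (szego w) y = 1 / (1 - cnj w * y)"
proof (rule bvI[OF _ z])
  have nz: "1 - cnj w * y \<noteq> 0" if "y \<in> sphere 0 1" for y
  proof
    assume "1 - cnj w * y = 0"
    then have "cnj w * y = 1" by simp
    then have "norm (cnj w * y) = 1" by simp
    then show False using w that by (simp add: norm_mult)
  qed
  show "(szego w \<longlongrightarrow> 1 / (1 - cnj w * y)) (nontangential y)"
    by (rule has_bv_of_cont[where F = "\<lambda>y. 1 / (1 - cnj w * y)"]) (use nz z szego(3)[OF w] in \<open>auto intro!: continuous_intros\<close>)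
qed

lemma sqrt_lnorm2_triangle:
  assumes f: "L2 f" and g: "L2 g"
  shows "sqrt (lnorm2 (\<lambda>y. f y + g y)) \<le> sqrt (lnorm2 f) + sqrt (lnorm2 g)"
proof -
  have fg: "L2 (\<lambda>y. f y + g y)" by (intro L2_add f g)
  have "complex_of_real (lnorm2 (\<lambda>y. f y + g y)) = lip f f + lip g g + (lip f g + cnj (lip f g))"
  proof -
    have "lip (\<lambda>y. f y + g y) (\<lambda>y. f y + g y) = lip f (\<lambda>y. f y + g y) + lip g (\<lambda>y. f y + g y)"
      by (rule lip_add_left[OF f g fg])
    also have "lip f (\<lambda>y. f y + g y) = cnj (lip f f + lip g f)"
      using lip_add_left[OF f g f] by (metis lip_cnj)
    also have "lip g (\<lambda>y. f y + g y) = cnj (lip f g + lip g g)"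
      using lip_add_left[OF f g g] by (metis lip_cnj)
    finally show ?thesis by (simp add: lip_cnj lip_self)
  qed
  then have "lnorm2 (\<lambda>y. f y + g y) = lnorm2 f + lnorm2 g + 2 * Re (lip f g)"
    by (simp add: lip_self complex_eq_iff)
  also have "Re (lip f g) \<le> sqrt (lnorm2 f * lnorm2 g)"
    using complex_Re_le_cmod[of "lip f g"] lip_bound[OF f g] real_le_rsqrt order_trans by blast
  finally have "lnorm2 (\<lambda>y. f y + g y) \<le> (sqrt (lnorm2 f) + sqrt (lnorm2 g))\<^sup>2"
    by (simp add: power2_sum real_sqrt_mult)
  then show ?thesis by (intro real_le_lsqrt) auto
qed

text \<open>The Herglotz integral, which occurs in the definition of outer functions.\<close>

definition herglotz :: "(complex \<Rightarrow> real) \<Rightarrow> complex \<Rightarrow> complex" where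
  "herglotz k z = (\<integral>y. (y + z) / (y - z) * of_real (k y) \<partial>mT)"

text \<open>The Herglotz kernel is twice the conjugated reproducing kernel minus \<open>1\<close>; so Herglotz integrals of square
  integrable functions are Riesz projections.\<close>

lemma herglotz_kernel:
  assumes z: "z \<in> ball 0 1" and x: "y \<in> sphere 0 1"
  shows "(y + z) / (y - z) = 2 * cnj (bv (szego z) y) - 1" "Re ((y + z) / (y - z)) \<ge> 0"
    "cmod ((y + z) / (y - z)) \<le> 2 / (1 - cmod z)"
proof -
  have ne: "y \<noteq> z" "y \<noteq> 0" using z x by auto
  have "1 - z * cnj y = (y - z) * cnj y" using sphere_cnj[OF x] by (simp add: algebra_simps)
  then have "1 / (1 - z * cnj y) = y / (y - z)"
    using ne sphere_cnj[OF x] by (simp add: divide_simps)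
  then have "cnj (bv (szego z) y) = y / (y - z)" by (simp add: bv_szego[OF z x])
  then have "2 * cnj (bv (szego z) y) - 1 = 2 * (y / (y - z)) - (y - z) / (y - z)" using ne by simp
  also have "\<dots> = (2 * y - (y - z)) / (y - z)" by (simp only: diff_divide_distrib times_divide_eq_right)
  also have "2 * y - (y - z) = y + z" by simp
  finally show "(y + z) / (y - z) = 2 * cnj (bv (szego z) y) - 1" ..
  have "Re ((y + z) / (y - z)) = Re ((y + z) * cnj (y - z)) / (cmod (y - z))\<^sup>2"
    by (simp only: Re_divide cmod_power2) (simp add: algebra_simps)
  also have "Re ((y + z) * cnj (y - z)) = (cmod y)\<^sup>2 - (cmod z)\<^sup>2"
    by (simp only: cmod_power2) (simp add: algebra_simps power2_eq_square)
  finally show "Re ((y + z) / (y - z)) \<ge> 0"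
    using x z power_mono[of "cmod z" 1 2] by simp
  have "cmod (y + z) \<le> 2" using norm_triangle_ineq[of y z] x z by simp
  moreover have "1 - cmod z \<le> cmod (y - z)" using norm_triangle_ineq2[of y z] x by simp
  ultimately show "cmod ((y + z) / (y - z)) \<le> 2 / (1 - cmod z)"
    using z unfolding norm_divide by (intro frac_le) auto
qed

lemma herglotz_measurable: 
  assumes "z \<in> ball 0 1" shows "(\<lambda>y. (y + z) / (y - z)) \<in> borel_measurable mT"
  by (intro borel_measurable_mT_continuous continuous_intros) (use assms in auto)

lemma herglotz_integrable:
  fixes k :: "complex \<Rightarrow> real"
  assumes "z \<in> ball 0 1" "integrable mT k"
  shows "integrable mT (\<lambda>y. (y + z) / (y - z) * of_real (k y))"
proof (rule Bochner_Integration.integrable_bound)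
  show "integrable mT (\<lambda>y. 2 / (1 - cmod z) * k y)" using assms(2) by simp
  show "(\<lambda>y. (y + z) / (y - z) * of_real (k y)) \<in> borel_measurable mT"
    using herglotz_measurable[OF assms(1)] assms(2) by measurable
  show "AE y in mT. norm ((y + z) / (y - z) * complex_of_real (k y)) \<le> norm (2 / (1 - cmod z) * k y)"
  proof (rule AE_I2)
    fix y assume "y \<in> space mT"
    then have "cmod ((y + z) / (y - z)) \<le> 2 / (1 - cmod z)" by (intro herglotz_kernel(3) assms) simp
    then have "cmod ((y + z) / (y - z)) * \<bar>k y\<bar> \<le> 2 / (1 - cmod z) * \<bar>k y\<bar>" by (rule mult_right_mono) simp
    moreover have "norm (2 / (1 - cmod z) * k y) = 2 / (1 - cmod z) * \<bar>k y\<bar>" using assms(1) by (simp add: abs_mult)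
    ultimately show "norm ((y + z) / (y - z) * complex_of_real (k y)) \<le> norm (2 / (1 - cmod z) * k y)"
      by (simp only: norm_mult norm_of_real)
  qed
qed

lemma herglotz_L2:
  assumes z: "z \<in> ball 0 1" and k: "L2 (\<lambda>y. of_real (k y))"
  shows "herglotz k z = 2 * lip (\<lambda>y. of_real (k y)) (bv (szego z)) - lip (\<lambda>y. of_real (k y)) (\<lambda>_. 1)"
proof -
  note i = L2_integrable_lip[OF k H2_E(3)[OF Hinf_H2[OF szego(1)[OF z]]]] L2_integrable[OF k]
  have "herglotz k z = (\<integral>y. 2 * (of_real (k y) * cnj (bv (szego z) y)) - of_real (k y) \<partial>mT)"
    unfolding herglotz_def by (rule Bochner_Integration.integral_cong) (auto simp: herglotz_kernel[OF z] algebra_simps)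
  also have "\<dots> = 2 * (\<integral>y. of_real (k y) * cnj (bv (szego z) y) \<partial>mT) - (\<integral>y. of_real (k y) \<partial>mT)"
    using i by simp
  finally show ?thesis by (simp add: lip_def)
qed

lemma herglotz_mono:
  fixes k l :: "complex \<Rightarrow> real"
  assumes z: "z \<in> ball 0 1" and k: "integrable mT k" and l: "integrable mT l" and le: "AE y in mT. k y \<le> l y"
  shows "Re (herglotz k z) \<le> Re (herglotz l z)"
proof -
  define K where "K y = (y + z) / (y - z)" for y
  note i = herglotz_integrable[OF z k, folded K_def] herglotz_integrable[OF z l, folded K_def]
  have "(\<integral>y. Re (K y) * k y \<partial>mT) \<le> (\<integral>y. Re (K y) * l y \<partial>mT)"
  proof (rule integral_mono_AE)
    show "AE y in mT. Re (K y) * k y \<le> Re (K y) * l y"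
      using le AE_sphere unfolding K_def by eventually_elim (rule mult_left_mono, auto intro!: herglotz_kernel(2) z)
  qed (use i[THEN integrable_Re] in simp_all)
  then show ?thesis unfolding herglotz_def K_def[symmetric] using integral_Re[OF i(1)] integral_Re[OF i(2)] by simp
qed

lemma herglotz_const: 
  assumes z: "z \<in> ball 0 1" shows "herglotz (\<lambda>_. c) z = of_real c"
proof -
  have "lip (bv one_disc) (bv (szego z)) = 1"
    using H2_eval[OF one_disc_H2 z] z by (simp add: one_disc_def on_disc_def)
  moreover have "lip (bv one_disc) (bv (szego z)) = lip (\<lambda>_. 1) (bv (szego z))"
    unfolding lip_def by (rule Bochner_Integration.integral_cong) (auto simp: bv_one_disc)
  moreover have "lip (\<lambda>_. of_real c) g = of_real c * lip (\<lambda>_. 1) g" for g by (simp add: lip_def)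
  ultimately show ?thesis using herglotz_L2[OF z, of "\<lambda>_. c"] by (simp add: lip_def)
qed

text \<open>With \<open>f\<close> the Riesz projection of \<open>k\<close> and \<open>c\<close> its mean, \<open>2 * f - c\<close>
  is the Herglotz integral of \<open>k\<close>. Its exponential is bounded because the Herglotz kernel has positive
  real part and mean \<open>1\<close>.\<close>

lemma bounded_outer_exists:
  fixes k :: "complex \<Rightarrow> real"
  assumes [measurable]: "k \<in> borel_measurable mT" and B: "AE y in mT. \<bar>k y\<bar> \<le> B"
  obtains H where "H \<in> Hinf" "AE y in mT. cmod (bv H y) = exp (k y)" "cmod (H 0) = exp (\<integral>y. k y \<partial>mT)"
proof -
  let ?h = "\<lambda>y. complex_of_real (k y)"
  have h: "L2 ?h" by (rule L2_bounded[where B = B]) (use B in auto)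
  have ik: "integrable mT k" by (rule mT.integrable_const_bound[where B = B]) (use B in auto)
  define c where "c = (\<integral>y. k y \<partial>mT)"
  have c: "lip ?h (\<lambda>_. 1) = of_real c" unfolding lip_def c_def by simp
  define f where "f = rproj ?h"
  have f: "f \<in> car H2" unfolding f_def by (rule rproj_H2[OF h])
  have fz: "2 * f z - of_real c = herglotz k z" if z: "z \<in> ball 0 1" for z
  proof -
    have "f z = lip ?h (bv (szego z))"
      using H2_eval[OF f z] lip_rproj[OF h Hinf_H2[OF szego(1)[OF z]]] by (simp add: f_def)
    then show ?thesis using herglotz_L2[OF z h] c by simp
  qed
  define H where "H = on_disc (\<lambda>z. exp (2 * f z - of_real c))"
  have hol: "f holomorphic_on ball 0 1" using H2_E(5)[OF f] by (simp add: disc_holomorphic_def)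
  have Hb: "cmod (H z) \<le> exp B" if z: "z \<in> ball 0 1" for z
  proof -
    have "AE y in mT. k y \<le> B" using B by eventually_elim auto
    then have "Re (herglotz k z) \<le> Re (herglotz (\<lambda>_. B) z)" by (intro herglotz_mono z ik) auto
    then have "Re (2 * f z - of_real c) \<le> B" unfolding fz[OF z] herglotz_const[OF z] by simp
    then show ?thesis using z by (simp add: H_def on_disc_def norm_exp)
  qed
  have "H \<in> disc_holomorphic" unfolding H_def by (intro disc_holomorphic_on_disc holomorphic_intros hol)
  then have "H \<in> Hinf" using Hb by (auto simp: Hinf_def intro!: boundedI[where B = "exp B"])
  moreover have "AE y in mT. cmod (bv H y) = exp (k y)"
  proof -
    have "has_bv (\<lambda>z. exp (2 * f z - of_real c)) (\<lambda>y. exp (2 * bv f y - of_real c))"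
      using H2_E(4)[OF f] unfolding has_bv_def by eventually_elim (intro tendsto_intros)
    then have "has_bv H (\<lambda>y. exp (2 * bv f y - of_real c))"
      by (rule has_bv_cong_disc) (simp add: H_def on_disc_def)
    from has_bv_imp[OF this] riesz_decomposition[OF h]
    show ?thesis
    proof eventually_elim
      case (elim y)
      have "complex_of_real (k y) = bv f y + cnj (bv f y) - of_real c"
        using elim(2) by (simp add: f_def c)
      then have "k y = Re (2 * bv f y - of_real c)" by (simp add: complex_eq_iff)
      then show ?case using elim(1) by (simp add: norm_exp)
    qed
  qed
  moreover have "cmod (H 0) = exp (\<integral>y. k y \<partial>mT)"
  proof -
    have "f 0 = of_real c" using H2_at_0[OF f] c by (simp add: f_def tc_rproj h)
    then show ?thesis by (simp add: H_def on_disc_def c_def)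
  qed
  ultimately show ?thesis using that by blast
qed

text \<open>Cyclicity for the shift: \<open>1\<close> is a limit of multiples of \<open>\<phi>\<close> in the Hardy space.\<close>

definition cyclic :: "(complex \<Rightarrow> complex) \<Rightarrow> bool" where
  "cyclic \<phi> \<longleftrightarrow> (\<exists>h. (\<forall>n. h n \<in> car H2) \<and> (\<lambda>n. lnorm2 (\<lambda>y. bv \<phi> y * bv (h n) y - 1)) \<longlonglongrightarrow> 0)"

lemma bv_Hinf_mult:
  assumes "\<phi> \<in> Hinf" "f \<in> car H2"
  shows "AE y in mT. bv (\<phi> * f) y = bv \<phi> y * bv f y"
  by (intro has_bv_imp has_bv_mult H2_E Hinf_H2 assms)

lemma H2_eval_le:
  assumes "f \<in> car H2" "w \<in> ball 0 1"
  shows "(cmod (f w))\<^sup>2 \<le> lnorm2 (bv f) * lnorm2 (bv (szego w))"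
  unfolding H2_eval[OF assms] by (intro lip_bound H2_E Hinf_H2 szego assms)

lemma H2_tendsto_pointwise:
  assumes f: "\<And>n. f n \<in> car H2" and g: "g \<in> car H2" and lim: "(\<lambda>n. lnorm2 (\<lambda>y. bv (f n) y - bv g y)) \<longlonglongrightarrow> 0"
    and z: "z \<in> ball 0 1"
  shows "(\<lambda>n. f n z) \<longlonglongrightarrow> g z"
proof -
  have "(\<lambda>n. f n z - g z) \<longlonglongrightarrow> 0"
  proof (rule Lim_null_comparison)
    show "\<forall>\<^sub>F n in sequentially. norm (f n z - g z) \<le> sqrt (lnorm2 (\<lambda>y. bv (f n) y - bv g y) * lnorm2 (bv (szego z)))"
    proof (intro always_eventually allI real_le_rsqrt)
      fix n
      have L: "L2 (\<lambda>y. bv (f n) y - bv g y)" by (intro L2_minus H2_E f g)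
      have "(cmod ((f n - g) z))\<^sup>2 \<le> lnorm2 (bv (f n - g)) * lnorm2 (bv (szego z))"
        by (intro H2_eval_le H2_diff f g z)
      also have "lnorm2 (bv (f n - g)) = lnorm2 (\<lambda>y. bv (f n) y - bv g y)"
        by (rule L2_cong_AE[OF L AE_bv_diff[OF f g]])
      finally show "(norm (f n z - g z))\<^sup>2 \<le> lnorm2 (\<lambda>y. bv (f n) y - bv g y) * lnorm2 (bv (szego z))" by simp
    qed
    show "(\<lambda>n. sqrt (lnorm2 (\<lambda>y. bv (f n) y - bv g y) * lnorm2 (bv (szego z)))) \<longlonglongrightarrow> 0"
      using tendsto_real_sqrt[OF tendsto_mult_right[OF lim, of "lnorm2 (bv (szego z))"]] by simp
  qed
  then show ?thesis by (simp add: LIM_zero_iff)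
qed

lemma cyclic_E:
  assumes p: "\<phi> \<in> Hinf" and c: "cyclic \<phi>"
  shows "\<exists>h. (\<forall>n. h n \<in> car H2) \<and> (\<lambda>n. lnorm2 (\<lambda>y. bv \<phi> y * bv (h n) y - 1)) \<longlonglongrightarrow> 0 \<and>
    (\<forall>z\<in>ball 0 1. (\<lambda>n. \<phi> z * h n z) \<longlonglongrightarrow> 1)"
proof -
  obtain h where h: "\<And>n. h n \<in> car H2" and l: "(\<lambda>n. lnorm2 (\<lambda>y. bv \<phi> y * bv (h n) y - 1)) \<longlonglongrightarrow> 0"
    using c unfolding cyclic_def by blast
  have ph: "\<phi> * h n \<in> car H2" for n by (intro Hinf_mult p h)
  have eq: "lnorm2 (\<lambda>y. bv (\<phi> * h n) y - bv one_disc y) = lnorm2 (\<lambda>y. bv \<phi> y * bv (h n) y - 1)" for n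
  proof (rule lnorm2_cong_AE)
    show "AE y in mT. bv (\<phi> * h n) y - bv one_disc y = bv \<phi> y * bv (h n) y - 1"
      using bv_Hinf_mult[OF p h, of n] AE_sphere by eventually_elim (simp add: bv_one_disc)
    show "(\<lambda>y. bv \<phi> y * bv (h n) y - 1) \<in> borel_measurable mT"
      using H2_measurable[OF h[of n]] H2_measurable[OF Hinf_H2[OF p]] by measurable
    show "(\<lambda>y. bv (\<phi> * h n) y - bv one_disc y) \<in> borel_measurable mT"
      using H2_measurable[OF ph[of n]] H2_measurable[OF one_disc_H2] by measurable
  qed
  have "(\<lambda>n. \<phi> z * h n z) \<longlonglongrightarrow> 1" if z: "z \<in> ball 0 1" for z
    using H2_tendsto_pointwise[where f = "\<lambda>n. \<phi> * h n", OF ph one_disc_H2 _ z] l z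
    unfolding eq by (simp add: one_disc_def on_disc_def)
  with h l show ?thesis by blast
qed

lemma cyclic_zero_free:
  assumes "\<phi> \<in> Hinf" "cyclic \<phi>" "z \<in> ball 0 1"
  shows "\<phi> z \<noteq> 0"
proof
  assume "\<phi> z = 0"
  obtain h where "\<And>n. h n \<in> car H2" "(\<lambda>n. lnorm2 (\<lambda>y. bv \<phi> y * bv (h n) y - 1)) \<longlonglongrightarrow> 0"
    and l: "\<And>z. z \<in> ball 0 1 \<Longrightarrow> (\<lambda>n. \<phi> z * h n z) \<longlonglongrightarrow> 1"
    using cyclic_E[OF assms(1,2)] by blast
  from l[OF assms(3)] have "(\<lambda>n::nat. 0::complex) \<longlonglongrightarrow> 1" using \<open>\<phi> z = 0\<close> by simp
  then show False using LIMSEQ_unique[OF tendsto_const] by fastforce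
qed

text \<open>The inequality that singles out outer functions. For multiples \<open>\<phi> * h\<close> close to \<open>1\<close> and
  an outer function \<open>H\<close> with \<open>\<bar>H\<bar>\<^sup>2 = \<bar>\<phi>\<bar>\<^sup>2 + e\<close> on the
  circle, the value of \<open>H * h\<close> at \<open>0\<close> is at most its norm. As \<open>e\<close> tends to
  \<open>0\<close>, the geometric mean of \<open>\<bar>\<phi>\<bar>\<close> times \<open>\<bar>h 0\<bar>\<close> is at
  most the norm of \<open>\<phi> * h\<close>, which is about \<open>1\<close>, and \<open>h 0\<close> is about
  \<open>1 / \<phi> 0\<close>.\<close>

lemma cyclic_log_integral_le:
  assumes p: "\<phi> \<in> Hinf" and c: "cyclic \<phi>" and nz: "AE y in mT. bv \<phi> y \<noteq> 0"
    and ik: "integrable mT (\<lambda>y. ln (cmod (bv \<phi> y)))"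
  shows "(\<integral>y. ln (cmod (bv \<phi> y)) \<partial>mT) \<le> ln (cmod (\<phi> 0))"
proof -
  obtain h where h: "\<And>n. h n \<in> car H2" and l: "(\<lambda>n. lnorm2 (\<lambda>y. bv \<phi> y * bv (h n) y - 1)) \<longlonglongrightarrow> 0"
    and pt: "\<And>z. z \<in> ball 0 1 \<Longrightarrow> (\<lambda>n. \<phi> z * h n z) \<longlonglongrightarrow> 1"
    using cyclic_E[OF p c] by blast
  obtain M where M: "M > 0" "\<And>z. cmod (\<phi> z) \<le> M" using Hinf_bound[OF p] by blast
  have bM: "AE y in mT. cmod (bv \<phi> y) \<le> M" by (rule Hinf_bv_bound[OF p M(2)])
  define I where "I = (\<integral>y. ln (cmod (bv \<phi> y)) \<partial>mT)"
  have mp [measurable]: "bv \<phi> \<in> borel_measurable mT" by (intro L2_measurable H2_E Hinf_H2 p)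
  have mh [measurable]: "bv (h n) \<in> borel_measurable mT" for n by (intro L2_measurable H2_E h)
  define q where "q n = lnorm2 (\<lambda>y. bv \<phi> y * bv (h n) y)" for n
  have Lq: "L2 (\<lambda>y. bv \<phi> y * bv (h n) y)" for n by (rule L2_bounded_mult(1)[OF H2_E(3)[OF h] mp bM])
  have e1: "(cmod (h n 0))\<^sup>2 * exp (2 * I) \<le> q n + e * lnorm2 (bv (h n))" if e: "e > 0" for n e
  proof -
    \<comment> \<open>Adding \<open>e\<close> makes the logarithm bounded, as needed for an outer function with this modulus.\<close>
    define k where "k y = ln ((cmod (bv \<phi> y))\<^sup>2 + e) / 2" for y
    have km [measurable]: "k \<in> borel_measurable mT" unfolding k_def by measurable
    have kb: "AE y in mT. \<bar>k y\<bar> \<le> max \<bar>ln e\<bar> \<bar>ln (M\<^sup>2 + e)\<bar>"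
      using bM
    proof eventually_elim
      case (elim y)
      have "(cmod (bv \<phi> y))\<^sup>2 \<le> M\<^sup>2" using elim by (intro power_mono) auto
      then have "ln e \<le> ln ((cmod (bv \<phi> y))\<^sup>2 + e)" "ln ((cmod (bv \<phi> y))\<^sup>2 + e) \<le> ln (M\<^sup>2 + e)"
        using e by (auto intro!: ln_mono add_nonneg_pos)
      then show ?case by (auto simp: k_def abs_if max_def)
    qed
    obtain H where H: "H \<in> Hinf" "AE y in mT. cmod (bv H y) = exp (k y)" "cmod (H 0) = exp (\<integral>y. k y \<partial>mT)"
      using bounded_outer_exists[OF km kb] by blast
    have "I \<le> (\<integral>y. k y \<partial>mT)" unfolding I_def
    proof (rule integral_mono_AE[OF ik])
      show "integrable mT k" by (rule mT.integrable_const_bound[OF _ km]) (use kb in simp)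
      show "AE y in mT. ln (cmod (bv \<phi> y)) \<le> k y"
        using nz
      proof eventually_elim
        case (elim y)
        then have "ln (cmod (bv \<phi> y)) = ln ((cmod (bv \<phi> y))\<^sup>2) / 2" by (simp add: ln_realpow)
        also have "\<dots> \<le> k y" using e elim by (simp add: k_def ln_mono)
        finally show ?case .
      qed
    qed
    then have "exp I \<le> cmod (H 0)" using H(3) by simp
    then have "(exp I)\<^sup>2 \<le> (cmod (H 0))\<^sup>2" by (rule power_mono) simp
    then have "exp (2 * I) \<le> (cmod (H 0))\<^sup>2" by (simp add: exp_double)
    then have "(cmod (h n 0))\<^sup>2 * exp (2 * I) \<le> (cmod (h n 0))\<^sup>2 * (cmod (H 0))\<^sup>2" by (rule mult_left_mono) simp
    also have "\<dots> = (cmod ((H * h n) 0))\<^sup>2" by (simp add: norm_mult power_mult_distrib)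
    also have "\<dots> \<le> lnorm2 (bv (H * h n))" by (intro H2_at_0_le Hinf_mult H h)
    also have "\<dots> = (\<integral>y. (cmod (bv \<phi> y * bv (h n) y))\<^sup>2 + e * (cmod (bv (h n) y))\<^sup>2 \<partial>mT)"
      unfolding lnorm2_def
    proof (rule integral_cong_AE)
      show "AE y in mT. (cmod (bv (H * h n) y))\<^sup>2 = (cmod (bv \<phi> y * bv (h n) y))\<^sup>2 + e * (cmod (bv (h n) y))\<^sup>2"
        using bv_Hinf_mult[OF H(1) h, of n] H(2)
      proof eventually_elim
        case (elim y)
        have pos: "(cmod (bv \<phi> y))\<^sup>2 + e > 0" using e by (intro add_nonneg_pos) auto
        have "(exp (k y))\<^sup>2 = exp (2 * k y)" by (simp add: exp_double)
        also have "\<dots> = (cmod (bv \<phi> y))\<^sup>2 + e" using pos by (simp add: k_def)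
        finally have "(cmod (bv H y))\<^sup>2 = (cmod (bv \<phi> y))\<^sup>2 + e" using elim(2) by simp
        then show ?case using elim(1) by (simp add: norm_mult power_mult_distrib algebra_simps)
      qed
      show "(\<lambda>y. (cmod (bv (H * h n) y))\<^sup>2) \<in> borel_measurable mT"
        using H2_measurable[OF Hinf_mult[OF H(1) h[of n]]] by measurable
    qed measurable
    also have "\<dots> = q n + e * lnorm2 (bv (h n))"
      using L2_integrable_sq[OF Lq[of n]] L2_integrable_sq[OF H2_E(3)[OF h[of n]]] by (simp add: q_def lnorm2_def)
    finally show ?thesis .
  qed
  have e2: "(cmod (h n 0))\<^sup>2 * exp (2 * I) \<le> q n" for n
  proof (rule tendsto_le[of "at_right (0::real)"])
    show "((\<lambda>e. q n + e * lnorm2 (bv (h n))) \<longlongrightarrow> q n) (at_right 0)"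
      by (rule tendsto_eq_intros refl | simp)+
    show "\<forall>\<^sub>F e in at_right 0. (cmod (h n 0))\<^sup>2 * exp (2 * I) \<le> q n + e * lnorm2 (bv (h n))"
      using eventually_at_right_less[of 0] by eventually_elim (rule e1)
  qed auto
  have q1: "q n \<le> (sqrt (lnorm2 (\<lambda>y. bv \<phi> y * bv (h n) y - 1)) + 1)\<^sup>2" for n
  proof -
    have "L2 (\<lambda>y. bv \<phi> y * bv (h n) y - 1)" by (intro L2_minus Lq) simp
    from sqrt_lnorm2_triangle[OF this L2_power(3)[of 1]]
    have "sqrt (q n) \<le> sqrt (lnorm2 (\<lambda>y. bv \<phi> y * bv (h n) y - 1)) + 1" by (simp add: q_def)
    then have "(sqrt (q n))\<^sup>2 \<le> (sqrt (lnorm2 (\<lambda>y. bv \<phi> y * bv (h n) y - 1)) + 1)\<^sup>2"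
      by (intro power_mono) (auto simp: q_def)
    then show ?thesis by (simp add: q_def)
  qed
  have fin: "exp (2 * I) \<le> (cmod (\<phi> 0))\<^sup>2"
  proof (rule LIMSEQ_le)
    show "(\<lambda>n. (cmod (\<phi> 0 * h n 0))\<^sup>2 * exp (2 * I)) \<longlonglongrightarrow> exp (2 * I)"
      by (rule tendsto_eq_intros pt refl | simp)+
    show "(\<lambda>n. (cmod (\<phi> 0))\<^sup>2 * (sqrt (lnorm2 (\<lambda>y. bv \<phi> y * bv (h n) y - 1)) + 1)\<^sup>2) \<longlonglongrightarrow> (cmod (\<phi> 0))\<^sup>2"
      by (rule tendsto_eq_intros l refl | simp)+
    show "\<exists>N. \<forall>n\<ge>N. (cmod (\<phi> 0 * h n 0))\<^sup>2 * exp (2 * I) \<le> (cmod (\<phi> 0))\<^sup>2 * (sqrt (lnorm2 (\<lambda>y. bv \<phi> y * bv (h n) y - 1)) + 1)\<^sup>2"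
    proof (intro exI allI impI)
      fix n
      have "(cmod (\<phi> 0))\<^sup>2 * ((cmod (h n 0))\<^sup>2 * exp (2 * I)) \<le> (cmod (\<phi> 0))\<^sup>2 * (sqrt (lnorm2 (\<lambda>y. bv \<phi> y * bv (h n) y - 1)) + 1)\<^sup>2"
        using order_trans[OF e2 q1] by (intro mult_left_mono) auto
      then show "(cmod (\<phi> 0 * h n 0))\<^sup>2 * exp (2 * I) \<le> (cmod (\<phi> 0))\<^sup>2 * (sqrt (lnorm2 (\<lambda>y. bv \<phi> y * bv (h n) y - 1)) + 1)\<^sup>2"
        by (simp add: norm_mult power_mult_distrib mult.assoc)
    qed
  qed
  have "cmod (\<phi> 0) > 0" using cyclic_zero_free[OF p c, of 0] by simp
  have "(exp I)\<^sup>2 \<le> (cmod (\<phi> 0))\<^sup>2" using fin by (simp add: exp_double)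
  then have "exp I \<le> cmod (\<phi> 0)" by (rule power2_le_imp_le) simp
  then show ?thesis using \<open>cmod (\<phi> 0) > 0\<close> by (simp add: I_def[symmetric] ln_ge_iff)
qed

text \<open>The Herglotz formula for a function that is analytic across the circle.\<close>

lemma zero_free_dilate:
  assumes L: "L holomorphic_on ball 0 1" and r: "0 \<le> r" "r < 1" and z: "z \<in> ball 0 1"
  shows "herglotz (\<lambda>y. Re (L (of_real r * y))) z = L (of_real r * z) - \<i> * of_real (Im (L 0))"
    and "integrable mT (\<lambda>y. Re (L (of_real r * y)))"
proof -
  define b where "b n = (deriv ^^ n) (on_disc L) 0 / fact n * of_real r ^ n" for n
  note d = disc_holomorphic_dilate[OF disc_holomorphic_on_disc[OF L] r, folded b_def]
  define g where "g = pser b"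
  have g: "g \<in> car H2" unfolding g_def by (rule H2_pser[OF d(1)])
  have bvg: "bv g y = L (of_real r * y)" if "y \<in> sphere 0 1" for y
    using d(2)[OF that] that r by (simp add: g_def on_disc_def norm_mult)
  have gz: "g z = L (of_real r * z)" if "z \<in> ball 0 1" for z
  proof -
    have "norm (of_real r * z) < 1" using that r by (auto simp: norm_mult intro: le_less_trans[OF mult_left_le_one_le])
    then show ?thesis using d(3)[OF that] by (simp add: g_def on_disc_def)
  qed
  have LC: "L2 (\<lambda>y. cnj (bv g y))" by (intro L2_cnj H2_E g)
  have Lg: "L2 (\<lambda>y. of_real (Re (bv g y)))"
  proof (rule L2_cong_AE(1))
    show "L2 (\<lambda>y. 1/2 * (bv g y + cnj (bv g y)))" by (intro L2_cmult L2_add H2_E g LC)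
  qed (simp add: complex_add_cnj)
  have lip: "lip (\<lambda>y. of_real (Re (bv g y))) (bv q) = (lip (bv g) (bv q) + cnj (g 0 * q 0)) / 2" if q: "q \<in> Hinf" for q
  proof -
    have qH: "q \<in> car H2" by (rule Hinf_H2[OF q])
    have "lip (\<lambda>y. of_real (Re (bv g y))) (bv q) = lip (\<lambda>y. 1/2 * (bv g y + cnj (bv g y))) (bv q)"
      by (simp add: complex_add_cnj)
    also have "\<dots> = 1/2 * (lip (bv g) (bv q) + lip (\<lambda>y. cnj (bv g y)) (bv q))"
      by (subst lip_cmult_left, subst lip_add_left) (auto intro: H2_E g qH LC)
    also have "lip (\<lambda>y. cnj (bv g y)) (bv q) = cnj (\<integral>y. bv q y * bv g y \<partial>mT)"
      unfolding lip_def Bochner_Integration.integral_cnj[symmetric] by (simp add: mult.commute)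
    also have "(\<integral>y. bv q y * bv g y \<partial>mT) = lip (bv (q * g)) (\<lambda>_. 1)"
      unfolding lip_def
    proof (rule integral_cong_AE)
      show "AE y in mT. bv q y * bv g y = bv (q * g) y * cnj 1"
        using bv_Hinf_mult[OF q g] by eventually_elim simp
    qed (use H2_measurable[OF qH] H2_measurable[OF g] H2_measurable[OF Hinf_mult[OF q g]] in auto)
    also have "\<dots> = q 0 * g 0" by (simp add: H2_mean Hinf_mult q g)
    finally show ?thesis by (simp add: field_simps)
  qed
  have "herglotz (\<lambda>y. Re (L (of_real r * y))) z = herglotz (\<lambda>y. Re (bv g y)) z"
    unfolding herglotz_def by (rule Bochner_Integration.integral_cong) (auto simp: bvg)
  also have "\<dots> = 2 * lip (\<lambda>y. of_real (Re (bv g y))) (bv (szego z)) - lip (\<lambda>y. of_real (Re (bv g y))) (\<lambda>_. 1)"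
    by (rule herglotz_L2[OF z Lg])
  also have "lip (\<lambda>y. of_real (Re (bv g y))) (\<lambda>_. 1) = (g 0 + cnj (g 0)) / 2"
    unfolding lip_one_disc[symmetric] using lip[OF one_disc_Hinf] H2_mean[OF g]
    by (simp add: lip_one_disc) (simp add: one_disc_def on_disc_def)
  also have "lip (\<lambda>y. of_real (Re (bv g y))) (bv (szego z)) = (g z + cnj (g 0)) / 2"
    using lip[OF szego(1)[OF z]] H2_eval[OF g z] szego(3)[OF z, of 0] by simp
  finally show "herglotz (\<lambda>y. Re (L (of_real r * y))) z = L (of_real r * z) - \<i> * of_real (Im (L 0))"
    using gz[OF z] gz[of 0] by (simp add: complex_eq_iff field_simps)
  have "integrable mT (\<lambda>y. Re (bv g y))" using L2_integrable[OF H2_E(3)[OF g]] by auto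
  then show "integrable mT (\<lambda>y. Re (L (of_real r * y)))"
    by (subst Bochner_Integration.integrable_cong[OF refl, of mT _ "\<lambda>y. Re (bv g y)"]) (auto simp: bvg)
qed

text \<open>A cyclic function has a logarithm \<open>L\<close> in the disc. The real parts of the dilates of \<open>L\<close>
  converge almost everywhere to \<open>ln \<bar>\<phi>\<bar>\<close>, are bounded above, and all have the integral
  \<open>ln \<bar>\<phi> 0\<bar>\<close>. By Fatou's lemma the integral of the limit is at least \<open>ln
  \<bar>\<phi> 0\<bar>\<close>, by \<open>cyclic_log_integral_le\<close> it is at most that; so Scheffe's lemma gives
  convergence in mean, under which the Herglotz formula passes to the limit.\<close>

theorem cyclic_outer:
  assumes p: "\<phi> \<in> Hinf" and c: "cyclic \<phi>"
  shows "AE y in mT. bv \<phi> y \<noteq> 0" "integrable mT (\<lambda>y. ln (cmod (bv \<phi> y)))"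
    "\<exists>\<gamma>. cmod \<gamma> = 1 \<and> (\<forall>z\<in>ball 0 1. \<phi> z = \<gamma> * exp (herglotz (\<lambda>y. ln (cmod (bv \<phi> y))) z))"
proof -
  have pH: "\<phi> \<in> car H2" by (rule Hinf_H2[OF p])
  have mp [measurable]: "bv \<phi> \<in> borel_measurable mT" by (intro L2_measurable H2_E pH)
  obtain M where M: "M > 0" "\<And>z. cmod (\<phi> z) \<le> M" using Hinf_bound[OF p] by blast
  have bM: "AE y in mT. cmod (bv \<phi> y) \<le> M" by (rule Hinf_bv_bound[OF p M(2)])
  have nzf: "\<phi> z \<noteq> 0" if "z \<in> ball 0 1" for z by (rule cyclic_zero_free[OF p c that])
  have hol: "\<phi> holomorphic_on ball 0 1" using p by (simp add: Hinf_def disc_holomorphic_def)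
  obtain L where L: "L holomorphic_on ball 0 1" "\<And>z. z \<in> ball 0 1 \<Longrightarrow> \<phi> z = exp (L z)"
    using contractible_imp_holomorphic_log[OF hol convex_imp_contractible[OF convex_ball] nzf] by blast
  have ReL: "Re (L z) = ln (cmod (\<phi> z))" if "z \<in> ball 0 1" for z using L(2)[OF that] by (simp add: norm_exp)
  define r where "r n = 1 - inverse (real (Suc n))" for n
  have r: "0 \<le> r n" "r n < 1" for n by (auto simp: r_def inverse_le_1_iff)
  have rl: "r \<longlonglongrightarrow> 1" using tendsto_diff[OF tendsto_const LIMSEQ_inverse_real_of_nat, of 1] by (simp add: r_def[abs_def])
  have rin: "of_real (r n) * y \<in> ball 0 1" if "y \<in> cball 0 1" for n and y :: complex
    using r[of n] that by (auto simp: norm_mult intro: le_less_trans[OF mult_left_le])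
  define q where "q n y = Re (L (of_real (r n) * y))" for n y
  define k where "k y = ln (cmod (bv \<phi> y))" for y
  have ik: "integrable mT (q n)" for n unfolding q_def by (rule zero_free_dilate(2)[OF L(1) r, of 0]) simp
  have hk: "herglotz (q n) z = L (of_real (r n) * z) - \<i> * of_real (Im (L 0))" if "z \<in> ball 0 1" for n z
    unfolding q_def by (rule zero_free_dilate(1)[OF L(1) r that])
  have qM: "q n y \<le> ln M" if "y \<in> sphere 0 1" for n y
  proof -
    have z: "of_real (r n) * y \<in> ball 0 1" using that by (intro rin) auto
    then have "0 < cmod (\<phi> (of_real (r n) * y))" using nzf by simp
    then show ?thesis unfolding q_def ReL[OF z] using M by (intro ln_mono) auto
  qed
  have intk: "(\<integral>y. q n y \<partial>mT) = ln (cmod (\<phi> 0))" for n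
  proof -
    have "herglotz (q n) 0 = (\<integral>y. of_real (q n y) \<partial>mT)"
      unfolding herglotz_def by (rule Bochner_Integration.integral_cong) auto
    also have "\<dots> = of_real (\<integral>y. q n y \<partial>mT)" by simp
    finally have "of_real (\<integral>y. q n y \<partial>mT) = L 0 - \<i> * of_real (Im (L 0))" using hk[of 0 n] by simp
    then have "(\<integral>y. q n y \<partial>mT) = Re (L 0)" by (simp add: complex_eq_iff)
    then show ?thesis using ReL[of 0] by simp
  qed
  define A where "A = ln M - ln (cmod (\<phi> 0))"
  have "0 < cmod (\<phi> 0)" using nzf[of 0] by simp
  have nnA: "(\<integral>\<^sup>+y. ennreal (ln M - q n y) \<partial>mT) = ennreal A" for n
  proof -
    have "(\<integral>\<^sup>+y. ennreal (ln M - q n y) \<partial>mT) = ennreal (\<integral>y. ln M - q n y \<partial>mT)"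
      by (rule nn_integral_eq_integral) (use ik qM in \<open>auto intro!: AE_I2\<close>)
    also have "(\<integral>y. ln M - q n y \<partial>mT) = A" using ik[of n] intk[of n] by (simp add: A_def)
    finally show ?thesis .
  qed
  have lim: "AE y in mT. (\<lambda>n. \<phi> (of_real (r n) * y)) \<longlonglongrightarrow> bv \<phi> y"
    using H2_E(4)[OF pH] AE_sphere unfolding has_bv_def
  proof eventually_elim
    case (elim y)
    have "filterlim r (at_left 1) sequentially"
      using rl r by (auto simp: filterlim_at intro!: always_eventually less_imp_neq)
    from filterlim_compose[OF filterlim_compose[OF elim(1) radial_nontangential[OF elim(2)]] this]
    show ?case .
  qed
  \<comment> \<open>The limes inferior stands in for \<open>ln M - k\<close> until the boundary values are known to be nonzero almost
    everywhere.\<close>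
  define G where "G y = liminf (\<lambda>n. ennreal (ln M - q n y))" for y
  have [measurable]: "q n \<in> borel_measurable mT" for n using ik by auto
  have Gm [measurable]: "G \<in> borel_measurable mT" unfolding G_def by measurable
  have GA: "(\<integral>\<^sup>+y. G y \<partial>mT) \<le> ennreal A"
  proof -
    have "(\<integral>\<^sup>+y. G y \<partial>mT) \<le> liminf (\<lambda>n. \<integral>\<^sup>+y. ennreal (ln M - q n y) \<partial>mT)"
      unfolding G_def by (rule nn_integral_liminf) measurable
    also have "\<dots> = ennreal A" unfolding nnA by (simp add: Liminf_const)
    finally show ?thesis .
  qed
  then have "(\<integral>\<^sup>+y. G y \<partial>mT) \<noteq> \<infinity>" by (auto simp: top_unique)
  then have fin: "AE y in mT. G y \<noteq> \<infinity>" by (rule nn_integral_PInf_AE[OF Gm])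
  show nz: "AE y in mT. bv \<phi> y \<noteq> 0"
    using fin lim AE_sphere
  proof eventually_elim
    case (elim y)
    show ?case
    proof
      assume 0: "bv \<phi> y = 0"
      have in1: "of_real (r n) * y \<in> ball 0 1" for n using elim(3) by (intro rin) auto
      have "(\<lambda>n. ennreal (ln M - q n y)) \<longlonglongrightarrow> \<infinity>"
        unfolding infinity_ennreal_def tendsto_top_iff_ennreal
      proof (intro allI impI)
        fix l :: real assume "l \<ge> 0"
        have "(\<lambda>n. cmod (\<phi> (of_real (r n) * y))) \<longlonglongrightarrow> 0"
          using tendsto_norm[OF elim(2)] 0 by simp
        then have "eventually (\<lambda>n. cmod (\<phi> (of_real (r n) * y)) < M * exp (- l - 1)) sequentially"
          by (rule order_tendstoD) (use M in simp)
        then show "eventually (\<lambda>n. ennreal l < ennreal (ln M - q n y)) sequentially"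
        proof eventually_elim
          case (elim n)
          have pos: "0 < cmod (\<phi> (of_real (r n) * y))" using nzf[OF in1] by simp
          have "q n y = ln (cmod (\<phi> (of_real (r n) * y)))" unfolding q_def by (rule ReL[OF in1])
          also have "\<dots> \<le> ln (M * exp (- l - 1))" using elim pos by (intro ln_mono) auto
          also have "\<dots> = ln M - l - 1" using M by (simp add: ln_mult)
          finally show ?case using \<open>l \<ge> 0\<close> by (intro ennreal_lessI) auto
        qed
      qed
      then have "G y = \<infinity>" unfolding G_def by (rule lim_imp_Liminf[OF trivial_limit_sequentially])
      then show False using elim(1) by simp
    qed
  qed
  have klim: "AE y in mT. (\<lambda>n. q n y) \<longlonglongrightarrow> k y"
    using nz lim AE_sphere
  proof eventually_elim
    case (elim y)
    have in1: "of_real (r n) * y \<in> ball 0 1" for n using elim(3) by (intro rin) auto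
    have "q n y = ln (cmod (\<phi> (of_real (r n) * y)))" for n unfolding q_def by (rule ReL[OF in1])
    then show ?case unfolding k_def using elim by (auto intro!: tendsto_intros)
  qed
  have km [measurable]: "k \<in> borel_measurable mT" unfolding k_def by measurable
  have kM: "AE y in mT. k y \<le> ln M"
    using bM nz by eventually_elim (use M in \<open>auto simp: k_def intro!: ln_mono\<close>)
  have nnk: "(\<integral>\<^sup>+y. ennreal (ln M - k y) \<partial>mT) \<le> ennreal A"
  proof -
    have "(\<integral>\<^sup>+y. ennreal (ln M - k y) \<partial>mT) = (\<integral>\<^sup>+y. G y \<partial>mT)"
    proof (rule nn_integral_cong_AE)
      show "AE y in mT. ennreal (ln M - k y) = G y"
        using klim
      proof eventually_elim
        case (elim y)
        then have "(\<lambda>n. ennreal (ln M - q n y)) \<longlonglongrightarrow> ennreal (ln M - k y)" by (intro tendsto_intros)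
        then show ?case unfolding G_def by (intro lim_imp_Liminf[symmetric] trivial_limit_sequentially)
      qed
    qed
    then show ?thesis using GA by simp
  qed
  have ikM: "integrable mT (\<lambda>y. ln M - k y)"
  proof (rule integrableI_nonneg)
    show "AE y in mT. 0 \<le> ln M - k y" using kM by eventually_elim simp
    show "(\<integral>\<^sup>+y. ennreal (ln M - k y) \<partial>mT) < \<infinity>" using nnk by (auto intro: le_less_trans)
  qed measurable
  have "integrable mT (\<lambda>y. ln M - (ln M - k y))" by (intro Bochner_Integration.integrable_diff ikM) simp
  then have int_k: "integrable mT k" by simp
  then show "integrable mT (\<lambda>y. ln (cmod (bv \<phi> y)))" by (simp add: k_def[abs_def])
  have "(\<integral>y. k y \<partial>mT) \<le> ln (cmod (\<phi> 0))"
    unfolding k_def by (rule cyclic_log_integral_le[OF p c nz]) (use int_k in \<open>simp add: k_def[abs_def]\<close>)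
  then have Ale: "A \<le> (\<integral>y. ln M - k y \<partial>mT)" using int_k by (simp add: A_def)
  have "(\<lambda>n. \<integral>\<^sup>+y. norm ((ln M - q n y) - (ln M - k y)) \<partial>mT) \<longlonglongrightarrow> 0"
  proof (rule Scheffe_lemma1)
    show "integrable mT (\<lambda>y. ln M - q n y)" for n using ik[of n] by simp
    show "AE y in mT. (\<lambda>n. ln M - q n y) \<longlonglongrightarrow> ln M - k y"
      using klim by eventually_elim (intro tendsto_intros)
    have "(\<integral>\<^sup>+y. ennreal (norm (ln M - q n y)) \<partial>mT) = ennreal A" for n
      unfolding nnA[of n, symmetric] by (rule nn_integral_cong) (use qM in auto)
    then have "limsup (\<lambda>n. \<integral>\<^sup>+y. ennreal (norm (ln M - q n y)) \<partial>mT) = ennreal A" by (simp add: Limsup_const)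
    also have "\<dots> \<le> ennreal (\<integral>y. ln M - k y \<partial>mT)" by (rule ennreal_leI[OF Ale])
    also have "\<dots> = (\<integral>\<^sup>+y. ennreal (ln M - k y) \<partial>mT)"
      by (rule nn_integral_eq_integral[symmetric, OF ikM]) (use kM in \<open>auto elim: eventually_mono\<close>)
    also have "\<dots> = (\<integral>\<^sup>+y. ennreal (norm (ln M - k y)) \<partial>mT)"
      by (rule nn_integral_cong_AE) (use kM in \<open>auto elim!: eventually_mono\<close>)
    finally show "limsup (\<lambda>n. \<integral>\<^sup>+y. ennreal (norm (ln M - q n y)) \<partial>mT) \<le> (\<integral>\<^sup>+y. ennreal (norm (ln M - k y)) \<partial>mT)" .
  qed (rule ikM)
  moreover have "(\<integral>\<^sup>+y. norm ((ln M - q n y) - (ln M - k y)) \<partial>mT) = ennreal (\<integral>y. \<bar>q n y - k y\<bar> \<partial>mT)" for n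
  proof -
    have "(\<integral>\<^sup>+y. norm ((ln M - q n y) - (ln M - k y)) \<partial>mT) = (\<integral>\<^sup>+y. ennreal \<bar>q n y - k y\<bar> \<partial>mT)"
      by (rule nn_integral_cong) (simp add: abs_minus_commute)
    also have "\<dots> = ennreal (\<integral>y. \<bar>q n y - k y\<bar> \<partial>mT)"
      by (rule nn_integral_eq_integral) (use ik int_k in auto)
    finally show ?thesis .
  qed
  ultimately have L1: "(\<lambda>n. \<integral>y. \<bar>q n y - k y\<bar> \<partial>mT) \<longlonglongrightarrow> 0"
    using tendsto_ennrealD[of "\<lambda>n. \<integral>y. \<bar>q n y - k y\<bar> \<partial>mT" 0 sequentially] by (simp add: ennreal_0[symmetric] del: ennreal_0)
  have herg: "L z = \<i> * of_real (Im (L 0)) + herglotz k z" if z: "z \<in> ball 0 1" for z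
  proof -
    have "(\<lambda>n. herglotz (q n) z - herglotz k z) \<longlonglongrightarrow> 0"
    proof (rule Lim_null_comparison)
      show "\<forall>\<^sub>F n in sequentially. norm (herglotz (q n) z - herglotz k z) \<le> 2 / (1 - cmod z) * (\<integral>y. \<bar>q n y - k y\<bar> \<partial>mT)"
      proof (intro always_eventually allI)
        fix n
        have "herglotz (q n) z - herglotz k z = (\<integral>y. (y + z) / (y - z) * of_real (q n y - k y) \<partial>mT)"
          unfolding herglotz_def using herglotz_integrable[OF z ik[of n]] herglotz_integrable[OF z int_k]
          by (simp add: right_diff_distrib)
        also have "norm \<dots> \<le> (\<integral>y. 2 / (1 - cmod z) * \<bar>q n y - k y\<bar> \<partial>mT)"
        proof (rule order_trans[OF integral_norm_bound integral_mono])
          show "integrable mT (\<lambda>y. norm ((y + z) / (y - z) * complex_of_real (q n y - k y)))"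
            by (intro integrable_norm herglotz_integrable z Bochner_Integration.integrable_diff ik int_k)
          fix y assume "y \<in> space mT"
          then show "norm ((y + z) / (y - z) * complex_of_real (q n y - k y)) \<le> 2 / (1 - cmod z) * \<bar>q n y - k y\<bar>"
            unfolding norm_mult norm_of_real by (intro mult_right_mono herglotz_kernel(3) z) auto
        qed (use ik[of n] int_k in auto)
        finally show "norm (herglotz (q n) z - herglotz k z) \<le> 2 / (1 - cmod z) * (\<integral>y. \<bar>q n y - k y\<bar> \<partial>mT)" by simp
      qed
      show "(\<lambda>n. 2 / (1 - cmod z) * (\<integral>y. \<bar>q n y - k y\<bar> \<partial>mT)) \<longlonglongrightarrow> 0"
        by (rule tendsto_mult_right_zero[OF L1])
    qed
    then have 1: "(\<lambda>n. herglotz (q n) z) \<longlonglongrightarrow> herglotz k z" by (simp add: LIM_zero_iff)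
    have "isCont L z" using L(1) z by (intro continuous_on_interior[OF holomorphic_on_imp_continuous_on]) auto
    moreover have "(\<lambda>n. of_real (r n) * z) \<longlonglongrightarrow> z"
      using tendsto_mult[OF tendsto_of_real[OF rl] tendsto_const[of z]] by simp
    ultimately have "(\<lambda>n. L (of_real (r n) * z)) \<longlonglongrightarrow> L z" by (rule isCont_tendsto_compose)
    then have "(\<lambda>n. herglotz (q n) z) \<longlonglongrightarrow> L z - \<i> * of_real (Im (L 0))"
      unfolding hk[OF z] by (intro tendsto_intros)
    from LIMSEQ_unique[OF this 1] show ?thesis by (simp add: algebra_simps)
  qed
  show "\<exists>\<gamma>. cmod \<gamma> = 1 \<and> (\<forall>z\<in>ball 0 1. \<phi> z = \<gamma> * exp (herglotz (\<lambda>y. ln (cmod (bv \<phi> y))) z))"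
  proof (intro exI conjI ballI)
    show "cmod (exp (\<i> * of_real (Im (L 0)))) = 1" by (simp add: norm_exp)
    fix z :: complex assume z: "z \<in> ball 0 1"
    show "\<phi> z = exp (\<i> * of_real (Im (L 0))) * exp (herglotz (\<lambda>y. ln (cmod (bv \<phi> y))) z)"
      unfolding L(2)[OF z] exp_add[symmetric] using herg[OF z] by (simp add: k_def[abs_def])
  qed
qed

corollary cyclic_outer_function:
  assumes p: "\<phi> \<in> Hinf" and c: "cyclic \<phi>"
  shows "outer_function \<phi>"
proof -
  obtain \<gamma> where "cmod \<gamma> = 1" "\<forall>z\<in>ball 0 1. \<phi> z = \<gamma> * exp (herglotz (\<lambda>y. ln (cmod (bv \<phi> y))) z)"
    using cyclic_outer(3)[OF assms] by blast
  then show ?thesis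
    using p cyclic_outer(2)[OF assms] unfolding outer_function_def herglotz_def Hinf_def by blast
qed

text \<open>An outer function is determined by its modulus on the circle up to a constant of modulus \<open>1\<close>.\<close>

corollary cyclic_eq_const_mult:
  assumes p: "\<phi> \<in> Hinf" "cyclic \<phi>" and q: "\<psi> \<in> Hinf" "cyclic \<psi>"
    and eq: "AE y in mT. cmod (bv \<phi> y) = cmod (bv \<psi> y)"
  obtains c where "cmod c = 1" "\<And>z. \<phi> z = c * \<psi> z"
proof -
  obtain \<gamma> where g: "cmod \<gamma> = 1" "\<And>z. z \<in> ball 0 1 \<Longrightarrow> \<phi> z = \<gamma> * exp (herglotz (\<lambda>y. ln (cmod (bv \<phi> y))) z)"
    using cyclic_outer(3)[OF p] by blast
  obtain \<delta> where d: "cmod \<delta> = 1" "\<And>z. z \<in> ball 0 1 \<Longrightarrow> \<psi> z = \<delta> * exp (herglotz (\<lambda>y. ln (cmod (bv \<psi> y))) z)"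
    using cyclic_outer(3)[OF q] by blast
  have same: "herglotz (\<lambda>y. ln (cmod (bv \<phi> y))) z = herglotz (\<lambda>y. ln (cmod (bv \<psi> y))) z" if z: "z \<in> ball 0 1" for z
    unfolding herglotz_def
  proof (rule integral_cong_AE)
    show "AE y in mT. (y + z) / (y - z) * complex_of_real (ln (cmod (bv \<phi> y))) = (y + z) / (y - z) * complex_of_real (ln (cmod (bv \<psi> y)))"
      using eq by eventually_elim simp
  qed (use borel_measurable_integrable[OF herglotz_integrable[OF z cyclic_outer(2)[OF p]]]
        borel_measurable_integrable[OF herglotz_integrable[OF z cyclic_outer(2)[OF q]]] in auto)
  show ?thesis
  proof (rule that[of "\<gamma> * inverse \<delta>"])
    have "\<delta> \<noteq> 0" using d by auto
    show "cmod (\<gamma> * inverse \<delta>) = 1" using g d by (simp add: norm_mult norm_inverse)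
    fix z show "\<phi> z = \<gamma> * inverse \<delta> * \<psi> z"
    proof (cases "z \<in> ball 0 1")
      case True
      then show ?thesis using g(2) d(2) same \<open>\<delta> \<noteq> 0\<close> by simp
    next
      case False
      then show ?thesis using p(1) q(1) by (simp add: Hinf_def disc_holomorphic_def)
    qed
  qed
qed

section \<open>Inner product spaces and the sequence space\<close>

text \<open>The algebraic part of a Hilbert space. The Hardy space enters as such a space, without reference to its completeness
  and separability.\<close>

locale ip_space = vector_space "scl H"
  for H :: "'a::ab_group_add ipspace" +
  assumes subspace_car: "subspace (car H)"
    and ip_add_left: "\<lbrakk>x \<in> car H; y \<in> car H; z \<in> car H\<rbrakk> \<Longrightarrow> ip H (x + y) z = ip H x z + ip H y z"
    and ip_scl_left: "\<lbrakk>x \<in> car H; y \<in> car H\<rbrakk> \<Longrightarrow> ip H (scl H a x) y = a * ip H x y"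
    and ip_cnj: "\<lbrakk>x \<in> car H; y \<in> car H\<rbrakk> \<Longrightarrow> ip H x y = cnj (ip H y x)"
    and ip_nonneg: "x \<in> car H \<Longrightarrow> 0 \<le> Re (ip H x x)"
    and ip_eq_0: "\<lbrakk>x \<in> car H; ip H x x = 0\<rbrakk> \<Longrightarrow> x = 0"
begin

lemma car_closed: "0 \<in> car H" "x \<in> car H \<Longrightarrow> y \<in> car H \<Longrightarrow> x + y \<in> car H"
  "x \<in> car H \<Longrightarrow> scl H a x \<in> car H" "x \<in> car H \<Longrightarrow> y \<in> car H \<Longrightarrow> x - y \<in> car H"
  "(\<And>i. i \<in> I \<Longrightarrow> f i \<in> car H) \<Longrightarrow> sum f I \<in> car H"
  using subspace_car subspace_0 subspace_add subspace_scale subspace_diff by (auto intro: subspace_sum)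

lemma ip_add_right: "\<lbrakk>x \<in> car H; y \<in> car H; z \<in> car H\<rbrakk> \<Longrightarrow> ip H z (x + y) = ip H z x + ip H z y"
  by (metis (no_types, lifting) car_closed(2) complex_cnj_add ip_add_left ip_cnj)

lemma ip_scl_right: "\<lbrakk>x \<in> car H; y \<in> car H\<rbrakk> \<Longrightarrow> ip H x (scl H a y) = cnj a * ip H x y"
  by (metis (no_types, lifting) car_closed(3) complex_cnj_mult ip_scl_left ip_cnj)

lemma ip_zero_left: "y \<in> car H \<Longrightarrow> ip H 0 y = 0"
  using ip_scl_left[of 0 y 0] car_closed(1) scale_zero_left by simp

lemma ip_sum_left: "finite I \<Longrightarrow> (\<And>i. i \<in> I \<Longrightarrow> f i \<in> car H) \<Longrightarrow> y \<in> car H \<Longrightarrow> ip H (sum f I) y = (\<Sum>i\<in>I. ip H (f i) y)"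
  by (induction I rule: finite_induct) (auto simp: ip_zero_left ip_add_left car_closed)

lemma ip_sum_right: "finite I \<Longrightarrow> (\<And>i. i \<in> I \<Longrightarrow> f i \<in> car H) \<Longrightarrow> y \<in> car H \<Longrightarrow> ip H y (sum f I) = (\<Sum>i\<in>I. ip H y (f i))"
  using ip_sum_left[of I f y] ip_cnj[of y "sum f I"] ip_cnj[of y] car_closed(5)[of I f] by (simp add: cnj_sum)

lemma ip_self: "x \<in> car H \<Longrightarrow> ip H x x = of_real ((hnorm H x)\<^sup>2)"
  using ip_cnj[of x x] ip_nonneg[of x] by (simp add: hnorm_def complex_eq_iff)

lemma hnorm_nonneg: "x \<in> car H \<Longrightarrow> hnorm H x \<ge> 0"
  using ip_nonneg by (simp add: hnorm_def)

lemma hnorm_scl: "x \<in> car H \<Longrightarrow> hnorm H (scl H a x) = cmod a * hnorm H x"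
proof -
  assume x: "x \<in> car H"
  have "of_real ((hnorm H (scl H a x))\<^sup>2) = ip H (scl H a x) (scl H a x)" by (simp only: ip_self car_closed x)
  also have "\<dots> = of_real ((cmod a * hnorm H x)\<^sup>2)"
  proof -
    have "ip H (scl H a x) (scl H a x) = (a * cnj a) * ip H x x"
      using x by (simp add: ip_scl_left ip_scl_right car_closed)
    also have "\<dots> = of_real ((cmod a)\<^sup>2) * of_real ((hnorm H x)\<^sup>2)"
      by (simp only: ip_self[OF x] complex_norm_square)
    finally show ?thesis by (simp add: power_mult_distrib)
  qed
  finally have "(hnorm H (scl H a x))\<^sup>2 = (cmod a * hnorm H x)\<^sup>2" using of_real_eq_iff by blast
  then show ?thesis using hnorm_nonneg x car_closed by (simp add: power2_eq_iff_nonneg)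
qed

lemma hnorm_add_sq:
  assumes "x \<in> car H" "y \<in> car H"
  shows "(hnorm H (x + y))\<^sup>2 = (hnorm H x)\<^sup>2 + (hnorm H y)\<^sup>2 + 2 * Re (ip H x y)"
proof -
  have "of_real ((hnorm H (x + y))\<^sup>2) = ip H x x + ip H y y + (ip H x y + ip H y x)"
    using assms by (simp only: ip_self[symmetric] car_closed) (simp add: ip_add_left ip_add_right car_closed)
  also have "ip H y x = cnj (ip H x y)" by (rule ip_cnj[OF assms(2,1)])
  finally show ?thesis using assms by (simp add: ip_self complex_eq_iff)
qed

lemma ip_Cauchy_Schwarz:
  assumes x: "x \<in> car H" and y: "y \<in> car H"
  shows "cmod (ip H x y) \<le> hnorm H x * hnorm H y"
proof -
  define e where "e = (if ip H x y = 0 then 1 else - ip H x y / of_real (cmod (ip H x y)))"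
  have e: "cmod e = 1" by (simp add: e_def norm_divide)
  have Re: "Re (ip H x (scl H e y)) = - cmod (ip H x y)"
  proof (cases "ip H x y = 0")
    case False
    have "ip H x (scl H e y) = cnj e * ip H x y" by (rule ip_scl_right[OF x y])
    also have "\<dots> = - (ip H x y * cnj (ip H x y)) / of_real (cmod (ip H x y))"
      using False by (simp add: e_def mult.commute)
    also have "\<dots> = of_real (- cmod (ip H x y))"
      using False by (simp add: complex_norm_square[symmetric] power2_eq_square)
    finally show ?thesis by simp
  qed (simp add: ip_scl_right x y)
  have "(cmod (ip H x y))\<^sup>2 \<le> (hnorm H x)\<^sup>2 * (hnorm H y)\<^sup>2"
  proof (rule sq_le_mult_of_AM_GM)
    fix t :: real assume t: "t > 0"
    define s where "s = complex_of_real (sqrt t)"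
    define w where "w = scl H s x + scl H (e / s) y"
    have s: "cmod s = sqrt t" "s \<noteq> 0" using t by (auto simp: s_def)
    have m: "scl H s x \<in> car H" "scl H (e / s) y \<in> car H" using x y car_closed by auto
    have "0 \<le> (hnorm H w)\<^sup>2" by simp
    also have "\<dots> = t * (hnorm H x)\<^sup>2 + (hnorm H y)\<^sup>2 / t + 2 * Re (ip H (scl H s x) (scl H (e / s) y))"
      unfolding w_def hnorm_add_sq[OF m] using x y t by (simp add: hnorm_scl s e norm_divide power_mult_distrib power_divide)
    also have "ip H (scl H s x) (scl H (e / s) y) = ip H x (scl H e y)"
      using x y s by (simp add: ip_scl_left ip_scl_right car_closed s_def)
    finally show "2 * cmod (ip H x y) \<le> t * (hnorm H x)\<^sup>2 + (hnorm H y)\<^sup>2 / t" using Re by simp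
  qed auto
  then have "(cmod (ip H x y))\<^sup>2 \<le> (hnorm H x * hnorm H y)\<^sup>2" by (simp add: power_mult_distrib)
  then show ?thesis by (rule power2_le_imp_le) (simp add: hnorm_nonneg x y)
qed

lemma hnorm_triangle:
  assumes x: "x \<in> car H" and y: "y \<in> car H"
  shows "hnorm H (x + y) \<le> hnorm H x + hnorm H y"
proof (rule power2_le_imp_le)
  have "Re (ip H x y) \<le> hnorm H x * hnorm H y"
    using complex_Re_le_cmod[of "ip H x y"] ip_Cauchy_Schwarz[OF assms] by linarith
  then show "(hnorm H (x + y))\<^sup>2 \<le> (hnorm H x + hnorm H y)\<^sup>2"
    by (simp add: hnorm_add_sq[OF assms] power2_sum)
qed (simp add: hnorm_nonneg x y)

lemma hnorm_eq_0: "x \<in> car H \<Longrightarrow> hnorm H x = 0 \<longleftrightarrow> x = 0"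
  using ip_self[of x] ip_eq_0[of x] ip_zero_left[OF car_closed(1)] by (auto simp: hnorm_def)

lemma hnorm_minus_commute: "x \<in> car H \<Longrightarrow> y \<in> car H \<Longrightarrow> hnorm H (x - y) = hnorm H (y - x)"
proof -
  assume "x \<in> car H" "y \<in> car H"
  then have "x - y \<in> car H" by (rule car_closed)
  moreover have "scl H (-1) (x - y) = y - x"
    using scale_minus_left[of 1 "x - y"] scale_one[of "x - y"] by simp
  ultimately show ?thesis using hnorm_scl[of "x - y" "-1"] by (simp only:) simp
qed

lemma Metric_space_hdist: "Metric_space (car H) (hdist H)"
proof
  show "0 \<le> hdist H x y" for x y by (simp add: hdist_def hnorm_nonneg car_closed)
  show "hdist H x y = hdist H y x" for x y by (simp add: hdist_def hnorm_minus_commute)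
  show "(hdist H x y = 0) = (x = y)" if "x \<in> car H" "y \<in> car H" for x y
    using that by (simp add: hdist_def hnorm_eq_0 car_closed)
  show "hdist H x z \<le> hdist H x y + hdist H y z" if "x \<in> car H" "y \<in> car H" "z \<in> car H" for x y z
    using that hnorm_triangle[of "x - y" "y - z"] by (simp add: hdist_def car_closed)
qed

lemma closure_htop:
  assumes "S \<subseteq> car H"
  shows "x \<in> htop H closure_of S \<longleftrightarrow> x \<in> car H \<and> (\<forall>e>0. \<exists>y\<in>S. hnorm H (x - y) < e)"
proof -
  interpret Metric_space "car H" "hdist H" by (rule Metric_space_hdist)
  show ?thesis
    unfolding htop_def metric_closure_of using assms by (auto simp: mball_def hdist_def subset_iff)
qed

lemma closure_htop_sequence:
  assumes "S \<subseteq> car H"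
  shows "x \<in> htop H closure_of S \<longleftrightarrow> x \<in> car H \<and> (\<exists>s. (\<forall>n. s n \<in> S) \<and> (\<lambda>n. hnorm H (x - s n)) \<longlonglongrightarrow> 0)"
proof
  assume "x \<in> htop H closure_of S"
  then have x: "x \<in> car H" "\<And>e. e > 0 \<Longrightarrow> \<exists>y\<in>S. hnorm H (x - y) < e" unfolding closure_htop[OF assms] by auto
  have "\<exists>y. y \<in> S \<and> hnorm H (x - y) < inverse (real (Suc n))" for n
    using x(2)[of "inverse (real (Suc n))"] by auto
  then obtain s where s: "\<And>n. s n \<in> S" "\<And>n. hnorm H (x - s n) < inverse (real (Suc n))" by metis
  have "(\<lambda>n. hnorm H (x - s n)) \<longlonglongrightarrow> 0"
  proof (rule Lim_null_comparison[OF _ LIMSEQ_inverse_real_of_nat])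
    show "\<forall>\<^sub>F n in sequentially. norm (hnorm H (x - s n)) \<le> inverse (real (Suc n))"
    proof (intro always_eventually allI)
      fix n
      have "hnorm H (x - s n) \<ge> 0" using s(1)[of n] assms x(1) by (intro hnorm_nonneg car_closed) auto
      then show "norm (hnorm H (x - s n)) \<le> inverse (real (Suc n))" using s(2)[of n] by simp
    qed
  qed
  then show "x \<in> car H \<and> (\<exists>s. (\<forall>n. s n \<in> S) \<and> (\<lambda>n. hnorm H (x - s n)) \<longlonglongrightarrow> 0)" using x(1) s(1) by blast
next
  assume "x \<in> car H \<and> (\<exists>s. (\<forall>n. s n \<in> S) \<and> (\<lambda>n. hnorm H (x - s n)) \<longlonglongrightarrow> 0)"
  then obtain s where x: "x \<in> car H" and s: "\<And>n. s n \<in> S" "(\<lambda>n. hnorm H (x - s n)) \<longlonglongrightarrow> 0" by blast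
  have "\<exists>y\<in>S. hnorm H (x - y) < e" if e: "e > 0" for e
  proof -
    obtain n where "hnorm H (x - s n) < e"
      using order_tendstoD(2)[OF s(2) e] by (auto simp: eventually_sequentially)
    then show ?thesis using s(1) by blast
  qed
  then show "x \<in> htop H closure_of S" unfolding closure_htop[OF assms] using x by blast
qed

text \<open>Polarization, with the multiples by \<open>1\<close> and \<open>\<i>\<close>.\<close>

lemma isometry_ip:
  assumes U: "U \<in> isometries H" and x: "x \<in> car H" and y: "y \<in> car H"
  shows "ip H (U x) (U y) = ip H x y"
proof -
  have Uc: "U z \<in> car H" if "z \<in> car H" for z using U that by (auto simp: isometries_def transformations_def)
  have add: "U (a + b) = U a + U b" if "a \<in> car H" "b \<in> car H" for a b
    using U that by (auto simp: isometries_def transformations_def)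
  have sc: "U (scl H c a) = scl H c (U a)" if "a \<in> car H" for a c
    using U that by (auto simp: isometries_def transformations_def)
  have n: "hnorm H (U a) = hnorm H a" if "a \<in> car H" for a
    using U that by (auto simp: isometries_def)
  have Re: "Re (ip H (U a) (U b)) = Re (ip H a b)" if a: "a \<in> car H" and b: "b \<in> car H" for a b
    using hnorm_add_sq[OF a b] hnorm_add_sq[OF Uc[OF a] Uc[OF b]] n[OF a] n[OF b] n[OF car_closed(2)[OF a b]] add[OF a b] by simp
  have "Re (ip H (U x) (U (scl H \<i> y))) = Re (ip H x (scl H \<i> y))" by (intro Re x car_closed y)
  then have "Im (ip H (U x) (U y)) = Im (ip H x y)"
    using x y by (simp add: sc ip_scl_right Uc)
  with Re[OF x y] show ?thesis by (simp add: complex_eq_iff)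
qed

end

sublocale separable_hilbert_space \<subseteq> ip_space
  by unfold_locales (fact subspace_car ip_add_left ip_scl_left ip_cnj ip_nonneg ip_eq_0)+

interpretation H2: ip_space H2
proof -
  have vs: "vector_space (scl H2)"
    by unfold_locales (auto simp: scl_H2 plus_fun_def ring_distribs mult.assoc)
  interpret vector_space "scl H2" by (rule vs)
  show "ip_space H2"
  proof unfold_locales
    show "subspace (car H2)"
      unfolding subspace_def by (auto simp: scl_H2 H2_add H2_cmult)
    fix x x' z :: "complex \<Rightarrow> complex" and a
    show "ip H2 (x + x') z = ip H2 x z + ip H2 x' z" if "x \<in> car H2" "x' \<in> car H2" "z \<in> car H2"
    proof -
      have "lip (bv (x + x')) (bv z) = lip (\<lambda>y. bv x y + bv x' y) (bv z)"
        by (rule lip_cong_AE) (use that in \<open>auto intro!: H2_E H2_add L2_add AE_bv_add\<close>)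
      then show ?thesis using that by (simp add: ip_H2 lip_add_left H2_E)
    qed
    show "ip H2 (scl H2 a x) x' = a * ip H2 x x'" if "x \<in> car H2" "x' \<in> car H2"
    proof -
      have "lip (bv (\<lambda>z. a * x z)) (bv x') = lip (\<lambda>y. a * bv x y) (bv x')"
        by (rule lip_cong_AE) (use that in \<open>auto intro!: H2_E H2_cmult L2_cmult AE_bv_cmult\<close>)
      then show ?thesis by (simp add: ip_H2 scl_H2 lip_cmult_left)
    qed
    show "ip H2 x x' = cnj (ip H2 x' x)" by (simp add: ip_H2 lip_cnj)
    show "0 \<le> Re (ip H2 x x)" by (simp add: ip_H2 lip_self)
    show "x = 0" if "x \<in> car H2" "ip H2 x x = 0" using that H2_norm_0 by (simp add: ip_H2 lip_self)
  qed
qed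

definition ell2 :: "(nat \<Rightarrow> complex) ipspace" where
  "ell2 = \<lparr>car = Collect l2, scl = (\<lambda>c a n. c * a n), ip = (\<lambda>a b. \<Sum>n. a n * cnj (b n))\<rparr>"

lemma ell2_simps: "car ell2 = Collect l2" "scl ell2 c a = (\<lambda>n. c * a n)" "ip ell2 a b = (\<Sum>n. a n * cnj (b n))"
  by (simp_all add: ell2_def)

lemma l2_mult_summable:
  assumes "l2 a" "l2 b" shows "summable (\<lambda>n. a n * cnj (b n))"
proof (rule summable_norm_cancel, rule summable_comparison_test')
  show "summable (\<lambda>n. (cmod (a n))\<^sup>2 + (cmod (b n))\<^sup>2)" using assms by (auto simp: l2_def intro: summable_add)
  fix n
  have "2 * cmod (a n) * cmod (b n) \<le> (cmod (a n))\<^sup>2 + (cmod (b n))\<^sup>2" by (rule sum_squares_bound)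
  moreover have "0 \<le> cmod (a n) * cmod (b n)" by simp
  ultimately have "cmod (a n) * cmod (b n) \<le> (cmod (a n))\<^sup>2 + (cmod (b n))\<^sup>2" by linarith
  then show "norm (norm (a n * cnj (b n))) \<le> (cmod (a n))\<^sup>2 + (cmod (b n))\<^sup>2" by (simp add: norm_mult)
qed

lemma ip_ell2_self: "l2 a \<Longrightarrow> ip ell2 a a = of_real (\<Sum>n. (cmod (a n))\<^sup>2)"
proof -
  assume a: "l2 a"
  then have "(\<lambda>n. (cmod (a n))\<^sup>2) sums (\<Sum>n. (cmod (a n))\<^sup>2)" by (simp add: l2_def summable_sums)
  then have "(\<lambda>n. complex_of_real ((cmod (a n))\<^sup>2)) sums of_real (\<Sum>n. (cmod (a n))\<^sup>2)" by (rule sums_of_real)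
  then show ?thesis unfolding ell2_simps complex_norm_square by (simp add: sums_iff)
qed

lemma hnorm_ell2: "l2 a \<Longrightarrow> hnorm ell2 a = sqrt (\<Sum>n. (cmod (a n))\<^sup>2)"
  by (simp add: hnorm_def ip_ell2_self)

interpretation ell2: ip_space ell2
proof -
  have vs: "vector_space (scl ell2)"
    by unfold_locales (auto simp: ell2_simps plus_fun_def ring_distribs mult.assoc)
  interpret vector_space "scl ell2" by (rule vs)
  show "ip_space ell2"
  proof unfold_locales
    show "subspace (car ell2)"
      unfolding subspace_def by (auto simp: ell2_simps plus_fun_def zero_fun_def l2_add l2_cmult) (simp add: l2_def)
    fix x y z :: "nat \<Rightarrow> complex" and a
    show "ip ell2 (x + y) z = ip ell2 x z + ip ell2 y z" if "x \<in> car ell2" "y \<in> car ell2" "z \<in> car ell2"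
      using that suminf_add[OF l2_mult_summable[of x z] l2_mult_summable[of y z]] by (simp add: ell2_simps ring_distribs)
    show "ip ell2 (scl ell2 a x) y = a * ip ell2 x y" if "x \<in> car ell2" "y \<in> car ell2"
      using that suminf_mult[OF l2_mult_summable[of x y], of a] by (simp add: ell2_simps mult.assoc)
    show "ip ell2 x y = cnj (ip ell2 y x)" if "x \<in> car ell2" "y \<in> car ell2"
    proof -
      have "(\<lambda>n. y n * cnj (x n)) sums ip ell2 y x"
        using that l2_mult_summable[of y x] by (simp add: ell2_simps summable_sums)
      then have "(\<lambda>n. x n * cnj (y n)) sums cnj (ip ell2 y x)"
        using sums_cnj[of "\<lambda>n. y n * cnj (x n)"] by (simp add: mult.commute)
      then show ?thesis by (simp add: ell2_simps sums_iff)
    qed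
    show "0 \<le> Re (ip ell2 x x)" if "x \<in> car ell2"
      using that suminf_nonneg[of "\<lambda>n. (cmod (x n))\<^sup>2"] by (simp add: ell2_simps(1) ip_ell2_self l2_def)
    show "x = 0" if "x \<in> car ell2" "ip ell2 x x = 0"
    proof -
      have l: "l2 x" using that by (simp add: ell2_simps)
      then have s: "summable (\<lambda>n. (cmod (x n))\<^sup>2)" by (simp add: l2_def)
      have "(\<Sum>n. (cmod (x n))\<^sup>2) = 0" using that(2) ip_ell2_self[OF l] by simp
      then have "\<forall>n. (cmod (x n))\<^sup>2 = 0" using suminf_eq_zero_iff[OF s] by simp
      then show ?thesis by (simp add: fun_eq_iff)
    qed
  qed
qed

lemma hnorm_ell2_sq_partial:
  assumes "l2 a" shows "(\<Sum>k<M. (cmod (a k))\<^sup>2) \<le> (hnorm ell2 a)\<^sup>2"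
  using assms sum_le_suminf[of "\<lambda>k. (cmod (a k))\<^sup>2" "{..<M}"] suminf_nonneg[of "\<lambda>k. (cmod (a k))\<^sup>2"]
  by (simp add: hnorm_ell2 l2_def)

text \<open>A Cauchy sequence converges in every coordinate, and the limit is controlled through the finite partial sums of the
  norms.\<close>

lemma ell2_mcomplete: "Metric_space.mcomplete (car ell2) (hdist ell2)"
proof -
  interpret Metric_space "car ell2" "hdist ell2" by (rule ell2.Metric_space_hdist)
  show ?thesis unfolding mcomplete_def
  proof (intro allI impI)
    fix \<sigma> assume "MCauchy \<sigma>"
    then have \<sigma>: "\<And>n. l2 (\<sigma> n)" and C: "\<And>e. e > 0 \<Longrightarrow> \<exists>N. \<forall>n m. N \<le> n \<longrightarrow> N \<le> m \<longrightarrow> hdist ell2 (\<sigma> n) (\<sigma> m) < e"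
      unfolding MCauchy_def by (auto simp: ell2_simps)
    have d: "hdist ell2 x y = hnorm ell2 (x - y)" if "l2 x" "l2 y" for x y using that by (simp add: hdist_def ell2_simps)
    have ld: "l2 (x - y)" if "l2 x" "l2 y" for x y using ell2.car_closed(4)[of x y] that by (simp add: ell2_simps)
    have part: "(\<Sum>k<M. (cmod (\<sigma> n k - \<sigma> m k))\<^sup>2) \<le> (hdist ell2 (\<sigma> n) (\<sigma> m))\<^sup>2" for n m M
      using hnorm_ell2_sq_partial[OF ld[OF \<sigma>[of n] \<sigma>[of m]], of M] by (simp add: d \<sigma>)
    have "Cauchy (\<lambda>n. \<sigma> n k)" for k
    proof (rule metric_CauchyI)
      fix e :: real assume "e > 0"
      then obtain N where N: "\<And>n m. N \<le> n \<Longrightarrow> N \<le> m \<Longrightarrow> hdist ell2 (\<sigma> n) (\<sigma> m) < e" using C by blast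
      show "\<exists>M. \<forall>m\<ge>M. \<forall>n\<ge>M. dist (\<sigma> m k) (\<sigma> n k) < e"
      proof (intro exI[of _ N] allI impI)
        fix m n assume mn: "m \<ge> N" "n \<ge> N"
        have "(cmod (\<sigma> m k - \<sigma> n k))\<^sup>2 \<le> (\<Sum>j<Suc k. (cmod (\<sigma> m j - \<sigma> n j))\<^sup>2)"
          by (rule member_le_sum) auto
        also have "\<dots> \<le> (hdist ell2 (\<sigma> m) (\<sigma> n))\<^sup>2" by (rule part)
        finally have "cmod (\<sigma> m k - \<sigma> n k) \<le> hdist ell2 (\<sigma> m) (\<sigma> n)" by (rule power2_le_imp_le) simp
        then show "dist (\<sigma> m k) (\<sigma> n k) < e" using N[OF mn] by (simp add: dist_norm)
      qed
    qed
    then have "\<forall>k. \<exists>l. (\<lambda>n. \<sigma> n k) \<longlonglongrightarrow> l" using Cauchy_convergent convergentD by blast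
    then obtain a where a: "\<And>k. (\<lambda>n. \<sigma> n k) \<longlonglongrightarrow> a k" by metis
    have key: "l2 (\<sigma> n - a) \<and> hnorm ell2 (\<sigma> n - a) \<le> e" if N: "\<And>n m. N \<le> n \<Longrightarrow> N \<le> m \<Longrightarrow> hdist ell2 (\<sigma> n) (\<sigma> m) < e" and n: "n \<ge> N" for n N e
    proof -
      have "0 \<le> e" using N[OF n n] nonneg[of "\<sigma> n" "\<sigma> n"] by linarith
      have p: "(\<Sum>k<M. (cmod (\<sigma> n k - a k))\<^sup>2) \<le> e\<^sup>2" for M
      proof (rule LIMSEQ_le_const2)
        show "(\<lambda>m. \<Sum>k<M. (cmod (\<sigma> n k - \<sigma> m k))\<^sup>2) \<longlonglongrightarrow> (\<Sum>k<M. (cmod (\<sigma> n k - a k))\<^sup>2)" by (intro tendsto_intros a)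
        show "\<exists>N. \<forall>m\<ge>N. (\<Sum>k<M. (cmod (\<sigma> n k - \<sigma> m k))\<^sup>2) \<le> e\<^sup>2"
        proof (intro exI[of _ N] allI impI)
          fix m assume "N \<le> m"
          then have "(hdist ell2 (\<sigma> n) (\<sigma> m))\<^sup>2 \<le> e\<^sup>2" using N[OF n] less_imp_le by (intro power_mono) auto
          then show "(\<Sum>k<M. (cmod (\<sigma> n k - \<sigma> m k))\<^sup>2) \<le> e\<^sup>2" by (rule order_trans[OF part])
        qed
      qed
      have s: "summable (\<lambda>k. (cmod (\<sigma> n k - a k))\<^sup>2)"
      proof (rule bounded_imp_summable)
        show "(\<Sum>k\<le>M. (cmod (\<sigma> n k - a k))\<^sup>2) \<le> e\<^sup>2" for M using p[of "Suc M"] by (simp add: lessThan_Suc_atMost)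
      qed simp
      then have l: "l2 (\<sigma> n - a)" by (simp add: l2_def)
      have "(\<Sum>k. (cmod (\<sigma> n k - a k))\<^sup>2) \<le> e\<^sup>2" by (rule suminf_le_const[OF s p])
      then have "hnorm ell2 (\<sigma> n - a) \<le> e" using \<open>0 \<le> e\<close> by (simp add: hnorm_ell2[OF l] real_le_lsqrt)
      with l show ?thesis by blast
    qed
    have la: "l2 a"
    proof -
      obtain N where "\<And>n m. N \<le> n \<Longrightarrow> N \<le> m \<Longrightarrow> hdist ell2 (\<sigma> n) (\<sigma> m) < 1" using C[of 1] by auto
      then have "l2 (\<sigma> N - a)" using key[of N 1 N] by blast
      from ld[OF \<sigma>[of N] this] show ?thesis by simp
    qed
    show "\<exists>x. limitin mtopology \<sigma> x sequentially"
    proof (intro exI[of _ a])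
      show "limitin mtopology \<sigma> a sequentially"
        unfolding limit_metric_sequentially
      proof (intro conjI allI impI)
        show "a \<in> car ell2" using la by (simp add: ell2_simps)
        fix e :: real assume "e > 0"
        then obtain N where N: "\<And>n m. N \<le> n \<Longrightarrow> N \<le> m \<Longrightarrow> hdist ell2 (\<sigma> n) (\<sigma> m) < e/2" using C[of "e/2"] by auto
        show "\<exists>N. \<forall>n\<ge>N. \<sigma> n \<in> car ell2 \<and> hdist ell2 (\<sigma> n) a < e"
        proof (intro exI[of _ N] allI impI conjI)
          fix n assume "N \<le> n"
          then have "hnorm ell2 (\<sigma> n - a) \<le> e/2" using key[of N "e/2" n] N by blast
          then show "hdist ell2 (\<sigma> n) a < e" using \<open>e > 0\<close> by (simp add: d \<sigma> la)
          show "\<sigma> n \<in> car ell2" using \<sigma> by (simp add: ell2_simps)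
        qed
      qed
    qed
  qed
qed

text \<open>Finite sequences with entries in a countable dense set of complex numbers approximate first a truncation, then the
  sequence.\<close>

lemma ell2_separable: "separable_space (htop ell2)"
proof -
  interpret Metric_space "car ell2" "hdist ell2" by (rule ell2.Metric_space_hdist)
  obtain D :: "complex set" where D: "countable D" "\<And>X. open X \<Longrightarrow> X \<noteq> {} \<Longrightarrow> \<exists>d\<in>D. d \<in> X"
    using countable_dense_setE by metis
  define f where "f xs = (\<lambda>k. if k < length xs then xs ! k else (0::complex))" for xs
  have lf: "l2 (f xs)" for xs unfolding l2_def by (rule summable_finite[of "{..<length xs}"]) (auto simp: f_def)
  have sub: "f ` lists D \<subseteq> car ell2" using lf by (auto simp: ell2_simps)
  have "htop ell2 closure_of (f ` lists D) = car ell2"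
  proof (intro equalityI subsetI)
    fix a assume "a \<in> car ell2"
    then have a: "l2 a" by (simp add: ell2_simps)
    show "a \<in> htop ell2 closure_of (f ` lists D)"
      unfolding ell2.closure_htop[OF sub]
    proof (intro conjI allI impI)
      fix e :: real assume e: "e > 0"
      have "eventually (\<lambda>N. (\<Sum>n. (cmod (l2_tail a N n))\<^sup>2) < e\<^sup>2 / 2) sequentially"
        by (rule order_tendstoD(2)[OF l2_tail_norm_tendsto_0[OF a]]) (use e in simp)
      then obtain N where N: "(\<Sum>n. (cmod (l2_tail a N n))\<^sup>2) < e\<^sup>2 / 2" by (auto simp: eventually_sequentially)
      define \<delta> where "\<delta> = sqrt (e\<^sup>2 / (2 * (real N + 1)))"
      have \<delta>: "\<delta> > 0" "\<delta>\<^sup>2 = e\<^sup>2 / (2 * (real N + 1))" using e by (auto simp: \<delta>_def)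
      have "\<exists>d\<in>D. d \<in> ball (a k) \<delta>" for k using \<delta>(1) by (intro D(2)) auto
      then obtain d where d: "\<And>k. d k \<in> D" "\<And>k. d k \<in> ball (a k) \<delta>" by metis
      define xs where "xs = map d [0..<N]"
      have xs: "xs \<in> lists D" using d by (auto simp: xs_def)
      have l: "l2 (a - f xs)" using ell2.car_closed(4)[of a "f xs"] a lf by (simp add: ell2_simps)
      have "(\<Sum>k. (cmod (a k - f xs k))\<^sup>2) = (\<Sum>k. (cmod (l2_tail a N k))\<^sup>2) + (\<Sum>k<N. (cmod (a k - d k))\<^sup>2)"
      proof -
        have "(\<lambda>k. (cmod (l2_tail a N k))\<^sup>2 + (if k < N then (cmod (a k - d k))\<^sup>2 else 0)) sums
           ((\<Sum>k. (cmod (l2_tail a N k))\<^sup>2) + (\<Sum>k<N. (cmod (a k - d k))\<^sup>2))"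
          using sums_If_finite_set[of "{..<N}" "\<lambda>k. (cmod (a k - d k))\<^sup>2"] l2_l2_tail[OF a, of N]
          by (intro sums_add) (auto simp: l2_def summable_sums)
        moreover have "(\<lambda>k. (cmod (l2_tail a N k))\<^sup>2 + (if k < N then (cmod (a k - d k))\<^sup>2 else 0)) = (\<lambda>k. (cmod (a k - f xs k))\<^sup>2)"
          by (auto simp: l2_tail_def f_def xs_def)
        ultimately show ?thesis by (simp add: sums_iff)
      qed
      also have "(\<Sum>k<N. (cmod (a k - d k))\<^sup>2) \<le> (\<Sum>k<N. \<delta>\<^sup>2)"
      proof (rule sum_mono)
        fix k show "(cmod (a k - d k))\<^sup>2 \<le> \<delta>\<^sup>2"
          using d(2)[of k] by (intro power_mono) (auto simp: dist_norm)
      qed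
      also have "(\<Sum>k<N. \<delta>\<^sup>2) \<le> e\<^sup>2 / 2"
      proof -
        have "real N * e\<^sup>2 \<le> (real N + 1) * e\<^sup>2" by (intro mult_right_mono) auto
        then show ?thesis by (simp add: \<delta>(2) divide_le_eq algebra_simps)
      qed
      finally have "(\<Sum>k. (cmod (a k - f xs k))\<^sup>2) < e\<^sup>2" using N by simp
      then have "hnorm ell2 (a - f xs) < sqrt (e\<^sup>2)" unfolding hnorm_ell2[OF l] by (simp del: real_sqrt_abs)
      then have "hnorm ell2 (a - f xs) < e" using e by simp
      then show "\<exists>y\<in>f ` lists D. hnorm ell2 (a - y) < e" using xs by blast
    qed (use a in \<open>simp add: ell2_simps\<close>)
  qed (use ell2.closure_htop[OF sub] in blast)
  moreover have "countable (f ` lists D)" using D(1) by auto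
  ultimately show ?thesis unfolding separable_space_def using sub by (metis htop_def topspace_mtopology)
qed

theorem ell2_hilbert: "separable_hilbert_space ell2"
  by unfold_locales (fact ell2.subspace_car ell2.ip_add_left ell2.ip_scl_left ell2.ip_cnj ell2.ip_nonneg ell2.ip_eq_0 ell2_mcomplete ell2_separable)+

lemma ell2_permute:
  assumes p: "bij p" and a: "l2 a"
  shows "l2 (\<lambda>n. a (p n))" "hnorm ell2 (\<lambda>n. a (p n)) = hnorm ell2 a"
proof -
  have "((\<lambda>n. (cmod (a n))\<^sup>2) has_sum (\<Sum>n. (cmod (a n))\<^sup>2)) UNIV"
    using a by (intro norm_summable_imp_has_sum summable_sums) (auto simp: l2_def)
  then have "((\<lambda>n. (cmod (a n))\<^sup>2) has_sum (\<Sum>n. (cmod (a n))\<^sup>2)) (range p)" using p by (simp add: bij_def)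
  then have "((\<lambda>n. (cmod (a (p n)))\<^sup>2) has_sum (\<Sum>n. (cmod (a n))\<^sup>2)) UNIV"
    using p by (subst (asm) has_sum_reindex) (auto simp: bij_def o_def)
  then have s: "(\<lambda>n. (cmod (a (p n)))\<^sup>2) sums (\<Sum>n. (cmod (a n))\<^sup>2)" by (rule has_sum_imp_sums)
  then show l: "l2 (\<lambda>n. a (p n))" by (simp add: l2_def sums_iff)
  show "hnorm ell2 (\<lambda>n. a (p n)) = hnorm ell2 a" using s by (simp add: hnorm_ell2 a l sums_iff)
qed

section \<open>Inner functions and model spaces\<close>

lemma H2_eq_tc: "f \<in> car H2 \<Longrightarrow> g \<in> car H2 \<Longrightarrow> (\<And>n. tc f n = tc g n) \<Longrightarrow> f = g"
  using H2_E(2)[of f] H2_E(2)[of g] by (metis ext)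

definition zmul :: "(complex \<Rightarrow> complex) \<Rightarrow> complex \<Rightarrow> complex" where
  "zmul f = (\<lambda>z. z * f z)"

lemma mono_disc_Hinf: "mono_disc n \<in> Hinf"
proof -
  have "bounded (mono_disc n ` ball 0 1)"
    by (rule boundedI[where B = 1]) (auto simp: mono_disc_def on_disc_def norm_power power_le_one)
  then show ?thesis using H2_E(5)[OF mono_disc_H2, of n] by (simp add: Hinf_def)
qed

lemma zmul_H2 [simp]: "f \<in> car H2 \<Longrightarrow> zmul f \<in> car H2"
proof -
  assume f: "f \<in> car H2"
  have "zmul f = mono_disc 1 * f"
    using H2_outside[OF f] by (auto simp: zmul_def mono_disc_def on_disc_def times_fun_def)
  then show ?thesis using Hinf_mult[OF mono_disc_Hinf f] by simp
qed

lemma bv_zmul: "f \<in> car H2 \<Longrightarrow> AE y in mT. bv (zmul f) y = y * bv f y"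
  unfolding zmul_def by (intro has_bv_imp has_bv_shift H2_E)

lemma lip_cong_AE': "AE y in mT. f y * cnj (g y) = f' y * cnj (g' y) \<Longrightarrow> L2 f \<Longrightarrow> L2 g \<Longrightarrow> L2 f' \<Longrightarrow> L2 g' \<Longrightarrow> lip f g = lip f' g'"
  unfolding lip_def by (rule integral_cong_AE) (auto dest!: L2_measurable)

lemma L2_mult_id [simp]: "L2 h \<Longrightarrow> L2 (\<lambda>y. y * h y)" "L2 h \<Longrightarrow> L2 (\<lambda>y. cnj y * h y)"
proof -
  assume h: "L2 h"
  show "L2 (\<lambda>y. y * h y)" 
    by (rule L2_bounded_mult(1)[OF h, where B = 1]) (auto intro!: borel_measurable_mT_continuous continuous_intros AE_I2)
  show "L2 (\<lambda>y. cnj y * h y)" 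
    by (rule L2_bounded_mult(1)[OF h, where B = 1]) (auto intro!: borel_measurable_mT_continuous continuous_intros AE_I2)
qed

lemma tc_zmul:
  assumes f: "f \<in> car H2"
  shows "tc (zmul f) 0 = 0" "tc (zmul f) (Suc n) = tc f n"
proof -
  have eq: "lip (bv (zmul f)) (\<lambda>y. y ^ n) = lip (\<lambda>y. y * bv f y) (\<lambda>y. y ^ n)" for n
    by (rule lip_cong_AE) (use f in \<open>auto intro!: H2_E bv_zmul L2_mult_id zmul_H2\<close>)
  have "lip (\<lambda>y. y * bv f y) (\<lambda>y. y ^ 0) = lip (bv f) (\<lambda>y. cnj y ^ Suc 0)"
    by (simp add: lip_def mult.commute)
  then show "tc (zmul f) 0 = 0" using H2_bv_cnj_power[OF f, of 0] eq[of 0] by (simp add: tc_def)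
  have "lip (\<lambda>y. y * bv f y) (\<lambda>y. y ^ Suc n) = lip (bv f) (\<lambda>y. y ^ n)"
    unfolding lip_def
  proof (rule Bochner_Integration.integral_cong[OF refl])
    fix y assume "y \<in> space mT"
    then have "y * cnj y = 1" by (simp add: sphere_cnj)
    then show "y * bv f y * cnj (y ^ Suc n) = bv f y * cnj (y ^ n)" by (simp add: mult_ac)
  qed
  then show "tc (zmul f) (Suc n) = tc f n" using eq[of "Suc n"] by (simp add: tc_def)
qed

lemma tc_add: "f \<in> car H2 \<Longrightarrow> g \<in> car H2 \<Longrightarrow> tc (f + g) n = tc f n + tc g n"
proof -
  assume fg: "f \<in> car H2" "g \<in> car H2"
  have "lip (bv (f + g)) (\<lambda>y. y ^ n) = lip (\<lambda>y. bv f y + bv g y) (\<lambda>y. y ^ n)"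
    by (rule lip_cong_AE) (use fg in \<open>auto intro!: H2_E H2_add L2_add AE_bv_add\<close>)
  then show ?thesis using fg by (simp add: tc_def lip_add_left H2_E)
qed

lemma tc_cmult: "f \<in> car H2 \<Longrightarrow> tc (\<lambda>z. c * f z) n = c * tc f n"
proof -
  assume f: "f \<in> car H2"
  have "lip (bv (\<lambda>z. c * f z)) (\<lambda>y. y ^ n) = lip (\<lambda>y. c * bv f y) (\<lambda>y. y ^ n)"
    by (rule lip_cong_AE) (use f in \<open>auto intro!: H2_E H2_cmult L2_cmult AE_bv_cmult\<close>)
  then show ?thesis by (simp add: tc_def lip_cmult_left)
qed

lemma tc_diff: "f \<in> car H2 \<Longrightarrow> g \<in> car H2 \<Longrightarrow> tc (f - g) n = tc f n - tc g n"
  using tc_add[of f "\<lambda>z. -1 * g z" n] H2_cmult[of g "-1"] tc_cmult[of g "-1" n] by (simp add: fun_diff_def plus_fun_def)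

lemma tc_one_disc: "tc one_disc n = (if n = 0 then 1 else 0)"
proof -
  have "tc one_disc n = lip (psum (\<lambda>_. 1) 1) (\<lambda>y. y ^ n)"
    unfolding tc_def lip_def by (rule Bochner_Integration.integral_cong) (auto simp: bv_one_disc psum_def)
  then show ?thesis using lip_psum_power[of "\<lambda>_. 1" 1 n] by simp
qed

lemma tc_zero [simp]: "tc 0 n = 0"
proof -
  have "(\<lambda>z. 0 * one_disc z) = 0" by (rule ext) simp
  moreover have "tc (\<lambda>z. 0 * one_disc z) n = 0" by (subst tc_cmult) simp_all
  ultimately show ?thesis by (simp only:)
qed

lemma H2_eq_0: "f \<in> car H2 \<Longrightarrow> (\<And>n. tc f n = 0) \<Longrightarrow> f = 0"
  by (rule H2_eq_tc) auto

text \<open>The Toeplitz operator with symbol \<open>cnj u\<close>, the adjoint of multiplication by \<open>u\<close>.\<close>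

definition toep :: "(complex \<Rightarrow> complex) \<Rightarrow> (complex \<Rightarrow> complex) \<Rightarrow> complex \<Rightarrow> complex" where
  "toep u f = rproj (\<lambda>y. cnj (bv u y) * bv f y)"

text \<open>The functional measuring the failure of \<open>toep u\<close> to commute with multiplication by the variable, see
  \<open>toep_zmul\<close>.\<close>

definition tfun :: "(complex \<Rightarrow> complex) \<Rightarrow> (complex \<Rightarrow> complex) \<Rightarrow> complex" where
  "tfun u f = lip (\<lambda>y. y * bv f y) (bv u)"

lemma Hinf_bv_bounded: "u \<in> Hinf \<Longrightarrow> \<exists>M. AE y in mT. cmod (bv u y) \<le> M"
  using Hinf_bound Hinf_bv_bound by metis

lemma L2_cnj_mult:
  assumes "u \<in> Hinf" "L2 h" shows "L2 (\<lambda>y. cnj (bv u y) * h y)" "L2 (\<lambda>y. bv u y * h y)"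
proof -
  obtain M where M: "AE y in mT. cmod (bv u y) \<le> M" using Hinf_bv_bounded[OF assms(1)] by blast
  have m: "bv u \<in> borel_measurable mT" by (intro L2_measurable H2_E Hinf_H2 assms)
  show "L2 (\<lambda>y. cnj (bv u y) * h y)" "L2 (\<lambda>y. bv u y * h y)"
    by (rule L2_bounded_mult(1)[OF assms(2), where B = M]; use M m in simp)+
qed

lemma toep_H2: "u \<in> Hinf \<Longrightarrow> f \<in> car H2 \<Longrightarrow> toep u f \<in> car H2"
  unfolding toep_def by (intro rproj_H2 L2_cnj_mult H2_E)

lemma tc_toep: 
  assumes "u \<in> Hinf" "f \<in> car H2" 
  shows "tc (toep u f) n = lip (\<lambda>y. cnj (bv u y) * bv f y) (\<lambda>y. y ^ n)"
  unfolding toep_def by (intro tc_rproj L2_cnj_mult H2_E assms)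

lemma lip_toep:
  assumes u: "u \<in> Hinf" and f: "f \<in> car H2" and g: "g \<in> car H2"
  shows "lip (bv (toep u f)) (bv g) = lip (bv f) (bv (u * g))"
proof -
  have "lip (bv (toep u f)) (bv g) = lip (\<lambda>y. cnj (bv u y) * bv f y) (bv g)"
    unfolding toep_def by (intro lip_rproj[symmetric] L2_cnj_mult H2_E u f g)
  also have "\<dots> = lip (bv f) (bv (u * g))"
  proof (rule lip_cong_AE')
    show "AE y in mT. cnj (bv u y) * bv f y * cnj (bv g y) = bv f y * cnj (bv (u * g) y)"
      using bv_Hinf_mult[OF u g] by eventually_elim simp
  qed (intro L2_cnj_mult H2_E Hinf_mult u f g)+
  finally show ?thesis .
qed

lemma toep_add:
  assumes u: "u \<in> Hinf" and f: "f \<in> car H2" and g: "g \<in> car H2"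
  shows "toep u (f + g) = toep u f + toep u g"
proof (rule H2_eq_tc)
  fix n
  have "lip (\<lambda>y. cnj (bv u y) * bv (f + g) y) (\<lambda>y. y ^ n) = lip (\<lambda>y. cnj (bv u y) * bv f y + cnj (bv u y) * bv g y) (\<lambda>y. y ^ n)"
  proof (rule lip_cong_AE)
    show "AE y in mT. cnj (bv u y) * bv (f + g) y = cnj (bv u y) * bv f y + cnj (bv u y) * bv g y"
      using AE_bv_add[OF f g] by eventually_elim (simp add: ring_distribs)
  qed (auto intro!: L2_add L2_cnj_mult H2_E H2_add u f g)
  also have "\<dots> = lip (\<lambda>y. cnj (bv u y) * bv f y) (\<lambda>y. y ^ n) + lip (\<lambda>y. cnj (bv u y) * bv g y) (\<lambda>y. y ^ n)"
    by (intro lip_add_left L2_cnj_mult H2_E u f g) simp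
  finally show "tc (toep u (f + g)) n = tc (toep u f + toep u g) n"
    by (simp add: tc_add tc_toep toep_H2 u f g H2_add)
qed (intro toep_H2 H2_add u f g)+

lemma toep_cmult:
  assumes u: "u \<in> Hinf" and f: "f \<in> car H2"
  shows "toep u (\<lambda>z. c * f z) = (\<lambda>z. c * toep u f z)"
proof (rule H2_eq_tc)
  fix n
  have "lip (\<lambda>y. cnj (bv u y) * bv (\<lambda>z. c * f z) y) (\<lambda>y. y ^ n) = lip (\<lambda>y. c * (cnj (bv u y) * bv f y)) (\<lambda>y. y ^ n)"
  proof (rule lip_cong_AE)
    show "AE y in mT. cnj (bv u y) * bv (\<lambda>z. c * f z) y = c * (cnj (bv u y) * bv f y)"
      using AE_bv_cmult[OF f, of c] by eventually_elim simp
  qed (auto intro!: L2_cmult L2_cnj_mult H2_E H2_cmult u f)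
  then show "tc (toep u (\<lambda>z. c * f z)) n = tc (\<lambda>z. c * toep u f z) n"
    by (simp add: tc_cmult tc_toep toep_H2 u f H2_cmult lip_cmult_left)
qed (intro toep_H2 H2_cmult u f)+

lemma toep_diff:
  assumes u: "u \<in> Hinf" and f: "f \<in> car H2" and g: "g \<in> car H2"
  shows "toep u (f - g) = toep u f - toep u g"
proof -
  have "f - g = f + (\<lambda>z. -1 * g z)" by (simp add: fun_diff_def plus_fun_def)
  then show ?thesis using toep_add[OF u f H2_cmult[OF g, of "-1"]] toep_cmult[OF u g, of "-1"] by (simp add: fun_diff_def plus_fun_def)
qed

text \<open>Shifting \<open>cnj u * f\<close> moves its Fourier coefficient of index \<open>-1\<close> to index \<open>0\<close>.\<close>

lemma toep_zmul:
  assumes u: "u \<in> Hinf" and f: "f \<in> car H2"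
  shows "toep u (zmul f) = zmul (toep u f) + (\<lambda>z. tfun u f * one_disc z)"
proof (rule H2_eq_tc)
  fix n
  have e: "tc (toep u (zmul f)) n = lip (\<lambda>y. cnj (bv u y) * (y * bv f y)) (\<lambda>y. y ^ n)"
    unfolding tc_toep[OF u zmul_H2[OF f]]
  proof (rule lip_cong_AE)
    show "AE y in mT. cnj (bv u y) * bv (zmul f) y = cnj (bv u y) * (y * bv f y)"
      using bv_zmul[OF f] by eventually_elim simp
  qed (auto intro!: L2_cnj_mult H2_E u f L2_mult_id zmul_H2)
  show "tc (toep u (zmul f)) n = tc (zmul (toep u f) + (\<lambda>z. tfun u f * one_disc z)) n"
  proof (cases n)
    case 0
    have "lip (\<lambda>y. cnj (bv u y) * (y * bv f y)) (\<lambda>y. y ^ 0) = tfun u f"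
      by (simp add: lip_def tfun_def mult_ac)
    then show ?thesis using e 0 by (simp add: tc_add tc_zmul tc_cmult tc_one_disc toep_H2 H2_cmult u f)
  next
    case (Suc m)
    have "lip (\<lambda>y. cnj (bv u y) * (y * bv f y)) (\<lambda>y. y ^ Suc m) = lip (\<lambda>y. cnj (bv u y) * bv f y) (\<lambda>y. y ^ m)"
      unfolding lip_def
    proof (rule Bochner_Integration.integral_cong[OF refl])
      fix y assume "y \<in> space mT"
      then have z: "y * cnj y = 1" by (simp add: sphere_cnj)
      have "cnj (bv u y) * (y * bv f y) * cnj (y ^ Suc m) = (y * cnj y) * (cnj (bv u y) * bv f y * cnj (y ^ m))" by simp
      then show "cnj (bv u y) * (y * bv f y) * cnj (y ^ Suc m) = cnj (bv u y) * bv f y * cnj (y ^ m)" unfolding z by simp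
    qed
    then show ?thesis using e Suc by (simp add: tc_add tc_zmul tc_cmult tc_one_disc toep_H2 H2_cmult u f tc_toep del: power_Suc)
  qed
qed (intro toep_H2 H2_add H2_cmult zmul_H2 one_disc_H2 u f)+

lemma toep_one: 
  assumes u: "u \<in> Hinf" shows "toep u one_disc = (\<lambda>z. cnj (u 0) * one_disc z)"
proof (rule H2_eq_tc)
  have uH: "u \<in> car H2" by (rule Hinf_H2[OF u])
  fix n
  have "tc (toep u one_disc) n = lip (\<lambda>y. cnj (bv u y)) (\<lambda>y. y ^ n)"
    unfolding tc_toep[OF u one_disc_H2] lip_def by (rule Bochner_Integration.integral_cong) (auto simp: bv_one_disc)
  also have "\<dots> = cnj (lip (bv u) (\<lambda>y. cnj y ^ n))"
    unfolding lip_def Bochner_Integration.integral_cnj[symmetric] by simp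
  also have "\<dots> = (if n = 0 then cnj (u 0) else 0)"
  proof (cases n)
    case 0 then show ?thesis using H2_mean[OF uH] by simp
  next
    case (Suc m) then show ?thesis using H2_bv_cnj_power[OF uH, of m] by simp
  qed
  finally show "tc (toep u one_disc) n = tc (\<lambda>z. cnj (u 0) * one_disc z) n" by (simp add: tc_cmult tc_one_disc)
qed (intro toep_H2 H2_cmult one_disc_H2 u)+

lemma inner_E:
  assumes "inner_function u"
  shows "u \<in> Hinf" "u \<in> car H2" "AE y in mT. cmod (bv u y) = 1" "AE y in mT. bv u y * cnj (bv u y) = 1"
    "\<And>z. z \<in> ball 0 1 \<Longrightarrow> cmod (u z) \<le> 1"
proof -
  show u: "u \<in> Hinf" "AE y in mT. cmod (bv u y) = 1" using assms by (auto simp: inner_function_def)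
  then show uH: "u \<in> car H2" by (simp add: Hinf_H2)
  show "AE y in mT. bv u y * cnj (bv u y) = 1"
    using u(2) by eventually_elim (simp add: complex_norm_square[symmetric])
  fix z :: complex assume "z \<in> ball 0 1"
  then show "cmod (u z) \<le> 1"
    by (rule H2_boundary_bound[OF uH, rotated]) (use u(2) in \<open>auto elim: eventually_mono\<close>)
qed

lemma inner_isometric:
  assumes u: "inner_function u" and f: "f \<in> car H2"
  shows "lnorm2 (bv (u * f)) = lnorm2 (bv f)"
  unfolding lnorm2_def
proof (rule integral_cong_AE)
  show "AE y in mT. (cmod (bv (u * f) y))\<^sup>2 = (cmod (bv f y))\<^sup>2"
    using bv_Hinf_mult[OF inner_E(1)[OF u] f] inner_E(3)[OF u] by eventually_elim (simp add: norm_mult)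
qed (use H2_measurable[OF Hinf_mult[OF inner_E(1)[OF u] f]] H2_measurable[OF f] in auto)

lemma toep_inner_mult:
  assumes u: "inner_function u" and f: "f \<in> car H2"
  shows "toep u (u * f) = f"
proof (rule H2_eq_tc)
  note uu = inner_E[OF u]
  fix n
  have "lip (\<lambda>y. cnj (bv u y) * bv (u * f) y) (\<lambda>y. y ^ n) = lip (bv f) (\<lambda>y. y ^ n)"
  proof (rule lip_cong_AE)
    show "AE y in mT. cnj (bv u y) * bv (u * f) y = bv f y"
      using bv_Hinf_mult[OF uu(1) f] uu(4)
    proof eventually_elim
      case (elim y)
      have "cnj (bv u y) * bv (u * f) y = (bv u y * cnj (bv u y)) * bv f y" using elim(1) by simp
      then show ?case using elim(2) by simp
    qed
  qed (auto intro!: L2_cnj_mult H2_E Hinf_mult uu f)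
  then show "tc (toep u (u * f)) n = tc f n" using tc_toep[OF uu(1) Hinf_mult[OF uu(1) f], of n] by (simp add: tc_def)
qed (intro toep_H2 Hinf_mult inner_E[OF u] f)+

lemma toep_norm:
  assumes u: "inner_function u" and f: "f \<in> car H2"
  shows "lnorm2 (bv (toep u f)) \<le> lnorm2 (bv f)"
proof -
  note uu = inner_E[OF u]
  have m: "(\<lambda>y. cnj (bv u y)) \<in> borel_measurable mT" using H2_measurable[OF uu(2)] by measurable
  have "lnorm2 (bv (toep u f)) \<le> lnorm2 (\<lambda>y. cnj (bv u y) * bv f y)"
    unfolding toep_def by (intro rproj_norm L2_cnj_mult H2_E uu f)
  also have "\<dots> \<le> 1\<^sup>2 * lnorm2 (bv f)"
    by (rule L2_bounded_mult(2)[OF H2_E(3)[OF f] m]) (use uu(3) in \<open>auto elim: eventually_mono\<close>)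
  finally show ?thesis by simp
qed

lemma model_space_iff:
  assumes u: "inner_function u"
  shows "f \<in> model_space u \<longleftrightarrow> f \<in> car H2 \<and> toep u f = 0"
proof
  note uu = inner_E[OF u]
  assume f: "f \<in> model_space u"
  then have fH: "f \<in> car H2" by (simp add: model_space_def)
  have "lip (bv (toep u f)) (bv (toep u f)) = 0"
    using f lip_toep[OF uu(1) fH toep_H2[OF uu(1) fH]] toep_H2[OF uu(1) fH] by (simp add: model_space_def ip_H2)
  then have "lnorm2 (bv (toep u f)) = 0" by (simp add: lip_self)
  then show "f \<in> car H2 \<and> toep u f = 0" using H2_norm_0[OF toep_H2[OF uu(1) fH]] fH by simp
next
  note uu = inner_E[OF u]
  assume f: "f \<in> car H2 \<and> toep u f = 0"
  have "lip (bv 0) (bv g) = 0" for g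
    unfolding lip_def by (subst Bochner_Integration.integral_cong[OF refl, of mT _ "\<lambda>_. 0"]) (auto simp: bv_zero)
  then show "f \<in> model_space u" using f lip_toep[OF uu(1), of f] by (auto simp: model_space_def ip_H2)
qed

lemma model_space_proj:
  assumes u: "inner_function u" and f: "f \<in> car H2"
  shows "f - u * toep u f \<in> model_space u"
proof -
  note uu = inner_E[OF u]
  have t: "toep u f \<in> car H2" by (rule toep_H2[OF uu(1) f])
  show ?thesis unfolding model_space_iff[OF u]
    by (simp add: H2_diff Hinf_mult uu f t toep_diff toep_inner_mult[OF u t])
qed

text \<open>The reproducing kernel of the model space at the origin.\<close>

definition ker0 :: "(complex \<Rightarrow> complex) \<Rightarrow> complex \<Rightarrow> complex" where
  "ker0 u = one_disc - (\<lambda>z. cnj (u 0) * u z)"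

lemma ker0_model_space:
  assumes u: "inner_function u" shows "ker0 u \<in> model_space u"
proof -
  note uu = inner_E[OF u]
  have "u * one_disc = u" using H2_outside[OF uu(2)] by (auto simp: one_disc_def on_disc_def times_fun_def)
  then have tu: "toep u u = one_disc" using toep_inner_mult[OF u one_disc_H2] by simp
  have "toep u (ker0 u) = 0"
    unfolding ker0_def by (subst toep_diff) (auto simp: uu H2_cmult toep_one toep_cmult tu zero_fun_def fun_diff_def)
  then show ?thesis unfolding model_space_iff[OF u] by (simp add: ker0_def H2_diff H2_cmult uu)
qed

lemma ker0_inverse:
  assumes u: "inner_function u" and lt: "cmod (u 0) < 1"
  obtains q B where "q \<in> Hinf" "\<And>z. z \<in> ball 0 1 \<Longrightarrow> q z * ker0 u z = 1" "AE y in mT. bv q y * bv (ker0 u) y = 1"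
    "AE y in mT. cmod (bv q y) \<le> B"
proof -
  note uu = inner_E[OF u]
  define q where "q = on_disc (\<lambda>z. 1 / (1 - cnj (u 0) * u z))"
  have low: "1 - cmod (u 0) \<le> cmod (1 - cnj (u 0) * u z)" if "z \<in> ball 0 1" for z
  proof -
    have "cmod (cnj (u 0) * u z) \<le> cmod (u 0)" using uu(5)[OF that] by (simp add: norm_mult mult_left_le)
    then show ?thesis using norm_triangle_ineq2[of 1 "cnj (u 0) * u z"] by simp
  qed
  have hol: "u holomorphic_on ball 0 1" using uu(1) by (simp add: Hinf_def disc_holomorphic_def)
  have ne: "1 - cnj (u 0) * u z \<noteq> 0" if "z \<in> ball 0 1" for z using low[OF that] lt by auto
  have "q \<in> disc_holomorphic" unfolding q_def
    by (intro disc_holomorphic_on_disc holomorphic_intros hol) (use ne in auto)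
  moreover have bd: "cmod (q z) \<le> 1 / (1 - cmod (u 0))" if "z \<in> ball 0 1" for z
    using low[OF that] lt that by (simp add: q_def on_disc_def norm_divide frac_le)
  ultimately have q: "q \<in> Hinf" by (auto simp: Hinf_def intro!: boundedI)
  have k: "ker0 u \<in> car H2" using ker0_model_space[OF u] by (simp add: model_space_def)
  have pt: "q z * ker0 u z = 1" if "z \<in> ball 0 1" for z
    using ne[OF that] that by (simp add: q_def ker0_def on_disc_def one_disc_def)
  have "q * ker0 u = one_disc"
  proof
    fix z show "(q * ker0 u) z = one_disc z"
      using pt[of z] by (cases "z \<in> ball 0 1") (auto simp: one_disc_def on_disc_def q_def)
  qed
  then have "AE y in mT. bv q y * bv (ker0 u) y = 1"
    using bv_Hinf_mult[OF q k] AE_sphere by (auto elim!: eventually_elim2 simp: bv_one_disc)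
  with that[OF q pt] Hinf_bv_bound[OF q bd] show ?thesis by blast
qed

text \<open>A case of the maximum principle: the value at the origin is the first Taylor coefficient of a function of norm
  \<open>1\<close>; if it has modulus \<open>1\<close>, the others vanish.\<close>

lemma inner_const:
  assumes u: "inner_function u" and 1: "cmod (u 0) \<ge> 1"
  shows "u = (\<lambda>z. u 0 * one_disc z)" "model_space u = {0}" "cmod (u 0) = 1"
proof -
  note uu = inner_E[OF u]
  show c: "cmod (u 0) = 1" using 1 uu(5)[of 0] by simp
  have n1: "lnorm2 (bv u) = 1"
  proof -
    have "lnorm2 (bv u) = lnorm2 (\<lambda>_. 1)"
      unfolding lnorm2_def by (rule integral_cong_AE) (use uu(3) H2_measurable[OF uu(2)] in auto)
    then show ?thesis by simp
  qed
  have z: "tc u n = 0" if "n \<noteq> 0" for n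
  proof -
    have "(\<Sum>k\<in>{0, n}. (cmod (tc u k))\<^sup>2) \<le> (\<Sum>k. (cmod (tc u k))\<^sup>2)"
      using H2_E(1)[OF uu(2)] by (intro sum_le_suminf) (auto simp: l2_def)
    then have "1 + (cmod (tc u n))\<^sup>2 \<le> 1"
      using that n1 lnorm2_bv[OF uu(2)] c H2_at_0[OF uu(2)] by simp
    then show ?thesis by simp
  qed
  show eq: "u = (\<lambda>z. u 0 * one_disc z)"
    by (rule H2_eq_tc) (use z in \<open>auto simp: uu H2_cmult tc_cmult tc_one_disc H2_at_0[OF uu(2)]\<close>)
  show "model_space u = {0}"
  proof (intro equalityI subsetI)
    fix f assume f: "f \<in> model_space u"
    then have fH: "f \<in> car H2" by (simp add: model_space_def)
    have "u * (\<lambda>z. cnj (u 0) * f z) = f"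
    proof
      fix z
      have "u z * (cnj (u 0) * f z) = (u 0 * cnj (u 0)) * (one_disc z * f z)" using fun_cong[OF eq, of z] by simp
      also have "u 0 * cnj (u 0) = 1" using c by (simp add: complex_norm_square[symmetric])
      finally show "(u * (\<lambda>z. cnj (u 0) * f z)) z = f z" using H2_outside[OF fH, of z]
        by (cases "z \<in> ball 0 1") (simp_all add: one_disc_def on_disc_def)
    qed
    then have "toep u f = (\<lambda>z. cnj (u 0) * f z)" using toep_inner_mult[OF u H2_cmult[OF fH]] by metis
    then have "(\<lambda>z. cnj (u 0) * f z) = 0" using f model_space_iff[OF u] by simp
    then have "f z = 0" for z using c by (auto simp: fun_eq_iff)
    then show "f \<in> {0}" by (auto simp: fun_eq_iff)
  next
    fix f :: "complex \<Rightarrow> complex" assume "f \<in> {0}"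
    then show "f \<in> model_space u" using model_space_iff[OF u] toep_cmult[OF uu(1) one_disc_H2, of 0] H2_zero[unfolded zero_fun_def] by (simp add: zero_fun_def)
  qed
qed

lemma model_space_trivial_imp:
  assumes u: "inner_function u" and "model_space u = {0}"
  shows "cmod (u 0) \<ge> 1"
proof (rule ccontr)
  assume lt: "\<not> ?thesis"
  have "ker0 u = 0" using ker0_model_space[OF u] assms(2) by simp
  then have "ker0 u 0 = 0" by simp
  then have "u 0 * cnj (u 0) = 1" by (simp add: ker0_def one_disc_def on_disc_def mult.commute)
  then have "of_real ((cmod (u 0))\<^sup>2) = (1::complex)" by (simp only: complex_norm_square)
  then have "(cmod (u 0))\<^sup>2 = 1" using of_real_eq_1_iff by blast
  then have "cmod (u 0) = 1 \<or> cmod (u 0) = -1" using power2_eq_1_iff by blast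
  then show False using lt norm_ge_zero[of "u 0"] by linarith
qed

text \<open>The map \<open>f \<mapsto> u * cnj y * cnj f\<close> on boundary functions. Both the absence of negative Fourier
  coefficients of its image and the orthogonality of its image to the multiples of \<open>u\<close> express membership
  of \<open>f\<close> in the model space.\<close>

lemma model_conjugation:
  assumes u: "inner_function u" and f: "f \<in> model_space u"
  obtains f' where "f' \<in> model_space u" "AE y in mT. bv f' y = bv u y * cnj y * cnj (bv f y)"
proof -
  note uu = inner_E[OF u]
  have fH: "f \<in> car H2" using f by (simp add: model_space_def)
  define h where "h y = bv u y * (cnj y * cnj (bv f y))" for y
  have h: "L2 h" unfolding h_def by (intro L2_cnj_mult uu L2_mult_id L2_cnj H2_E fH)
  have "AE y in mT. bv (rproj h) y = h y"
  proof (rule H2_of_fourier[OF h])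
    fix n
    have "lip h (\<lambda>y. cnj y ^ Suc n) = (\<integral>y. cnj (bv f y * cnj (bv u y * y ^ n)) \<partial>mT)"
      unfolding lip_def h_def
    proof (rule Bochner_Integration.integral_cong[OF refl])
      fix y assume "y \<in> space mT"
      then have z: "y * cnj y = 1" by (simp add: sphere_cnj)
      have "bv u y * (cnj y * cnj (bv f y)) * cnj (cnj y ^ Suc n) = (y * cnj y) * (cnj (bv f y) * (bv u y * y ^ n))" by simp
      then show "bv u y * (cnj y * cnj (bv f y)) * cnj (cnj y ^ Suc n) = cnj (bv f y * cnj (bv u y * y ^ n))" unfolding z by simp
    qed
    also have "\<dots> = cnj (lip (bv f) (\<lambda>y. bv u y * y ^ n))" unfolding lip_def by (rule Bochner_Integration.integral_cnj)
    also have "lip (bv f) (\<lambda>y. bv u y * y ^ n) = lip (bv f) (bv (u * mono_disc n))"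
    proof (rule lip_cong_AE)
      show "AE y in mT. bv u y * y ^ n = bv (u * mono_disc n) y"
        using bv_Hinf_mult[OF uu(1) mono_disc_H2, of n] AE_sphere by eventually_elim (simp add: bv_mono_disc)
    qed (auto intro!: H2_E L2_cnj_mult Hinf_mult uu fH)
    also have "\<dots> = 0" using f by (simp add: model_space_def ip_H2)
    finally show "lip h (\<lambda>y. cnj y ^ Suc n) = 0" by simp
  qed
  then have bvf': "AE y in mT. bv (rproj h) y = h y" .
  have f'H: "rproj h \<in> car H2" by (rule rproj_H2[OF h])
  have "toep u (rproj h) = 0"
  proof (rule H2_eq_0[OF toep_H2[OF uu(1) f'H]])
    fix n
    have "tc (toep u (rproj h)) n = lip (\<lambda>y. cnj y * cnj (bv f y)) (\<lambda>y. y ^ n)"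
      unfolding tc_toep[OF uu(1) f'H]
    proof (rule lip_cong_AE)
      show "AE y in mT. cnj (bv u y) * bv (rproj h) y = cnj y * cnj (bv f y)"
        using bvf' uu(4)
      proof eventually_elim
        case (elim y)
        have "cnj (bv u y) * bv (rproj h) y = (bv u y * cnj (bv u y)) * (cnj y * cnj (bv f y))"
          using elim(1) by (simp add: h_def)
        then show ?case using elim(2) by simp
      qed
    qed (auto intro!: H2_E L2_cnj_mult L2_cnj fH uu f'H L2_mult_id)
    also have "\<dots> = cnj (lip (bv f) (\<lambda>y. cnj y ^ Suc n))"
      unfolding lip_def Bochner_Integration.integral_cnj[symmetric] by (simp add: mult_ac)
    also have "\<dots> = 0" using H2_bv_cnj_power[OF fH, of n] by simp
    finally show "tc (toep u (rproj h)) n = 0" .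
  qed
  then have "rproj h \<in> model_space u" using f'H model_space_iff[OF u] by simp
  then show ?thesis using that[of "rproj h"] bvf' by (simp add: h_def mult.assoc)
qed

section \<open>The multiplier\<close>

lemma lnorm2_diff_bv:
  assumes "f \<in> car H2" "g \<in> car H2"
  shows "lnorm2 (\<lambda>y. bv f y - bv g y) = (hnorm H2 (f - g))\<^sup>2"
proof -
  have "L2 (\<lambda>y. bv f y - bv g y)" by (intro L2_minus H2_E assms)
  from L2_cong_AE(2)[OF this AE_bv_diff[OF assms]] show ?thesis by (simp add: hnorm_H2)
qed

lemma H2_closure_iff:
  assumes "S \<subseteq> car H2"
  shows "x \<in> htop H2 closure_of S \<longleftrightarrow> x \<in> car H2 \<and>
     (\<exists>s. (\<forall>n. s n \<in> S) \<and> (\<lambda>n. lnorm2 (\<lambda>y. bv (s n) y - bv x y)) \<longlonglongrightarrow> 0)"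
proof -
  have "(\<lambda>n. hnorm H2 (x - s n)) \<longlonglongrightarrow> 0 \<longleftrightarrow> (\<lambda>n. lnorm2 (\<lambda>y. bv (s n) y - bv x y)) \<longlonglongrightarrow> 0"
    if "x \<in> car H2" "\<And>n. s n \<in> car H2" for s :: "nat \<Rightarrow> complex \<Rightarrow> complex"
  proof -
    have eq: "lnorm2 (\<lambda>y. bv (s n) y - bv x y) = (hnorm H2 (x - s n))\<^sup>2" for n
      using that by (simp add: lnorm2_diff_bv H2.hnorm_minus_commute)
    show ?thesis
    proof
      assume "(\<lambda>n. hnorm H2 (x - s n)) \<longlonglongrightarrow> 0"
      from tendsto_power[OF this, of 2] show "(\<lambda>n. lnorm2 (\<lambda>y. bv (s n) y - bv x y)) \<longlonglongrightarrow> 0" by (simp add: eq)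
    next
      assume "(\<lambda>n. lnorm2 (\<lambda>y. bv (s n) y - bv x y)) \<longlonglongrightarrow> 0"
      from tendsto_real_sqrt[OF this] show "(\<lambda>n. hnorm H2 (x - s n)) \<longlonglongrightarrow> 0"
        using that H2.hnorm_nonneg[OF H2_diff] by (simp add: eq)
    qed
  qed
  note key = this
  show ?thesis unfolding H2.closure_htop_sequence[OF assms]
  proof (intro conj_cong refl iff_exI)
    fix s :: "nat \<Rightarrow> complex \<Rightarrow> complex" assume "x \<in> car H2" "\<forall>n. s n \<in> S"
    then show "(\<lambda>n. hnorm H2 (x - s n)) \<longlonglongrightarrow> 0 \<longleftrightarrow> (\<lambda>n. lnorm2 (\<lambda>y. bv (s n) y - bv x y)) \<longlonglongrightarrow> 0"
      using assms by (intro key) auto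
  qed
qed

lemma lnorm2_mult_tendsto:
  assumes q: "q \<in> borel_measurable mT" "AE y in mT. cmod (q y) \<le> B" and L: "\<And>n. L2 (d n)" and lim: "(\<lambda>n. lnorm2 (d n)) \<longlonglongrightarrow> 0"
  shows "(\<lambda>n. lnorm2 (\<lambda>y. q y * d n y)) \<longlonglongrightarrow> 0"
proof (rule Lim_null_comparison)
  show "\<forall>\<^sub>F n in sequentially. norm (lnorm2 (\<lambda>y. q y * d n y)) \<le> B\<^sup>2 * lnorm2 (d n)"
    using L2_bounded_mult(2)[OF L q] by (intro always_eventually allI) simp
  show "(\<lambda>n. B\<^sup>2 * lnorm2 (d n)) \<longlonglongrightarrow> 0" by (rule tendsto_mult_right_zero[OF lim])
qed

text \<open>Multiplication by the bounded inverse of the kernel at the origin turns approximations of the kernel into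
  approximations of \<open>1\<close>.\<close>

lemma cyclic_of_approx:
  assumes v: "inner_function v" and lt: "cmod (v 0) < 1" and p: "\<phi> \<in> Hinf"
    and f: "\<And>n. f n \<in> car H2" and lim: "(\<lambda>n. lnorm2 (\<lambda>y. bv (\<phi> * f n) y - bv (ker0 v) y)) \<longlonglongrightarrow> 0"
  shows "cyclic \<phi>"
proof -
  have k: "ker0 v \<in> car H2" using ker0_model_space[OF v] by (simp add: model_space_def)
  obtain q B where q: "q \<in> Hinf" "AE y in mT. bv q y * bv (ker0 v) y = 1" "AE y in mT. cmod (bv q y) \<le> B"
    using ker0_inverse[OF v lt] by metis
  note qm = H2_measurable[OF Hinf_H2[OF q(1)]]
  have Ld: "L2 (\<lambda>y. bv (\<phi> * f n) y - bv (ker0 v) y)" for n by (intro L2_minus H2_E Hinf_mult p f k)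
  have "lnorm2 (\<lambda>y. bv \<phi> y * bv (q * f n) y - 1) = lnorm2 (\<lambda>y. bv q y * (bv (\<phi> * f n) y - bv (ker0 v) y))" for n
  proof (rule L2_cong_AE(2))
    show "L2 (\<lambda>y. bv q y * (bv (\<phi> * f n) y - bv (ker0 v) y))" by (intro L2_cnj_mult q Ld)
    show "AE y in mT. bv \<phi> y * bv (q * f n) y - 1 = bv q y * (bv (\<phi> * f n) y - bv (ker0 v) y)"
      using bv_Hinf_mult[OF q(1) f, of n] bv_Hinf_mult[OF p f, of n] q(2) by eventually_elim (simp add: algebra_simps)
  qed
  then have "(\<lambda>n. lnorm2 (\<lambda>y. bv \<phi> y * bv (q * f n) y - 1)) \<longlonglongrightarrow> 0"
    using lnorm2_mult_tendsto[OF qm q(3) Ld lim] by simp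
  then show ?thesis unfolding cyclic_def by (intro exI[of _ "\<lambda>n. q * f n"]) (auto intro!: Hinf_mult q f)
qed

locale dense_multiplier =
  fixes u v \<phi> :: "complex \<Rightarrow> complex"
  assumes u: "inner_function u" and v: "inner_function v" and p: "\<phi> \<in> Hinf"
    and mult: "(\<lambda>f. \<phi> * f) ` model_space u \<subseteq> model_space v"
    and dense: "htop H2 closure_of ((\<lambda>f. \<phi> * f) ` model_space u) = model_space v"
begin

lemma model_H2: "f \<in> model_space w \<Longrightarrow> f \<in> car H2" by (simp add: model_space_def)

lemma approx:
  assumes "g \<in> model_space v"
  obtains f where "\<And>n. f n \<in> model_space u" "(\<lambda>n. lnorm2 (\<lambda>y. bv (\<phi> * f n) y - bv g y)) \<longlonglongrightarrow> 0"
proof -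
  have sub: "(\<lambda>f. \<phi> * f) ` model_space u \<subseteq> car H2" using mult model_H2 by blast
  have "g \<in> htop H2 closure_of ((\<lambda>f. \<phi> * f) ` model_space u)" using assms dense by simp
  then obtain s where s: "\<And>n. s n \<in> (\<lambda>f. \<phi> * f) ` model_space u" "(\<lambda>n. lnorm2 (\<lambda>y. bv (s n) y - bv g y)) \<longlonglongrightarrow> 0"
    unfolding H2_closure_iff[OF sub] by blast
  have "\<forall>n. \<exists>f. f \<in> model_space u \<and> s n = \<phi> * f" using s(1) by blast
  then obtain f where "\<And>n. f n \<in> model_space u" "\<And>n. s n = \<phi> * f n" by metis
  then show ?thesis using s(2) by (intro that[of f]) simp_all
qed

text \<open>Conjugate in the model space of \<open>u\<close>, multiply by \<open>\<phi>\<close> and conjugate in the model space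
  of \<open>v\<close>: on boundary functions this is multiplication by \<open>v * cnj u * cnj \<phi>\<close>. Applied
  to the kernel at the origin, and divided by this kernel, it exhibits the product as a bounded analytic function.\<close>

lemma reflected_multiplier:
  assumes lt: "cmod (u 0) < 1"
  obtains \<psi> where "\<psi> \<in> Hinf" "AE y in mT. bv \<psi> y = bv v y * cnj (bv u y) * cnj (bv \<phi> y)"
proof -
  note uu = inner_E[OF u] and vv = inner_E[OF v]
  obtain f1 where f1: "f1 \<in> model_space u" "AE y in mT. bv f1 y = bv u y * cnj y * cnj (bv (ker0 u) y)"
    using model_conjugation[OF u ker0_model_space[OF u]] by blast
  have "\<phi> * f1 \<in> model_space v" using mult f1 by blast
  then obtain G where G: "G \<in> model_space v" "AE y in mT. bv G y = bv v y * cnj y * cnj (bv (\<phi> * f1) y)"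
    using model_conjugation[OF v] by blast
  obtain q B where q: "q \<in> Hinf" "AE y in mT. bv q y * bv (ker0 u) y = 1"
    using ker0_inverse[OF u lt] by metis
  have GH: "G \<in> car H2" by (rule model_H2[OF G(1)])
  have b: "AE y in mT. bv (q * G) y = bv v y * cnj (bv u y) * cnj (bv \<phi> y)"
    using bv_Hinf_mult[OF q(1) GH] G(2) f1(2) q(2) bv_Hinf_mult[OF p model_H2[OF f1(1)]] AE_sphere
  proof eventually_elim
    case (elim y)
    have "bv (q * G) y = bv q y * (bv v y * cnj y * cnj (bv \<phi> y * (bv u y * cnj y * cnj (bv (ker0 u) y))))"
      using elim(1,2,3,5) by simp
    also have "\<dots> = (bv q y * bv (ker0 u) y) * (y * cnj y) * (bv v y * cnj (bv u y) * cnj (bv \<phi> y))" by simp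
    finally show ?case using elim(4) sphere_cnj[OF elim(6)] by simp
  qed
  obtain M where M: "AE y in mT. cmod (bv \<phi> y) \<le> M" using Hinf_bv_bounded[OF p] by blast
  have "q * G \<in> Hinf"
  proof (rule Hinf_of_boundary)
    show "q * G \<in> car H2" by (intro Hinf_mult q GH)
    show "AE y in mT. cmod (bv (q * G) y) \<le> M"
      using b M uu(3) vv(3) by eventually_elim (simp add: norm_mult)
  qed
  with b that show ?thesis by blast
qed

lemma cyclic_multiplier:
  assumes lt: "cmod (v 0) < 1"
  shows "cyclic \<phi>"
proof -
  obtain f where f: "\<And>n. f n \<in> model_space u" "(\<lambda>n. lnorm2 (\<lambda>y. bv (\<phi> * f n) y - bv (ker0 v) y)) \<longlonglongrightarrow> 0"
    using approx[OF ker0_model_space[OF v]] by blast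
  show ?thesis by (rule cyclic_of_approx[OF v lt p model_H2[OF f(1)] f(2)])
qed

text \<open>Conjugations are isometric, so that the reflected multiplier also maps the model space of \<open>u\<close> onto a
  dense subset of that of \<open>v\<close>.\<close>

lemma cyclic_reflected:
  assumes lt: "cmod (v 0) < 1" and ps: "\<psi> \<in> Hinf" "AE y in mT. bv \<psi> y = bv v y * cnj (bv u y) * cnj (bv \<phi> y)"
  shows "cyclic \<psi>"
proof -
  note uu = inner_E[OF u] and vv = inner_E[OF v]
  obtain g where g: "g \<in> model_space v" "AE y in mT. bv g y = bv v y * cnj y * cnj (bv (ker0 v) y)"
    using model_conjugation[OF v ker0_model_space[OF v]] by blast
  obtain f where f: "\<And>n. f n \<in> model_space u" "(\<lambda>n. lnorm2 (\<lambda>y. bv (\<phi> * f n) y - bv g y)) \<longlonglongrightarrow> 0"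
    using approx[OF g(1)] by blast
  have "\<forall>n. \<exists>f'. f' \<in> model_space u \<and> (AE y in mT. bv f' y = bv u y * cnj y * cnj (bv (f n) y))"
    using model_conjugation[OF u f(1)] by metis
  then obtain f' where f': "\<And>n. f' n \<in> model_space u" "\<And>n. AE y in mT. bv (f' n) y = bv u y * cnj y * cnj (bv (f n) y)" by metis
  have k: "ker0 v \<in> car H2" by (rule model_H2[OF ker0_model_space[OF v]])
  have "lnorm2 (\<lambda>y. bv (\<psi> * f' n) y - bv (ker0 v) y) = lnorm2 (\<lambda>y. bv (\<phi> * f n) y - bv g y)" for n
    unfolding lnorm2_def
  proof (rule integral_cong_AE)
    have "L2 (\<lambda>y. bv (\<psi> * f' n) y - bv (ker0 v) y)" "L2 (\<lambda>y. bv (\<phi> * f n) y - bv g y)"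
      by (intro L2_minus H2_E Hinf_mult ps p k model_H2[OF f(1)] model_H2[OF f'(1)] model_H2[OF g(1)])+
    from this[THEN L2_integrable_sq] show "(\<lambda>y. (cmod (bv (\<psi> * f' n) y - bv (ker0 v) y))\<^sup>2) \<in> borel_measurable mT"
      "(\<lambda>y. (cmod (bv (\<phi> * f n) y - bv g y))\<^sup>2) \<in> borel_measurable mT" by auto
    show "AE y in mT. (cmod (bv (\<psi> * f' n) y - bv (ker0 v) y))\<^sup>2 = (cmod (bv (\<phi> * f n) y - bv g y))\<^sup>2"
      using bv_Hinf_mult[OF ps(1) model_H2[OF f'(1)], of n] bv_Hinf_mult[OF p model_H2[OF f(1)], of n] ps(2) f'(2)[of n] g(2) uu(4) vv(4) vv(3) AE_sphere
    proof eventually_elim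
      case (elim y)
      note z = sphere_cnj[OF elim(9)]
      have 1: "bv (\<psi> * f' n) y = (bv u y * cnj (bv u y)) * (bv v y * cnj y * cnj (bv (\<phi> * f n) y))"
        using elim(1,2,3,4) by simp
      have 2: "bv (ker0 v) y = bv v y * cnj y * cnj (bv g y)"
      proof -
        have "bv v y * cnj y * cnj (bv g y) = (bv v y * cnj (bv v y)) * (y * cnj y) * bv (ker0 v) y"
          using elim(5) by simp
        then show ?thesis using elim(7) z by simp
      qed
      have "bv (\<psi> * f' n) y - bv (ker0 v) y = bv v y * cnj y * cnj (bv (\<phi> * f n) y - bv g y)"
        using 1 2 elim(6) by (simp add: right_diff_distrib)
      then show ?case using elim(8,9) by (simp add: norm_mult del: complex_cnj_diff)
    qed
  qed
  then have "(\<lambda>n. lnorm2 (\<lambda>y. bv (\<psi> * f' n) y - bv (ker0 v) y)) \<longlonglongrightarrow> 0" using f(2) by simp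
  then show ?thesis by (rule cyclic_of_approx[OF v lt ps(1) model_H2[OF f'(1)]])
qed

text \<open>Otherwise \<open>\<phi>\<close> would annihilate a nonzero function of the model space of \<open>u\<close>.\<close>

lemma nontrivial_v:
  assumes ne: "\<phi> \<noteq> 0" and nt: "model_space u \<noteq> {0}"
  shows "cmod (v 0) < 1"
proof (rule ccontr)
  assume "\<not> ?thesis"
  then have v0: "model_space v = {0}" by (intro inner_const(2)[OF v]) simp
  have "0 \<in> model_space u"
    using model_space_iff[OF u] toep_cmult[OF inner_E(1)[OF u] one_disc_H2, of 0] H2_zero[unfolded zero_fun_def] by (simp add: zero_fun_def)
  then obtain f where f: "f \<in> model_space u" "f \<noteq> 0" using nt by blast
  then have z: "\<phi> * f = 0" using mult v0 by blast
  have hol: "\<phi> holomorphic_on ball 0 1" "f holomorphic_on ball 0 1"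
    using p H2_E(5)[OF model_H2[OF f(1)]] by (auto simp: Hinf_def disc_holomorphic_def)
  obtain w where w: "f w \<noteq> 0" using f(2) by (auto simp: fun_eq_iff)
  then have wb: "w \<in> ball 0 1" using H2_outside[OF model_H2[OF f(1)]] by blast
  define U where "U = {x \<in> ball 0 1. f x \<noteq> 0}"
  have "open U" unfolding U_def
    using continuous_open_preimage[OF holomorphic_on_imp_continuous_on[OF hol(2)] open_ball, of "- {0}"]
    by (simp add: vimage_def Int_def open_delete Compl_eq_Diff_UNIV)
  moreover have "w \<in> U" using w wb by (simp add: U_def)
  ultimately have "w islimpt U" by (meson islimpt_subset open_imp_islimpt order_refl interior_limit_point interior_open)
  have "\<phi> x = 0" for x
  proof (cases "x \<in> ball 0 1")
    case True
    show ?thesis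
    proof (rule analytic_continuation[of \<phi> "ball 0 1" U w])
      show "\<phi> y = 0" if "y \<in> U" for y using fun_cong[OF z, of y] that by (simp add: U_def)
    qed (use hol wb True \<open>w islimpt U\<close> in \<open>auto simp: U_def\<close>)
  next
    case False
    then show ?thesis using p by (simp add: Hinf_def disc_holomorphic_def)
  qed
  then show False using ne by (auto simp: fun_eq_iff)
qed

end

text \<open>Both inner functions are then constant, and the relation says that the boundary values of \<open>\<phi>\<close> are a
  constant multiple of their conjugates; so all Taylor coefficients of \<open>\<phi>\<close> except the first vanish.\<close>

lemma trivial_contradiction:
  assumes "dense_multiplier u v \<phi>" and triv: "model_space u = {0}"
    and rel: "AE y in mT. bv \<phi> y = c * bv v y * cnj (bv u y) * cnj (bv \<phi> y)"
  shows "on_disc (\<lambda>z. 1 / \<phi> z) \<in> car H2"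
proof -
  interpret dense_multiplier u v \<phi> by fact
  have u1: "cmod (u 0) \<ge> 1" by (rule model_space_trivial_imp[OF u triv])
  have "model_space v = {0}"
  proof -
    have im: "(\<lambda>f. \<phi> * f) ` model_space u = {0}" unfolding triv by auto
    have "g = 0" if "g \<in> model_space v" for g
    proof -
      have "g \<in> htop H2 closure_of {0}" using that dense im by simp
      then have g: "g \<in> car H2" "\<forall>e>0. hnorm H2 g < e" using H2.closure_htop[of "{0}" g] by auto
      then have "hnorm H2 g \<le> 0" by (meson dense_ge less_imp_le)
      then show ?thesis using H2.hnorm_nonneg[OF g(1)] H2.hnorm_eq_0[OF g(1)] by simp
    qed
    moreover have "0 \<in> model_space v" using mult im by blast
    ultimately show ?thesis by blast
  qed
  then have v1: "cmod (v 0) \<ge> 1" by (rule model_space_trivial_imp[OF v])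
  have pH: "\<phi> \<in> car H2" by (rule Hinf_H2[OF p])
  have bu: "bv w y = w 0" if w: "w = (\<lambda>z. w 0 * one_disc z)" and z: "y \<in> sphere 0 1" for w y
  proof (rule bvI[OF _ z])
    have "((\<lambda>_. w 0) \<longlongrightarrow> w 0) (nontangential y)" by simp
    then have "((\<lambda>z. w 0 * one_disc z) \<longlongrightarrow> w 0) (nontangential y)"
      by (rule Lim_transform_eventually) (rule eventually_mono[OF nontangential_disc], simp add: one_disc_def on_disc_def)
    then show "(w \<longlongrightarrow> w 0) (nontangential y)" using w by metis
  qed
  define d where "d = c * v 0 * cnj (u 0)"
  have rel': "AE y in mT. bv \<phi> y = d * cnj (bv \<phi> y)"
    using rel AE_sphere by eventually_elim (simp add: d_def bu[OF inner_const(1)[OF u u1]] bu[OF inner_const(1)[OF v v1]])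
  have "tc \<phi> (Suc n) = 0" for n
  proof -
    have "tc \<phi> (Suc n) = lip (\<lambda>y. d * cnj (bv \<phi> y)) (\<lambda>y. y ^ Suc n)"
      unfolding tc_def by (rule lip_cong_AE) (use rel' in \<open>auto intro!: L2_cmult L2_cnj H2_E pH simp del: power_Suc\<close>)
    also have "\<dots> = d * cnj (lip (bv \<phi>) (\<lambda>y. cnj y ^ Suc n))"
      unfolding lip_cmult_left lip_def Bochner_Integration.integral_cnj[symmetric] by simp
    also have "\<dots> = 0" by (simp only: H2_bv_cnj_power[OF pH]) simp
    finally show ?thesis .
  qed
  then have tz: "tc \<phi> n = 0" if "n \<noteq> 0" for n using that by (cases n) auto
  have "\<phi> = (\<lambda>z. \<phi> 0 * one_disc z)"
    by (rule H2_eq_tc) (use tz in \<open>auto simp: pH H2_cmult tc_cmult tc_one_disc H2_at_0[OF pH]\<close>)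
  then have "\<phi> z = \<phi> 0" if "z \<in> ball 0 1" for z
    using fun_cong[of \<phi> "\<lambda>z. \<phi> 0 * one_disc z" z] that by (simp add: one_disc_def on_disc_def)
  note const = this
  have "on_disc (\<lambda>z. 1 / \<phi> z) = (\<lambda>z. (1 / \<phi> 0) * one_disc z)"
  proof
    fix z show "on_disc (\<lambda>z. 1 / \<phi> z) z = (1 / \<phi> 0) * one_disc z"
      by (cases "z \<in> ball 0 1") (simp_all only: on_disc_def one_disc_def const if_True if_False mult_1_right mult_zero_right)
  qed
  then show ?thesis using H2_cmult[OF one_disc_H2, of "1 / \<phi> 0"] by (simp only:)
qed

section \<open>The two intertwining quasiaffinities\<close>

lemma cmult_fun: "(\<lambda>z. c * f z) = (\<lambda>_. c) * f" by (simp add: times_fun_def)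

lemma one_disc_mult [simp]: "f \<in> car H2 \<Longrightarrow> f * one_disc = f" "f \<in> car H2 \<Longrightarrow> one_disc * f = f"
  using H2_outside[of f] by (auto simp: one_disc_def on_disc_def times_fun_def)

lemma backward_shift:
  assumes f: "f \<in> car H2"
  obtains g where "g \<in> car H2" "f = (\<lambda>z. f 0 * one_disc z) + zmul g"
proof -
  have l: "l2 (\<lambda>n. tc f (Suc n))" using H2_E(1)[OF f] unfolding l2_def by (simp add: summable_Suc_iff[of "\<lambda>n. (cmod (tc f n))\<^sup>2"])
  define g where "g = pser (\<lambda>n. tc f (Suc n))"
  have g: "g \<in> car H2" "\<And>n. tc g n = tc f (Suc n)" unfolding g_def by (simp_all add: H2_pser tc_pser l)
  have "f = (\<lambda>z. f 0 * one_disc z) + zmul g"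
  proof (rule H2_eq_tc)
    fix n show "tc f n = tc ((\<lambda>z. f 0 * one_disc z) + zmul g) n"
      by (cases n) (simp_all add: tc_add tc_cmult tc_one_disc tc_zmul g H2_cmult H2_at_0[OF f])
  qed (use f g in \<open>auto intro!: H2_add H2_cmult zmul_H2 one_disc_H2\<close>)
  with g that show ?thesis by blast
qed

lemma poly_disc_Hinf: "on_disc (psum a N) \<in> Hinf"
proof (rule Hinf_of_boundary[OF poly_disc_H2])
  show "AE y in mT. cmod (bv (on_disc (psum a N)) y) \<le> (\<Sum>n<N. cmod (a n))"
    using AE_sphere
  proof eventually_elim
    case (elim y)
    have "cmod (psum a N y) \<le> (\<Sum>n<N. cmod (a n * y ^ n))" unfolding psum_def by (rule norm_sum)
    then show ?case using elim by (simp add: bv_poly_disc norm_mult norm_power)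
  qed
qed

text \<open>Fourier partial sums of the boundary function converge in mean.\<close>

lemma polynomials_dense:
  assumes g: "g \<in> car H2"
  shows "(\<lambda>N. hnorm H2 (g - on_disc (psum (tc g) N))) \<longlonglongrightarrow> 0"
proof -
  have eq: "(hnorm H2 (g - on_disc (psum (tc g) N)))\<^sup>2 = lnorm2 (\<lambda>y. bv g y - psum (tc g) N y)" for N
    unfolding lnorm2_diff_bv[OF g poly_disc_H2, symmetric] lnorm2_def
    by (rule Bochner_Integration.integral_cong) (auto simp: bv_poly_disc)
  have "(\<lambda>N. lnorm2 (\<lambda>y. bv g y - psum (tc g) N y)) \<longlonglongrightarrow> 0"
  proof (rule Lim_null_comparison[OF _ l2_tail_norm_tendsto_0[OF H2_E(1)[OF g]]])
    show "\<forall>\<^sub>F N in sequentially. norm (lnorm2 (\<lambda>y. bv g y - psum (tc g) N y)) \<le> (\<Sum>n. (cmod (l2_tail (tc g) N n))\<^sup>2)"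
      using bv_pser_facts(3)[OF H2_E(1)[OF g]] by (intro always_eventually allI) (simp add: H2_E[OF g])
  qed
  from tendsto_real_sqrt[OF this] show ?thesis
    using H2.hnorm_nonneg[OF H2_diff[OF g poly_disc_H2]] by (simp add: eq[symmetric])
qed

lemma hnorm_Hinf_mult:
  assumes p: "\<phi> \<in> Hinf" and M: "AE y in mT. cmod (bv \<phi> y) \<le> M" "M \<ge> 0" and f: "f \<in> car H2"
  shows "hnorm H2 (\<phi> * f) \<le> M * hnorm H2 f"
proof -
  note mp = H2_measurable[OF Hinf_H2[OF p]]
  have "lnorm2 (bv (\<phi> * f)) = lnorm2 (\<lambda>y. bv \<phi> y * bv f y)"
    by (rule L2_cong_AE(2)[OF L2_cnj_mult(2)[OF p H2_E(3)[OF f]] bv_Hinf_mult[OF p f]])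
  also have "\<dots> \<le> M\<^sup>2 * lnorm2 (bv f)" by (rule L2_bounded_mult(2)[OF H2_E(3)[OF f] mp M(1)])
  finally have "sqrt (lnorm2 (bv (\<phi> * f))) \<le> sqrt (M\<^sup>2 * lnorm2 (bv f))" by (rule real_sqrt_le_mono)
  then show ?thesis using M(2) by (simp add: hnorm_H2 real_sqrt_mult)
qed

lemma hnorm_Hinf_mult_ex:
  assumes p: "\<phi> \<in> Hinf" obtains M where "M \<ge> 0" "\<And>f. f \<in> car H2 \<Longrightarrow> hnorm H2 (\<phi> * f) \<le> M * hnorm H2 f"
proof -
  obtain M where M: "M > 0" "\<And>z. cmod (\<phi> z) \<le> M" using Hinf_bound[OF p] by blast
  then show ?thesis using that[of M] hnorm_Hinf_mult[OF p Hinf_bv_bound[OF p M(2)]] by simp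
qed

lemma hnorm_zmul: "f \<in> car H2 \<Longrightarrow> hnorm H2 (zmul f) = hnorm H2 f"
proof -
  assume f: "f \<in> car H2"
  have "lnorm2 (bv (zmul f)) = lnorm2 (bv f)"
    unfolding lnorm2_def
  proof (rule integral_cong_AE)
    show "AE y in mT. (cmod (bv (zmul f) y))\<^sup>2 = (cmod (bv f y))\<^sup>2"
      using bv_zmul[OF f] AE_sphere by eventually_elim (simp add: norm_mult)
  qed (use H2_measurable[OF zmul_H2[OF f]] H2_measurable[OF f] in auto)
  then show ?thesis by (simp add: hnorm_H2)
qed

lemma hnorm_inner_mult: "inner_function u \<Longrightarrow> f \<in> car H2 \<Longrightarrow> hnorm H2 (u * f) = hnorm H2 f"
  by (simp add: hnorm_H2 inner_isometric)

lemma hnorm_toep: "inner_function u \<Longrightarrow> f \<in> car H2 \<Longrightarrow> hnorm H2 (toep u f) \<le> hnorm H2 f"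
  by (simp add: hnorm_H2 toep_norm)

lemma H2_transformation:
  assumes cl: "\<And>f. f \<in> car H2 \<Longrightarrow> F f \<in> car H2"
    and add: "\<And>f g. f \<in> car H2 \<Longrightarrow> g \<in> car H2 \<Longrightarrow> F (f + g) = F f + F g"
    and sc: "\<And>f c. f \<in> car H2 \<Longrightarrow> F (\<lambda>z. c * f z) = (\<lambda>z. c * F f z)"
    and bd: "\<And>f. f \<in> car H2 \<Longrightarrow> hnorm H2 (F f) \<le> C * hnorm H2 f"
  shows "(\<lambda>f\<in>car H2. F f) \<in> transformations H2 H2"
proof -
  have "\<exists>C. \<forall>x\<in>car H2. hnorm H2 ((\<lambda>f\<in>car H2. F f) x) \<le> C * hnorm H2 x" using bd by (intro exI[of _ C]) simp
  with cl add sc show ?thesis unfolding transformations_def by (simp add: scl_H2 H2_add H2_cmult restrict_PiE_iff)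
qed

lemma H2_hnorm_diff_le:
  assumes "f \<in> car H2" "g \<in> car H2" shows "hnorm H2 (f - g) \<le> hnorm H2 f + hnorm H2 g"
  using H2.hnorm_triangle[OF assms(1) H2_diff[OF H2_zero assms(2)]] H2.hnorm_minus_commute[OF H2_zero assms(2)] by simp

context dense_multiplier
begin

text \<open>On the model space of \<open>u\<close> this is multiplication by \<open>\<phi>\<close>, and on the multiples of
  \<open>u\<close> it replaces the factor \<open>u\<close> by \<open>v\<close>.\<close>

definition Xop :: "(complex \<Rightarrow> complex) \<Rightarrow> complex \<Rightarrow> complex" where
  "Xop f = \<phi> * (f - u * toep u f) + v * toep u f"

text \<open>On the model space of \<open>v\<close> this is the identity, and on the multiples of \<open>v\<close> it replaces the
  factor \<open>v\<close> by \<open>\<phi> * u\<close>.\<close>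

definition Yop :: "(complex \<Rightarrow> complex) \<Rightarrow> complex \<Rightarrow> complex" where
  "Yop f = (f - v * toep v f) + \<phi> * (u * toep v f)"

lemmas uu = inner_E[OF u] and vv = inner_E[OF v]
lemmas H2_rules = Hinf_mult[OF p] Hinf_mult[OF inner_E(1)[OF u]] Hinf_mult[OF inner_E(1)[OF v]] H2_add H2_diff H2_cmult
  toep_H2[OF inner_E(1)[OF u]] toep_H2[OF inner_E(1)[OF v]] zmul_H2

lemma X_H2: "f \<in> car H2 \<Longrightarrow> Xop f \<in> car H2" unfolding Xop_def by (intro H2_rules)
lemma Y_H2: "f \<in> car H2 \<Longrightarrow> Yop f \<in> car H2" unfolding Yop_def by (intro H2_rules)

lemma toep_X: 
  assumes f: "f \<in> car H2" shows "toep v (Xop f) = toep u f"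
proof -
  have "\<phi> * (f - u * toep u f) \<in> model_space v" using mult model_space_proj[OF u f] by blast
  then have "toep v (\<phi> * (f - u * toep u f)) = 0" by (simp add: model_space_iff[OF v])
  then show ?thesis unfolding Xop_def using f
    by (subst toep_add[OF vv(1)]) (auto intro!: H2_rules simp: toep_inner_mult[OF v] toep_H2[OF uu(1)])
qed

lemma YX: 
  assumes f: "f \<in> car H2" shows "Yop (Xop f) = \<phi> * f"
  unfolding Yop_def toep_X[OF f] by (simp add: Xop_def algebra_simps)

lemma X_transformation: "(\<lambda>f\<in>car H2. Xop f) \<in> transformations H2 H2"
proof -
  obtain M where M: "M \<ge> 0" "\<And>f. f \<in> car H2 \<Longrightarrow> hnorm H2 (\<phi> * f) \<le> M * hnorm H2 f" using hnorm_Hinf_mult_ex[OF p] by blast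
  show ?thesis
  proof (rule H2_transformation[where C = "2 * M + 1"])
    fix f g :: "complex \<Rightarrow> complex" and c assume f: "f \<in> car H2"
    show "Xop (f + g) = Xop f + Xop g" if "g \<in> car H2"
      using toep_add[OF uu(1) f that] by (simp add: Xop_def algebra_simps)
    show "Xop (\<lambda>z. c * f z) = (\<lambda>z. c * Xop f z)"
      using toep_cmult[OF uu(1) f, of c] by (simp add: Xop_def fun_eq_iff algebra_simps)
    have t: "hnorm H2 (toep u f) \<le> hnorm H2 f" by (rule hnorm_toep[OF u f])
    have "hnorm H2 (f - u * toep u f) \<le> hnorm H2 f + hnorm H2 (u * toep u f)"
      by (intro H2_hnorm_diff_le H2_rules f)
    then have 1: "hnorm H2 (f - u * toep u f) \<le> 2 * hnorm H2 f" using t by (simp add: hnorm_inner_mult u toep_H2 uu f)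
    have "hnorm H2 (Xop f) \<le> hnorm H2 (\<phi> * (f - u * toep u f)) + hnorm H2 (v * toep u f)"
      unfolding Xop_def by (intro H2.hnorm_triangle H2_rules f)
    also have "\<dots> \<le> M * hnorm H2 (f - u * toep u f) + hnorm H2 f"
      using t by (intro add_mono M(2) H2_rules f) (simp add: hnorm_inner_mult v toep_H2 uu f)
    also have "\<dots> \<le> M * (2 * hnorm H2 f) + hnorm H2 f" using 1 M(1) by (intro add_mono mult_left_mono) auto
    finally show "hnorm H2 (Xop f) \<le> (2 * M + 1) * hnorm H2 f" by (simp add: algebra_simps)
  qed (rule X_H2)
qed

lemma Y_transformation: "(\<lambda>f\<in>car H2. Yop f) \<in> transformations H2 H2"
proof -
  obtain M where M: "M \<ge> 0" "\<And>f. f \<in> car H2 \<Longrightarrow> hnorm H2 (\<phi> * f) \<le> M * hnorm H2 f" using hnorm_Hinf_mult_ex[OF p] by blast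
  show ?thesis
  proof (rule H2_transformation[where C = "2 + M"])
    fix f g :: "complex \<Rightarrow> complex" and c assume f: "f \<in> car H2"
    show "Yop (f + g) = Yop f + Yop g" if "g \<in> car H2"
      using toep_add[OF vv(1) f that] by (simp add: Yop_def algebra_simps)
    show "Yop (\<lambda>z. c * f z) = (\<lambda>z. c * Yop f z)"
      using toep_cmult[OF vv(1) f, of c] by (simp add: Yop_def fun_eq_iff algebra_simps)
    have t: "hnorm H2 (toep v f) \<le> hnorm H2 f" by (rule hnorm_toep[OF v f])
    have "hnorm H2 (f - v * toep v f) \<le> hnorm H2 f + hnorm H2 (v * toep v f)"
      by (intro H2_hnorm_diff_le H2_rules f)
    then have 1: "hnorm H2 (f - v * toep v f) \<le> 2 * hnorm H2 f" using t by (simp add: hnorm_inner_mult v toep_H2 vv f)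
    have "hnorm H2 (Yop f) \<le> hnorm H2 (f - v * toep v f) + hnorm H2 (\<phi> * (u * toep v f))"
      unfolding Yop_def by (intro H2.hnorm_triangle H2_rules f)
    also have "\<dots> \<le> 2 * hnorm H2 f + M * hnorm H2 (u * toep v f)"
      by (intro add_mono 1 M(2) H2_rules f)
    also have "\<dots> \<le> 2 * hnorm H2 f + M * hnorm H2 f"
      using t M(1) by (intro add_mono mult_left_mono order_refl) (simp add: hnorm_inner_mult u toep_H2 vv f)
    finally show "hnorm H2 (Yop f) \<le> (2 + M) * hnorm H2 f" by (simp add: algebra_simps)
  qed (rule Y_H2)
qed

text \<open>The image contains the image of the model space under \<open>\<phi>\<close>, which is dense in the model space of
  \<open>v\<close>, and all multiples of \<open>v\<close>.\<close>

lemma X_dense: "htop H2 closure_of (Xop ` car H2) = car H2"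
proof -
  have sub: "Xop ` car H2 \<subseteq> car H2" using X_H2 by blast
  have "g \<in> htop H2 closure_of (Xop ` car H2)" if g: "g \<in> car H2" for g
  proof -
    obtain f where f: "\<And>n. f n \<in> model_space u" "(\<lambda>n. lnorm2 (\<lambda>y. bv (\<phi> * f n) y - bv (g - v * toep v g) y)) \<longlonglongrightarrow> 0"
      using approx[OF model_space_proj[OF v g]] by blast
    have fH: "f n \<in> car H2" for n by (rule model_H2[OF f(1)])
    have tq: "toep v g \<in> car H2" by (intro H2_rules g)
    have Xf: "Xop (f n + u * toep v g) = \<phi> * f n + v * toep v g" for n
    proof -
      have "toep u (f n + u * toep v g) = toep v g"
        using f(1)[of n] by (simp add: toep_add uu H2_rules tq fH toep_inner_mult[OF u tq] model_space_iff[OF u])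
      then show ?thesis by (simp add: Xop_def)
    qed
    have "lnorm2 (\<lambda>y. bv (Xop (f n + u * toep v g)) y - bv g y) = lnorm2 (\<lambda>y. bv (\<phi> * f n) y - bv (g - v * toep v g) y)" for n
    proof -
      have E: "Xop (f n + u * toep v g) - g = \<phi> * f n - (g - v * toep v g)" unfolding Xf by simp
      have "Xop (f n + u * toep v g) \<in> car H2" by (intro X_H2 H2_rules fH tq)
      from lnorm2_diff_bv[OF this g] show ?thesis
        unfolding E using lnorm2_diff_bv[of "\<phi> * f n" "g - v * toep v g"] by (simp add: H2_rules fH tq g)
    qed
    then have "(\<lambda>n. lnorm2 (\<lambda>y. bv (Xop (f n + u * toep v g)) y - bv g y)) \<longlonglongrightarrow> 0" using f(2) by simp
    moreover have "Xop (f n + u * toep v g) \<in> Xop ` car H2" for n by (intro imageI H2_rules fH g)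
    ultimately show ?thesis unfolding H2_closure_iff[OF sub] using g by (intro conjI exI[of _ "\<lambda>n. Xop (f n + u * toep v g)"]) auto
  qed
  then show ?thesis using H2.closure_htop[OF sub] by blast
qed

end

locale dense_cyclic_multiplier = dense_multiplier +
  fixes c :: complex
  assumes cyc: "cyclic \<phi>" and c1: "cmod c = 1"
    and rel: "AE y in mT. bv \<phi> y = c * bv v y * cnj (bv u y) * cnj (bv \<phi> y)"
begin

lemma phi_nz: "z \<in> ball 0 1 \<Longrightarrow> \<phi> z \<noteq> 0" by (rule cyclic_zero_free[OF p cyc])

lemma phi_inj: "f \<in> car H2 \<Longrightarrow> \<phi> * f = 0 \<Longrightarrow> f = 0"
proof
  fix z assume f: "f \<in> car H2" "\<phi> * f = 0"
  have "\<phi> z * f z = 0" using fun_cong[OF f(2), of z] by simp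
  then show "f z = 0 z" using phi_nz[of z] H2_outside[OF f(1), of z] by auto
qed

text \<open>The operator of the theorem; the inner product with the projection of \<open>v * cnj \<chi>\<close> is the functional
  \<open>tfun v\<close>.\<close>

definition T :: "(complex \<Rightarrow> complex) \<Rightarrow> complex \<Rightarrow> complex" where
  "T f = zmul f + (\<lambda>_. tfun v f / (c * cnj (\<phi> 0))) * (v - \<phi> * u)"

lemma T_op_eq:
  assumes f: "f \<in> car H2" shows "T_op u v \<phi> c f = T f"
proof -
  have h: "L2 (\<lambda>y. bv v y * cnj y)" using L2_mult_id(2)[OF H2_E(3)[OF vv(2)]] by (simp add: mult.commute)
  define P where "P = proj_H2 (\<lambda>y. bv v y * cnj y)"
  have P: "P \<in> car H2" "P = rproj (\<lambda>y. bv v y * cnj y)" unfolding P_def proj_H2_eq[OF h] by (auto intro: rproj_H2[OF h])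
  have "ip H2 f P = lip (bv f) (\<lambda>y. bv v y * cnj y)"
  proof -
    have "lip (\<lambda>y. bv v y * cnj y) (bv f) = lip (bv P) (bv f)" unfolding P(2) by (rule lip_rproj[OF h f])
    then show ?thesis unfolding ip_H2 by (metis lip_cnj)
  qed
  also have "\<dots> = tfun v f" unfolding tfun_def lip_def by (simp add: mult_ac)
  finally have ip: "ip H2 f P = tfun v f" .
  have "ip H2 f (scl H2 (1 / (cnj c * \<phi> 0)) P) = tfun v f / (c * cnj (\<phi> 0))"
    using H2.ip_scl_right[OF f P(1)] ip by simp
  then show ?thesis using f unfolding T_op_def P_def[symmetric]
    by (simp add: rank_one_def shift_def T_def zmul_def scl_H2 times_fun_def plus_fun_def)
qed

lemma T_H2: "f \<in> car H2 \<Longrightarrow> T f \<in> car H2"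
  unfolding T_def cmult_fun[symmetric] by (intro H2_rules vv uu)

lemma tfun_bound: "f \<in> car H2 \<Longrightarrow> cmod (tfun v f) \<le> hnorm H2 f"
proof -
  assume f: "f \<in> car H2"
  have "lip (\<lambda>y. y * bv f y) (bv v) = lip (bv (zmul f)) (bv v)"
    by (rule lip_cong_AE) (use bv_zmul[OF f] in \<open>auto intro!: L2_mult_id H2_E vv zmul_H2 f elim: eventually_mono\<close>)
  then have "tfun v f = ip H2 (zmul f) v" by (simp add: tfun_def ip_H2)
  then have "cmod (tfun v f) \<le> hnorm H2 (zmul f) * hnorm H2 v" using H2.ip_Cauchy_Schwarz[OF zmul_H2[OF f] vv(2)] by simp
  moreover have "hnorm H2 v = hnorm H2 one_disc"
    using inner_isometric[OF v one_disc_H2] vv(2) by (simp add: hnorm_H2)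
  moreover have "hnorm H2 one_disc = 1"
  proof -
    have "lnorm2 (bv one_disc) = lnorm2 (\<lambda>_. 1)" unfolding lnorm2_def by (rule Bochner_Integration.integral_cong) (auto simp: bv_one_disc)
    then show ?thesis by (simp add: hnorm_H2)
  qed
  ultimately show ?thesis by (simp add: hnorm_zmul f)
qed

lemma tfun_add: "f \<in> car H2 \<Longrightarrow> g \<in> car H2 \<Longrightarrow> tfun w (f + g) = tfun w f + tfun w g" if w: "w \<in> car H2"
proof -
  assume f: "f \<in> car H2" and g: "g \<in> car H2"
  have "lip (\<lambda>y. y * bv (f + g) y) (bv w) = lip (\<lambda>y. y * bv f y + y * bv g y) (bv w)"
  proof (rule lip_cong_AE)
    show "AE y in mT. y * bv (f + g) y = y * bv f y + y * bv g y"
      using AE_bv_add[OF f g] by eventually_elim (simp add: ring_distribs)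
  qed (auto intro!: L2_mult_id H2_E w H2_add f g L2_add)
  then show ?thesis unfolding tfun_def by (simp add: lip_add_left H2_E w f g)
qed

lemma tfun_cmult: "f \<in> car H2 \<Longrightarrow> tfun w (\<lambda>z. a * f z) = a * tfun w f" if w: "w \<in> car H2"
proof -
  assume f: "f \<in> car H2"
  have "lip (\<lambda>y. y * bv (\<lambda>z. a * f z) y) (bv w) = lip (\<lambda>y. a * (y * bv f y)) (bv w)"
  proof (rule lip_cong_AE)
    show "AE y in mT. y * bv (\<lambda>z. a * f z) y = a * (y * bv f y)"
      using AE_bv_cmult[OF f, of a] by eventually_elim simp
  qed (auto intro!: L2_mult_id H2_E w H2_cmult f L2_cmult)
  then show ?thesis unfolding tfun_def by (simp add: lip_cmult_left)
qed

lemma T_transformation: "T_op u v \<phi> c \<in> transformations H2 H2"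
proof -
  have w: "v - \<phi> * u \<in> car H2" by (intro H2_rules vv uu)
  define K where "K = inverse (c * cnj (\<phi> 0))"
  have TK: "T f = zmul f + (\<lambda>_. K * tfun v f) * (v - \<phi> * u)" for f by (simp add: T_def K_def divide_inverse mult.commute)
  have "(\<lambda>f\<in>car H2. T f) \<in> transformations H2 H2"
  proof (rule H2_transformation[where C = "1 + cmod K * hnorm H2 (v - \<phi> * u)"])
    fix f g :: "complex \<Rightarrow> complex" and a assume f: "f \<in> car H2"
    show "T (f + g) = T f + T g" if "g \<in> car H2"
      by (rule ext) (simp add: TK tfun_add[OF vv(2) f that] zmul_def algebra_simps)
    show "T (\<lambda>z. a * f z) = (\<lambda>z. a * T f z)"
      by (rule ext) (simp add: TK tfun_cmult[OF vv(2) f] zmul_def algebra_simps)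
    have "hnorm H2 (T f) \<le> hnorm H2 (zmul f) + hnorm H2 (scl H2 (K * tfun v f) (v - \<phi> * u))"
    proof -
      have "T f = zmul f + scl H2 (K * tfun v f) (v - \<phi> * u)" by (rule ext) (simp add: TK scl_H2)
      moreover have "scl H2 (K * tfun v f) (v - \<phi> * u) \<in> car H2" unfolding scl_H2 by (rule H2_cmult[OF w])
      ultimately show ?thesis using H2.hnorm_triangle[OF zmul_H2[OF f]] by simp
    qed
    also have "\<dots> = hnorm H2 f + cmod K * cmod (tfun v f) * hnorm H2 (v - \<phi> * u)"
      using H2.hnorm_scl[OF w] by (simp add: hnorm_zmul f norm_mult)
    also have "\<dots> \<le> hnorm H2 f + cmod K * hnorm H2 f * hnorm H2 (v - \<phi> * u)"
      using tfun_bound[OF f] H2.hnorm_nonneg[OF w] by (intro add_mono mult_right_mono mult_left_mono) auto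
    finally show "hnorm H2 (T f) \<le> (1 + cmod K * hnorm H2 (v - \<phi> * u)) * hnorm H2 f" by (simp add: algebra_simps)
  qed (rule T_H2)
  moreover have "T_op u v \<phi> c = (\<lambda>f\<in>car H2. T f)"
    using T_op_eq by (auto simp: T_op_def fun_eq_iff restrict_def)
  ultimately show ?thesis by simp
qed

text \<open>Here the boundary relation enters: \<open>\<phi> * cnj v = c * cnj u * cnj \<phi>\<close>, and only the constant term
  of \<open>cnj \<phi>\<close> survives because \<open>cnj u * f\<close> minus its projection is orthogonal to the
  Hardy space.\<close>

lemma tfun_X:
  assumes f: "f \<in> car H2"
  shows "tfun v (Xop f) = c * cnj (\<phi> 0) * tfun u f"
proof -
  define q where "q = toep u f"
  have q: "q \<in> car H2" unfolding q_def by (intro H2_rules f)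
  define d where "d y = cnj (bv u y) * bv f y - bv q y" for y
  have uf: "L2 (\<lambda>y. cnj (bv u y) * bv f y)" by (intro L2_cnj_mult uu H2_E f)
  have d: "L2 d" unfolding d_def by (intro L2_minus uf H2_E q)
  have orth: "lip d (bv g) = 0" if g: "g \<in> car H2" for g
  proof -
    have "lip d (bv g) = lip (\<lambda>y. cnj (bv u y) * bv f y) (bv g) - lip (bv q) (bv g)"
      unfolding d_def by (intro lip_diff_left uf H2_E q g)
    also have "\<dots> = 0" unfolding q_def toep_def using lip_rproj[OF uf g] by simp
    finally show ?thesis .
  qed
  have q0: "(\<integral>y. y * bv q y \<partial>mT) = 0"
    using H2_bv_cnj_power[OF q, of 0] by (simp add: lip_def mult.commute)
  have zd: "(\<integral>y. y * d y \<partial>mT) = tfun u f"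
  proof -
    have "(\<integral>y. y * d y \<partial>mT) = (\<integral>y. y * (cnj (bv u y) * bv f y) - y * bv q y \<partial>mT)" by (simp add: d_def right_diff_distrib)
    also have "\<dots> = (\<integral>y. y * (cnj (bv u y) * bv f y) \<partial>mT) - (\<integral>y. y * bv q y \<partial>mT)"
      by (intro Bochner_Integration.integral_diff L2_integrable L2_mult_id uf H2_E q)
    also have "\<dots> = tfun u f" unfolding q0 by (simp add: tfun_def lip_def mult_ac)
    finally show ?thesis .
  qed
  have pH: "\<phi> \<in> car H2" by (rule Hinf_H2[OF p])
  obtain \<phi>\<^sub>1 where \<phi>\<^sub>1: "\<phi>\<^sub>1 \<in> car H2" "\<phi> = (\<lambda>z. \<phi> 0 * one_disc z) + zmul \<phi>\<^sub>1" using backward_shift[OF pH] by blast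
  have bphi: "AE y in mT. bv \<phi> y = \<phi> 0 + y * bv \<phi>\<^sub>1 y"
  proof -
    have "AE y in mT. bv ((\<lambda>z. \<phi> 0 * one_disc z) + zmul \<phi>\<^sub>1) y = \<phi> 0 + y * bv \<phi>\<^sub>1 y"
      using AE_bv_add[OF H2_cmult[OF one_disc_H2] zmul_H2[OF \<phi>\<^sub>1(1)], of "\<phi> 0"] AE_bv_cmult[OF one_disc_H2, of "\<phi> 0"] bv_zmul[OF \<phi>\<^sub>1(1)] AE_sphere
      by eventually_elim (simp add: bv_one_disc)
    then show ?thesis using \<phi>\<^sub>1(2) by metis
  qed
  have "tfun v (Xop f) = (\<integral>y. c * (cnj (\<phi> 0) * (y * d y) + d y * cnj (bv \<phi>\<^sub>1 y)) + y * bv q y \<partial>mT)"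
    unfolding tfun_def lip_def
  proof (rule integral_cong_AE)
    show "(\<lambda>y. y * bv (Xop f) y * cnj (bv v y)) \<in> borel_measurable mT"
      using L2_integrable_lip[OF L2_mult_id(1)[OF H2_E(3)[OF X_H2[OF f]]] H2_E(3)[OF vv(2)]] by auto
    show "(\<lambda>y. c * (cnj (\<phi> 0) * (y * d y) + d y * cnj (bv \<phi>\<^sub>1 y)) + y * bv q y) \<in> borel_measurable mT"
      using L2_measurable[OF d] L2_measurable[OF L2_mult_id(1)[OF d]] H2_measurable[OF \<phi>\<^sub>1(1)] L2_measurable[OF L2_mult_id(1)[OF H2_E(3)[OF q]]] by measurable
    have fq: "f - u * q \<in> car H2" "u * q \<in> car H2" "v * q \<in> car H2" "\<phi> * (f - u * q) \<in> car H2" by (intro H2_rules f q)+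
    show "AE y in mT. y * bv (Xop f) y * cnj (bv v y) = c * (cnj (\<phi> 0) * (y * d y) + d y * cnj (bv \<phi>\<^sub>1 y)) + y * bv q y"
      using AE_bv_add[OF fq(4,3)] bv_Hinf_mult[OF p fq(1)] AE_bv_diff[OF f fq(2)] bv_Hinf_mult[OF uu(1) q] bv_Hinf_mult[OF vv(1) q]
        rel bphi uu(4) vv(4) AE_sphere
    proof eventually_elim
      case (elim y)
      note z = sphere_cnj[OF elim(10)]
      have X: "bv (Xop f) y = bv \<phi> y * (bv f y - bv u y * bv q y) + bv v y * bv q y"
        using elim(1-5) by (simp add: Xop_def q_def)
      have 1: "bv \<phi> y * cnj (bv v y) = c * cnj (bv u y) * cnj (bv \<phi> y)"
      proof -
        have "bv \<phi> y * cnj (bv v y) = c * (bv v y * cnj (bv v y)) * cnj (bv u y) * cnj (bv \<phi> y)" by (subst elim(6)) simp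
        then show ?thesis using elim(9) by simp
      qed
      have 2: "cnj (bv u y) * (bv f y - bv u y * bv q y) = d y"
      proof -
        have "cnj (bv u y) * (bv f y - bv u y * bv q y) = cnj (bv u y) * bv f y - (bv u y * cnj (bv u y)) * bv q y"
          by (simp add: algebra_simps)
        then show ?thesis using elim(8) by (simp add: d_def)
      qed
      have "y * bv (Xop f) y * cnj (bv v y) = 
         y * (bv \<phi> y * cnj (bv v y)) * (bv f y - bv u y * bv q y) + y * (bv v y * cnj (bv v y)) * bv q y"
        unfolding X by (simp add: algebra_simps)
      also have "\<dots> = c * cnj (bv \<phi> y) * y * (cnj (bv u y) * (bv f y - bv u y * bv q y)) + y * bv q y"
        unfolding 1 elim(9) by (simp add: mult_ac)
      also have "\<dots> = c * (cnj (\<phi> 0) * (y * d y) + (y * cnj y) * (d y * cnj (bv \<phi>\<^sub>1 y))) + y * bv q y"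
        unfolding 2 elim(7) by (simp add: algebra_simps)
      finally show ?case unfolding z by simp
    qed
  qed
  also have "\<dots> = c * (cnj (\<phi> 0) * (\<integral>y. y * d y \<partial>mT) + lip d (bv \<phi>\<^sub>1)) + (\<integral>y. y * bv q y \<partial>mT)"
    using L2_integrable[OF L2_mult_id(1)[OF d]] L2_integrable_lip[OF d H2_E(3)[OF \<phi>\<^sub>1(1)]] L2_integrable[OF L2_mult_id(1)[OF H2_E(3)[OF q]]]
    by (simp add: lip_def)
  also have "\<dots> = c * cnj (\<phi> 0) * tfun u f" unfolding q0 zd orth[OF \<phi>\<^sub>1(1)] by simp
  finally show ?thesis .
qed

lemma c_phi_nz: "c * cnj (\<phi> 0) \<noteq> 0" using phi_nz[of 0] c1 by auto

lemma TX: 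
  assumes f: "f \<in> car H2" shows "T (Xop f) = Xop (zmul f)"
proof -
  have 1: "T (Xop f) = zmul (Xop f) + (\<lambda>_. tfun u f) * (v - \<phi> * u)"
    unfolding T_def tfun_X[OF f] using c_phi_nz by simp
  have t: "toep u (zmul f) = zmul (toep u f) + (\<lambda>_. tfun u f) * one_disc"
    using toep_zmul[OF uu(1) f] by (simp only: times_fun_def)
  have o: "v * one_disc = v" "u * one_disc = u" using uu(2) vv(2) by auto
  have "Xop (zmul f) = zmul (Xop f) + (\<lambda>_. tfun u f) * (v * one_disc - \<phi> * (u * one_disc))"
    unfolding Xop_def t by (rule ext) (simp add: zmul_def algebra_simps)
  then show ?thesis unfolding o 1 by (rule sym)
qed

text \<open>By the boundary relation, \<open>cnj v * \<phi> * u = c * cnj \<phi>\<close>.\<close>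

lemma toep_v_phi: 
  assumes h: "h \<in> car H2" shows "toep v (\<phi> * (u * h)) = (\<lambda>z. c * toep \<phi> h z)"
proof (rule H2_eq_tc)
  have uh: "u * h \<in> car H2" "\<phi> * (u * h) \<in> car H2" by (intro H2_rules h)+
  show "toep v (\<phi> * (u * h)) \<in> car H2" by (intro H2_rules uh)
  show "(\<lambda>z. c * toep \<phi> h z) \<in> car H2" by (intro H2_cmult toep_H2 p h)
  fix n
  have "lip (\<lambda>y. cnj (bv v y) * bv (\<phi> * (u * h)) y) (\<lambda>y. y ^ n) = lip (\<lambda>y. c * (cnj (bv \<phi> y) * bv h y)) (\<lambda>y. y ^ n)"
  proof (rule lip_cong_AE)
    show "AE y in mT. cnj (bv v y) * bv (\<phi> * (u * h)) y = c * (cnj (bv \<phi> y) * bv h y)"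
      using bv_Hinf_mult[OF p uh(1)] bv_Hinf_mult[OF uu(1) h] rel uu(4) vv(4)
    proof eventually_elim
      case (elim y)
      have "cnj (bv v y) * bv (\<phi> * (u * h)) y = cnj (bv v y) * ((c * bv v y * cnj (bv u y) * cnj (bv \<phi> y)) * (bv u y * bv h y))"
        using elim(1-3) by simp
      also have "\<dots> = (bv v y * cnj (bv v y)) * (bv u y * cnj (bv u y)) * (c * (cnj (bv \<phi> y) * bv h y))" by (simp add: mult_ac)
      finally show ?case using elim(4,5) by simp
    qed
  qed (auto intro!: L2_cnj_mult L2_cmult H2_E vv p uh h)
  then show "tc (toep v (\<phi> * (u * h))) n = tc (\<lambda>z. c * toep \<phi> h z) n"
    by (simp add: tc_toep vv uh tc_cmult toep_H2 p h lip_cmult_left)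
qed

lemma YT: 
  assumes f: "f \<in> car H2" shows "Yop (T f) = zmul (Yop f)"
proof -
  define s where "s = tfun v f / (c * cnj (\<phi> 0))"
  have st: "s * (c * cnj (\<phi> 0)) = tfun v f" unfolding s_def using c_phi_nz by simp
  have pu: "\<phi> * u \<in> car H2" by (intro H2_rules uu)
  have w: "v - \<phi> * u \<in> car H2" by (intro H2_rules vv uu)
  have "toep v (v * one_disc) = one_disc" by (rule toep_inner_mult[OF v one_disc_H2])
  then have tv: "toep v v = one_disc" using vv(2) by simp
  have "toep v (\<phi> * (u * one_disc)) = (\<lambda>z. c * (cnj (\<phi> 0) * one_disc z))"
    using toep_v_phi[OF one_disc_H2] toep_one[OF p] by simp
  then have tp: "toep v (\<phi> * u) = (\<lambda>z. c * cnj (\<phi> 0) * one_disc z)" using uu(2) by (simp add: mult.assoc)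
  have "toep v (T f) = toep v (zmul f) + toep v (\<lambda>z. s * (v - \<phi> * u) z)"
    unfolding T_def s_def[symmetric] cmult_fun[symmetric] by (rule toep_add[OF vv(1) zmul_H2[OF f] H2_cmult[OF w]])
  also have "toep v (\<lambda>z. s * (v - \<phi> * u) z) = (\<lambda>z. s * (toep v v - toep v (\<phi> * u)) z)"
    unfolding toep_cmult[OF vv(1) w] toep_diff[OF vv(1) vv(2) pu] ..
  also have "toep v (zmul f) + (\<lambda>z. s * (toep v v - toep v (\<phi> * u)) z) = zmul (toep v f) + (\<lambda>_. s) * one_disc"
    unfolding toep_zmul[OF vv(1) f] tv tp by (rule ext) (simp add: st[symmetric] algebra_simps)
  finally have q: "toep v (T f) = zmul (toep v f) + (\<lambda>_. s) * one_disc" .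
  have o: "v * one_disc = v" "u * one_disc = u" using uu(2) vv(2) by auto
  have "Yop (T f) = zmul (Yop f) + (\<lambda>_. s) * (v - \<phi> * u - v * one_disc + \<phi> * (u * one_disc))"
    unfolding Yop_def q unfolding T_def s_def[symmetric] by (rule ext) (simp add: zmul_def algebra_simps)
  then show ?thesis unfolding o by simp
qed

text \<open>Multiplying the approximations of \<open>1\<close> by a bounded function gives approximations of that function.\<close>

lemma cyclic_seq:
  obtains h where "\<And>n. h n \<in> car H2" "\<And>q. q \<in> Hinf \<Longrightarrow> (\<lambda>n. hnorm H2 (q - \<phi> * (q * h n))) \<longlonglongrightarrow> 0"
proof -
  obtain h where h: "\<And>n. h n \<in> car H2" "(\<lambda>n. lnorm2 (\<lambda>y. bv \<phi> y * bv (h n) y - 1)) \<longlonglongrightarrow> 0"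
    using cyc unfolding cyclic_def by blast
  have Ld: "L2 (\<lambda>y. bv \<phi> y * bv (h n) y - 1)" for n by (intro L2_minus L2_cnj_mult p H2_E h) simp
  have "(\<lambda>n. hnorm H2 (q - \<phi> * (q * h n))) \<longlonglongrightarrow> 0" if q: "q \<in> Hinf" for q
  proof -
    obtain B where B: "AE y in mT. cmod (bv q y) \<le> B" using Hinf_bv_bounded[OF q] by blast
    have qH: "q \<in> car H2" by (rule Hinf_H2[OF q])
    have qh: "q * h n \<in> car H2" "\<phi> * (q * h n) \<in> car H2" for n by (intro Hinf_mult q p h)+
    have "(hnorm H2 (q - \<phi> * (q * h n)))\<^sup>2 = lnorm2 (\<lambda>y. bv q y * (bv \<phi> y * bv (h n) y - 1))" for n
    proof -
      have "(hnorm H2 (q - \<phi> * (q * h n)))\<^sup>2 = lnorm2 (\<lambda>y. bv (\<phi> * (q * h n)) y - bv q y)"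
        by (simp add: lnorm2_diff_bv qh qH H2.hnorm_minus_commute)
      also have "\<dots> = lnorm2 (\<lambda>y. bv q y * (bv \<phi> y * bv (h n) y - 1))"
      proof (rule L2_cong_AE(2)[OF L2_cnj_mult(2)[OF q Ld]])
        show "AE y in mT. bv (\<phi> * (q * h n)) y - bv q y = bv q y * (bv \<phi> y * bv (h n) y - 1)"
          using bv_Hinf_mult[OF p qh(1)[of n]] bv_Hinf_mult[OF q h(1)[of n]] by eventually_elim (simp add: algebra_simps)
      qed
      finally show ?thesis .
    qed
    then have "(\<lambda>n. (hnorm H2 (q - \<phi> * (q * h n)))\<^sup>2) \<longlonglongrightarrow> 0"
      using lnorm2_mult_tendsto[OF H2_measurable[OF qH] B Ld h(2)] by simp
    from tendsto_real_sqrt[OF this] show ?thesis using H2.hnorm_nonneg[OF H2_diff[OF qH qh(2)]] by simp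
  qed
  with h(1) that show ?thesis by blast
qed

text \<open>The kernel of the adjoint of multiplication by \<open>\<phi>\<close> is orthogonal to all multiples of
  \<open>\<phi>\<close>, which are dense.\<close>

lemma toep_phi_inj:
  assumes f: "f \<in> car H2" and 0: "toep \<phi> f = 0" shows "f = 0"
proof (rule H2_eq_0[OF f])
  fix m
  obtain h where h: "\<And>n. h n \<in> car H2" "\<And>q. q \<in> Hinf \<Longrightarrow> (\<lambda>n. hnorm H2 (q - \<phi> * (q * h n))) \<longlonglongrightarrow> 0"
    using cyclic_seq by blast
  let ?m = "mono_disc m"
  have mh: "?m * h n \<in> car H2" "\<phi> * (?m * h n) \<in> car H2" for n by (intro Hinf_mult mono_disc_Hinf p h)+
  have z: "ip H2 f (\<phi> * (?m * h n)) = 0" for n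
  proof -
    have "ip H2 f (\<phi> * (?m * h n)) = lip (bv (toep \<phi> f)) (bv (?m * h n))"
      by (simp add: ip_H2 lip_toep p f mh)
    also have "\<dots> = ip H2 0 (?m * h n)" by (simp add: 0 ip_H2)
    finally show ?thesis using H2.ip_zero_left[OF mh(1)] by simp
  qed
  have "cmod (ip H2 f ?m) \<le> hnorm H2 f * hnorm H2 (?m - \<phi> * (?m * h n))" for n
  proof -
    have "ip H2 f ?m = ip H2 f (\<phi> * (?m * h n) + (?m - \<phi> * (?m * h n)))" by simp
    also have "\<dots> = ip H2 f (?m - \<phi> * (?m * h n))"
      using z[of n] f mh by (subst H2.ip_add_right) (auto intro: H2_diff)
    finally show ?thesis using H2.ip_Cauchy_Schwarz[OF f H2_diff[OF mono_disc_H2 mh(2)]] by simp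
  qed
  moreover have "(\<lambda>n. hnorm H2 f * hnorm H2 (?m - \<phi> * (?m * h n))) \<longlonglongrightarrow> 0"
    by (rule tendsto_mult_right_zero[OF h(2)[OF mono_disc_Hinf]])
  ultimately have "cmod (ip H2 f ?m) \<le> 0" by (intro LIMSEQ_le_const) auto
  then show "tc f m = 0" using lip_mono_disc[OF H2_E(3)[OF f], of m] by (simp add: ip_H2 tc_def)
qed

lemma X_inj: "f \<in> car H2 \<Longrightarrow> Xop f = 0 \<Longrightarrow> f = 0"
proof -
  assume f: "f \<in> car H2" "Xop f = 0"
  have t0: "toep v 0 = 0" using toep_cmult[OF vv(1) one_disc_H2, of 0] by (simp add: zero_fun_def)
  have "\<phi> * f = Yop 0" using YX[OF f(1)] f(2) by simp
  also have "\<dots> = 0" by (simp add: Yop_def t0)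
  finally show "f = 0" by (rule phi_inj[OF f(1)])
qed

lemma Y_inj:
  assumes f: "f \<in> car H2" and 0: "Yop f = 0" shows "f = 0"
proof -
  define h where "h = toep v f"
  have h: "h \<in> car H2" unfolding h_def by (intro H2_rules f)
  have t0: "toep v 0 = 0" using toep_cmult[OF vv(1) one_disc_H2, of 0] by (simp add: zero_fun_def)
  have "toep v (Yop f) = toep v (f - v * h) + toep v (\<phi> * (u * h))"
    unfolding Yop_def h_def[symmetric] by (intro toep_add vv H2_rules f h)
  also have "toep v (f - v * h) = 0" using model_space_proj[OF v f] by (simp add: h_def model_space_iff[OF v])
  finally have "toep v (Yop f) = 0 + toep v (\<phi> * (u * h))" .
  then have "(\<lambda>z. c * toep \<phi> h z) = 0" unfolding 0 t0 toep_v_phi[OF h] by (metis add_0)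
  then have "toep \<phi> h = 0" using c1 by (auto simp: fun_eq_iff)
  then have "h = 0" by (rule toep_phi_inj[OF h])
  then show "f = 0" using 0 by (simp add: Yop_def h_def[symmetric])
qed

text \<open>The image contains all multiples of \<open>\<phi>\<close>, by \<open>YX\<close>.\<close>

lemma Y_dense: "htop H2 closure_of (Yop ` car H2) = car H2"
proof -
  have sub: "Yop ` car H2 \<subseteq> car H2" using Y_H2 by blast
  obtain h where h: "\<And>n. h n \<in> car H2" "\<And>q. q \<in> Hinf \<Longrightarrow> (\<lambda>n. hnorm H2 (q - \<phi> * (q * h n))) \<longlonglongrightarrow> 0"
    using cyclic_seq by blast
  have "g \<in> htop H2 closure_of (Yop ` car H2)" if g: "g \<in> car H2" for g
    unfolding H2.closure_htop[OF sub]
  proof (intro conjI allI impI g)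
    fix e :: real assume "e > 0"
    then have e: "e / 2 > 0" by simp
    obtain N where N: "hnorm H2 (g - on_disc (psum (tc g) N)) < e / 2"
      using order_tendstoD(2)[OF polynomials_dense[OF g] e] by (auto simp: eventually_sequentially)
    define q where "q = on_disc (psum (tc g) N)"
    have q: "q \<in> Hinf" "q \<in> car H2" unfolding q_def by (rule poly_disc_Hinf poly_disc_H2)+
    obtain n where n: "hnorm H2 (q - \<phi> * (q * h n)) < e / 2"
      using order_tendstoD(2)[OF h(2)[OF q(1)] e] by (auto simp: eventually_sequentially)
    have qh: "q * h n \<in> car H2" by (intro Hinf_mult q h)
    have "g - \<phi> * (q * h n) = (g - q) + (q - \<phi> * (q * h n))" by simp
    then have "hnorm H2 (g - \<phi> * (q * h n)) \<le> hnorm H2 (g - q) + hnorm H2 (q - \<phi> * (q * h n))"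
      using H2.hnorm_triangle[of "g - q" "q - \<phi> * (q * h n)"] g q qh by (simp add: H2_rules del: diff_add_cancel)
    then have "hnorm H2 (g - \<phi> * (q * h n)) < e" using N n by (simp add: q_def)
    moreover have "\<phi> * (q * h n) \<in> Yop ` car H2" using YX[OF qh] X_H2[OF qh] by (metis imageI)
    ultimately show "\<exists>y\<in>Yop ` car H2. hnorm H2 (g - y) < e" by blast
  qed
  then show ?thesis using H2.closure_htop[OF sub] by blast
qed

lemma restrict_image: "(\<lambda>f\<in>car H2. F f) ` car H2 = F ` car H2" by auto

theorem T_quasisimilar: "quasisimilar H2 (T_op u v \<phi> c) H2 shift"
proof -
  have sh: "shift f = zmul f" if "f \<in> car H2" for f using that by (simp add: shift_def zmul_def)
  have X0: "Xop 0 = 0"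
  proof -
    have "toep u 0 = 0" using toep_cmult[OF uu(1) one_disc_H2, of 0] by (simp add: zero_fun_def)
    then show ?thesis by (simp add: Xop_def)
  qed
  have Y0: "Yop 0 = 0"
  proof -
    have "toep v 0 = 0" using toep_cmult[OF vv(1) one_disc_H2, of 0] by (simp add: zero_fun_def)
    then show ?thesis by (simp add: Yop_def)
  qed
  have "quasiaffinity H2 H2 (\<lambda>f\<in>car H2. Yop f)"
    unfolding quasiaffinity_def restrict_image using Y_transformation Y_dense Y_inj Y0 by auto
  moreover have "intertwines H2 (\<lambda>f\<in>car H2. Yop f) (T_op u v \<phi> c) shift"
    unfolding intertwines_def by (simp add: T_op_eq T_H2 YT sh Y_H2)
  moreover have "quasiaffinity H2 H2 (\<lambda>f\<in>car H2. Xop f)"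
    unfolding quasiaffinity_def restrict_image using X_transformation X_dense X_inj X0 by auto
  moreover have "intertwines H2 (\<lambda>f\<in>car H2. Xop f) shift (T_op u v \<phi> c)"
    unfolding intertwines_def by (simp add: T_op_eq TX sh X_H2)
  ultimately show ?thesis unfolding quasisimilar_def quasiaffine_transform_def by blast
qed

end

section \<open>Boundary evaluation on a model space\<close>

lemma boundary_kernel_eq:
  assumes v: "inner_function v" and z: "y \<in> sphere 0 1"
  defines "q \<equiv> boundary_kernel v y"
  shows "q = (one_disc - (\<lambda>z. cnj (bv v y) * v z)) + (\<lambda>z. cnj y * zmul q z)"
proof
  fix x
  show "q x = ((one_disc - (\<lambda>z. cnj (bv v y) * v z)) + (\<lambda>z. cnj y * zmul q z)) x"
  proof (cases "x \<in> ball 0 1")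
    case True
    have "cmod (cnj y * x) < 1" using True z by (simp add: norm_mult)
    then have "1 - cnj y * x \<noteq> 0" by auto
    moreover have "q x * (1 - cnj y * x) = 1 - cnj (bv v y) * v x"
      using True calculation by (simp add: q_def boundary_kernel_def on_disc_def)
    ultimately show ?thesis using True by (simp add: one_disc_def on_disc_def zmul_def algebra_simps)
  next
    case False
    then show ?thesis using H2_outside[OF inner_E(2)[OF v], of x]
      by (simp add: one_disc_def on_disc_def zmul_def q_def boundary_kernel_def)
  qed
qed

lemma ip_zmul:
  assumes f: "f \<in> car H2" and g: "g \<in> car H2"
  shows "ip H2 (zmul f) (zmul g) = ip H2 f g"
  unfolding ip_H2
proof (rule lip_cong_AE')
  show "AE y in mT. bv (zmul f) y * cnj (bv (zmul g) y) = bv f y * cnj (bv g y)"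
    using bv_zmul[OF f] bv_zmul[OF g] AE_sphere
  proof eventually_elim
    case (elim y)
    have "bv (zmul f) y * cnj (bv (zmul g) y) = (y * cnj y) * (bv f y * cnj (bv g y))" using elim(1,2) by simp
    then show ?case using sphere_cnj[OF elim(3)] by simp
  qed
qed (intro H2_E zmul_H2 f g)+

lemma ip_one_disc: 
  assumes f: "f \<in> car H2" shows "ip H2 f one_disc = f 0"
  by (simp add: ip_H2 lip_one_disc H2_mean[OF f])

text \<open>Model spaces are invariant under the backward shift, and the boundary kernel at \<open>y\<close> behaves
  under the backward shift like the evaluation of a power series at \<open>y\<close>.\<close>

lemma model_space_backward_shift:
  assumes v: "inner_function v" and g: "g \<in> model_space v"
  obtains G where "G \<in> model_space v" "\<And>n. tc G n = tc g (Suc n)"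
    "\<And>y. y \<in> E_set v \<Longrightarrow> ip H2 g (boundary_kernel v y) = tc g 0 + y * ip H2 G (boundary_kernel v y)"
proof -
  note vv = inner_E[OF v]
  have gH: "g \<in> car H2" and orth: "\<And>h. h \<in> car H2 \<Longrightarrow> ip H2 g (v * h) = 0" using g by (auto simp: model_space_def)
  define a where "a = g 0"
  obtain G where G: "G \<in> car H2" "g = (\<lambda>z. a * one_disc z) + zmul G"
    unfolding a_def by (rule backward_shift[OF gH])
  have tG: "tc G n = tc g (Suc n)" for n
    unfolding G(2) by (simp add: tc_add tc_cmult tc_one_disc tc_zmul G(1) H2_cmult)
  have split: "ip H2 g (zmul h) = ip H2 G h" if h: "h \<in> car H2" for h
  proof -
    have "ip H2 one_disc (zmul h) = cnj (ip H2 (zmul h) one_disc)" by (intro H2.ip_cnj one_disc_H2 zmul_H2 h)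
    also have "\<dots> = 0" using ip_one_disc[OF zmul_H2[OF h]] by (simp add: zmul_def)
    finally have 0: "ip H2 (scl H2 a one_disc) (zmul h) = 0"
      using H2.ip_scl_left[OF one_disc_H2 zmul_H2[OF h]] by simp
    have "ip H2 g (zmul h) = ip H2 (scl H2 a one_disc + zmul G) (zmul h)" unfolding scl_H2 by (rule arg_cong[OF G(2)])
    also have "\<dots> = ip H2 (scl H2 a one_disc) (zmul h) + ip H2 (zmul G) (zmul h)"
      by (rule H2.ip_add_left) (auto simp: scl_H2 H2_cmult G h)
    finally show ?thesis using 0 ip_zmul[OF G(1) h] by simp
  qed
  have "ip H2 G (v * h) = 0" if h: "h \<in> car H2" for h
  proof -
    have "zmul (v * h) = v * zmul h" by (rule ext) (simp add: zmul_def)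
    then show ?thesis using split[OF Hinf_mult[OF vv(1) h]] orth[OF zmul_H2[OF h]] by simp
  qed
  then have GK: "G \<in> model_space v" using G by (simp add: model_space_def)
  have "ip H2 g (boundary_kernel v y) = tc g 0 + y * ip H2 G (boundary_kernel v y)" if E: "y \<in> E_set v" for y
  proof -
    define q where "q = boundary_kernel v y"
    have z: "y \<in> sphere 0 1" and q: "q \<in> car H2" using E by (auto simp: E_set_def q_def)
    have eq: "q = (one_disc - scl H2 (cnj (bv v y)) v) + scl H2 (cnj y) (zmul q)"
      using boundary_kernel_eq[OF v z] unfolding q_def[symmetric] scl_H2 .
    have c: "scl H2 (cnj (bv v y)) v \<in> car H2" "scl H2 (cnj y) (zmul q) \<in> car H2"
      unfolding scl_H2 by (intro H2_cmult vv zmul_H2 q)+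
    have "v * one_disc = v" using vv(2) by simp
    then have v0: "ip H2 g v = 0" using orth[OF one_disc_H2] by simp
    have "ip H2 g q = ip H2 g (one_disc - scl H2 (cnj (bv v y)) v) + ip H2 g (scl H2 (cnj y) (zmul q))"
      by (subst (1) eq) (intro H2.ip_add_right H2_diff one_disc_H2 c gH)
    also have "ip H2 g (scl H2 (cnj y) (zmul q)) = y * ip H2 G q"
      using H2.ip_scl_right[OF gH zmul_H2[OF q], of "cnj y"] split[OF q] by simp
    also have "ip H2 g (one_disc - scl H2 (cnj (bv v y)) v) = g 0"
    proof -
      have "ip H2 g one_disc = ip H2 g ((one_disc - scl H2 (cnj (bv v y)) v) + scl H2 (cnj (bv v y)) v)" by simp
      also have "\<dots> = ip H2 g (one_disc - scl H2 (cnj (bv v y)) v) + ip H2 g (scl H2 (cnj (bv v y)) v)"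
        by (intro H2.ip_add_right H2_diff one_disc_H2 c gH)
      also have "ip H2 g (scl H2 (cnj (bv v y)) v) = 0" using H2.ip_scl_right[OF gH vv(2)] v0 by simp
      finally show ?thesis using ip_one_disc[OF gH] by (metis add_0_right)
    qed
    finally show ?thesis unfolding q_def H2_at_0[OF gH] .
  qed
  with GK tG that show ?thesis by blast
qed

lemma model_space_iterated_shift:
  assumes v: "inner_function v" and g: "g \<in> model_space v"
  shows "\<exists>G. G \<in> model_space v \<and> (\<forall>n. tc G n = tc g (n + N)) \<and> (\<forall>y\<in>E_set v.
     ip H2 g (boundary_kernel v y) = psum (tc g) N y + y ^ N * ip H2 G (boundary_kernel v y))"
proof (induction N)
  case 0
  show ?case using g by (intro exI[of _ g]) (simp add: psum_def)
next
  case (Suc N)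
  then obtain G where G: "G \<in> model_space v" "\<And>n. tc G n = tc g (n + N)"
    "\<And>y. y \<in> E_set v \<Longrightarrow> ip H2 g (boundary_kernel v y) = psum (tc g) N y + y ^ N * ip H2 G (boundary_kernel v y)" by blast
  obtain G' where G': "G' \<in> model_space v" "\<And>n. tc G' n = tc G (Suc n)"
    "\<And>y. y \<in> E_set v \<Longrightarrow> ip H2 G (boundary_kernel v y) = tc G 0 + y * ip H2 G' (boundary_kernel v y)"
    using model_space_backward_shift[OF v G(1)] by metis
  have "ip H2 g (boundary_kernel v y) = psum (tc g) (Suc N) y + y ^ Suc N * ip H2 G' (boundary_kernel v y)" if "y \<in> E_set v" for y
    using G(3)[OF that] G'(3)[OF that] G(2)[of 0] by (simp add: psum_def algebra_simps)
  then show ?case using G'(1,2) G(2) by (intro exI[of _ G']) simp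
qed

text \<open>The remainder is an inner product with an iterated backward shift, whose norm tends to \<open>0\<close>.\<close>

lemma model_space_eval:
  assumes v: "inner_function v" and g: "g \<in> model_space v" and E: "y \<in> E_set v"
  shows "(\<lambda>N. psum (tc g) N y) \<longlonglongrightarrow> ip H2 g (boundary_kernel v y)"
proof -
  let ?q = "boundary_kernel v y"
  have z: "cmod y = 1" and q: "?q \<in> car H2" using E by (auto simp: E_set_def)
  have gH: "g \<in> car H2" using g by (simp add: model_space_def)
  have sm: "summable (\<lambda>n. (cmod (tc g n))\<^sup>2)" using H2_E(1)[OF gH] by (simp add: l2_def)
  have bd: "cmod (psum (tc g) N y - ip H2 g ?q) \<le> sqrt (\<Sum>n. (cmod (tc g (n + N)))\<^sup>2) * hnorm H2 ?q" for N
  proof -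
    obtain G where G: "G \<in> model_space v" "\<And>n. tc G n = tc g (n + N)"
      "ip H2 g ?q = psum (tc g) N y + y ^ N * ip H2 G ?q" using model_space_iterated_shift[OF v g, of N] E by blast
    have GH: "G \<in> car H2" using G(1) by (simp add: model_space_def)
    have "cmod (psum (tc g) N y - ip H2 g ?q) = cmod (ip H2 G ?q)" using G(3) z by (simp add: norm_mult norm_power)
    also have "\<dots> \<le> hnorm H2 G * hnorm H2 ?q" by (rule H2.ip_Cauchy_Schwarz[OF GH q])
    also have "hnorm H2 G = sqrt (\<Sum>n. (cmod (tc g (n + N)))\<^sup>2)" by (simp add: hnorm_H2 lnorm2_bv[OF GH] G(2))
    finally show ?thesis .
  qed
  have "(\<lambda>N. sqrt (\<Sum>n. (cmod (tc g (n + N)))\<^sup>2)) \<longlonglongrightarrow> sqrt 0"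
    by (rule tendsto_real_sqrt[OF suminf_exist_split2[OF sm]])
  then have "(\<lambda>N. sqrt (\<Sum>n. (cmod (tc g (n + N)))\<^sup>2) * hnorm H2 ?q) \<longlonglongrightarrow> 0"
    by (intro tendsto_mult_left_zero) simp
  then have "(\<lambda>N. psum (tc g) N y - ip H2 g ?q) \<longlonglongrightarrow> 0"
    by (rule Lim_null_comparison[rotated]) (use bd in \<open>auto intro: always_eventually\<close>)
  then show ?thesis by (simp add: LIM_zero_iff)
qed

text \<open>The partial sums of the Taylor series converge to the inner product by \<open>model_space_eval\<close>, and a
  subsequence of them converges to the boundary function almost everywhere.\<close>

lemma AE_bv_model_space:
  assumes v: "inner_function v" and g: "g \<in> model_space v"
  shows "AE y in mT. y \<in> E_set v \<longrightarrow> bv g y = ip H2 g (boundary_kernel v y)"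
proof -
  have gH: "g \<in> car H2" using g by (simp add: model_space_def)
  obtain N where N: "\<And>k. k \<le> N k" "AE y in mT. (pser (tc g) \<longlongrightarrow> bv (pser (tc g)) y) (nontangential y) \<and> (\<lambda>k. psum (tc g) (N k) y) \<longlonglongrightarrow> bv (pser (tc g)) y"
    by (rule Fatou_l2[OF H2_E(1)[OF gH]]) (rule that)
  have lim: "filterlim N at_top sequentially"
    by (rule filterlim_at_top_mono[OF filterlim_ident]) (use N(1) in auto)
  from N(2) show ?thesis
  proof eventually_elim
    case (elim y)
    then have "(\<lambda>k. psum (tc g) (N k) y) \<longlonglongrightarrow> bv g y" by (simp add: H2_E(2)[OF gH])
    then show ?case using filterlim_compose[OF model_space_eval[OF v g] lim] by (blast intro: LIMSEQ_unique)
  qed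
qed

text \<open>The Taylor coefficients of the boundary kernel at \<open>y\<close>, written so that they are visibly
  measurable in \<open>y\<close>.\<close>

primrec kernel_coeff :: "(complex \<Rightarrow> complex) \<Rightarrow> complex \<Rightarrow> nat \<Rightarrow> complex" where
  "kernel_coeff v y 0 = 1 - cnj (bv v y) * tc v 0"
| "kernel_coeff v y (Suc n) = cnj y * kernel_coeff v y n - cnj (bv v y) * tc v (Suc n)"

definition kernel_norm :: "(complex \<Rightarrow> complex) \<Rightarrow> complex \<Rightarrow> real" where
  "kernel_norm v y = (\<Sum>n. (cmod (kernel_coeff v y n))\<^sup>2)"

lemma tc_boundary_kernel:
  assumes v: "inner_function v" and E: "y \<in> E_set v"
  shows "tc (boundary_kernel v y) n = kernel_coeff v y n"
proof -
  define q where "q = boundary_kernel v y"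
  have z: "y \<in> sphere 0 1" and q: "q \<in> car H2" using E by (auto simp: E_set_def q_def)
  have c: "(\<lambda>z. cnj (bv v y) * v z) \<in> car H2" "(\<lambda>z. cnj y * zmul q z) \<in> car H2"
    by (intro H2_cmult inner_E[OF v] zmul_H2 q)+
  have eq: "tc q n = tc ((one_disc - (\<lambda>z. cnj (bv v y) * v z)) + (\<lambda>z. cnj y * zmul q z)) n" for n
    using boundary_kernel_eq[OF v z] unfolding q_def[symmetric] by (rule arg_cong)
  have rec: "tc q n = tc one_disc n - cnj (bv v y) * tc v n + cnj y * tc (zmul q) n" for n
    unfolding eq[of n] by (simp only: tc_add[OF H2_diff[OF one_disc_H2 c(1)] c(2)] tc_diff[OF one_disc_H2 c(1)] tc_cmult[OF inner_E(2)[OF v]] tc_cmult[OF zmul_H2[OF q]])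
  have "tc q n = kernel_coeff v y n"
  proof (induction n)
    case 0 show ?case using rec[of 0] by (simp add: tc_one_disc tc_zmul(1)[OF q])
  next
    case (Suc n) show ?case using rec[of "Suc n"] Suc by (simp add: tc_one_disc tc_zmul(2)[OF q])
  qed
  then show ?thesis by (simp add: q_def)
qed

lemma kernel_norm_measurable:
  assumes v: "inner_function v"
  shows "kernel_norm v \<in> borel_measurable mT"
proof -
  have [measurable]: "bv v \<in> borel_measurable mT" by (rule H2_measurable[OF inner_E(2)[OF v]])
  have [measurable]: "(\<lambda>y. y) \<in> borel_measurable mT" by (rule borel_measurable_mT_continuous(2)) (rule continuous_on_id)
  have [measurable]: "(\<lambda>y. kernel_coeff v y n) \<in> borel_measurable mT" for n by (induction n) simp_all
  show ?thesis unfolding kernel_norm_def[abs_def] by measurable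
qed

lemma model_space_boundary_bound:
  assumes v: "inner_function v" and g: "g \<in> model_space v"
  shows "AE y in mT. y \<in> E_set v \<longrightarrow> (cmod (bv g y))\<^sup>2 \<le> kernel_norm v y * (hnorm H2 g)\<^sup>2"
  using AE_bv_model_space[OF v g]
proof eventually_elim
  case (elim y)
  show ?case
  proof
    assume E: "y \<in> E_set v"
    have q: "boundary_kernel v y \<in> car H2" using E by (simp add: E_set_def)
    have gH: "g \<in> car H2" using g by (simp add: model_space_def)
    have "(hnorm H2 (boundary_kernel v y))\<^sup>2 = lnorm2 (bv (boundary_kernel v y))" by (simp add: hnorm_H2)
    also have "\<dots> = kernel_norm v y" unfolding lnorm2_bv[OF q] kernel_norm_def tc_boundary_kernel[OF v E] ..
    finally have "(hnorm H2 (boundary_kernel v y))\<^sup>2 = kernel_norm v y" .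
    moreover have "(cmod (bv g y))\<^sup>2 \<le> (hnorm H2 g * hnorm H2 (boundary_kernel v y))\<^sup>2"
      using elim E H2.ip_Cauchy_Schwarz[OF gH q] by (intro power_mono) auto
    ultimately show "(cmod (bv g y))\<^sup>2 \<le> kernel_norm v y * (hnorm H2 g)\<^sup>2"
      by (simp add: power_mult_distrib mult.commute)
  qed
qed

lemma AE_E_set:
  assumes "measure mT (E_set v) = 1" shows "AE y in mT. y \<in> E_set v"
proof -
  have s: "E_set v \<in> sets mT" using assms measure_notin_sets by force
  have "measure mT (space mT - E_set v) = 0" using mT.finite_measure_compl[OF s] assms by simp
  then have "space mT - E_set v \<in> null_sets mT"
    using sets.compl_sets[OF s] by (intro null_setsI) (simp_all add: mT.emeasure_eq_measure)
  from AE_not_in[OF this] AE_sphere show ?thesis by eventually_elim simp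
qed

section \<open>Weighted boundary traces in the sequence space\<close>

lemma l2_fourier_coeffs: "L2 h \<Longrightarrow> l2 (fourier h)"
  using parseval[of h] by (simp add: l2_def sums_iff)

lemma hnorm_fourier: "L2 h \<Longrightarrow> hnorm ell2 (fourier h) = sqrt (lnorm2 h)"
  using parseval[of h] by (simp add: hnorm_ell2 l2_fourier_coeffs sums_iff)

lemma fourier_cong: "L2 f \<Longrightarrow> L2 g \<Longrightarrow> AE y in mT. f y = g y \<Longrightarrow> fourier f = fourier g"
  unfolding fourier_def by (rule ext, rule lip_cong_AE) auto

lemma fourier_add: "L2 f \<Longrightarrow> L2 g \<Longrightarrow> fourier (\<lambda>y. f y + g y) = fourier f + fourier g"
  by (rule ext) (simp add: fourier_def lip_add_left)

lemma fourier_cmult: "fourier (\<lambda>y. c * f y) = (\<lambda>n. c * fourier f n)"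
  by (rule ext) (simp add: fourier_def lip_cmult_left)

text \<open>The index of the preceding frequency.\<close>

definition back_index :: "nat \<Rightarrow> nat" where "back_index n = int_encode (int_decode n - 1)"

lemma bij_back_index: "bij back_index"
proof (rule o_bij)
  show "(\<lambda>n. int_encode (int_decode n + 1)) \<circ> back_index = id" "back_index \<circ> (\<lambda>n. int_encode (int_decode n + 1)) = id"
    by (auto simp: back_index_def fun_eq_iff)
qed

lemma fourier_id_mult: 
  assumes "L2 h" shows "fourier (\<lambda>y. y * h y) n = fourier h (back_index n)"
  unfolding fourier_def back_index_def int_encode_inverse lip_def
proof (rule Bochner_Integration.integral_cong[OF refl])
  fix y assume "y \<in> space mT"
  then have z: "y \<in> sphere 0 1" by simp
  let ?k = "int_decode n - 1"
  have "y * h y * cnj (freq (?k + 1) y) = (y * cnj y) * (h y * cnj (freq ?k y))"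
    unfolding freq_Suc[OF z] by simp
  then show "y * h y * cnj (freq (int_decode n) y) = h y * cnj (freq ?k y)" using sphere_cnj[OF z] by simp
qed

definition bilateral_shift :: "(nat \<Rightarrow> complex) \<Rightarrow> nat \<Rightarrow> complex" where
  "bilateral_shift = (\<lambda>a\<in>car ell2. \<lambda>n. a (back_index n))"

lemma bilateral_shift_isometry: "bilateral_shift \<in> isometries ell2"
  unfolding isometries_def transformations_def bilateral_shift_def mem_Collect_eq
proof (intro conjI exI[of _ 1])
  show "(\<lambda>a\<in>car ell2. \<lambda>n. a (back_index n)) \<in> car ell2 \<rightarrow>\<^sub>E car ell2"
    using ell2_permute(1)[OF bij_back_index] by (auto simp: ell2_simps)
qed (use ell2_permute[OF bij_back_index] ell2.car_closed in \<open>auto simp: ell2_simps fun_eq_iff\<close>)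

lemma transformation_E:
  assumes "F \<in> transformations H K"
  shows "\<And>x. x \<in> car H \<Longrightarrow> F x \<in> car K" "\<And>x y. x \<in> car H \<Longrightarrow> y \<in> car H \<Longrightarrow> F (x + y) = F x + F y"
    "\<And>x a. x \<in> car H \<Longrightarrow> F (scl H a x) = scl K a (F x)" "\<exists>C. \<forall>x\<in>car H. hnorm K (F x) \<le> C * hnorm H x"
  using assms by (auto simp: transformations_def)

context dense_cyclic_multiplier
begin

lemma Y_add: "f \<in> car H2 \<Longrightarrow> g \<in> car H2 \<Longrightarrow> Yop (f + g) = Yop f + Yop g"
  and Y_cmult: "f \<in> car H2 \<Longrightarrow> Yop (\<lambda>z. a * f z) = (\<lambda>z. a * Yop f z)"
  using transformation_E(2,3)[OF Y_transformation] by (simp_all add: H2_add H2_cmult scl_H2)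

text \<open>The squared norm of the functional \<open>f \<mapsto> f y / \<phi> y\<close> on the model space of
  \<open>v\<close>. The absolute value keeps the function nonnegative off \<open>E_set v\<close>.\<close>

definition weight :: "complex \<Rightarrow> real" where
  "weight y = \<bar>kernel_norm v y\<bar> / (cmod (bv \<phi> y))\<^sup>2"

definition wtrace :: "(complex \<Rightarrow> real) \<Rightarrow> (complex \<Rightarrow> complex) \<Rightarrow> complex \<Rightarrow> complex" where
  "wtrace \<tau> f y = of_real (sqrt (\<tau> y)) / bv \<phi> y * bv (Yop f) y"

lemma bv_phi_measurable: "bv \<phi> \<in> borel_measurable mT" by (rule H2_measurable[OF Hinf_H2[OF p]])

text \<open>The two parts of \<open>Yop f\<close> are treated separately: on the model space the boundary values are bounded by
  the norm of the boundary kernel, and in the other part the factor \<open>\<phi>\<close> cancels.\<close>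

lemma trace_bound:
  assumes E: "measure mT (E_set v) = 1" and \<tau>: "\<tau> \<in> borel_measurable mT" "\<And>y. 0 \<le> \<tau> y" "\<And>y. \<tau> y \<le> 1"
    and int: "integrable mT (\<lambda>y. \<tau> y * weight y)" and f: "f \<in> car H2"
  shows "L2 (wtrace \<tau> f)" "lnorm2 (wtrace \<tau> f) \<le> (8 * (\<integral>y. \<tau> y * weight y \<partial>mT) + 2) * (hnorm H2 f)\<^sup>2"
proof -
  note [measurable] = \<tau>(1) bv_phi_measurable
  have [measurable]: "bv (Yop f) \<in> borel_measurable mT" by (rule H2_measurable[OF Y_H2[OF f]])
  define h where "h = toep v f"
  define g where "g = f - v * h"
  have h: "h \<in> car H2" "u * h \<in> car H2" "v * h \<in> car H2" "\<phi> * (u * h) \<in> car H2" unfolding h_def by (intro H2_rules f)+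
  have g: "g \<in> model_space v" "g \<in> car H2" using model_space_proj[OF v f] h f by (auto simp: g_def h_def intro: H2_diff)
  have Y: "Yop f = g + \<phi> * (u * h)" by (simp add: Yop_def g_def h_def)
  have hn: "lnorm2 (bv (u * h)) \<le> (hnorm H2 f)\<^sup>2"
    using toep_norm[OF v f] inner_isometric[OF u h(1)] by (simp add: hnorm_H2 h_def)
  have hu: "hnorm H2 (v * h) \<le> hnorm H2 f"
    using toep_norm[OF v f] inner_isometric[OF v h(1)] by (simp add: hnorm_H2 h_def)
  have "hnorm H2 g \<le> 2 * hnorm H2 f" using H2_hnorm_diff_le[OF f h(3)] hu by (simp add: g_def)
  then have gn: "(hnorm H2 g)\<^sup>2 \<le> 4 * (hnorm H2 f)\<^sup>2"
    using power_mono[of "hnorm H2 g" "2 * hnorm H2 f" 2] H2.hnorm_nonneg[OF g(2)] by (simp add: power_mult_distrib)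
  define D where "D y = 2 * (hnorm H2 g)\<^sup>2 * (\<tau> y * weight y) + 2 * (cmod (bv (u * h) y))\<^sup>2" for y
  have uh: "integrable mT (\<lambda>y. (cmod (bv (u * h) y))\<^sup>2)" by (rule L2_integrable_sq[OF H2_E(3)[OF h(2)]])
  have D: "integrable mT D" unfolding D_def by (intro Bochner_Integration.integrable_add integrable_mult_right int uh)
  have [measurable]: "wtrace \<tau> f \<in> borel_measurable mT" unfolding wtrace_def[abs_def] by measurable
  have le: "AE y in mT. (cmod (wtrace \<tau> f y))\<^sup>2 \<le> D y"
    using AE_bv_add[OF g(2) h(4)] bv_Hinf_mult[OF p h(2)] model_space_boundary_bound[OF v g(1)] AE_E_set[OF E] cyclic_outer(1)[OF p cyc]
  proof eventually_elim
    case (elim y)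
    have nz: "(cmod (bv \<phi> y))\<^sup>2 > 0" using elim(5) by simp
    have "(cmod (bv (Yop f) y))\<^sup>2 \<le> 2 * (cmod (bv g y))\<^sup>2 + 2 * (cmod (bv \<phi> y * bv (u * h) y))\<^sup>2"
      unfolding Y elim(1,2) by (rule norm_add_sq_le)
    also have "\<dots> \<le> 2 * (\<bar>kernel_norm v y\<bar> * (hnorm H2 g)\<^sup>2) + 2 * ((cmod (bv \<phi> y))\<^sup>2 * (cmod (bv (u * h) y))\<^sup>2)"
    proof -
      have "kernel_norm v y * (hnorm H2 g)\<^sup>2 \<le> \<bar>kernel_norm v y\<bar> * (hnorm H2 g)\<^sup>2" by (intro mult_right_mono) auto
      then show ?thesis using elim(3,4) by (simp add: norm_mult power_mult_distrib)
    qed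
    also have "\<dots> = (2 * weight y * (hnorm H2 g)\<^sup>2 + 2 * (cmod (bv (u * h) y))\<^sup>2) * (cmod (bv \<phi> y))\<^sup>2"
      using elim(5) by (simp add: weight_def field_simps)
    finally have b: "(cmod (bv (Yop f) y))\<^sup>2 / (cmod (bv \<phi> y))\<^sup>2 \<le> 2 * weight y * (hnorm H2 g)\<^sup>2 + 2 * (cmod (bv (u * h) y))\<^sup>2"
      using nz by (simp add: pos_divide_le_eq)
    have "(cmod (wtrace \<tau> f y))\<^sup>2 = \<tau> y * ((cmod (bv (Yop f) y))\<^sup>2 / (cmod (bv \<phi> y))\<^sup>2)"
      using \<tau>(2)[of y] by (simp add: wtrace_def norm_mult norm_divide power_mult_distrib power_divide)
    also have "\<dots> \<le> \<tau> y * (2 * weight y * (hnorm H2 g)\<^sup>2 + 2 * (cmod (bv (u * h) y))\<^sup>2)"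
      by (intro mult_left_mono b \<tau>)
    also have "\<dots> = 2 * (hnorm H2 g)\<^sup>2 * (\<tau> y * weight y) + \<tau> y * (2 * (cmod (bv (u * h) y))\<^sup>2)" by (simp add: algebra_simps)
    also have "\<dots> \<le> D y" unfolding D_def using \<tau>(3)[of y] mult_right_mono[of "\<tau> y" 1 "2 * (cmod (bv (u * h) y))\<^sup>2"] by simp
    finally show ?case .
  qed
  have i: "integrable mT (\<lambda>y. (cmod (wtrace \<tau> f y))\<^sup>2)"
    by (rule Bochner_Integration.integrable_bound[OF D]) (use le in \<open>auto elim!: eventually_mono\<close>)
  then show "L2 (wtrace \<tau> f)" by (simp add: L2_def)
  have I: "(\<integral>y. \<tau> y * weight y \<partial>mT) \<ge> 0" by (rule Bochner_Integration.integral_nonneg) (simp add: weight_def \<tau>)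
  have "lnorm2 (wtrace \<tau> f) \<le> (\<integral>y. D y \<partial>mT)" unfolding lnorm2_def by (rule integral_mono_AE[OF i D le])
  also have "\<dots> = 2 * (hnorm H2 g)\<^sup>2 * (\<integral>y. \<tau> y * weight y \<partial>mT) + 2 * lnorm2 (bv (u * h))"
    unfolding D_def lnorm2_def using int uh by simp
  also have "\<dots> \<le> 2 * (4 * (hnorm H2 f)\<^sup>2) * (\<integral>y. \<tau> y * weight y \<partial>mT) + 2 * (hnorm H2 f)\<^sup>2"
    using gn hn I by (intro add_mono mult_right_mono) auto
  finally show "lnorm2 (wtrace \<tau> f) \<le> (8 * (\<integral>y. \<tau> y * weight y \<partial>mT) + 2) * (hnorm H2 f)\<^sup>2" by (simp add: algebra_simps)
qed

lemma trace_X: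
  assumes g: "g \<in> car H2"
  shows "AE y in mT. wtrace \<tau> (Xop g) y = of_real (sqrt (\<tau> y)) * bv g y"
  using bv_Hinf_mult[OF p g] cyclic_outer(1)[OF p cyc]
  by eventually_elim (simp add: wtrace_def YX[OF g])

lemma trace_pair:
  assumes E: "measure mT (E_set v) = 1" and \<tau>: "\<tau> \<in> borel_measurable mT" "\<And>y. 0 \<le> \<tau> y" "\<And>y. \<tau> y \<le> 1"
    and int: "integrable mT (\<lambda>y. \<tau> y * weight y)"
  shows "isometric_pair H2 (T_op u v \<phi> c) ell2 (\<lambda>f\<in>car H2. fourier (wtrace \<tau> f)) bilateral_shift"
proof -
  note L = trace_bound(1)[OF E \<tau> int] and bd = trace_bound(2)[OF E \<tau> int]
  define C where "C = 8 * (\<integral>y. \<tau> y * weight y \<partial>mT) + 2"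
  have "(\<lambda>f\<in>car H2. fourier (wtrace \<tau> f)) \<in> transformations H2 ell2"
    unfolding transformations_def mem_Collect_eq
  proof (intro conjI ballI allI exI[of _ "sqrt C"])
    show "(\<lambda>f\<in>car H2. fourier (wtrace \<tau> f)) \<in> car H2 \<rightarrow>\<^sub>E car ell2"
      using l2_fourier_coeffs[OF L] by (simp add: ell2_simps restrict_PiE_iff)
    fix f :: "complex \<Rightarrow> complex" and a assume f: "f \<in> car H2"
    show "(\<lambda>f\<in>car H2. fourier (wtrace \<tau> f)) (f + g) = (\<lambda>f\<in>car H2. fourier (wtrace \<tau> f)) f + (\<lambda>f\<in>car H2. fourier (wtrace \<tau> f)) g"
      if g: "g \<in> car H2" for g
    proof -
      have "fourier (wtrace \<tau> (f + g)) = fourier (\<lambda>y. wtrace \<tau> f y + wtrace \<tau> g y)"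
      proof (rule fourier_cong[OF L[OF H2_add[OF f g]] L2_add(1)[OF L[OF f] L[OF g]]])
        show "AE y in mT. wtrace \<tau> (f + g) y = wtrace \<tau> f y + wtrace \<tau> g y"
          using AE_bv_add[OF Y_H2[OF f] Y_H2[OF g]]
          by eventually_elim (simp only: wtrace_def Y_add[OF f g] distrib_left)
      qed
      also have "\<dots> = fourier (wtrace \<tau> f) + fourier (wtrace \<tau> g)" by (rule fourier_add[OF L[OF f] L[OF g]])
      finally show ?thesis using f g by (simp add: H2_add)
    qed
    show "(\<lambda>f\<in>car H2. fourier (wtrace \<tau> f)) (scl H2 a f) = scl ell2 a ((\<lambda>f\<in>car H2. fourier (wtrace \<tau> f)) f)"
    proof -
      have "fourier (wtrace \<tau> (\<lambda>z. a * f z)) = fourier (\<lambda>y. a * wtrace \<tau> f y)"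
      proof (rule fourier_cong[OF L[OF H2_cmult[OF f]] L2_cmult[OF L[OF f]]])
        show "AE y in mT. wtrace \<tau> (\<lambda>z. a * f z) y = a * wtrace \<tau> f y"
          using AE_bv_cmult[OF Y_H2[OF f], of a]
          by eventually_elim (simp only: wtrace_def Y_cmult[OF f] mult.left_commute)
      qed
      then show ?thesis using f by (simp add: H2_cmult scl_H2 ell2_simps fourier_cmult)
    qed
    have "sqrt (lnorm2 (wtrace \<tau> f)) \<le> sqrt (C * (hnorm H2 f)\<^sup>2)" using bd[OF f] by (simp add: C_def)
    then show "hnorm ell2 ((\<lambda>f\<in>car H2. fourier (wtrace \<tau> f)) f) \<le> sqrt C * hnorm H2 f"
      using f H2.hnorm_nonneg[OF f] by (simp add: hnorm_fourier[OF L[OF f]] real_sqrt_mult)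
  qed
  moreover have "intertwines H2 (\<lambda>f\<in>car H2. fourier (wtrace \<tau> f)) (T_op u v \<phi> c) bilateral_shift"
    unfolding intertwines_def
  proof
    fix f :: "complex \<Rightarrow> complex" assume f: "f \<in> car H2"
    have "fourier (wtrace \<tau> (T f)) = fourier (\<lambda>y. y * wtrace \<tau> f y)"
    proof (rule fourier_cong[OF L[OF T_H2[OF f]] L2_mult_id(1)[OF L[OF f]]])
      show "AE y in mT. wtrace \<tau> (T f) y = y * wtrace \<tau> f y"
        using bv_zmul[OF Y_H2[OF f]] by eventually_elim (simp only: wtrace_def YT[OF f] mult.left_commute)
    qed
    also have "\<dots> = bilateral_shift (fourier (wtrace \<tau> f))"
      using l2_fourier_coeffs[OF L[OF f]] by (simp add: fun_eq_iff fourier_id_mult[OF L[OF f]] bilateral_shift_def ell2_simps)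
    finally show "(\<lambda>f\<in>car H2. fourier (wtrace \<tau> f)) (T_op u v \<phi> c f) = bilateral_shift ((\<lambda>f\<in>car H2. fourier (wtrace \<tau> f)) f)"
      using f by (simp add: T_op_eq T_H2)
  qed
  ultimately show ?thesis unfolding isometric_pair_def using ell2_hilbert bilateral_shift_isometry by blast
qed

text \<open>The universal property, applied to the competing pair with values in the sequence space.\<close>

lemma asymptote_dominates:
  assumes E: "measure mT (E_set v) = 1" and asy: "isometric_asymptote H2 (T_op u v \<phi> c) K X0 U"
    and \<tau>: "\<tau> \<in> borel_measurable mT" "\<And>y. 0 \<le> \<tau> y" "\<And>y. \<tau> y \<le> 1"
    and int: "integrable mT (\<lambda>y. \<tau> y * weight y)"
  obtains C where "C \<ge> 0" "\<And>g. g \<in> car H2 \<Longrightarrow> (\<integral>y. \<tau> y * (cmod (bv g y))\<^sup>2 \<partial>mT) \<le> C * (hnorm K (X0 (Xop g)))\<^sup>2"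
proof -
  note L = trace_bound(1)[OF E \<tau> int]
  have X0: "X0 \<in> transformations H2 K" using asy by (simp add: isometric_asymptote_def isometric_pair_def)
  obtain Z where Z: "Z \<in> transformations K ell2" "\<And>x. x \<in> car H2 \<Longrightarrow> (\<lambda>f\<in>car H2. fourier (wtrace \<tau> f)) x = Z (X0 x)"
    using asy trace_pair[OF E \<tau> int] unfolding isometric_asymptote_def by blast
  obtain C where C: "\<And>k. k \<in> car K \<Longrightarrow> hnorm ell2 (Z k) \<le> C * hnorm K k" using transformation_E(4)[OF Z(1)] by blast
  have "(\<integral>y. \<tau> y * (cmod (bv g y))\<^sup>2 \<partial>mT) \<le> C\<^sup>2 * (hnorm K (X0 (Xop g)))\<^sup>2" if g: "g \<in> car H2" for g
  proof -
    have tr: "wtrace \<tau> (Xop g) \<in> borel_measurable mT" by (rule L2_measurable[OF L[OF X_H2[OF g]]])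
    have [measurable]: "bv g \<in> borel_measurable mT" "\<tau> \<in> borel_measurable mT" using H2_measurable[OF g] \<tau>(1) by auto
    have "(\<integral>y. \<tau> y * (cmod (bv g y))\<^sup>2 \<partial>mT) = lnorm2 (wtrace \<tau> (Xop g))"
      unfolding lnorm2_def
    proof (rule integral_cong_AE)
      show "AE y in mT. \<tau> y * (cmod (bv g y))\<^sup>2 = (cmod (wtrace \<tau> (Xop g) y))\<^sup>2"
        using trace_X[OF g, of \<tau>] by eventually_elim (simp add: norm_mult power_mult_distrib \<tau>(2))
    qed (use tr in measurable)
    also have "\<dots> = (hnorm ell2 (Z (X0 (Xop g))))\<^sup>2"
      using Z(2)[OF X_H2[OF g]] X_H2[OF g] hnorm_fourier[OF L[OF X_H2[OF g]]] by simp
    also have "\<dots> \<le> (C * hnorm K (X0 (Xop g)))\<^sup>2"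
      using C[OF transformation_E(1)[OF X0 X_H2[OF g]]] ell2.hnorm_nonneg[OF transformation_E(1)[OF Z(1) transformation_E(1)[OF X0 X_H2[OF g]]]]
      by (intro power_mono) auto
    finally show ?thesis by (simp add: power_mult_distrib)
  qed
  then show ?thesis using that[of "C\<^sup>2"] by simp
qed

end

section \<open>The form of an isometric pair on polynomials\<close>

lemma zmul_mono_disc: "zmul (mono_disc n) = mono_disc (Suc n)"
  by (rule ext) (simp add: zmul_def mono_disc_def on_disc_def)

lemma poly_disc_Suc: "on_disc (psum a (Suc N)) = on_disc (psum a N) + scl H2 (a N) (mono_disc N)"
  by (rule ext) (simp add: on_disc_def psum_def scl_H2 mono_disc_def)

lemma hnorm_poly_disc: "(hnorm H2 (on_disc (psum a N)))\<^sup>2 = (\<Sum>n<N. (cmod (a n))\<^sup>2)"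
proof -
  have "lnorm2 (bv (on_disc (psum a N))) = lnorm2 (psum a N)"
    unfolding lnorm2_def by (rule Bochner_Integration.integral_cong) (simp_all add: bv_poly_disc)
  then show ?thesis by (simp add: hnorm_H2 lnorm2_psum sum_nonneg)
qed

locale shift_pair = K: ip_space K for K :: "'k::ab_group_add ipspace" +
  fixes A :: "(complex \<Rightarrow> complex) \<Rightarrow> 'k" and U :: "'k \<Rightarrow> 'k"
  assumes U: "U \<in> isometries K"
    and A_car: "\<And>f. f \<in> car H2 \<Longrightarrow> A f \<in> car K"
    and A_add: "\<And>f g. f \<in> car H2 \<Longrightarrow> g \<in> car H2 \<Longrightarrow> A (f + g) = A f + A g"
    and A_scl: "\<And>f a. f \<in> car H2 \<Longrightarrow> A (scl H2 a f) = scl K a (A f)"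
    and A_bounded: "\<exists>C. \<forall>f\<in>car H2. hnorm K (A f) \<le> C * hnorm H2 f"
    and A_zmul: "\<And>f. f \<in> car H2 \<Longrightarrow> A (zmul f) = U (A f)"
begin

definition e :: "nat \<Rightarrow> 'k" where "e n = A (mono_disc n)"
definition c :: "nat \<Rightarrow> complex" where "c n = ip K (e n) (e 0)"

lemma e_car: "e n \<in> car K" unfolding e_def by (intro A_car) simp

lemma ip_e: "ip K (e (n + k)) (e k) = c n"
proof (induction k)
  case 0 show ?case by (simp add: c_def)
next
  case (Suc k)
  have "e (Suc m) = U (e m)" for m using A_zmul[OF mono_disc_H2, of m] by (simp add: e_def zmul_mono_disc)
  then show ?case using K.isometry_ip[OF U e_car e_car, of "n + k" k] Suc by simp
qed

lemma A_0: "A 0 = 0" using A_add[OF H2_zero H2_zero] by simp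

lemma A_poly: "A (on_disc (psum a N)) = (\<Sum>n<N. scl K (a n) (e n))"
proof (induction N)
  case 0
  have "on_disc (psum a 0) = 0" by (rule ext) (simp add: on_disc_def psum_def)
  then have "A (on_disc (psum a 0)) = 0" by (simp only: A_0)
  then show ?case by (simp only: lessThan_0 sum.empty)
next
  case (Suc N)
  have "scl H2 (a N) (mono_disc N) \<in> car H2" unfolding scl_H2 by (intro H2_cmult mono_disc_H2)
  then show ?case unfolding poly_disc_Suc by (simp only: A_add[OF poly_disc_H2] A_scl[OF mono_disc_H2] Suc e_def sum.lessThan_Suc)
qed

text \<open>The functional \<open>f \<mapsto> ip K (A f) (e 0)\<close> is bounded; evaluate it on the polynomials with
  coefficients \<open>cnj (c n)\<close>.\<close>

lemma l2_c: "l2 (\<lambda>n. cnj (c n))"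
proof -
  obtain M where M: "\<And>f. f \<in> car H2 \<Longrightarrow> hnorm K (A f) \<le> M * hnorm H2 f" using A_bounded by blast
  define B where "B = M * hnorm K (e 0)"
  have "(\<Sum>n<N. (cmod (c n))\<^sup>2) \<le> B\<^sup>2" for N
  proof -
    \<comment> \<open>The test polynomial for which the functional equals its squared norm.\<close>
    define p where "p = on_disc (psum (\<lambda>n. cnj (c n)) N)"
    define S where "S = (\<Sum>n<N. (cmod (c n))\<^sup>2)"
    have pH: "p \<in> car H2" unfolding p_def by (rule poly_disc_H2)
    have S: "S \<ge> 0" "hnorm H2 p = sqrt S" 
      using hnorm_poly_disc[of "\<lambda>n. cnj (c n)" N] H2.hnorm_nonneg[OF pH]
      by (auto simp: S_def p_def sum_nonneg real_sqrt_unique)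
    have "ip K (A p) (e 0) = (\<Sum>n<N. ip K (scl K (cnj (c n)) (e n)) (e 0))"
      unfolding p_def A_poly by (intro K.ip_sum_left K.car_closed e_car) simp
    also have "\<dots> = of_real S"
      unfolding S_def of_real_sum
      by (rule sum.cong) (simp_all add: K.ip_scl_left[OF e_car e_car] c_def[symmetric] complex_norm_square[symmetric] mult.commute)
    finally have "S \<le> cmod (ip K (A p) (e 0))" using S by simp
    also have "\<dots> \<le> hnorm K (A p) * hnorm K (e 0)" by (rule K.ip_Cauchy_Schwarz[OF A_car[OF pH] e_car])
    also have "\<dots> \<le> M * hnorm H2 p * hnorm K (e 0)" by (intro mult_right_mono M pH K.hnorm_nonneg e_car)
    also have "\<dots> = B * sqrt S" by (simp add: B_def S)
    finally have le: "S \<le> B * sqrt S" .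
    have "S \<le> B\<^sup>2"
    proof (cases "S = 0")
      case False
      then have "sqrt S > 0" using S by simp
      moreover have "sqrt S * sqrt S \<le> B * sqrt S" using le S by simp
      ultimately have "sqrt S \<le> B" by (metis mult_right_le_imp_le)
      then have "(sqrt S)\<^sup>2 \<le> B\<^sup>2" using S by (intro power_mono) auto
      then show ?thesis using S by simp
    qed simp
    then show ?thesis by (simp add: S_def)
  qed
  then show ?thesis unfolding l2_def by (intro summableI_nonneg_bounded) auto
qed

text \<open>The Gram matrix of the vectors \<open>e n\<close> is a Toeplitz matrix since \<open>U\<close> is isometric. Its symbol
  is square integrable by \<open>l2_c\<close>, and the sum of its analytic and antianalytic parts is the density.\<close>

theorem polynomial_density:
  obtains \<rho> where "\<rho> \<in> borel_measurable mT" "integrable mT \<rho>"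
    "\<And>a N. (hnorm K (A (on_disc (psum a N))))\<^sup>2 = (\<integral>y. \<rho> y * (cmod (psum a N y))\<^sup>2 \<partial>mT)"
proof -
  define r where "r = pser (\<lambda>n. cnj (c n))"
  have r: "r \<in> car H2" "\<And>n. tc r n = cnj (c n)" unfolding r_def by (simp_all add: H2_pser tc_pser l2_c)
  \<comment> \<open>The constant coefficient occurs both in \<open>r\<close> and in its conjugate, and is subtracted once.\<close>
  define \<rho> where "\<rho> y = 2 * Re (bv r y) - Re (c 0)" for y
  define h where "h y = complex_of_real (\<rho> y)" for y
  have c0: "cnj (c 0) = c 0" "c 0 = of_real (Re (c 0))"
    unfolding c_def K.ip_self[OF e_car] by simp_all
  have h_eq: "h = (\<lambda>y. bv r y + cnj (bv r y) - c 0)"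
    by (rule ext) (subst c0(2), simp add: h_def \<rho>_def complex_add_cnj)
  have Lr: "L2 (bv r)" "L2 (\<lambda>y. cnj (bv r y))" using H2_E(3)[OF r(1)] by auto
  have hL: "L2 h" unfolding h_eq by (intro L2_minus L2_add Lr) simp
  have i\<rho>: "integrable mT \<rho>" using L2_integrable[OF hL] unfolding h_def by (simp only: complex_of_real_integrable_eq)
  have lip_h: "lip h g = lip (bv r) g + lip (\<lambda>y. cnj (bv r y)) g - c 0 * lip (\<lambda>_. 1) g" if "L2 g" for g
  proof -
    have "lip h g = lip (\<lambda>y. bv r y + cnj (bv r y)) g - lip (\<lambda>_. c 0 * 1) g"
      unfolding h_eq by (subst lip_diff_left) (auto intro!: L2_add Lr that)
    also have "\<dots> = lip (bv r) g + lip (\<lambda>y. cnj (bv r y)) g - c 0 * lip (\<lambda>_. 1) g"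
      unfolding lip_cmult_left by (subst lip_add_left) (auto intro!: Lr that)
    finally show ?thesis .
  qed
  have cn: "lip (\<lambda>y. cnj (bv r y)) (\<lambda>y. y ^ k) = cnj (lip (bv r) (\<lambda>y. cnj y ^ k))"
    "lip (\<lambda>y. cnj (bv r y)) (\<lambda>y. cnj y ^ k) = cnj (lip (bv r) (\<lambda>y. y ^ k))" for k
    unfolding lip_def Bochner_Integration.integral_cnj[symmetric] by simp_all
  have tcr: "lip (bv r) (\<lambda>y. y ^ k) = cnj (c k)" for k using r(2)[of k] by (simp add: tc_def)
  have one: "lip (\<lambda>_. 1) (\<lambda>y. y ^ k) = (if k = 0 then 1 else 0)" "lip (\<lambda>_. 1) (\<lambda>y. cnj y ^ k) = (if k = 0 then 1 else 0)" for k
    using integral_mT_power[of 0 k] integral_mT_power[of k 0] by (simp_all add: lip_def)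
  have pos: "lip h (\<lambda>y. y ^ k) = cnj (c k)" for k
  proof (cases k)
    case 0
    have "lip (bv r) (\<lambda>y. cnj y ^ 0) = cnj (c 0)" using tcr[of 0] by simp
    then show ?thesis using 0 c0(1) tcr[of 0] cn(1)[of 0] one(1)[of 0] lip_h[OF L2_power(1)[of 0]] by simp
  next
    case (Suc m)
    show ?thesis using H2_bv_cnj_power[OF r(1), of m] lip_h[OF L2_power(1)[of k]] tcr[of k] one(1)[of k] cn(1)[of k] by (simp only: Suc) simp
  qed
  have neg: "lip h (\<lambda>y. cnj y ^ k) = c k" if k0: "k \<noteq> 0" for k
  proof -
    obtain m where k: "k = Suc m" using not0_implies_Suc[OF k0] by blast
    show ?thesis using H2_bv_cnj_power[OF r(1), of m] lip_h[OF L2_power(2)[of k]] tcr[of k] one(2)[of k] cn(2)[of k] by (simp only: k) simp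
  qed
  have "(hnorm K (A (on_disc (psum a N))))\<^sup>2 = (\<integral>y. \<rho> y * (cmod (psum a N y))\<^sup>2 \<partial>mT)" for a N
  proof -
    have se: "scl K (a n) (e n) \<in> car K" for n by (intro K.car_closed e_car)
    have "complex_of_real ((hnorm K (A (on_disc (psum a N))))\<^sup>2) = ip K (\<Sum>i<N. scl K (a i) (e i)) (\<Sum>j<N. scl K (a j) (e j))"
      unfolding A_poly by (rule K.ip_self[symmetric]) (intro K.car_closed e_car)
    also have "\<dots> = (\<Sum>i<N. \<Sum>j<N. ip K (scl K (a i) (e i)) (scl K (a j) (e j)))"
      by (subst K.ip_sum_left) (auto intro!: se K.car_closed(5) sum.cong K.ip_sum_right)
    also have "\<dots> = (\<Sum>i<N. \<Sum>j<N. a i * cnj (a j) * (\<integral>y. h y * (y ^ i * cnj y ^ j) \<partial>mT))"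
    proof (intro sum.cong refl)
      fix i j
      have "ip K (scl K (a i) (e i)) (scl K (a j) (e j)) = a i * cnj (a j) * ip K (e i) (e j)"
        by (simp add: K.ip_scl_left[OF e_car se] K.ip_scl_right[OF e_car e_car])
      also have "ip K (e i) (e j) = (\<integral>y. h y * (y ^ i * cnj y ^ j) \<partial>mT)"
      proof (cases "i \<le> j")
        case True
        then have "ip K (e j) (e i) = c (j - i)" using ip_e[of "j - i" i] by simp
        then have "ip K (e i) (e j) = cnj (c (j - i))" using K.ip_cnj[OF e_car e_car, of i j] by simp
        then show ?thesis unfolding lip_as_powers[OF hL] using True pos by simp
      next
        case False
        then have "ip K (e i) (e j) = c (i - j)" using ip_e[of "i - j" j] by simp
        then show ?thesis unfolding lip_as_powers[OF hL] using False neg[of "i - j"] by simp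
      qed
      finally show "ip K (scl K (a i) (e i)) (scl K (a j) (e j)) = a i * cnj (a j) * (\<integral>y. h y * (y ^ i * cnj y ^ j) \<partial>mT)" .
    qed
    also have "\<dots> = (\<integral>y. h y * complex_of_real ((cmod (psum a N y))\<^sup>2) \<partial>mT)"
      by (rule integral_psum_sq[OF L2_integrable[OF hL], symmetric])
    also have "\<dots> = (\<integral>y. complex_of_real (\<rho> y * (cmod (psum a N y))\<^sup>2) \<partial>mT)" by (simp add: h_def)
    also have "\<dots> = complex_of_real (\<integral>y. \<rho> y * (cmod (psum a N y))\<^sup>2 \<partial>mT)" by (rule integral_complex_of_real)
    finally show ?thesis by (simp only: of_real_eq_iff)
  qed
  with i\<rho> that show ?thesis by blast
qed

end

section \<open>Domination by weights with prescribed integrability\<close>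

text \<open>If \<open>\<rho>\<close> were not bounded away from \<open>0\<close>, a convergent sum of small multiples of indicators of tiny
  subsets of \<open>{\<rho> < 4 ^ - n}\<close>, on which \<open>w\<close> is bounded, would not be dominated by \<open>\<rho>\<close>.\<close>

lemma essentially_bounded_below:
  fixes \<rho> w :: "complex \<Rightarrow> real"
  assumes \<rho>[measurable]: "\<rho> \<in> borel_measurable mT" and w[measurable]: "w \<in> borel_measurable mT"
    and dom: "\<And>\<tau>. \<tau> \<in> borel_measurable mT \<Longrightarrow> (\<And>y. 0 \<le> \<tau> y) \<Longrightarrow> (\<And>y. \<tau> y \<le> 1) \<Longrightarrow>
      integrable mT (\<lambda>y. \<tau> y * w y) \<Longrightarrow> \<exists>C\<ge>0. AE y in mT. \<tau> y \<le> C * \<rho> y"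
  obtains \<delta> where "\<delta> > 0" "AE y in mT. \<rho> y \<ge> \<delta>"
proof (rule ccontr)
  assume "\<not> thesis"
  with that have neg: "\<delta> > 0 \<Longrightarrow> \<not> (AE y in mT. \<rho> y \<ge> \<delta>)" for \<delta> by blast
  have ex: "\<exists>B M. B \<in> sets mT \<and> measure mT B > 0 \<and> (\<forall>y\<in>B. \<rho> y < (1/4) ^ n \<and> \<bar>w y\<bar> \<le> real M) \<and> measure mT B \<le> 1 / (real M + 1)" for n :: nat
  proof -
    define D where "D M = {y \<in> space mT. \<rho> y < (1/4) ^ n \<and> \<bar>w y\<bar> \<le> real M}" for M :: nat
    have D[measurable]: "D M \<in> sets mT" for M unfolding D_def by measurable
    have "\<exists>M. measure mT (D M) > 0"
    proof (rule ccontr)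
      assume "\<not> ?thesis"
      then have "measure mT (D M) = 0" for M using measure_nonneg[of mT "D M"] by (metis less_eq_real_def)
      then have "D M \<in> null_sets mT" for M using D by (intro null_setsI) (simp_all add: mT.emeasure_eq_measure)
      then have "(\<Union>M. D M) \<in> null_sets mT" by (rule null_sets_UN)
      from AE_not_in[OF this] AE_sphere have "AE y in mT. \<rho> y \<ge> (1/4) ^ n"
      proof eventually_elim
        case (elim y)
        obtain M :: nat where "\<bar>w y\<bar> \<le> real M" using real_arch_simple by blast
        then show ?case using elim by (force simp: D_def)
      qed
      then show False using neg[of "(1/4) ^ n"] by simp
    qed
    then obtain M where M: "measure mT (D M) > 0" by blast
    have "1 / (real M + 1) > 0" by simp
    then obtain B where "B \<in> sets mT" "B \<subseteq> D M" "measure mT B > 0" "measure mT B \<le> 1 / (real M + 1)"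
      using mT_small_subset[OF D M] by metis
    then show ?thesis by (intro exI[of _ B] exI[of _ M]) (auto simp: D_def)
  qed
  obtain B M where B[measurable]: "\<And>n. B n \<in> sets mT" and Bp: "\<And>n. measure mT (B n) > 0"
    and B\<rho>: "\<And>n y. y \<in> B n \<Longrightarrow> \<rho> y < (1/4) ^ n" and Bw: "\<And>n y. y \<in> B n \<Longrightarrow> \<bar>w y\<bar> \<le> real (M n)"
    and Bm: "\<And>n. measure mT (B n) \<le> 1 / (real (M n) + 1)" for n :: nat
    using ex by metis
  \<comment> \<open>The factors tend to \<open>0\<close> more slowly than the bound \<open>4 ^ - n\<close> of \<open>\<rho>\<close> on
    \<open>B n\<close>, while the measure of \<open>B n\<close> balances the bound of \<open>w\<close>.\<close>
  define t where "t n y = (1/2) ^ Suc n * (indicator (B n) y :: real)" for n y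
  have t: "0 \<le> t n y" "t n y \<le> (1/2) ^ Suc n" for n y unfolding t_def by (auto simp: indicator_def)
  have [measurable]: "t n \<in> borel_measurable mT" for n unfolding t_def[abs_def] by measurable
  have ts: "summable (\<lambda>n. t n y)" for y
    by (rule summable_comparison_test[OF _ sums_summable[OF power_half_series]]) (use t in auto)
  define \<tau> where "\<tau> y = (\<Sum>n. t n y)" for y
  have \<tau>: "0 \<le> \<tau> y" "\<tau> y \<le> 1" "t n y \<le> \<tau> y" for n y
  proof -
    show "0 \<le> \<tau> y" unfolding \<tau>_def by (intro suminf_nonneg ts t)
    have "\<tau> y \<le> (\<Sum>n. (1/2) ^ Suc n)" unfolding \<tau>_def by (intro suminf_le t ts sums_summable[OF power_half_series])
    then show "\<tau> y \<le> 1" using sums_unique[OF power_half_series] by simp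
    show "t n y \<le> \<tau> y" unfolding \<tau>_def using sum_le_suminf[OF ts[of y], of "{n}"] t by auto
  qed
  have [measurable]: "\<tau> \<in> borel_measurable mT" unfolding \<tau>_def[abs_def] by measurable
  have bd: "norm (t n y * w y) \<le> (1/2) ^ Suc n * real (M n) * indicator (B n) y" for n y
    using Bw[of y n] by (auto simp: t_def indicator_def abs_mult intro!: mult_left_mono)
  have ib: "integrable mT (\<lambda>y. (1/2) ^ Suc n * real (M n) * indicator (B n) y :: real)" for n
    by (intro integrable_mult_right integrable_real_indicator) (auto simp: mT.emeasure_eq_measure)
  have iw: "integrable mT (\<lambda>y. t n y * w y)" for n
    by (rule Bochner_Integration.integrable_bound[OF ib[of n]]) (use bd in \<open>auto intro!: AE_I2 order_trans[OF bd] abs_ge_self\<close>)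
  have "integrable mT (\<lambda>y. \<Sum>n. t n y * w y)"
  proof (rule integrable_suminf[OF iw])
    show "AE y in mT. summable (\<lambda>n. norm (t n y * w y))"
      using summable_mult2[OF ts] t by (intro AE_I2) (simp add: abs_mult)
    show "summable (\<lambda>n. \<integral>y. norm (t n y * w y) \<partial>mT)"
    proof (rule summable_comparison_test[OF _ sums_summable[OF power_half_series]], intro exI allI impI)
      fix n
      have "(\<integral>y. norm (t n y * w y) \<partial>mT) \<le> (\<integral>y. (1/2) ^ Suc n * real (M n) * indicator (B n) y \<partial>mT)"
        by (intro integral_mono integrable_norm iw ib bd)
      also have "\<dots> = (1/2) ^ Suc n * real (M n) * measure mT (B n)"
        using sets.sets_into_space[OF B[of n]] by (simp add: Int_absorb2)
      also have "\<dots> \<le> (1/2) ^ Suc n * real (M n) * (1 / (real (M n) + 1))" by (intro mult_left_mono Bm) auto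
      also have "\<dots> = (1/2) ^ Suc n * (real (M n) / (real (M n) + 1))" by simp
      also have "\<dots> \<le> (1/2) ^ Suc n * 1" by (intro mult_left_mono) auto
      finally show "norm (\<integral>y. norm (t n y * w y) \<partial>mT) \<le> (1/2) ^ Suc n" by simp
    qed
  qed
  then have "integrable mT (\<lambda>y. \<tau> y * w y)" unfolding \<tau>_def by (simp add: suminf_mult2[OF ts])
  then obtain C where C: "C \<ge> 0" "AE y in mT. \<tau> y \<le> C * \<rho> y" using dom[of \<tau>] \<tau> by auto
  have le: "2 ^ n \<le> 2 * C" for n :: nat
  proof -
    have "\<exists>y\<in>B n. \<tau> y \<le> C * \<rho> y"
    proof (rule ccontr)
      assume "\<not> ?thesis"
      then have ae: "AE y in mT. y \<notin> B n" using C(2) by (auto elim!: eventually_mono)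
      have "{y \<in> space mT. \<not> y \<notin> B n} = B n" using sets.sets_into_space[OF B[of n]] by blast
      from AE_iff_measurable[OF B[of n] this, THEN iffD1, OF ae] have "emeasure mT (B n) = 0" .
      then show False using Bp[of n] by (simp add: measure_def)
    qed
    then obtain y where z: "y \<in> B n" "\<tau> y \<le> C * \<rho> y" by blast
    have "(1/2) ^ Suc n = t n y" using z(1) by (simp add: t_def)
    also have "\<dots> \<le> C * \<rho> y" using \<tau>(3)[of n y] z(2) by linarith
    also have "\<dots> \<le> C * (1/4) ^ n" using B\<rho>[OF z(1)] C(1) by (intro mult_left_mono) auto
    finally have "(1/2) ^ Suc n * 4 ^ n \<le> C * (1/4) ^ n * 4 ^ n" by (intro mult_right_mono) auto
    moreover have "C * (1/4) ^ n * 4 ^ n = C" by (simp add: power_divide)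
    moreover have "(1/2) ^ Suc n * 4 ^ n = (2 :: real) ^ n / 2"
      using power_mult_distrib[of "1/2 :: real" 4 n] by simp
    ultimately show ?thesis by simp
  qed
  obtain n where "2 * C < 2 ^ n" using real_arch_pow[of 2 "2 * C"] by auto
  then show False using le[of n] by simp
qed

section \<open>No isometric asymptote\<close>

lemma lnorm2_szego: "w \<in> ball 0 1 \<Longrightarrow> lnorm2 (bv (szego w)) = (\<Sum>n. (cmod w ^ n)\<^sup>2)"
  using lnorm2_bv[OF Hinf_H2[OF szego(1)], of w] by (simp add: szego(2) norm_power)

text \<open>Circle means pass to the limit by dominated convergence, since point evaluations are uniformly bounded on smaller
  circles.\<close>

lemma H2_pointwise_limit:
  assumes f: "\<And>n. f n \<in> car H2" and B: "\<And>n. hnorm H2 (f n) \<le> B" and F: "F \<in> disc_holomorphic"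
    and lim: "\<And>z. z \<in> ball 0 1 \<Longrightarrow> (\<lambda>n. f n z) \<longlonglongrightarrow> F z"
  shows "F \<in> car H2"
  unfolding H2_car
proof (intro conjI F bdd_aboveI2)
  fix r :: real assume r: "r \<in> {0..<1}"
  then have rb: "of_real r * y \<in> ball 0 1" "cmod (of_real r * y) = r" if "y \<in> sphere 0 1" for y :: complex
    using that by (auto simp: norm_mult)
  have B0: "B \<ge> 0" using B[of 0] H2.hnorm_nonneg[OF f, of 0] by simp
  have nB: "lnorm2 (bv (f n)) \<le> B\<^sup>2" for n
  proof -
    have "sqrt (lnorm2 (bv (f n))) \<le> B" using B[of n] by (simp add: hnorm_H2)
    then show ?thesis using real_sqrt_le_iff[of "lnorm2 (bv (f n))" "B\<^sup>2"] B0 by simp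
  qed
  define S where "S = (\<Sum>n. (r ^ n)\<^sup>2)"
  have "(\<lambda>n. \<integral>y. (cmod (f n (of_real r * y)))\<^sup>2 \<partial>mT) \<longlonglongrightarrow> (\<integral>y. (cmod (F (of_real r * y)))\<^sup>2 \<partial>mT)"
  proof (rule integral_dominated_convergence[where w = "\<lambda>_. B\<^sup>2 * S"])
    have m: "(\<lambda>y. (cmod (g (of_real r * y)))\<^sup>2) \<in> borel_measurable mT" if "g \<in> disc_holomorphic" for g
      using L2_integrable_sq[OF dilate_L2[OF that, of r]] r by auto
    show "(\<lambda>y. (cmod (F (of_real r * y)))\<^sup>2) \<in> borel_measurable mT" by (rule m[OF F])
    show "(\<lambda>y. (cmod (f n (of_real r * y)))\<^sup>2) \<in> borel_measurable mT" for n by (rule m[OF H2_E(5)[OF f]])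
    show "integrable mT (\<lambda>_. B\<^sup>2 * S)" by simp
    show "AE y in mT. (\<lambda>n. (cmod (f n (of_real r * y)))\<^sup>2) \<longlonglongrightarrow> (cmod (F (of_real r * y)))\<^sup>2"
      using AE_sphere by eventually_elim (intro tendsto_intros lim rb)
    show "AE y in mT. norm ((cmod (f n (of_real r * y)))\<^sup>2) \<le> B\<^sup>2 * S" for n
      using AE_sphere
    proof eventually_elim
      case (elim y)
      have "(cmod (f n (of_real r * y)))\<^sup>2 \<le> lnorm2 (bv (f n)) * lnorm2 (bv (szego (of_real r * y)))"
        by (rule H2_eval_le[OF f rb(1)[OF elim]])
      also have "lnorm2 (bv (szego (of_real r * y))) = S" unfolding lnorm2_szego[OF rb(1)[OF elim]] rb(2)[OF elim] S_def ..
      also have "lnorm2 (bv (f n)) * S \<le> B\<^sup>2 * S"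
        using lnorm2_szego[OF rb(1)[OF elim]] lnorm2_nonneg[of "bv (szego (of_real r * y))"]
        by (intro mult_right_mono nB) (simp add: rb(2)[OF elim] S_def)
      finally show ?case by simp
    qed
  qed
  moreover have "(\<integral>y. (cmod (f n (of_real r * y)))\<^sup>2 \<partial>mT) \<le> B\<^sup>2" for n
    using pser_circle_mean_le[OF H2_E(1)[OF f] H2_E(2)[OF f, symmetric] r, of n] nB[of n] by (simp add: lnorm2_bv[OF f])
  ultimately show "(\<integral>y. (cmod (F (of_real r * y)))\<^sup>2 \<partial>mT) \<le> B\<^sup>2" by (intro LIMSEQ_le_const2) auto
qed

context dense_cyclic_multiplier
begin

text \<open>If multiplication by \<open>\<phi>\<close> were bounded below on the model space of \<open>u\<close>, its range would be all
  of the model space of \<open>v\<close> and would contain the reproducing kernel at the origin, which is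
  boundedly invertible; this would put the reciprocal of \<open>\<phi>\<close> into the Hardy space.\<close>

lemma reciprocal_of_bounded_below:
  assumes lt: "cmod (v 0) < 1" and bd: "\<And>f. f \<in> model_space u \<Longrightarrow> hnorm H2 f \<le> C * hnorm H2 (\<phi> * f)"
  shows "on_disc (\<lambda>z. 1 / \<phi> z) \<in> car H2"
proof -
  have k: "ker0 v \<in> car H2" using ker0_model_space[OF v] by (rule model_H2)
  obtain f where f: "\<And>n. f n \<in> model_space u" and lim: "(\<lambda>n. lnorm2 (\<lambda>y. bv (\<phi> * f n) y - bv (ker0 v) y)) \<longlonglongrightarrow> 0"
    using approx[OF ker0_model_space[OF v]] by blast
  have fH: "f n \<in> car H2" "\<phi> * f n \<in> car H2" for n using model_H2[OF f] H2_rules(1) by blast+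
  have pt: "(\<lambda>n. f n z) \<longlonglongrightarrow> ker0 v z / \<phi> z" if z: "z \<in> ball 0 1" for z
  proof -
    have "(\<lambda>n. (\<phi> * f n) z / \<phi> z) \<longlonglongrightarrow> ker0 v z / \<phi> z"
      by (intro tendsto_divide H2_tendsto_pointwise[OF fH(2) k lim z] tendsto_const phi_nz z)
    then show ?thesis using phi_nz[OF z] by simp
  qed
  have "convergent (\<lambda>n. lnorm2 (\<lambda>y. bv (\<phi> * f n) y - bv (ker0 v) y))" using lim by (auto simp: convergent_def)
  then obtain E where E: "\<And>n. lnorm2 (\<lambda>y. bv (\<phi> * f n) y - bv (ker0 v) y) \<le> E"
    using convergent_imp_Bseq by (force simp: Bseq_def)
  have "hnorm H2 (\<phi> * f n) \<le> sqrt E + hnorm H2 (ker0 v)" for n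
  proof -
    have "(hnorm H2 (\<phi> * f n - ker0 v))\<^sup>2 \<le> E" using E[of n] by (simp add: lnorm2_diff_bv[OF fH(2) k])
    then have "hnorm H2 (\<phi> * f n - ker0 v) \<le> sqrt E" by (rule real_le_rsqrt)
    moreover have "hnorm H2 ((\<phi> * f n - ker0 v) + ker0 v) \<le> hnorm H2 (\<phi> * f n - ker0 v) + hnorm H2 (ker0 v)"
      by (intro H2.hnorm_triangle H2_diff fH k)
    ultimately show ?thesis by simp
  qed
  then have "\<bar>C\<bar> * hnorm H2 (\<phi> * f n) \<le> \<bar>C\<bar> * (sqrt E + hnorm H2 (ker0 v))" for n by (intro mult_left_mono) auto
  moreover have "hnorm H2 (f n) \<le> \<bar>C\<bar> * hnorm H2 (\<phi> * f n)" for n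
    using bd[OF f[of n]] mult_right_mono[OF abs_ge_self H2.hnorm_nonneg[OF fH(2)]] by (rule order_trans)
  ultimately have fB: "hnorm H2 (f n) \<le> \<bar>C\<bar> * (sqrt E + hnorm H2 (ker0 v))" for n by (rule order_trans[rotated])
  have hol: "\<phi> holomorphic_on ball 0 1" "ker0 v holomorphic_on ball 0 1"
    using H2_E(5)[OF Hinf_H2[OF p]] H2_E(5)[OF k] by (auto simp: disc_holomorphic_def)
  define F where "F = on_disc (\<lambda>z. ker0 v z / \<phi> z)"
  have "F \<in> car H2"
  proof (rule H2_pointwise_limit[OF fH(1) fB])
    show "F \<in> disc_holomorphic" unfolding F_def
      by (intro disc_holomorphic_on_disc holomorphic_on_divide hol phi_nz)
    show "(\<lambda>n. f n z) \<longlonglongrightarrow> F z" if "z \<in> ball 0 1" for z using pt[OF that] that by (simp add: F_def on_disc_def)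
  qed
  moreover obtain q B where q: "q \<in> Hinf" "\<And>z. z \<in> ball 0 1 \<Longrightarrow> q z * ker0 v z = 1"
    using ker0_inverse[OF v lt] by metis
  ultimately have "q * F \<in> car H2" by (intro Hinf_mult)
  also have "q * F = on_disc (\<lambda>z. 1 / \<phi> z)"
  proof
    fix z show "(q * F) z = on_disc (\<lambda>z. 1 / \<phi> z) z" using q(2)[of z] by (simp add: F_def on_disc_def)
  qed
  finally show ?thesis .
qed

theorem no_isometric_asymptote:
  assumes lt: "cmod (v 0) < 1" and E: "measure mT (E_set v) = 1" and nin: "on_disc (\<lambda>z. 1 / \<phi> z) \<notin> car H2"
    and asy: "isometric_asymptote H2 (T_op u v \<phi> c) K X0 U"
  shows False
proof -
  have hK: "separable_hilbert_space K" and U: "U \<in> isometries K" and X0: "X0 \<in> transformations H2 K"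
    and tw: "intertwines H2 X0 (T_op u v \<phi> c) U" using asy by (auto simp: isometric_asymptote_def isometric_pair_def)
  interpret K: separable_hilbert_space K by (rule hK)
  note X0E = transformation_E[OF X0]
  have XE: "Xop (f + g) = Xop f + Xop g" "Xop (scl H2 a f) = scl H2 a (Xop f)" if "f \<in> car H2" "g \<in> car H2" for f g a
    using transformation_E(2,3)[OF X_transformation] that by (simp_all add: H2_add H2_cmult scl_H2)
  obtain M0 where M0: "\<And>f. f \<in> car H2 \<Longrightarrow> hnorm K (X0 f) \<le> M0 * hnorm H2 f" using X0E(4) by blast
  obtain M1 where M1: "\<And>f. f \<in> car H2 \<Longrightarrow> hnorm H2 (Xop f) \<le> M1 * hnorm H2 f"
    using transformation_E(4)[OF X_transformation] by auto
  have M: "hnorm K (X0 (Xop f)) \<le> \<bar>M0\<bar> * M1 * hnorm H2 f" if f: "f \<in> car H2" for f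
  proof -
    have "hnorm K (X0 (Xop f)) \<le> M0 * hnorm H2 (Xop f)" by (rule M0[OF X_H2[OF f]])
    also have "\<dots> \<le> \<bar>M0\<bar> * hnorm H2 (Xop f)" by (intro mult_right_mono H2.hnorm_nonneg X_H2 f) simp
    also have "\<dots> \<le> \<bar>M0\<bar> * (M1 * hnorm H2 f)" by (intro mult_left_mono M1 f) simp
    finally show ?thesis by simp
  qed
  interpret A: shift_pair K "\<lambda>f. X0 (Xop f)" U
  proof
    show "U \<in> isometries K" by (rule U)
    show "X0 (Xop f) \<in> car K" if "f \<in> car H2" for f by (intro X0E(1) X_H2 that)
    show "X0 (Xop (f + g)) = X0 (Xop f) + X0 (Xop g)" if "f \<in> car H2" "g \<in> car H2" for f g
      using XE(1)[OF that] X0E(2)[OF X_H2 X_H2] that by simp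
    show "X0 (Xop (scl H2 a f)) = scl K a (X0 (Xop f))" if "f \<in> car H2" for f a
      using XE(2)[OF that that] X0E(3)[OF X_H2] that by simp
    show "\<exists>C. \<forall>f\<in>car H2. hnorm K (X0 (Xop f)) \<le> C * hnorm H2 f" using M by blast
    show "X0 (Xop (zmul f)) = U (X0 (Xop f))" if f: "f \<in> car H2" for f
      using tw X_H2[OF f] by (simp add: intertwines_def TX[OF f, symmetric] T_op_eq)
  qed
  obtain \<rho> where \<rho>: "\<rho> \<in> borel_measurable mT" "integrable mT \<rho>"
    "\<And>a N. (hnorm K (X0 (Xop (on_disc (psum a N)))))\<^sup>2 = (\<integral>y. \<rho> y * (cmod (psum a N y))\<^sup>2 \<partial>mT)"
    using A.polynomial_density by blast
  have ip: "integrable mT (\<lambda>y. \<sigma> y * (cmod (psum a N y))\<^sup>2)" if \<sigma>: "integrable mT \<sigma>" for \<sigma> :: "complex \<Rightarrow> real" and a N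
  proof -
    define B where "B = (\<Sum>n<N. cmod (a n))"
    have B: "cmod (psum a N y) \<le> B" if "y \<in> sphere 0 1" for y
    proof -
      have "cmod (psum a N y) \<le> (\<Sum>n<N. cmod (a n * y ^ n))" unfolding psum_def by (rule norm_sum)
      then show ?thesis using that by (simp add: B_def norm_mult norm_power)
    qed
    have [measurable]: "psum a N \<in> borel_measurable mT" by (rule L2_measurable[OF L2_psum])
    have [measurable]: "\<sigma> \<in> borel_measurable mT" using \<sigma> by auto
    show ?thesis
    proof (rule Bochner_Integration.integrable_bound[of _ "\<lambda>y. B\<^sup>2 * \<sigma> y"])
      show "integrable mT (\<lambda>y. B\<^sup>2 * \<sigma> y)" using \<sigma> by simp
      show "AE y in mT. norm (\<sigma> y * (cmod (psum a N y))\<^sup>2) \<le> norm (B\<^sup>2 * \<sigma> y)"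
        using AE_sphere
      proof eventually_elim
        case (elim y)
        have "(cmod (psum a N y))\<^sup>2 \<le> B\<^sup>2" by (intro power_mono B elim) simp
        then show ?case using mult_left_mono[of "(cmod (psum a N y))\<^sup>2" "B\<^sup>2" "\<bar>\<sigma> y\<bar>"] by (simp add: abs_mult mult.commute)
      qed
    qed measurable
  qed
  have km: "kernel_norm v \<in> borel_measurable mT" by (rule kernel_norm_measurable[OF v])
  have wm: "weight \<in> borel_measurable mT"
    using km bv_phi_measurable unfolding weight_def[abs_def] by measurable
  obtain \<delta> where \<delta>: "\<delta> > 0" "AE y in mT. \<rho> y \<ge> \<delta>"
  proof (rule essentially_bounded_below[OF \<rho>(1) wm])
    fix \<tau> :: "complex \<Rightarrow> real" assume \<tau>: "\<tau> \<in> borel_measurable mT" "\<And>y. 0 \<le> \<tau> y" "\<And>y. \<tau> y \<le> 1" "integrable mT (\<lambda>y. \<tau> y * weight y)"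
    obtain C where C: "C \<ge> 0" "\<And>g. g \<in> car H2 \<Longrightarrow> (\<integral>y. \<tau> y * (cmod (bv g y))\<^sup>2 \<partial>mT) \<le> C * (hnorm K (X0 (Xop g)))\<^sup>2"
      using asymptote_dominates[OF E asy \<tau>] by blast
    have i\<tau>: "integrable mT \<tau>"
      by (rule mT.integrable_const_bound[where B = 1]) (use \<tau> in \<open>auto intro!: AE_I2\<close>)
    have "AE y in mT. C * \<rho> y - \<tau> y \<ge> 0"
    proof (rule AE_nonneg_of_polynomials)
      show "integrable mT (\<lambda>y. C * \<rho> y - \<tau> y)" using \<rho>(2) i\<tau> by simp
      fix a N
      have "(\<integral>y. (C * \<rho> y - \<tau> y) * (cmod (psum a N y))\<^sup>2 \<partial>mT) =
        (\<integral>y. C * (\<rho> y * (cmod (psum a N y))\<^sup>2) - \<tau> y * (cmod (psum a N y))\<^sup>2 \<partial>mT)" by (simp add: algebra_simps)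
      also have "\<dots> = C * (\<integral>y. \<rho> y * (cmod (psum a N y))\<^sup>2 \<partial>mT) - (\<integral>y. \<tau> y * (cmod (psum a N y))\<^sup>2 \<partial>mT)"
        using ip[OF \<rho>(2)] ip[OF i\<tau>] by simp
      also have "(\<integral>y. \<tau> y * (cmod (psum a N y))\<^sup>2 \<partial>mT) = (\<integral>y. \<tau> y * (cmod (bv (on_disc (psum a N)) y))\<^sup>2 \<partial>mT)"
        by (rule Bochner_Integration.integral_cong) (simp_all add: bv_poly_disc)
      finally show "0 \<le> (\<integral>y. (C * \<rho> y - \<tau> y) * (cmod (psum a N y))\<^sup>2 \<partial>mT)"
        using C(2)[OF poly_disc_H2[of a N]] by (simp add: \<rho>(3))
    qed
    then show "\<exists>C\<ge>0. AE y in mT. \<tau> y \<le> C * \<rho> y" using C(1) by (intro exI[of _ C]) simp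
  qed
  have poly: "sqrt \<delta> * hnorm H2 (on_disc (psum a N)) \<le> hnorm K (X0 (Xop (on_disc (psum a N))))" for a N
  proof (rule power2_le_imp_le)
    have "\<delta> * lnorm2 (psum a N) = (\<integral>y. \<delta> * (cmod (psum a N y))\<^sup>2 \<partial>mT)" by (simp add: lnorm2_def)
    also have "\<dots> \<le> (\<integral>y. \<rho> y * (cmod (psum a N y))\<^sup>2 \<partial>mT)"
    proof (rule integral_mono_AE)
      show "AE y in mT. \<delta> * (cmod (psum a N y))\<^sup>2 \<le> \<rho> y * (cmod (psum a N y))\<^sup>2"
        using \<delta>(2) by eventually_elim (rule mult_right_mono, simp_all)
    qed (use ip[OF \<rho>(2)] L2_integrable_sq[OF L2_psum[of a N]] in simp_all)
    finally show "(sqrt \<delta> * hnorm H2 (on_disc (psum a N)))\<^sup>2 \<le> (hnorm K (X0 (Xop (on_disc (psum a N)))))\<^sup>2"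
      using \<delta>(1) by (simp add: power_mult_distrib hnorm_poly_disc \<rho>(3) lnorm2_psum)
    show "0 \<le> hnorm K (X0 (Xop (on_disc (psum a N))))" by (intro K.hnorm_nonneg A.A_car poly_disc_H2)
  qed
  have below: "sqrt \<delta> * hnorm H2 f \<le> hnorm K (X0 (Xop f))" if f: "f \<in> car H2" for f
  proof -
    define P where "P N = on_disc (psum (tc f) N)" for N
    have P: "P N \<in> car H2" for N unfolding P_def by (rule poly_disc_H2)
    have "sqrt \<delta> * hnorm H2 f - hnorm K (X0 (Xop f)) \<le> (sqrt \<delta> + \<bar>M0\<bar> * M1) * hnorm H2 (f - P N)" for N
    proof -
      have d: "P N - f \<in> car H2" by (intro H2_diff P f)
      have "hnorm H2 ((f - P N) + P N) \<le> hnorm H2 (f - P N) + hnorm H2 (P N)" by (intro H2.hnorm_triangle H2_diff P f)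
      then have 1: "sqrt \<delta> * hnorm H2 f \<le> sqrt \<delta> * hnorm H2 (f - P N) + sqrt \<delta> * hnorm H2 (P N)"
        using \<delta>(1) mult_left_mono[of "hnorm H2 f" "hnorm H2 (f - P N) + hnorm H2 (P N)" "sqrt \<delta>"] by (simp add: distrib_left)
      have "X0 (Xop (f + (P N - f))) = X0 (Xop f) + X0 (Xop (P N - f))" by (rule A.A_add[OF f d])
      then have "X0 (Xop (P N)) = X0 (Xop f) + X0 (Xop (P N - f))" by simp
      then have "hnorm K (X0 (Xop (P N))) \<le> hnorm K (X0 (Xop f)) + hnorm K (X0 (Xop (P N - f)))"
        using K.hnorm_triangle[OF A.A_car[OF f] A.A_car[OF d]] by simp
      also have "\<dots> \<le> hnorm K (X0 (Xop f)) + \<bar>M0\<bar> * M1 * hnorm H2 (f - P N)"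
        using M[OF d] H2.hnorm_minus_commute[OF f P[of N]] by simp
      finally show ?thesis using 1 poly[of "tc f" N] unfolding P_def[symmetric] by (simp add: algebra_simps)
    qed
    moreover have "(\<lambda>N. (sqrt \<delta> + \<bar>M0\<bar> * M1) * hnorm H2 (f - P N)) \<longlonglongrightarrow> 0"
      unfolding P_def by (rule tendsto_mult_right_zero[OF polynomials_dense[OF f]])
    ultimately have "sqrt \<delta> * hnorm H2 f - hnorm K (X0 (Xop f)) \<le> 0" by (intro LIMSEQ_le_const) auto
    then show ?thesis by simp
  qed
  have "hnorm H2 f \<le> (M0 / sqrt \<delta>) * hnorm H2 (\<phi> * f)" if f: "f \<in> model_space u" for f
  proof -
    have fH: "f \<in> car H2" by (rule model_H2[OF f])
    have X: "Xop f = \<phi> * f" using f by (simp add: Xop_def model_space_iff[OF u])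
    have "sqrt \<delta> * hnorm H2 f \<le> M0 * hnorm H2 (\<phi> * f)"
      using below[OF fH] M0[OF X_H2[OF fH]] unfolding X by (rule order_trans)
    then show ?thesis using \<delta>(1) by (simp add: field_simps)
  qed
  then have "on_disc (\<lambda>z. 1 / \<phi> z) \<in> car H2" by (rule reciprocal_of_bounded_below[OF lt])
  then show False using nin by contradiction
qed

end

text \<open>The relation between \<open>\<phi>\<close> and its reflection, and the outerness of \<open>\<phi>\<close>, come from comparing
  two cyclic functions of the same modulus.\<close>

lemma (in dense_multiplier) outer_and_relation:
  assumes nt: "model_space u \<noteq> {0}" and ne: "\<phi> \<noteq> 0"
  shows "outer_function \<phi>" "\<exists>c. cmod c = 1 \<and> (AE y in mT. bv \<phi> y = c * bv v y * cnj (bv u y) * cnj (bv \<phi> y))"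
proof -
  have lt: "cmod (v 0) < 1" by (rule nontrivial_v[OF ne nt])
  have ltu: "cmod (u 0) < 1" using inner_const(2)[OF u] nt by force
  have cy: "cyclic \<phi>" by (rule cyclic_multiplier[OF lt])
  show "outer_function \<phi>" by (rule cyclic_outer_function[OF p cy])
  obtain \<psi> where ps: "\<psi> \<in> Hinf" "AE y in mT. bv \<psi> y = bv v y * cnj (bv u y) * cnj (bv \<phi> y)"
    by (rule reflected_multiplier[OF ltu])
  have "AE y in mT. cmod (bv \<phi> y) = cmod (bv \<psi> y)"
    using ps(2) inner_E(3)[OF u] inner_E(3)[OF v] by eventually_elim (simp add: norm_mult)
  then obtain c where c: "cmod c = 1" "\<And>z. \<phi> z = c * \<psi> z"
    by (rule cyclic_eq_const_mult[OF p cy ps(1) cyclic_reflected[OF lt ps]]) (rule that)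
  have "\<phi> = (\<lambda>z. c * \<psi> z)" using c(2) by blast
  then have "AE y in mT. bv \<phi> y = c * bv \<psi> y" using AE_bv_cmult[OF Hinf_H2[OF ps(1)], of c] by simp
  then have "AE y in mT. bv \<phi> y = c * bv v y * cnj (bv u y) * cnj (bv \<phi> y)"
    using ps(2) by eventually_elim (simp add: mult.assoc)
  then show "\<exists>c. cmod c = 1 \<and> (AE y in mT. bv \<phi> y = c * bv v y * cnj (bv u y) * cnj (bv \<phi> y))" using c(1) by blast
qed

theorem theorem4p3:
  fixes u v \<phi>\<^sub>0 :: "complex \<Rightarrow> complex"
  assumes "inner_function u" and "inner_function v"
    and "\<phi>\<^sub>0 \<in> Hinf"
    and "(\<lambda>f. \<phi>\<^sub>0 * f) ` model_space u \<subseteq> model_space v"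
    and "htop H2 closure_of ((\<lambda>f. \<phi>\<^sub>0 * f) ` model_space u) = model_space v"
    and "on_disc (\<lambda>z. 1 / \<phi>\<^sub>0 z) \<notin> car H2"
    and "measure mT (E_set v) = 1"
  shows "(model_space u \<noteq> {0} \<longrightarrow>
            outer_function \<phi>\<^sub>0 \<and>
            (\<exists>c. cmod c = 1 \<and> (AE \<zeta> in mT. bv \<phi>\<^sub>0 \<zeta> = c * bv v \<zeta> * cnj (bv u \<zeta>) * cnj (bv \<phi>\<^sub>0 \<zeta>)))) \<and>
         (\<forall>c. cmod c = 1 \<and> (AE \<zeta> in mT. bv \<phi>\<^sub>0 \<zeta> = c * bv v \<zeta> * cnj (bv u \<zeta>) * cnj (bv \<phi>\<^sub>0 \<zeta>)) \<longrightarrow>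
            T_op u v \<phi>\<^sub>0 c \<in> transformations H2 H2 \<and>
            quasisimilar H2 (T_op u v \<phi>\<^sub>0 c) H2 shift \<and>
            (\<nexists>(K :: 'k::ab_group_add ipspace) X U. isometric_asymptote H2 (T_op u v \<phi>\<^sub>0 c) K X U))"
proof -
  interpret dense_multiplier u v \<phi>\<^sub>0 by unfold_locales (rule assms)+
  have ne: "\<phi>\<^sub>0 \<noteq> 0"
  proof
    assume "\<phi>\<^sub>0 = 0"
    then have "on_disc (\<lambda>z. 1 / \<phi>\<^sub>0 z) = 0" by (auto simp: on_disc_def)
    then show False using assms(6) H2_zero by metis
  qed
  show ?thesis
  proof (intro conjI allI impI)
    assume nt: "model_space u \<noteq> {0}"
    show "outer_function \<phi>\<^sub>0" "\<exists>c. cmod c = 1 \<and> (AE \<zeta> in mT. bv \<phi>\<^sub>0 \<zeta> = c * bv v \<zeta> * cnj (bv u \<zeta>) * cnj (bv \<phi>\<^sub>0 \<zeta>))"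
      by (rule outer_and_relation[OF nt ne])+
  next
    fix c assume "cmod c = 1 \<and> (AE \<zeta> in mT. bv \<phi>\<^sub>0 \<zeta> = c * bv v \<zeta> * cnj (bv u \<zeta>) * cnj (bv \<phi>\<^sub>0 \<zeta>))"
    then have c: "cmod c = 1" "AE \<zeta> in mT. bv \<phi>\<^sub>0 \<zeta> = c * bv v \<zeta> * cnj (bv u \<zeta>) * cnj (bv \<phi>\<^sub>0 \<zeta>)" by auto
    have nt: "model_space u \<noteq> {0}"
      using trivial_contradiction[OF dense_multiplier_axioms _ c(2)] assms(6) by blast
    have lt: "cmod (v 0) < 1" by (rule nontrivial_v[OF ne nt])
    interpret dense_cyclic_multiplier u v \<phi>\<^sub>0 c by unfold_locales (rule cyclic_multiplier[OF lt] c)+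
    show "T_op u v \<phi>\<^sub>0 c \<in> transformations H2 H2" by (rule T_transformation)
    show "quasisimilar H2 (T_op u v \<phi>\<^sub>0 c) H2 shift" by (rule T_quasisimilar)
    show "\<nexists>(K :: 'k::ab_group_add ipspace) X U. isometric_asymptote H2 (T_op u v \<phi>\<^sub>0 c) K X U"
      using no_isometric_asymptote[OF lt assms(7,6)] by blast
  qed
qed

end
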